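(* Assume condition (P) with $m\ge2$, and let $b_i\in\Gamma_i$ ($i=1,\dots,m$) be non-degenerate points of $P$ on $\Gamma_i$ satisfying $\langle\nabla(\Delta P)(b_i),\tau_{i,j}\rangle=0$ for $i=1,\dots,m$, $j=1,2$, where $\tau_{i,1},\tau_{i,2}$ are the principal tangential unit vectors of $\Gamma_i$ at $b_i$. Then there exists $a_0>0$ such that, for $a\ge a_0$, Problem $(Q_a)$ has no solution of the form $$u_a(x)=\frac{-\mu_a}{\sqrt a}\Big(\sum_{i=1}^mU\big(\sqrt{-\mu_a}(x-x_{a,i})\big)+\varpi_a(x)\Big),\qquad \int_{\mathbb{R}^3}\Big[-\frac1{\mu_a}|\nabla\varpi_a|^2+\varpi_a^2\Big]=o\big((-\mu_a)^{-3/2}\big),$$ with points $x_{a,i}\in\mathbb{R}^3$ satisfying $x_{a,i}\to b_i$ ($i=1,\dots,m$) as $a\to+\infty$, where $b_i\neq b_j$ for $i\neq j$.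
   Context: $U$ is the unique positive radial solution in $H^1(\mathbb{R}^3)$ (maximal at $0$) of $-\Delta u+u=\frac{1}{8\pi}\big(\int_{\mathbb{R}^3}\frac{u^2(y)}{|x-y|}dy\big)u$. Problem $(Q_a)$: find $(u,\mu)\in H^1(\mathbb{R}^3)\times\mathbb{R}$, $u>0$, with $-\Delta u+P(x)u=\frac{a}{8\pi}\big(\int_{\mathbb{R}^3}\frac{u^2(y)}{|x-y|}dy\big)u+\mu u$ in $\mathbb{R}^3$ and $\int_{\mathbb{R}^3}u^2=1$. Condition (P): $P:\mathbb{R}^3\to\mathbb{R}$ is continuous and there exist $\delta>0$ and pairwise disjoint compact $C^2$ surfaces $\Gamma_1,\dots,\Gamma_m\subset\mathbb{R}^3$ without boundary such that for each $i$ and every $x\in\Gamma_i$: $P(x)=P_i$ (a constant), $\partial P(x)/\partial\nu_i=0$ and $\partial^2P(x)/\partial\nu_i^2\neq0$, where $\nu_i$ is the outward unit normal of $\Gamma_i$ at $x$; moreover $P\in C^4\big(\bigcup_iW_{\delta,i}\big)$ with $W_{\delta,i}=\{x:\mathrm{dist}(x,\Gamma_i)<\delta\}$, and $P(x)=O(e^{\alpha|x|})$ for some $\alpha\in(0,2)$. Non-degenerate point: $x_0\in\Gamma_i$ is non-degenerate on $\Gamma_i$ if $\partial^2P(x_0)/\partial\nu_i^2\neq0$ and $\det\big(\langle D^2(\Delta P)(x_0)\tau_l,\tau_j\rangle\big)_{1\le l,j\le2}\neq0$, where $\tau_1,\tau_2$ are the principal tangential unit vectors of $\Gamma_i$ at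 $x_0$. *)

theory Defs
  imports "HOL-Analysis.Analysis" "HOL-Library.Landau_Symbols"
begin

definition dd :: "('a::euclidean_space \<Rightarrow> real) \<Rightarrow> 'a \<Rightarrow> 'a \<Rightarrow> real" where
  "dd f v x = frechet_derivative f (at x) v"

definition lap :: "('a::euclidean_space \<Rightarrow> real) \<Rightarrow> 'a \<Rightarrow> real" where
  "lap f x = (\<Sum>e\<in>Basis. dd (\<lambda>y. dd f e y) e x)"

fun Ck :: "nat \<Rightarrow> ('a::euclidean_space \<Rightarrow> real) \<Rightarrow> 'a set \<Rightarrow> bool" where
  "Ck 0 f S = continuous_on S f"
| "Ck (Suc k) f S = (f differentiable_on S \<and> (\<forall>v. Ck k (\<lambda>x. dd f v x) S))"

definition test_fun :: "('a::euclidean_space \<Rightarrow> real) \<Rightarrow> bool" where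
  "test_fun \<phi> = ((\<forall>k. Ck k \<phi> UNIV) \<and> compact (closure {x. \<phi> x \<noteq> 0}))"

definition H1_grad :: "('a::euclidean_space \<Rightarrow> real) \<Rightarrow> ('a \<Rightarrow> 'a) \<Rightarrow> bool" where
  "H1_grad f G = (f \<in> borel_measurable lebesgue \<and> G \<in> borel_measurable lebesgue \<and>
     integrable lebesgue (\<lambda>x. (f x)^2) \<and> integrable lebesgue (\<lambda>x. (norm (G x))^2) \<and>
     (\<forall>\<phi>. test_fun \<phi> \<longrightarrow> (\<forall>e\<in>Basis.
        (LINT x|lebesgue. f x * dd \<phi> e x) = - (LINT x|lebesgue. (G x \<bullet> e) * \<phi> x))))"

definition newton :: "(real^3 \<Rightarrow> real) \<Rightarrow> real^3 \<Rightarrow> real" where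
  "newton u x = (LINT y|lebesgue. (u y)^2 / norm (x - y))"

text \<open>Weak (distributional) form of  -\<Delta>u + P u = (a/(8\<pi>)) (newton u) u + \<mu> u,
  for u in H^1 with weak gradient G.\<close>
definition weak_eq :: "(real^3 \<Rightarrow> real) \<Rightarrow> real \<Rightarrow> real \<Rightarrow> (real^3 \<Rightarrow> real) \<Rightarrow> (real^3 \<Rightarrow> real^3) \<Rightarrow> bool" where
  "weak_eq P a \<mu> u G = (\<forall>\<phi>. test_fun \<phi> \<longrightarrow>
     (LINT x|lebesgue. (\<Sum>e\<in>Basis. (G x \<bullet> e) * dd \<phi> e x) + P x * u x * \<phi> x)
   = (LINT x|lebesgue. a / (8 * pi) * newton u x * u x * \<phi> x + \<mu> * u x * \<phi> x))"

definition solves_Q :: "(real^3 \<Rightarrow> real) \<Rightarrow> real \<Rightarrow> (real^3 \<Rightarrow> real) \<Rightarrow> real \<Rightarrow> bool" where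
  "solves_Q P a u \<mu> = (\<exists>G. H1_grad u G \<and> weak_eq P a \<mu> u G \<and>
     (AE x in lebesgue. u x > 0) \<and> (LINT x|lebesgue. (u x)^2) = 1)"

text \<open>U: positive radial H^1 solution of -\<Delta>U + U = (1/(8\<pi>)) (newton U) U, maximal at 0
  (continuous representative).  By the paper this is unique.\<close>
definition choquard_ground_state :: "(real^3 \<Rightarrow> real) \<Rightarrow> bool" where
  "choquard_ground_state U = (\<exists>G. H1_grad U G \<and> weak_eq (\<lambda>_. 1) 1 0 U G \<and>
     continuous_on UNIV U \<and> (\<forall>x. U x > 0) \<and>
     (\<forall>x y. norm x = norm y \<longrightarrow> U x = U y) \<and> (\<forall>x. U x \<le> U 0))"

definition local_def :: "(real^3) set \<Rightarrow> real^3 \<Rightarrow> (real^3) set \<Rightarrow> (real^3 \<Rightarrow> real) \<Rightarrow> bool" where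
  "local_def S x V g = (open V \<and> x \<in> V \<and> Ck 2 g V \<and>
     (\<forall>y\<in>V. frechet_derivative g (at y) \<noteq> (\<lambda>v. 0)) \<and> S \<inter> V = {y\<in>V. g y = 0})"

definition C2_surface :: "(real^3) set \<Rightarrow> bool" where
  "C2_surface S = (compact S \<and> (\<forall>x\<in>S. \<exists>V g. local_def S x V g))"

definition unit_normal :: "(real^3) set \<Rightarrow> real^3 \<Rightarrow> real^3 \<Rightarrow> bool" where
  "unit_normal S x \<nu> = (norm \<nu> = 1 \<and>
     (\<exists>V g. local_def S x V g \<and> (\<forall>v. frechet_derivative g (at x) v = 0 \<longleftrightarrow> \<nu> \<bullet> v = 0)))"

text \<open>Principal tangential unit vectors of S at x: an orthonormal basis of the tangent plane
  diagonalising the second fundamental form (computed from a local defining function).\<close>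
definition principal_dirs :: "(real^3) set \<Rightarrow> real^3 \<Rightarrow> real^3 \<Rightarrow> real^3 \<Rightarrow> bool" where
  "principal_dirs S x \<tau>1 \<tau>2 = (norm \<tau>1 = 1 \<and> norm \<tau>2 = 1 \<and> \<tau>1 \<bullet> \<tau>2 = 0 \<and>
     (\<exists>V g. local_def S x V g \<and> frechet_derivative g (at x) \<tau>1 = 0 \<and>
        frechet_derivative g (at x) \<tau>2 = 0 \<and> dd (\<lambda>y. dd g \<tau>1 y) \<tau>2 x = 0))"

definition condition_P :: "(real^3 \<Rightarrow> real) \<Rightarrow> nat \<Rightarrow> (nat \<Rightarrow> (real^3) set) \<Rightarrow> (nat \<Rightarrow> real) \<Rightarrow> real \<Rightarrow> bool" where
  "condition_P P m \<Gamma> Pc \<delta> = (continuous_on UNIV P \<and> \<delta> > 0 \<and>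
     (\<forall>i<m. C2_surface (\<Gamma> i)) \<and>
     (\<forall>i<m. \<forall>j<m. i \<noteq> j \<longrightarrow> \<Gamma> i \<inter> \<Gamma> j = {}) \<and>
     (\<forall>i<m. \<forall>x\<in>\<Gamma> i. P x = Pc i \<and>
        (\<forall>\<nu>. unit_normal (\<Gamma> i) x \<nu> \<longrightarrow> dd P \<nu> x = 0 \<and> dd (\<lambda>y. dd P \<nu> y) \<nu> x \<noteq> 0)) \<and>
     Ck 4 P (\<Union>i<m. {x. infdist x (\<Gamma> i) < \<delta>}) \<and>
     (\<exists>\<alpha>. 0 < \<alpha> \<and> \<alpha> < 2 \<and> P \<in> O[at_infinity](\<lambda>x. exp (\<alpha> * norm x))))"

definition nondegenerate :: "(real^3 \<Rightarrow> real) \<Rightarrow> (real^3) set \<Rightarrow> real^3 \<Rightarrow> bool" where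
  "nondegenerate P S x0 = (x0 \<in> S \<and>
     (\<forall>\<nu>. unit_normal S x0 \<nu> \<longrightarrow> dd (\<lambda>y. dd P \<nu> y) \<nu> x0 \<noteq> 0) \<and>
     (\<forall>\<tau>1 \<tau>2. principal_dirs S x0 \<tau>1 \<tau>2 \<longrightarrow>
        (let h = (\<lambda>v w. dd (\<lambda>y. dd (lap P) v y) w x0) in
          h \<tau>1 \<tau>1 * h \<tau>2 \<tau>2 - h \<tau>1 \<tau>2 * h \<tau>2 \<tau>1 \<noteq> 0)))"

end

(* The Newton potential of a bump decays only like 1/|x|, so two bumps at fixed distinct positions
   attract each other with a force that, at the scale of the bumps, is much larger than the force
   exerted by grad P near the centres. Let b i be a centre of maximal norm; all other centres then
   pull the bump at b i strictly towards the origin. Testing the equation with the derivative of u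
   in direction - b i, cut off around b i, gives a local Pohozaev identity in which this attraction
   has weight a/(8 pi), whereas the term with grad P stays bounded and the terms carried by the
   annulus where the cutoff varies are controlled by a Caccioppoli estimate. The normalisation of u
   forces sqrt(-mu) to be comparable to a, so the identity fails as a tends to infinity. *)

theory Submission
  imports Defs
begin

section \<open>Directional derivatives and smooth functions\<close>


text \<open>Maximality of the norm places all other centres in one open half space seen from
  \<open>b i\<close>, so their forces cannot cancel. The dangerous terms sit on the annulus, where
  the derivative of the cutoff meets \<open>- \<mu>\<close> and \<open>a * newt u\<close>, both of
  which may grow like \<open>- \<mu>\<close>. There the effective potential is at least
  \<open>- \<mu> / 2\<close>, and the Caccioppoli estimate bounds \<open>- \<mu>\<close> times the
  mass of the annulus, which compensates this growth. What remains is
  \<open>\<kappa> * c * m_i * m_l \<le> C + C * c * e\<close>, where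
  \<open>c = a / (8 * pi)\<close>, m_i and m_l are the masses in two core balls, e is the mass away
  from all centres, and \<kappa> and C are fixed before the solution. Since m_i and m_l are bounded
  below while e becomes small, one late index of the sequence gives the contradiction. The solution
  is only known to lie in H^1 and the kernel is singular, so two regularisations are needed:
  \<open>u\<close> is mollified for the Pohozaev identity, and \<open>1 / norm z\<close> is replaced
  by \<open>ker \<eta>\<close>, with Hardy's inequality justifying the limit.\<close>

lemma dd_eqI: "(f has_derivative f') (at x) \<Longrightarrow> dd f v x = f' v"
  unfolding dd_def using frechet_derivative_at by metis

lemma has_derivative_dd: "f differentiable (at x) \<Longrightarrow> (f has_derivative (\<lambda>v. dd f v x)) (at x)"
  unfolding dd_def by (simp add: frechet_derivative_works)

lemma dd_add: "f differentiable (at x) \<Longrightarrow> g differentiable (at x) \<Longrightarrow>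
    dd (\<lambda>y. f y + g y) v x = dd f v x + dd g v x"
  by (rule dd_eqI[OF has_derivative_add[OF has_derivative_dd has_derivative_dd]])

lemma dd_diff: "f differentiable (at x) \<Longrightarrow> g differentiable (at x) \<Longrightarrow>
    dd (\<lambda>y. f y - g y) v x = dd f v x - dd g v x"
  by (rule dd_eqI[OF has_derivative_diff[OF has_derivative_dd has_derivative_dd]])

lemma dd_mult: "f differentiable (at x) \<Longrightarrow> g differentiable (at x) \<Longrightarrow>
    dd (\<lambda>y. f y * g y) v x = f x * dd g v x + dd f v x * g x"
  by (rule dd_eqI[OF has_derivative_mult[OF has_derivative_dd has_derivative_dd]])

lemma dd_const [simp]: "dd (\<lambda>x. c) v x = 0"
  by (simp add: dd_def)

lemma dd_affine:
  fixes f :: "'a::euclidean_space \<Rightarrow> real"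
  assumes "f differentiable (at (c *\<^sub>R x + a))"
  shows "dd (\<lambda>y. f (c *\<^sub>R y + a)) v x = c * dd f v (c *\<^sub>R x + a)"
proof -
  have "((\<lambda>y. f (c *\<^sub>R y + a)) has_derivative (\<lambda>v. dd f (c *\<^sub>R v) (c *\<^sub>R x + a))) (at x)"
    by (rule has_derivative_compose[of "\<lambda>y. c *\<^sub>R y + a" "\<lambda>v. c *\<^sub>R v" x UNIV f, simplified])
      (auto intro!: derivative_eq_intros has_derivative_dd assms)
  from dd_eqI[OF this] show ?thesis
    using linear_frechet_derivative[OF assms] by (simp add: dd_def linear_cmul)
qed

lemma dd_scale_dir: "f differentiable (at x) \<Longrightarrow> dd f (c *\<^sub>R v) x = c * dd f v x"
  by (simp add: dd_def linear_cmul[OF linear_frechet_derivative])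

lemma dd_basis_sum:
  fixes v :: "'a::euclidean_space"
  assumes "f differentiable (at x)"
  shows "dd f v x = (\<Sum>b\<in>Basis. (v \<bullet> b) * dd f b x)"
proof -
  have "frechet_derivative f (at x) (\<Sum>b\<in>Basis. (v \<bullet> b) *\<^sub>R b) = (\<Sum>b\<in>Basis. (v \<bullet> b) * dd f b x)"
    using linear_frechet_derivative[OF assms] by (simp add: linear_sum linear_cmul dd_def)
  then show ?thesis by (simp add: euclidean_representation dd_def)
qed

lemma dd_locally_zero:
  fixes f :: "'a::euclidean_space \<Rightarrow> real"
  assumes "open W" "x \<in> W" "\<And>y. y \<in> W \<Longrightarrow> f y = 0"
  shows "f differentiable (at x)" "dd f v x = 0"
proof -
  have "(f has_derivative (\<lambda>v. 0)) (at x)"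
    using has_derivative_transform_within_open[OF has_derivative_const[of 0] assms(1,2)] assms(3)
    by metis
  then show "f differentiable (at x)" "dd f v x = 0"
    by (auto simp: differentiable_def intro: dd_eqI)
qed

lemma has_real_derivative_line:
  fixes f :: "'a::euclidean_space \<Rightarrow> real"
  assumes "f differentiable (at (x + t *\<^sub>R v))"
  shows "((\<lambda>t. f (x + t *\<^sub>R v)) has_real_derivative dd f v (x + t *\<^sub>R v)) (at t)"
proof -
  have "((\<lambda>t. f (x + t *\<^sub>R v)) has_derivative (\<lambda>h. dd f (h *\<^sub>R v) (x + t *\<^sub>R v))) (at t)"
    by (rule has_derivative_compose[of "\<lambda>t. x + t *\<^sub>R v" "\<lambda>h. h *\<^sub>R v" t UNIV f, simplified])
      (auto intro!: derivative_eq_intros has_derivative_dd assms)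
  then show ?thesis
    by (simp add: has_field_derivative_def dd_scale_dir[OF assms] mult_commute_abs)
qed

lemma dd_mvt:
  fixes f :: "'a::euclidean_space \<Rightarrow> real"
  assumes "\<And>y. f differentiable (at y)" "h > 0"
  obtains t where "0 < t" "t < h" "f (x + h *\<^sub>R v) - f x = h * dd f v (x + t *\<^sub>R v)"
proof -
  have "\<exists>z. 0 < z \<and> z < h \<and> f (x + h *\<^sub>R v) - f (x + 0 *\<^sub>R v) = (h - 0) * dd f v (x + z *\<^sub>R v)"
    using has_real_derivative_line[OF assms(1)] assms(2) by (intro MVT2)
  then show ?thesis using that by auto
qed

lemma Ck_Suc_D: "Ck (Suc k) f S \<Longrightarrow> Ck k f S"
proof (induction k arbitrary: f)
  case 0 then show ?case by (simp add: differentiable_imp_continuous_on)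
next
  case (Suc k)
  have "f differentiable_on S" "\<And>v. Ck k (\<lambda>x. dd f v x) S"
    using Suc.prems Suc.IH by (metis Ck.simps(2))+
  then show ?case by simp
qed

section \<open>Smooth functions\<close>

definition smooth :: "('a::euclidean_space \<Rightarrow> real) \<Rightarrow> bool" where
  "smooth f \<longleftrightarrow> (\<forall>k. Ck k f UNIV)"

lemma smooth_differentiable: "smooth f \<Longrightarrow> f differentiable (at x)"
  using Ck.simps(2)[of 0 f UNIV] by (auto simp: smooth_def differentiable_on_def simp del: Ck.simps)

lemma smooth_dd: "smooth f \<Longrightarrow> smooth (dd f v)"
  unfolding smooth_def using Ck.simps(2)[of _ f UNIV] by blast

lemma smooth_continuous: "smooth f \<Longrightarrow> continuous_on A f"
  unfolding smooth_def by (metis Ck.simps(1) continuous_on_subset subset_UNIV)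

text \<open>Induction on the order treats all members at once, because a derivative of a member is
  again a member. Smoothness of products, bumps and convolutions is proved below by exhibiting such
  a derivative-closed family.\<close>

lemma smooth_class:
  assumes F: "\<And>f. f \<in> F \<Longrightarrow> (\<forall>x. f differentiable (at x)) \<and> (\<forall>v. dd f v \<in> F)" and "f \<in> F"
  shows "smooth f"
proof -
  have "f \<in> F \<Longrightarrow> Ck k f UNIV" for k f
  proof (induction k arbitrary: f)
    case 0
    then have "f differentiable_on UNIV" using F by (simp add: differentiable_on_def)
    then show ?case by (simp add: differentiable_imp_continuous_on)
  next
    case (Suc k)
    then show ?case using F by (auto simp: differentiable_on_def)
  qed
  then show ?thesis using assms(2) by (simp add: smooth_def)
qed

section \<open>Flat functions and the closure properties of smoothness\<close>

definition flat :: "nat \<Rightarrow> real \<Rightarrow> real" where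
  "flat n t = (if t > 0 then exp (- (1 / t)) / t ^ n else 0)"

lemma flat_tendsto: "((\<lambda>t. flat n t) \<longlongrightarrow> 0) (at 0)"
proof -
  \<comment> \<open>The substitution \<open>t = 1 / y\<close> turns the limit at 0 from the right
    into the decay of \<open>y ^ n / exp y\<close> at infinity.\<close>
  have "((\<lambda>y. y ^ n / exp y) \<longlongrightarrow> 0) (at_top :: real filter)"
    by (rule tendsto_power_div_exp_0)
  then have "((\<lambda>t. (inverse t) ^ n / exp (inverse t)) \<longlongrightarrow> 0) (at_right (0::real))"
    by (rule filterlim_compose) (rule filterlim_inverse_at_top_right)
  then have r: "((\<lambda>t. flat n t) \<longlongrightarrow> 0) (at_right 0)"
    by (rule Lim_transform_eventually)
      (auto simp: flat_def eventually_at_filter exp_minus field_simps)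
  have l: "((\<lambda>t. flat n t) \<longlongrightarrow> 0) (at_left 0)"
    by (rule Lim_transform_eventually[OF tendsto_const])
      (auto simp: flat_def eventually_at_filter)
  show ?thesis using r l by (simp add: filterlim_at_split)
qed

text \<open>Differentiating \<open>exp (- (1 / t)) / t ^ n\<close> only produces functions of the
  same shape with larger exponents. Indexing \<open>flat\<close> by the power of \<open>t\<close>
  therefore gives a family whose span is closed under differentiation, also across the
  origin.\<close>

lemma DERIV_flat: "DERIV (flat n) t :> flat (Suc (Suc n)) t - of_nat n * flat (Suc n) t"
proof -
  consider "t > 0" | "t < 0" | "t = 0" by linarith
  then show ?thesis
  proof cases
    case 1
    have d: "((\<lambda>t. exp (- (1 / t)) / t ^ n) has_real_derivative
       flat (Suc (Suc n)) t - of_nat n * flat (Suc n) t) (at t)"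
    proof (cases n)
      case 0
      then show ?thesis
        using 1 by (auto intro!: derivative_eq_intros simp: flat_def field_simps power2_eq_square)
    next
      case (Suc k)
      then show ?thesis
        using 1 by (cases k) (auto intro!: derivative_eq_intros
            simp del: power_Suc simp: flat_def power2_eq_square divide_simps power_Suc[of t],
            simp_all add: algebra_simps)
    qed
    have "eventually (\<lambda>s. s > 0) (nhds t)"
      using eventually_nhds_in_open[of "{0<..}" t] 1 by simp
    then have ev: "eventually (\<lambda>s. exp (- (1 / s)) / s ^ n = flat n s) (nhds t)"
      by eventually_elim (simp add: flat_def)
    show ?thesis using DERIV_cong_ev[OF refl ev refl] d by blast
  next
    case 2
    have "eventually (\<lambda>s. s < 0) (nhds t)"
      using eventually_nhds_in_open[of "{..<0}" t] 2 by simp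
    then have ev: "eventually (\<lambda>s. 0 = flat n s) (nhds t)"
      by eventually_elim (simp add: flat_def)
    have d: "((\<lambda>t. 0) has_real_derivative flat (Suc (Suc n)) t - of_nat n * flat (Suc n) t) (at t)"
      using 2 by (simp add: flat_def)
    show ?thesis using DERIV_cong_ev[OF refl ev refl] d by blast
  next
    case 3
    \<comment> \<open>At the origin the difference quotient of \<open>flat n\<close> is
      \<open>flat (Suc n)\<close>, which tends to 0 by \<open>flat_tendsto\<close>.\<close>
    have "((\<lambda>h. (flat n (0 + h) - flat n 0) / h) \<longlongrightarrow> 0) (at 0)"
      by (rule Lim_transform_eventually[OF flat_tendsto[of "Suc n"]])
        (auto simp: flat_def eventually_at_filter)
    moreover have "flat k 0 = 0" for k by (simp add: flat_def)
    ultimately show ?thesis using 3 by (simp add: DERIV_def)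
  qed
qed

text \<open>A derivative-closed family in the sense of \<open>smooth_class\<close>. Admitting affine
  pullbacks of arbitrary smooth functions as generators makes the closure of smoothness under sums,
  products and affine maps a consequence of the same induction; all exponents \<open>n\<close> occur
  because differentiating the bump raises \<open>n\<close>.\<close>

inductive_set smooth_alg :: "('a::euclidean_space \<Rightarrow> real) set" where
  const: "(\<lambda>x. c) \<in> smooth_alg"
| inner: "(\<lambda>x. x \<bullet> w) \<in> smooth_alg"
| affine: "smooth f \<Longrightarrow> (\<lambda>x. f (c *\<^sub>R x + a)) \<in> smooth_alg"
| bump: "(\<lambda>x. flat n (1 - x \<bullet> x)) \<in> smooth_alg"
| add: "f \<in> smooth_alg \<Longrightarrow> g \<in> smooth_alg \<Longrightarrow> (\<lambda>x. f x + g x) \<in> smooth_alg"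
| mult: "f \<in> smooth_alg \<Longrightarrow> g \<in> smooth_alg \<Longrightarrow> (\<lambda>x. f x * g x) \<in> smooth_alg"

lemma smooth_alg_dd:
  "f \<in> smooth_alg \<Longrightarrow> (\<forall>x. f differentiable (at x)) \<and> (\<forall>v. dd f v \<in> smooth_alg)"
proof (induction rule: smooth_alg.induct)
  case (const c)
  have "dd (\<lambda>x::'a. c) v = (\<lambda>x. 0)" for v by auto
  then show ?case by (auto intro: smooth_alg.const)
next
  case (inner w)
  have *: "((\<lambda>x. x \<bullet> w) has_derivative (\<lambda>v. v \<bullet> w)) (at x)" for x
    by (auto intro!: derivative_eq_intros)
  then have "dd (\<lambda>x. x \<bullet> w) v = (\<lambda>x. v \<bullet> w)" for v by (auto intro!: dd_eqI)
  then show ?case using * by (auto intro: smooth_alg.const simp: differentiable_def)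
next
  case (affine f c a)
  have "(\<lambda>x. f (c *\<^sub>R x + a)) differentiable (at x)" for x
    by (rule differentiable_compose[of f "\<lambda>x. c *\<^sub>R x + a"])
      (auto intro!: smooth_differentiable affine derivative_intros)
  moreover have "dd (\<lambda>x. f (c *\<^sub>R x + a)) v = (\<lambda>x. c * dd f v (c *\<^sub>R x + a))" for v
    by (auto intro!: dd_affine smooth_differentiable affine)
  moreover have "(\<lambda>x. c * dd f v (c *\<^sub>R x + a)) \<in> smooth_alg" for v
    by (intro smooth_alg.mult smooth_alg.const smooth_alg.affine smooth_dd affine)
  ultimately show ?case by metis
next
  case (bump n)
  have q: "((\<lambda>x::'a. 1 - x \<bullet> x) has_derivative (\<lambda>v. - 2 * (x \<bullet> v))) (at x)" for x
    by (auto intro!: derivative_eq_intros simp: inner_commute)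
  have *: "((\<lambda>x::'a. flat n (1 - x \<bullet> x)) has_derivative
      (\<lambda>v. (flat (Suc (Suc n)) (1 - x \<bullet> x) - of_nat n * flat (Suc n) (1 - x \<bullet> x)) * (- 2 * (x \<bullet> v)))) (at x)" for x
    by (rule has_derivative_compose[OF q DERIV_flat[unfolded has_field_derivative_def]])
  have eq: "dd (\<lambda>x::'a. flat n (1 - x \<bullet> x)) v =
      (\<lambda>x. (flat (Suc (Suc n)) (1 - x \<bullet> x) + (- of_nat n) * flat (Suc n) (1 - x \<bullet> x)) * ((- 2) * (x \<bullet> v)))" for v
    using dd_eqI[OF *] by auto
  have "(\<lambda>x. (flat (Suc (Suc n)) (1 - x \<bullet> x) + (- of_nat n) * flat (Suc n) (1 - x \<bullet> x)) * ((- 2) * (x \<bullet> v)))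
      \<in> smooth_alg" for v :: 'a
    by (intro smooth_alg.intros)
  then show ?case
    unfolding eq using * by (auto simp only: differentiable_def)
next
  case (add f g)
  have "dd (\<lambda>x. f x + g x) v = (\<lambda>x. dd f v x + dd g v x)" for v
    using add.IH by (auto intro!: dd_add)
  then show ?case using add by (auto intro!: smooth_alg.add)
next
  case (mult f g)
  have "dd (\<lambda>x. f x * g x) v = (\<lambda>x. f x * dd g v x + dd f v x * g x)" for v
    using mult.IH by (auto intro!: dd_mult)
  then show ?case using mult by (auto intro!: smooth_alg.add smooth_alg.mult)
qed

lemma smooth_alg_smooth: "f \<in> smooth_alg \<Longrightarrow> smooth f"
  using smooth_class[of smooth_alg] smooth_alg_dd by blast

lemma smooth_in_alg: "smooth f \<Longrightarrow> f \<in> smooth_alg"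
  by (drule smooth_alg.affine[of f 1 0]) simp

lemma smooth_const: "smooth (\<lambda>x. c)"
  by (rule smooth_alg_smooth[OF smooth_alg.const])

lemma smooth_add: "smooth f \<Longrightarrow> smooth g \<Longrightarrow> smooth (\<lambda>x. f x + g x)"
  by (rule smooth_alg_smooth[OF smooth_alg.add[OF smooth_in_alg smooth_in_alg]])

lemma smooth_mult: "smooth f \<Longrightarrow> smooth g \<Longrightarrow> smooth (\<lambda>x. f x * g x)"
  by (rule smooth_alg_smooth[OF smooth_alg.mult[OF smooth_in_alg smooth_in_alg]])

lemma smooth_affine: "smooth f \<Longrightarrow> smooth (\<lambda>x. f (c *\<^sub>R x + a))"
  by (rule smooth_alg_smooth, erule smooth_alg.affine)

text \<open>The second difference of \<open>f\<close> over the parallelogram spanned by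
  \<open>h *\<^sub>R v\<close> and \<open>h *\<^sub>R w\<close> is symmetric in \<open>v\<close> and
  \<open>w\<close>, and two mean value steps turn it into \<open>h * h\<close> times a mixed
  derivative at a nearby point. Continuity of both mixed derivatives then forces equality.\<close>

lemma dd_dd_commute:
  fixes f :: "'a::euclidean_space \<Rightarrow> real"
  assumes f: "smooth f"
  shows "dd (dd f v) w x = dd (dd f w) v x"
proof -
  have key: "\<exists>y. dist y x \<le> h * (norm v + norm w) \<and>
      f (x + h *\<^sub>R v + h *\<^sub>R w) - f (x + h *\<^sub>R v) - f (x + h *\<^sub>R w) + f x = h * h * dd (dd f v) w y"
    if h: "h > 0" for h v w
  proof -
    let ?p = "\<lambda>y. f (y + h *\<^sub>R w) - f y"
    have diff: "(\<lambda>y. f (y + h *\<^sub>R w)) differentiable (at y)" for y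
      using smooth_differentiable[OF smooth_affine[OF f, of 1 "h *\<^sub>R w"]] by simp
    have ddp: "dd ?p v y = dd f v (y + h *\<^sub>R w) - dd f v y" for y
      using dd_affine[of f 1 y "h *\<^sub>R w" v] smooth_differentiable[OF f] diff
      by (simp add: dd_diff)
    have "?p differentiable (at y)" for y
      using diff smooth_differentiable[OF f] by (intro differentiable_diff)
    from this h obtain t where t: "0 < t" "t < h"
      "?p (x + h *\<^sub>R v) - ?p x = h * dd ?p v (x + t *\<^sub>R v)" by (rule dd_mvt)
    obtain r where r: "0 < r" "r < h"
      "dd f v (x + t *\<^sub>R v + h *\<^sub>R w) - dd f v (x + t *\<^sub>R v) = h * dd (dd f v) w (x + t *\<^sub>R v + r *\<^sub>R w)"
      by (rule dd_mvt[where f="dd f v" and v=w and x="x + t *\<^sub>R v" and h=h,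
            OF smooth_differentiable[OF smooth_dd[OF f]] h])
    have "norm (t *\<^sub>R v + r *\<^sub>R w) \<le> t * norm v + r * norm w"
      using norm_triangle_ineq[of "t *\<^sub>R v" "r *\<^sub>R w"] t r by simp
    also have "\<dots> \<le> h * (norm v + norm w)"
      using t r by (simp add: distrib_left add_mono mult_right_mono)
    finally show ?thesis
      using t r ddp by (intro exI[of _ "x + t *\<^sub>R v + r *\<^sub>R w"])
        (simp add: dist_norm algebra_simps)
  qed
  have "\<bar>dd (dd f v) w x - dd (dd f w) v x\<bar> \<le> e" if e: "e > 0" for e
  proof -
    have "isCont (dd (dd f v) w) x" "isCont (dd (dd f w) v) x"
      using smooth_continuous[OF smooth_dd[OF smooth_dd[OF f]], of UNIV]
      by (auto simp: continuous_on_eq_continuous_at)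
    then obtain d1 d2 where d: "d1 > 0" "d2 > 0"
      "\<And>y. dist y x < d1 \<Longrightarrow> dist (dd (dd f v) w y) (dd (dd f v) w x) < e/2"
      "\<And>y. dist y x < d2 \<Longrightarrow> dist (dd (dd f w) v y) (dd (dd f w) v x) < e/2"
      using e unfolding continuous_at_eps_delta dist_norm[symmetric] by (metis half_gt_zero)
    define N where "N = norm v + norm w"
    have n: "N + 1 > 0" unfolding N_def by (smt (verit) norm_ge_zero)
    \<comment> \<open>This \<open>h\<close> puts both intermediate points within
      \<open>min d1 d2\<close> of \<open>x\<close>; the summand 1 avoids a division by zero when
      both directions vanish.\<close>
    define h where "h = min d1 d2 / (2 * (N + 1))"
    have h: "h > 0" using d n by (simp add: h_def)
    have "h * N \<le> h * (N + 1)" using h by simp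
    also have "\<dots> = min d1 d2 / 2" using n unfolding h_def
      by (metis less_irrefl mult.commute divide_divide_eq_left nonzero_eq_divide_eq)
    also have "\<dots> < min d1 d2" using d(1,2) by (simp add: min_def)
    finally have hh: "h * (norm v + norm w) < min d1 d2" by (simp add: N_def)
    obtain y where y: "dist y x \<le> h * (norm v + norm w)"
      "f (x + h *\<^sub>R v + h *\<^sub>R w) - f (x + h *\<^sub>R v) - f (x + h *\<^sub>R w) + f x = h * h * dd (dd f v) w y"
      using key[OF h] by blast
    obtain z where z: "dist z x \<le> h * (norm w + norm v)"
      "f (x + h *\<^sub>R w + h *\<^sub>R v) - f (x + h *\<^sub>R w) - f (x + h *\<^sub>R v) + f x = h * h * dd (dd f w) v z"
      using key[OF h] by blast
    have "h * h * dd (dd f v) w y = h * h * dd (dd f w) v z"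
      using y z by (simp add: algebra_simps)
    then have "dd (dd f v) w y = dd (dd f w) v z" using h by simp
    moreover have "dist (dd (dd f v) w y) (dd (dd f v) w x) < e/2" "dist (dd (dd f w) v z) (dd (dd f w) v x) < e/2"
      using d y z hh by (auto simp: add.commute)
    ultimately show ?thesis unfolding dist_real_def by argo
  qed
  then have "\<bar>dd (dd f v) w x - dd (dd f w) v x\<bar> \<le> 0"
    using field_le_epsilon[of "\<bar>dd (dd f v) w x - dd (dd f w) v x\<bar>" 0] by simp
  then show ?thesis by simp
qed

section \<open>Compactly supported functions and square integrability\<close>


text \<open>Compact support recorded as vanishing outside a ball, which passes through products,
  derivatives and affine maps more easily than a statement about closures.\<close>

definition bsupp :: "('a::euclidean_space \<Rightarrow> real) \<Rightarrow> bool" where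
  "bsupp f \<longleftrightarrow> (\<exists>R. \<forall>x. norm x > R \<longrightarrow> f x = 0)"

definition C1c :: "('a::euclidean_space \<Rightarrow> real) \<Rightarrow> bool" where
  "C1c f \<longleftrightarrow> (\<forall>x. f differentiable (at x)) \<and> (\<forall>v. continuous_on UNIV (dd f v)) \<and> bsupp f"

lemma bsupp_mult: "bsupp f \<or> bsupp g \<Longrightarrow> bsupp (\<lambda>x. f x * g x)"
  unfolding bsupp_def by force

lemma bsupp_add:
  assumes "bsupp f" "bsupp g" shows "bsupp (\<lambda>x. f x + g x)"
proof -
  obtain R S where "\<forall>x. norm x > R \<longrightarrow> f x = 0" "\<forall>x. norm x > S \<longrightarrow> g x = 0"
    using assms unfolding bsupp_def by blast
  then show ?thesis unfolding bsupp_def by (intro exI[of _ "max R S"]) auto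
qed

lemma bsupp_dd:
  assumes "bsupp f" shows "bsupp (dd f v)"
proof -
  obtain R where R: "\<And>x. norm x > R \<Longrightarrow> f x = 0" using assms unfolding bsupp_def by blast
  have "dd f v x = 0" if "norm x > R" for x
    using that R by (intro dd_locally_zero[of "- cball 0 R"]) auto
  then show ?thesis unfolding bsupp_def by blast
qed

lemma test_fun_iff: "test_fun f \<longleftrightarrow> smooth f \<and> bsupp f"
proof -
  have "compact (closure {x. f x \<noteq> 0}) \<longleftrightarrow> bounded {x. f x \<noteq> 0}" by simp
  also have "\<dots> \<longleftrightarrow> bsupp f"
    unfolding bsupp_def bounded_iff by (auto simp: not_less[symmetric])
  finally show ?thesis unfolding test_fun_def smooth_def by blast
qed

lemma test_fun_dd: "test_fun f \<Longrightarrow> test_fun (dd f v)"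
  by (simp add: test_fun_iff smooth_dd bsupp_dd)

lemma test_fun_C1c: "test_fun f \<Longrightarrow> C1c f"
  by (simp add: test_fun_iff C1c_def smooth_differentiable smooth_continuous[OF smooth_dd])

lemma test_fun_mult: "test_fun f \<Longrightarrow> smooth g \<Longrightarrow> test_fun (\<lambda>x. f x * g x)"
  by (simp add: test_fun_iff smooth_mult bsupp_mult)

lemma test_fun_add: "test_fun f \<Longrightarrow> test_fun g \<Longrightarrow> test_fun (\<lambda>x. f x + g x)"
  by (simp add: test_fun_iff smooth_add bsupp_add)

lemma bsupp_affine:
  assumes "bsupp f" "c \<noteq> 0" shows "bsupp (\<lambda>x. f (c *\<^sub>R x + a))"
proof -
  obtain R where R: "\<And>x. norm x > R \<Longrightarrow> f x = 0" using assms unfolding bsupp_def by blast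
  have "f (c *\<^sub>R x + a) = 0" if "norm x > (R + norm a) / \<bar>c\<bar>" for x
  proof (rule R)
    have "R + norm a < norm (c *\<^sub>R x)" using that assms(2) by (simp add: field_simps)
    then show "R < norm (c *\<^sub>R x + a)" using norm_triangle_ineq4[of "c *\<^sub>R x + a" a] by simp
  qed
  then show ?thesis unfolding bsupp_def by blast
qed

lemma test_fun_affine: "test_fun f \<Longrightarrow> c \<noteq> 0 \<Longrightarrow> test_fun (\<lambda>x. f (c *\<^sub>R x + a))"
  by (simp add: test_fun_iff smooth_affine bsupp_affine)

lemma test_fun_reflect: "test_fun f \<Longrightarrow> test_fun (\<lambda>x. f (a - x))"
  using test_fun_affine[of f "-1" a] by simp

lemma continuous_bsupp_bounded:
  assumes "continuous_on UNIV f" "bsupp f"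
  obtains B where "B > 0" "\<And>x. \<bar>f x\<bar> \<le> B"
proof -
  obtain R where R: "\<And>x. norm x > R \<Longrightarrow> f x = 0" using assms unfolding bsupp_def by blast
  have "compact (f ` cball 0 R)"
    using assms(1) by (intro compact_continuous_image) (auto intro: continuous_on_subset)
  then obtain B where B: "\<And>y. y \<in> f ` cball 0 R \<Longrightarrow> \<bar>y\<bar> \<le> B"
    using compact_imp_bounded bounded_iff by (metis real_norm_def)
  have "\<bar>f x\<bar> \<le> \<bar>B\<bar> + 1" for x
    using B[of "f x"] R[of x] by (cases "norm x \<le> R") auto
  then show ?thesis using that[of "\<bar>B\<bar> + 1"] by auto
qed

lemma continuous_bsupp_integrable:
  fixes f :: "'a::euclidean_space \<Rightarrow> real"
  assumes "continuous_on UNIV f" "bsupp f"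
  shows "integrable lborel f"
proof -
  obtain R where R: "\<And>x. norm x > R \<Longrightarrow> f x = 0" using assms unfolding bsupp_def by blast
  have "integrable lborel (\<lambda>x. indicator (cball 0 R) x *\<^sub>R f x)"
    using assms(1) by (intro borel_integrable_compact) (auto intro: continuous_on_subset)
  moreover have "(\<lambda>x. indicator (cball 0 R) x *\<^sub>R f x) = f"
    using R by (intro ext) (auto simp: indicator_def not_le)
  ultimately show ?thesis by simp
qed

lemma continuous_bsupp_uniform:
  fixes f :: "'a::euclidean_space \<Rightarrow> real"
  assumes "continuous_on UNIV f" "bsupp f" "e > 0"
  obtains d where "d > 0" "\<And>x y. norm (x - y) < d \<Longrightarrow> \<bar>f x - f y\<bar> < e"
proof -
  obtain R where R: "\<And>x. norm x > R \<Longrightarrow> f x = 0" using assms unfolding bsupp_def by blast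
  have "uniformly_continuous_on (cball 0 (R + 1)) f"
    using assms(1) by (intro compact_uniformly_continuous) (auto intro: continuous_on_subset)
  then obtain d where d: "d > 0"
    "\<And>x y. x \<in> cball 0 (R+1) \<Longrightarrow> y \<in> cball 0 (R+1) \<Longrightarrow> dist y x < d \<Longrightarrow> dist (f y) (f x) < e"
    unfolding uniformly_continuous_on_def using \<open>e > 0\<close> by metis
  have "\<bar>f x - f y\<bar> < e" if "norm (x - y) < min d 1" for x y
  proof (cases "norm x \<le> R \<or> norm y \<le> R")
    case True
    then have "norm x \<le> R + 1 \<and> norm y \<le> R + 1"
      using that norm_triangle_sub[of x y] norm_triangle_sub[of y x] by (auto simp: norm_minus_commute)
    then show ?thesis using d(2)[of y x] that by (auto simp: dist_norm)
  next
    case False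
    then show ?thesis using R \<open>e > 0\<close> by auto
  qed
  then show ?thesis using that[of "min d 1"] d by auto
qed

lemma integrable_indicator_cball: "integrable lborel (indicator (cball (a::'a::euclidean_space) r) :: 'a \<Rightarrow> real)"
  using emeasure_lborel_cball_finite[of a r] by (intro integrable_real_indicator) auto

lemma integrable_lborel_affine:
  fixes f :: "'a::euclidean_space \<Rightarrow> real"
  assumes [measurable]: "f \<in> borel_measurable borel" and c: "c \<noteq> 0"
  shows "integrable lborel (\<lambda>x. f (t + c *\<^sub>R x)) \<longleftrightarrow> integrable lborel f"
    and "integral\<^sup>L lborel f = \<bar>c\<bar> ^ DIM('a) * integral\<^sup>L lborel (\<lambda>x. f (t + c *\<^sub>R x))"
proof -
  have *: "integrable lborel f \<longleftrightarrow> integrable (density (distr lborel borel (\<lambda>x. t + c *\<^sub>R x)) (\<lambda>_. ennreal (\<bar>c\<bar>^DIM('a)))) f"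
    "integral\<^sup>L lborel f = integral\<^sup>L (density (distr lborel borel (\<lambda>x. t + c *\<^sub>R x)) (\<lambda>_. ennreal (\<bar>c\<bar>^DIM('a)))) f"
    using lborel_affine[OF c, of t] by (simp_all add: ennreal_power)
  show "integrable lborel (\<lambda>x. f (t + c *\<^sub>R x)) \<longleftrightarrow> integrable lborel f"
    using c by (subst *(1), subst integrable_density) (auto simp: integrable_distr_eq)
  show "integral\<^sup>L lborel f = \<bar>c\<bar> ^ DIM('a) * integral\<^sup>L lborel (\<lambda>x. f (t + c *\<^sub>R x))"
    by (subst *(2), subst integral_density) (auto simp: integral_distr)
qed

lemma lborel_shift:
  fixes f :: "'a::euclidean_space \<Rightarrow> real"
  assumes "f \<in> borel_measurable borel"
  shows "integrable lborel (\<lambda>x. f (x + a)) \<longleftrightarrow> integrable lborel f"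
    and "integral\<^sup>L lborel (\<lambda>x. f (x + a)) = integral\<^sup>L lborel f"
  using integrable_lborel_affine[OF assms, of 1 a] by (simp_all add: add.commute)

lemma lborel_reflect:
  fixes f :: "'a::euclidean_space \<Rightarrow> real"
  assumes "f \<in> borel_measurable borel"
  shows "integrable lborel (\<lambda>x. f (a - x)) \<longleftrightarrow> integrable lborel f"
    and "integral\<^sup>L lborel (\<lambda>x. f (a - x)) = integral\<^sup>L lborel f"
  using integrable_lborel_affine[OF assms, of "-1" a] by simp_all

lemma continuous_borel: "continuous_on UNIV f \<Longrightarrow> f \<in> borel_measurable borel"
  by (rule borel_measurable_continuous_onI)

lemma C1c_continuous: "C1c f \<Longrightarrow> continuous_on A f"
  unfolding C1c_def by (meson continuous_at_imp_continuous_on differentiable_imp_continuous_within)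

text \<open>By translation invariance every difference quotient of \<open>f\<close> has integral 0;
  the quotients converge to the derivative and are dominated by a constant on a fixed ball. All
  integrations by parts below rest on this fact.\<close>

lemma C1c_integral_dd:
  assumes f: "C1c f"
  shows "integral\<^sup>L lborel (dd f v) = 0"
proof -
  have diff: "\<And>x. f differentiable (at x)" and cont: "continuous_on UNIV (dd f v)" and b: "bsupp f"
    using f by (auto simp: C1c_def)
  obtain R where R: "\<And>x. norm x > R \<Longrightarrow> f x = 0" using b unfolding bsupp_def by blast
  obtain B where B: "B > 0" "\<And>x. \<bar>dd f v x\<bar> \<le> B"
    using continuous_bsupp_bounded[OF cont bsupp_dd[OF b]] by blast
  have fm: "f \<in> borel_measurable borel" using C1c_continuous[OF f] continuous_borel by blast
  have fi: "integrable lborel f" using continuous_bsupp_integrable[OF C1c_continuous[OF f] b] .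
  define h where "h n = inverse (real (Suc n))" for n
  have h: "h n > 0" "h n \<le> 1" for n by (auto simp: h_def field_simps)
  define q where "q n x = (f (x + h n *\<^sub>R v) - f x) / h n" for n x
  have "(\<lambda>n. integral\<^sup>L lborel (q n)) \<longlonglongrightarrow> integral\<^sup>L lborel (dd f v)"
  proof (rule integral_dominated_convergence[where w="\<lambda>x. B * indicator (cball 0 (R + norm v)) x"])
    show "dd f v \<in> borel_measurable lborel" using continuous_borel[OF cont] by simp
    show "q n \<in> borel_measurable lborel" for n
      unfolding q_def using fm by measurable
    show "integrable lborel (\<lambda>x. B * indicator (cball 0 (R + norm v)) x)"
      by (intro Bochner_Integration.integrable_mult_right integrable_indicator_cball)
    have "(\<lambda>n. q n x) \<longlonglongrightarrow> dd f v x" for x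
    proof -
      have "((\<lambda>t. (f (x + t *\<^sub>R v) - f x) / t) \<longlongrightarrow> dd f v x) (at 0)"
        using has_real_derivative_line[where t=0 and x=x and v=v, OF diff] by (simp add: DERIV_def)
      moreover have "filterlim h (at 0) sequentially"
        unfolding filterlim_at using LIMSEQ_inverse_real_of_nat
        by (auto simp: h_def[abs_def])
      ultimately show ?thesis unfolding q_def by (rule filterlim_compose)
    qed
    then show "AE x in lborel. (\<lambda>n. q n x) \<longlonglongrightarrow> dd f v x" by simp
    \<comment> \<open>Increments \<open>h n\<close> of at most 1 keep the support of the quotient
      inside the ball of radius \<open>R + norm v\<close>; there the mean value theorem bounds it by
      \<open>B\<close>.\<close>
    have "norm (q n x) \<le> B * indicator (cball 0 (R + norm v)) x" for n x
    proof (cases "norm x \<le> R + norm v")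
      case True
      obtain t where "f (x + h n *\<^sub>R v) - f x = h n * dd f v (x + t *\<^sub>R v)"
        using dd_mvt[OF diff h(1)[of n], of x v] by blast
      then have "q n x = dd f v (x + t *\<^sub>R v)" unfolding q_def using h(1)[of n] by simp
      then show ?thesis using True B(2) by simp
    next
      case False
      have "norm (h n *\<^sub>R v) \<le> norm v" using h[of n] by (simp add: mult_left_le_one_le)
      then have "norm (x + h n *\<^sub>R v) > R"
        using False norm_triangle_ineq4[of "x + h n *\<^sub>R v" "h n *\<^sub>R v"] by simp
      moreover have "norm x > R" using False norm_ge_zero[of v] by linarith
      ultimately show ?thesis using False R by (simp add: q_def)
    qed
    then show "AE x in lborel. norm (q n x) \<le> B * indicator (cball 0 (R + norm v)) x" for n by simp
  qed
  moreover have "integral\<^sup>L lborel (q n) = 0" for n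
  proof -
    have "integrable lborel (\<lambda>x. f (x + h n *\<^sub>R v))" using lborel_shift(1)[OF fm] fi by simp
    then show ?thesis unfolding q_def using fi lborel_shift(2)[OF fm] by simp
  qed
  ultimately show ?thesis by (simp add: LIMSEQ_const_iff)
qed

lemma C1c_mult:
  assumes f: "C1c f" and g: "\<And>x. g differentiable (at x)" "\<And>v. continuous_on UNIV (dd g v)"
  shows "C1c (\<lambda>x. f x * g x)"
proof -
  have "continuous_on UNIV g"
    using g(1) by (meson continuous_at_imp_continuous_on differentiable_imp_continuous_within)
  moreover have "dd (\<lambda>x. f x * g x) v = (\<lambda>x. f x * dd g v x + dd f v x * g x)" for v
    using f g by (auto simp: C1c_def intro!: dd_mult)
  ultimately show ?thesis
    using f g C1c_continuous[OF f] unfolding C1c_def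
    by (auto intro!: differentiable_mult bsupp_mult continuous_intros)
qed

lemma C1c_mult_smooth: "C1c f \<Longrightarrow> smooth g \<Longrightarrow> C1c (\<lambda>x. f x * g x)"
  by (rule C1c_mult) (auto intro: smooth_differentiable smooth_continuous smooth_dd)

section \<open>Square-integrable functions and their limits\<close>

definition L2 :: "('a::euclidean_space \<Rightarrow> real) \<Rightarrow> bool" where
  "L2 f \<longleftrightarrow> f \<in> borel_measurable borel \<and> integrable lborel (\<lambda>x. (f x)\<^sup>2)"

lemma L2_measurable [measurable_dest]: "L2 f \<Longrightarrow> f \<in> borel_measurable borel"
  by (simp add: L2_def)

lemma L2_integrable: "L2 f \<Longrightarrow> integrable lborel (\<lambda>x. (f x)\<^sup>2)"
  by (simp add: L2_def)

lemma L2_mult_integrable: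
  assumes "L2 f" "L2 g" shows "integrable lborel (\<lambda>x. f x * g x)"
proof (rule Bochner_Integration.integrable_bound)
  show "integrable lborel (\<lambda>x. (f x)\<^sup>2 + (g x)\<^sup>2)" using assms by (simp add: L2_def)
  have "\<bar>a * b\<bar> \<le> a\<^sup>2 + b\<^sup>2" for a b :: real
  proof -
    have "2 * \<bar>a * b\<bar> \<le> a\<^sup>2 + b\<^sup>2"
      using zero_le_power2[of "\<bar>a\<bar> - \<bar>b\<bar>"] by (simp add: power2_diff abs_mult)
    then show ?thesis by (smt (verit) abs_ge_zero)
  qed
  then show "AE x in lborel. norm (f x * g x) \<le> norm ((f x)\<^sup>2 + (g x)\<^sup>2)" by simp
qed (use assms in \<open>auto simp: L2_def\<close>)

lemma L2_bound:
  assumes "L2 g" "f \<in> borel_measurable borel" "\<And>x. \<bar>f x\<bar> \<le> C * \<bar>g x\<bar>" "C \<ge> 0"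
  shows "L2 f"
proof -
  have "integrable lborel (\<lambda>x. (f x)\<^sup>2)"
  proof (rule Bochner_Integration.integrable_bound)
    show "integrable lborel (\<lambda>x. C\<^sup>2 * (g x)\<^sup>2)" using assms by (simp add: L2_def)
    have "(f x)\<^sup>2 \<le> C\<^sup>2 * (g x)\<^sup>2" for x
      using power_mono[OF assms(3), of x 2] by (simp add: power_mult_distrib)
    then show "AE x in lborel. norm ((f x)\<^sup>2) \<le> norm (C\<^sup>2 * (g x)\<^sup>2)" by simp
  qed (use assms in simp)
  then show ?thesis using assms by (simp add: L2_def)
qed

lemma L2_bounded_mult:
  assumes "L2 g" "f \<in> borel_measurable borel" "\<And>x. \<bar>f x\<bar> \<le> C"
  shows "L2 (\<lambda>x. f x * g x)"
proof (rule L2_bound[OF assms(1), of _ C])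
  show "0 \<le> C" using assms(3)[of undefined] by linarith
qed (use assms in \<open>auto simp: abs_mult mult_right_mono\<close>)

lemma L2_cmult: "L2 f \<Longrightarrow> L2 (\<lambda>x. c * f x)"
  by (auto simp: L2_def power_mult_distrib)

lemma L2_add:
  assumes "L2 f" "L2 g" shows "L2 (\<lambda>x. f x + g x)"
proof -
  have "integrable lborel (\<lambda>x. (f x)\<^sup>2 + (g x)\<^sup>2 + 2 * (f x * g x))"
    using assms L2_mult_integrable[OF assms] by (simp add: L2_def)
  moreover have "(\<lambda>x. (f x + g x)\<^sup>2) = (\<lambda>x. (f x)\<^sup>2 + (g x)\<^sup>2 + 2 * (f x * g x))"
    by (simp add: power2_sum mult.assoc)
  ultimately show ?thesis using assms by (auto simp: L2_def)
qed

lemma L2_diff: "L2 f \<Longrightarrow> L2 g \<Longrightarrow> L2 (\<lambda>x. f x - g x)"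
  using L2_add[OF _ L2_cmult[of g "-1"], of f] by simp

lemma L2_abs: "L2 f \<Longrightarrow> L2 (\<lambda>x. \<bar>f x\<bar>)"
  by (auto simp: L2_def)

lemma L2_affine: "L2 f \<Longrightarrow> c \<noteq> 0 \<Longrightarrow> L2 (\<lambda>x. f (t + c *\<^sub>R x))"
  using integrable_lborel_affine(1)[of "\<lambda>x. (f x)\<^sup>2" c t] by (auto simp: L2_def)

lemma L2_continuous_bsupp: "continuous_on UNIV f \<Longrightarrow> bsupp f \<Longrightarrow> L2 f"
  unfolding L2_def using continuous_bsupp_integrable[of "\<lambda>x. f x * f x"] bsupp_mult[of f f]
  by (simp add: continuous_borel power2_eq_square continuous_on_mult)

lemma test_fun_L2: "test_fun f \<Longrightarrow> L2 f"
  by (simp add: test_fun_iff L2_continuous_bsupp smooth_continuous)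

lemma Cauchy_Schwarz_integral:
  assumes "L2 f" "L2 g"
  shows "(\<integral>x. f x * g x \<partial>lborel)\<^sup>2 \<le> (\<integral>x. (f x)\<^sup>2 \<partial>lborel) * (\<integral>x. (g x)\<^sup>2 \<partial>lborel)"
proof -
  let ?A = "\<integral>x. (f x)\<^sup>2 \<partial>lborel" and ?B = "\<integral>x. f x * g x \<partial>lborel" and ?C = "\<integral>x. (g x)\<^sup>2 \<partial>lborel"
  have i: "integrable lborel (\<lambda>x. (f x)\<^sup>2)" "integrable lborel (\<lambda>x. (g x)\<^sup>2)" "integrable lborel (\<lambda>x. f x * g x)"
    using assms L2_mult_integrable by (auto simp: L2_def)
  have q: "0 \<le> ?A - 2 * t * ?B + t\<^sup>2 * ?C" for t
  proof -
    have "0 \<le> (\<integral>x. (f x - t * g x)\<^sup>2 \<partial>lborel)" by simp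
    also have "\<dots> = (\<integral>x. (f x)\<^sup>2 - 2 * t * (f x * g x) + t\<^sup>2 * (g x)\<^sup>2 \<partial>lborel)"
      by (simp add: power2_diff power_mult_distrib algebra_simps)
    also have "\<dots> = ?A - 2 * t * ?B + t\<^sup>2 * ?C" using i by simp
    finally show ?thesis .
  qed
  show ?thesis
  proof (cases "?C = 0")
    case True
    have "?B = 0"
    proof (rule ccontr)
      assume nz: "?B \<noteq> 0"
      \<comment> \<open>With \<open>?C = 0\<close> the quadratic is affine in \<open>t\<close>, and
        this \<open>t\<close> gives it the value -1.\<close>
      show False using q[of "(?A + 1) / (2 * ?B)"] True nz by simp
    qed
    then show ?thesis by simp
  next
    case False
    then have C: "?C > 0" by (simp add: less_le)
    have "?A - 2 * (?B / ?C) * ?B + (?B / ?C)\<^sup>2 * ?C = ?A - ?B\<^sup>2 / ?C"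
      using C by (simp add: power2_eq_square field_simps)
    then have "?B\<^sup>2 / ?C \<le> ?A" using q[of "?B / ?C"] by simp
    then show ?thesis using C by (simp add: field_simps)
  qed
qed

lemma Cauchy_Schwarz_sqrt:
  assumes "L2 f" "L2 g"
  shows "(\<integral>x. \<bar>f x\<bar> * \<bar>g x\<bar> \<partial>lborel) \<le> sqrt (\<integral>x. (f x)\<^sup>2 \<partial>lborel) * sqrt (\<integral>x. (g x)\<^sup>2 \<partial>lborel)"
  using real_le_rsqrt[OF Cauchy_Schwarz_integral[OF L2_abs[OF assms(1)] L2_abs[OF assms(2)]]]
  by (simp add: real_sqrt_mult)

definition L2_conv :: "(nat \<Rightarrow> 'a::euclidean_space \<Rightarrow> real) \<Rightarrow> ('a \<Rightarrow> real) \<Rightarrow> bool" where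
  "L2_conv p q \<longleftrightarrow> (\<forall>n. L2 (p n)) \<and> L2 q \<and> (\<lambda>n. \<integral>x. (p n x - q x)\<^sup>2 \<partial>lborel) \<longlonglongrightarrow> 0"

lemma L2_conv_const: "L2 p \<Longrightarrow> L2_conv (\<lambda>n. p) p"
  by (simp add: L2_conv_def)

text \<open>The difference of the products is split into \<open>(p n - p') * (q n - q')\<close>,
  \<open>(p n - p') * q'\<close> and \<open>p' * (q n - q')\<close>, and Cauchy-Schwarz handles each
  part. This is how the identities for mollified functions pass to the limit, with
  \<open>psi\<close> a fixed weight such as a cutoff or its derivative.\<close>

lemma L2_conv_product:
  assumes p: "L2_conv p p'" and q: "L2_conv q q'"
    and psi: "psi \<in> borel_measurable borel" "\<And>x. \<bar>psi x\<bar> \<le> C"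
  shows "(\<lambda>n. \<integral>x. psi x * (p n x * q n x) \<partial>lborel) \<longlonglongrightarrow> (\<integral>x. psi x * (p' x * q' x) \<partial>lborel)"
proof -
  have C: "C \<ge> 0" using psi(2)[of undefined] by linarith
  have l: "L2 (p n)" "L2 (q n)" "L2 p'" "L2 q'" "L2 (\<lambda>x. p n x - p' x)" "L2 (\<lambda>x. q n x - q' x)" for n
    using p q by (auto simp: L2_conv_def intro: L2_diff)
  define a where "a n = sqrt (\<integral>x. (p n x - p' x)\<^sup>2 \<partial>lborel)" for n
  define b where "b n = sqrt (\<integral>x. (q n x - q' x)\<^sup>2 \<partial>lborel)" for n
  define P where "P = sqrt (\<integral>x. (p' x)\<^sup>2 \<partial>lborel)"
  define Q where "Q = sqrt (\<integral>x. (q' x)\<^sup>2 \<partial>lborel)"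
  have a: "a \<longlonglongrightarrow> 0" and b: "b \<longlonglongrightarrow> 0"
    using p q tendsto_real_sqrt unfolding L2_conv_def a_def b_def by fastforce+
  have int: "integrable lborel (\<lambda>x. psi x * (f x * g x))" if "L2 f" "L2 g" for f g
    using L2_mult_integrable[OF L2_bounded_mult[OF that(1) psi] that(2)] by (simp add: mult.assoc)
  have iabs: "integrable lborel (\<lambda>x. \<bar>f x\<bar> * \<bar>g x\<bar>)" if "L2 f" "L2 g" for f g :: "'a \<Rightarrow> real"
    using L2_mult_integrable[OF L2_abs L2_abs] that by blast
  have bound: "\<bar>(\<integral>x. psi x * (p n x * q n x) \<partial>lborel) - (\<integral>x. psi x * (p' x * q' x) \<partial>lborel)\<bar>
      \<le> C * (a n * b n + a n * Q + P * b n)" for n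
  proof -
    let ?r = "\<lambda>x. \<bar>p n x - p' x\<bar> * \<bar>q n x - q' x\<bar> + \<bar>p n x - p' x\<bar> * \<bar>q' x\<bar> + \<bar>p' x\<bar> * \<bar>q n x - q' x\<bar>"
    have ir: "integrable lborel ?r" using iabs l by (intro Bochner_Integration.integrable_add) auto
    have "\<bar>(\<integral>x. psi x * (p n x * q n x) \<partial>lborel) - (\<integral>x. psi x * (p' x * q' x) \<partial>lborel)\<bar>
      = \<bar>\<integral>x. psi x * (p n x * q n x) - psi x * (p' x * q' x) \<partial>lborel\<bar>"
      using int l by simp
    also have "\<dots> \<le> (\<integral>x. C * ?r x \<partial>lborel)"
    proof (rule integral_abs_bound_integral)
      fix x
      have "p n x * q n x - p' x * q' x = (p n x - p' x) * (q n x - q' x) + (p n x - p' x) * q' x + p' x * (q n x - q' x)"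
        by (simp add: algebra_simps)
      then have "\<bar>p n x * q n x - p' x * q' x\<bar> \<le> ?r x"
        by (simp only: abs_mult[symmetric])
      then show "\<bar>psi x * (p n x * q n x) - psi x * (p' x * q' x)\<bar> \<le> C * ?r x"
        using psi(2)[of x] C mult_mono[of "\<bar>psi x\<bar>" C "\<bar>p n x * q n x - p' x * q' x\<bar>" "?r x"]
        by (simp only: right_diff_distrib[symmetric] abs_mult)
    qed (use int l ir in auto)
    also have "\<dots> = C * ((\<integral>x. \<bar>p n x - p' x\<bar> * \<bar>q n x - q' x\<bar> \<partial>lborel)
        + (\<integral>x. \<bar>p n x - p' x\<bar> * \<bar>q' x\<bar> \<partial>lborel) + (\<integral>x. \<bar>p' x\<bar> * \<bar>q n x - q' x\<bar> \<partial>lborel))"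
      using iabs l by simp
    also have "\<dots> \<le> C * (a n * b n + a n * Q + P * b n)"
      unfolding a_def b_def P_def Q_def using l C
      by (intro mult_left_mono add_mono Cauchy_Schwarz_sqrt) auto
    finally show ?thesis .
  qed
  have "(\<lambda>n. C * (a n * b n + a n * Q + P * b n)) \<longlonglongrightarrow> C * (0 * 0 + 0 * Q + P * 0)"
    by (intro tendsto_intros a b)
  then have "(\<lambda>n. C * (a n * b n + a n * Q + P * b n)) \<longlonglongrightarrow> 0" by simp
  moreover have "\<forall>\<^sub>F n in sequentially. norm ((\<integral>x. psi x * (p n x * q n x) \<partial>lborel) - (\<integral>x. psi x * (p' x * q' x) \<partial>lborel))
      \<le> norm (C * (a n * b n + a n * Q + P * b n)) * 1"
    using order_trans[OF bound abs_ge_self] by simp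
  ultimately have "(\<lambda>n. (\<integral>x. psi x * (p n x * q n x) \<partial>lborel) - (\<integral>x. psi x * (p' x * q' x) \<partial>lborel)) \<longlonglongrightarrow> 0"
    by (rule tendsto_0_le)
  then show ?thesis by (simp add: LIM_zero_iff)
qed

section \<open>Continuity of translations\<close>


text \<open>Measurability and integrability are part of the predicate so that it can be carried
  through the induction over integrable functions.\<close>

definition L1_translation_continuous :: "('a::euclidean_space \<Rightarrow> real) \<Rightarrow> bool" where
  "L1_translation_continuous f \<longleftrightarrow> f \<in> borel_measurable borel \<and> integrable lborel f \<and>
     (\<forall>e>0. \<exists>d>0. \<forall>z. norm z < d \<longrightarrow> (\<integral>x. \<bar>f (x + z) - f x\<bar> \<partial>lborel) < e)"

text \<open>A three-epsilon argument: a translation does not change the L^1 distance between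
  \<open>f\<close> and its approximation.\<close>

lemma L1_translation_continuous_limit:
  fixes f :: "'a::euclidean_space \<Rightarrow> real"
  assumes f[measurable]: "f \<in> borel_measurable borel" and fi: "integrable lborel f"
    and app: "\<And>e. e > 0 \<Longrightarrow> \<exists>g. L1_translation_continuous g \<and> (\<integral>x. \<bar>f x - g x\<bar> \<partial>lborel) < e"
  shows "L1_translation_continuous f"
  unfolding L1_translation_continuous_def
proof (intro conjI allI impI f fi)
  fix e :: real assume "e > 0"
  then obtain g where g: "L1_translation_continuous g" "(\<integral>x. \<bar>f x - g x\<bar> \<partial>lborel) < e / 3"
    using app[of "e/3"] by auto
  then obtain d where d: "d > 0" "\<And>z. norm z < d \<Longrightarrow> (\<integral>x. \<bar>g (x + z) - g x\<bar> \<partial>lborel) < e / 3"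
    using \<open>e > 0\<close> unfolding L1_translation_continuous_def by (meson divide_pos_pos zero_less_numeral)
  have [measurable]: "g \<in> borel_measurable borel" and gi: "integrable lborel g"
    using g by (auto simp: L1_translation_continuous_def)
  have "(\<integral>x. \<bar>f (x + z) - f x\<bar> \<partial>lborel) < e" if "norm z < d" for z
  proof -
    have sh: "integrable lborel (\<lambda>x. f (x + z))" "integrable lborel (\<lambda>x. g (x + z))"
      using fi gi by (simp_all add: lborel_shift)
    have "(\<integral>x. \<bar>f (x + z) - f x\<bar> \<partial>lborel) \<le>
        (\<integral>x. \<bar>f (x + z) - g (x + z)\<bar> + \<bar>g (x + z) - g x\<bar> + \<bar>f x - g x\<bar> \<partial>lborel)"
      using fi gi sh by (intro Bochner_Integration.integral_mono) auto
    also have "\<dots> = (\<integral>x. \<bar>f (x + z) - g (x + z)\<bar> \<partial>lborel) + (\<integral>x. \<bar>g (x + z) - g x\<bar> \<partial>lborel) + (\<integral>x. \<bar>f x - g x\<bar> \<partial>lborel)"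
      using fi gi sh by simp
    also have "(\<integral>x. \<bar>f (x + z) - g (x + z)\<bar> \<partial>lborel) = (\<integral>x. \<bar>f x - g x\<bar> \<partial>lborel)"
      by (rule lborel_shift(2)[of "\<lambda>x. \<bar>f x - g x\<bar>" z]) measurable
    finally show ?thesis using g d(2)[OF that] by simp
  qed
  then show "\<exists>d>0. \<forall>z. norm z < d \<longrightarrow> (\<integral>x. \<bar>f (x + z) - f x\<bar> \<partial>lborel) < e" using d(1) by blast
qed

lemma L1_translation_continuous_limit_seq:
  fixes f :: "'a::euclidean_space \<Rightarrow> real"
  assumes g: "\<And>n::nat. L1_translation_continuous (g n)"
    and f[measurable]: "f \<in> borel_measurable borel" and w: "integrable lborel w"
    and lim: "\<And>x. (\<lambda>n. g n x) \<longlonglongrightarrow> f x" and bound: "\<And>n x. \<bar>g n x\<bar> \<le> w x"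
  shows "L1_translation_continuous f"
proof (rule L1_translation_continuous_limit[OF f])
  have [measurable]: "g n \<in> borel_measurable borel" for n
    using g by (simp add: L1_translation_continuous_def)
  have bf: "\<bar>f x\<bar> \<le> w x" for x
    by (rule LIMSEQ_le_const2[OF tendsto_rabs[OF lim]]) (use bound in auto)
  have w0: "w x \<ge> 0" for x using bound[of 0 x] by linarith
  show "integrable lborel f"
    by (rule Bochner_Integration.integrable_bound[OF w]) (use bf w0 in auto)
  have "(\<lambda>n. \<integral>x. \<bar>f x - g n x\<bar> \<partial>lborel) \<longlonglongrightarrow> (\<integral>x. 0 \<partial>(lborel :: 'a measure))"
  proof (rule integral_dominated_convergence[where w="\<lambda>x. 2 * w x"])
    show "AE x in lborel. (\<lambda>n. \<bar>f x - g n x\<bar>) \<longlonglongrightarrow> 0"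
    proof (rule AE_I2)
      fix x
      have "(\<lambda>n. \<bar>f x - g n x\<bar>) \<longlonglongrightarrow> \<bar>f x - f x\<bar>" by (intro tendsto_intros lim)
      then show "(\<lambda>n. \<bar>f x - g n x\<bar>) \<longlonglongrightarrow> 0" by simp
    qed
    have "\<bar>f x - g n x\<bar> \<le> 2 * w x" for n x using bf[of x] bound[of n x] by linarith
    then show "AE x in lborel. norm \<bar>f x - g n x\<bar> \<le> 2 * w x" for n by simp
  qed (use w in auto)
  then have L: "(\<lambda>n. \<integral>x. \<bar>f x - g n x\<bar> \<partial>lborel) \<longlonglongrightarrow> 0" by simp
  show "\<exists>g. L1_translation_continuous g \<and> (\<integral>x. \<bar>f x - g x\<bar> \<partial>lborel) < e" if "e > 0" for e
    using order_tendstoD(2)[OF L that] g unfolding eventually_sequentially by blast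
qed

lemma L1_translation_continuous_continuous:
  fixes f :: "'a::euclidean_space \<Rightarrow> real"
  assumes f: "continuous_on UNIV f" "bsupp f"
  shows "L1_translation_continuous f"
  unfolding L1_translation_continuous_def
proof (intro conjI allI impI)
  show fm[measurable]: "f \<in> borel_measurable borel" using f continuous_borel by blast
  show fi: "integrable lborel f" by (rule continuous_bsupp_integrable[OF f])
  obtain R where R: "\<And>x. norm x > R \<Longrightarrow> f x = 0" using f unfolding bsupp_def by blast
  fix e :: real assume "e > 0"
  define V where "V = measure lborel (cball (0::'a) (R + 1))"
  have V: "V \<ge> 0" by (simp add: V_def)
  define r where "r = e / (V + 1)"
  have r: "r > 0" using V \<open>e > 0\<close> by (simp add: r_def)
  then obtain d where d: "d > 0" "\<And>x y. norm (x - y) < d \<Longrightarrow> \<bar>f x - f y\<bar> < r"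
    using continuous_bsupp_uniform[OF f] by blast
  have "(\<integral>x. \<bar>f (x + z) - f x\<bar> \<partial>lborel) < e" if z: "norm z < min d 1" for z
  proof -
    have "(\<integral>x. \<bar>f (x + z) - f x\<bar> \<partial>lborel) \<le> (\<integral>x. r * indicator (cball (0::'a) (R + 1)) x \<partial>lborel)"
    proof (rule Bochner_Integration.integral_mono)
      show "integrable lborel (\<lambda>x. \<bar>f (x + z) - f x\<bar>)" using fi by (simp add: lborel_shift)
      show "integrable lborel (\<lambda>x::'a. r * indicator (cball 0 (R + 1)) x)"
        by (intro Bochner_Integration.integrable_mult_right integrable_indicator_cball)
      fix x
      show "\<bar>f (x + z) - f x\<bar> \<le> r * indicator (cball 0 (R + 1)) x"
      proof (cases "norm x \<le> R + 1")
        case True then show ?thesis using d(2)[of "x + z" x] z by (simp add: less_imp_le)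
      next
        case False
        then have "norm (x + z) > R" using norm_triangle_ineq4[of "x + z" z] z by simp
        then show ?thesis using False R by simp
      qed
    qed
    also have "\<dots> = r * V" by (simp add: V_def)
    also have "\<dots> < e" using V \<open>e > 0\<close> by (simp add: r_def field_simps)
    finally show ?thesis .
  qed
  then show "\<exists>d>0. \<forall>z. norm z < d \<longrightarrow> (\<integral>x. \<bar>f (x + z) - f x\<bar> \<partial>lborel) < e"
    using d(1) by (intro exI[of _ "min d 1"]) auto
qed

text \<open>The indicator of a nonempty compact set is the limit of the continuous functions
  \<open>max 0 (1 - n * infdist x K)\<close>.\<close>

lemma L1_translation_continuous_compact:
  fixes K :: "'a::euclidean_space set"
  assumes K: "compact K"
  shows "L1_translation_continuous (indicator K)"
proof (cases "K = {}")
  case True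
  then show ?thesis
    using L1_translation_continuous_continuous[of "\<lambda>x::'a. 0"] by (simp add: bsupp_def indicator_def[abs_def])
next
  case False
  obtain R where R: "\<And>x. x \<in> K \<Longrightarrow> norm x \<le> R" using compact_imp_bounded[OF K] bounded_iff by metis
  have cl: "closed K" by (rule compact_imp_closed[OF K])
  let ?g = "\<lambda>(n::nat) x. max 0 (1 - real n * infdist x K)"
  have out: "infdist x K \<ge> 1" if "norm x > R + 1" for x
  proof -
    have "1 \<le> dist x y" if y: "y \<in> K" for y
    proof -
      have "norm x \<le> norm (x - y) + norm y" by (metis norm_triangle_sub add.commute)
      then show ?thesis using R[OF y] \<open>norm x > R + 1\<close> by (simp add: dist_norm)
    qed
    then show ?thesis using False by (simp add: infdist_def cINF_greatest)
  qed
  show ?thesis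
  \<comment> \<open>The index \<open>Suc n\<close> rather than \<open>n\<close> makes every
    approximant vanish at distance at least 1 from \<open>K\<close>, so that one ball dominates them
    all.\<close>
  proof (rule L1_translation_continuous_limit_seq[where g="\<lambda>n. ?g (Suc n)" and w="indicator (cball 0 (R + 1))"])
    fix n
    have "continuous_on UNIV (?g (Suc n))" by (intro continuous_intros)
    moreover have "?g (Suc n) x = 0" if "norm x > R + 1" for x
    proof -
      have "1 * 1 \<le> real (Suc n) * infdist x K" by (rule mult_mono) (use out[OF that] in auto)
      then show ?thesis by simp
    qed
    then have b: "bsupp (?g (Suc n))" unfolding bsupp_def by blast
    ultimately show "L1_translation_continuous (?g (Suc n))"
      by (rule L1_translation_continuous_continuous)
    fix x
    show "\<bar>?g (Suc n) x\<bar> \<le> indicator (cball 0 (R + 1)) x"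
      using \<open>\<And>x. norm x > R + 1 \<Longrightarrow> ?g (Suc n) x = 0\<close>[of x] infdist_nonneg[of x K]
      by (auto simp: indicator_def not_le)
  next
    fix x
    show "(\<lambda>n. ?g (Suc n) x) \<longlonglongrightarrow> indicator K x"
    proof (cases "x \<in> K")
      case True then show ?thesis by simp
    next
      case nx: False
      then have p: "infdist x K > 0"
        using in_closed_iff_infdist_zero[OF cl False] infdist_nonneg[of x K] by (metis less_le)
      obtain N :: nat where N: "real N * infdist x K > 1" using reals_Archimedean3[OF p] by blast
      have "?g (Suc n) x = 0" if "n \<ge> N" for n
      proof -
        have "real N * infdist x K \<le> real (Suc n) * infdist x K"
          using that p by (intro mult_right_mono) auto
        then show ?thesis using N by simp
      qed
      then have "\<forall>\<^sub>F n in sequentially. indicator K x = ?g (Suc n) x"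
        using nx unfolding eventually_sequentially by (intro exI[of _ N]) auto
      then show ?thesis by (rule Lim_transform_eventually[OF tendsto_const])
    qed
  next
    show "indicator K \<in> borel_measurable borel" using cl by simp
    show "integrable lborel (indicator (cball 0 (R + 1)) :: 'a \<Rightarrow> real)" by (rule integrable_indicator_cball)
  qed
qed

lemma L1_translation_continuous_closed:
  fixes K :: "'a::euclidean_space set"
  assumes K: "closed K" "emeasure lborel K < \<infinity>"
  shows "L1_translation_continuous (indicator K)"
proof (rule L1_translation_continuous_limit_seq[where g="\<lambda>n. indicator (K \<inter> cball 0 (real n))" and w="indicator K"])
  fix n :: nat
  have "compact (K \<inter> cball 0 (real n))" using K(1) by (simp add: closed_Int_compact)
  then show "L1_translation_continuous (indicator (K \<inter> cball 0 (real n)))"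
    by (rule L1_translation_continuous_compact)
  fix x :: 'a
  show "\<bar>indicator (K \<inter> cball 0 (real n)) x\<bar> \<le> (indicator K x :: real)" by (auto simp: indicator_def)
next
  fix x :: 'a
  obtain N :: nat where "norm x \<le> real N" using real_arch_simple by blast
  then have "\<forall>\<^sub>F n in sequentially. indicator K x = (indicator (K \<inter> cball 0 (real n)) x :: real)"
    unfolding eventually_sequentially by (intro exI[of _ N]) (auto simp: indicator_def)
  then show "(\<lambda>n. indicator (K \<inter> cball 0 (real n)) x :: real) \<longlonglongrightarrow> indicator K x"
    by (rule Lim_transform_eventually[OF tendsto_const])
qed (use K in \<open>auto intro!: integrable_real_indicator\<close>)

text \<open>Inner regularity of Lebesgue measure supplies a closed subset of almost full measure, to
  which the preceding case applies.\<close>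

lemma L1_translation_continuous_indicator:
  fixes A :: "'a::euclidean_space set"
  assumes A: "A \<in> sets borel" "emeasure lborel A < \<infinity>"
  shows "L1_translation_continuous (indicator A)"
proof (rule L1_translation_continuous_limit)
  show "integrable lborel (indicator A :: 'a \<Rightarrow> real)" using A by (auto intro!: integrable_real_indicator)
  show "indicator A \<in> borel_measurable borel" using A by simp
  fix e :: real assume e: "e > 0"
  have "A \<in> sets lebesgue" using A(1) by simp
  then obtain T where T: "closed T" "T \<subseteq> A" "A - T \<in> lmeasurable" "emeasure lebesgue (A - T) < ennreal e"
    using sets_lebesgue_inner_closed[OF _ e] by metis
  have Tb: "T \<in> sets borel" using T(1) by simp
  have "emeasure lborel T \<le> emeasure lborel A" using T(2) A(1) by (intro emeasure_mono) auto
  then have "L1_translation_continuous (indicator T)"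
    using L1_translation_continuous_closed[OF T(1)] A(2) by (metis order_le_less_trans)
  moreover have "(\<lambda>x. \<bar>indicator A x - indicator T x\<bar> :: real) = indicator (A - T)"
    using T(2) by (intro ext) (auto simp: indicator_def)
  moreover have "measure lborel (A - T) < e"
  proof -
    have "emeasure lborel (A - T) < ennreal e"
      using T(4) A(1) Tb by (simp add: emeasure_completion)
    then have "ennreal (measure lborel (A - T)) < ennreal e"
      by (subst emeasure_eq_ennreal_measure[symmetric]) (auto simp: top_unique)
    then show ?thesis using e by (simp add: ennreal_less_iff)
  qed
  moreover have "(\<integral>x. indicator (A - T) x \<partial>lborel) = measure lborel (A - T)"
    using A(1) Tb by simp
  ultimately have "(\<integral>x. \<bar>indicator A x - indicator T x\<bar> \<partial>lborel) < e" by simp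
  then show "\<exists>g. L1_translation_continuous g \<and> (\<integral>x. \<bar>indicator A x - g x\<bar> \<partial>lborel) < e"
    using \<open>L1_translation_continuous (indicator T)\<close> by blast
qed

lemma L1_translation_continuous_add:
  assumes f: "L1_translation_continuous f" and g: "L1_translation_continuous g"
  shows "L1_translation_continuous (\<lambda>x. f x + g x)"
  unfolding L1_translation_continuous_def
proof (intro conjI allI impI)
  have [measurable]: "f \<in> borel_measurable borel" "g \<in> borel_measurable borel"
    and i: "integrable lborel f" "integrable lborel g"
    using f g by (auto simp: L1_translation_continuous_def)
  show "(\<lambda>x. f x + g x) \<in> borel_measurable borel" by measurable
  show "integrable lborel (\<lambda>x. f x + g x)" using i by simp
  fix e :: real assume "e > 0"
  then have e2: "e / 2 > 0" by simp
  obtain d1 where d1: "d1 > 0" "\<And>z. norm z < d1 \<Longrightarrow> (\<integral>x. \<bar>f (x + z) - f x\<bar> \<partial>lborel) < e/2"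
    using f e2 unfolding L1_translation_continuous_def by blast
  obtain d2 where d2: "d2 > 0" "\<And>z. norm z < d2 \<Longrightarrow> (\<integral>x. \<bar>g (x + z) - g x\<bar> \<partial>lborel) < e/2"
    using g e2 unfolding L1_translation_continuous_def by blast
  have "(\<integral>x. \<bar>f (x + z) + g (x + z) - (f x + g x)\<bar> \<partial>lborel) < e" if "norm z < min d1 d2" for z
  proof -
    have "(\<integral>x. \<bar>f (x + z) + g (x + z) - (f x + g x)\<bar> \<partial>lborel)
      \<le> (\<integral>x. \<bar>f (x + z) - f x\<bar> + \<bar>g (x + z) - g x\<bar> \<partial>lborel)"
      using i by (intro Bochner_Integration.integral_mono) (auto simp: lborel_shift)
    also have "\<dots> = (\<integral>x. \<bar>f (x + z) - f x\<bar> \<partial>lborel) + (\<integral>x. \<bar>g (x + z) - g x\<bar> \<partial>lborel)"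
      using i by (simp add: lborel_shift)
    finally show ?thesis using d1(2)[of z] d2(2)[of z] that by simp
  qed
  then show "\<exists>d>0. \<forall>z. norm z < d \<longrightarrow> (\<integral>x. \<bar>f (x + z) + g (x + z) - (f x + g x)\<bar> \<partial>lborel) < e"
    using d1 d2 by (intro exI[of _ "min d1 d2"]) auto
qed

lemma L1_translation_continuous_cmult:
  assumes f: "L1_translation_continuous f"
  shows "L1_translation_continuous (\<lambda>x. f x * c)"
  unfolding L1_translation_continuous_def
proof (intro conjI allI impI)
  have [measurable]: "f \<in> borel_measurable borel" and i: "integrable lborel f"
    using f by (auto simp: L1_translation_continuous_def)
  show "(\<lambda>x. f x * c) \<in> borel_measurable borel" by measurable
  show "integrable lborel (\<lambda>x. f x * c)" using i by simp
  fix e :: real assume e: "e > 0"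
  have "e / (\<bar>c\<bar> + 1) > 0" using e by simp
  then obtain d where d: "d > 0" "\<And>z. norm z < d \<Longrightarrow> (\<integral>x. \<bar>f (x + z) - f x\<bar> \<partial>lborel) < e / (\<bar>c\<bar> + 1)"
    using f unfolding L1_translation_continuous_def by metis
  have "(\<integral>x. \<bar>f (x + z) * c - f x * c\<bar> \<partial>lborel) < e" if "norm z < d" for z
  proof -
    have "(\<integral>x. \<bar>f (x + z) * c - f x * c\<bar> \<partial>lborel) = (\<integral>x. \<bar>f (x + z) - f x\<bar> \<partial>lborel) * \<bar>c\<bar>"
      by (simp add: left_diff_distrib[symmetric] abs_mult)
    also have "\<dots> \<le> (\<integral>x. \<bar>f (x + z) - f x\<bar> \<partial>lborel) * (\<bar>c\<bar> + 1)" by (simp add: mult_left_mono)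
    also have "\<dots> < e" using d(2)[OF that] by (simp add: field_simps add_pos_nonneg)
    finally show ?thesis .
  qed
  then show "\<exists>d>0. \<forall>z. norm z < d \<longrightarrow> (\<integral>x. \<bar>f (x + z) * c - f x * c\<bar> \<partial>lborel) < e"
    using d(1) by blast
qed

lemma integrable_L1_translation_continuous:
  fixes f :: "'a::euclidean_space \<Rightarrow> real"
  assumes "integrable lborel f"
  shows "L1_translation_continuous f"
  using assms
proof (induction f rule: integrable_induct)
  case (base A c)
  then show ?case
    using L1_translation_continuous_cmult[OF L1_translation_continuous_indicator[of A], of c] by simp
next
  case (add f g)
  then show ?case using L1_translation_continuous_add by blast
next
  case (lim f s)
  show ?case
  proof (rule L1_translation_continuous_limit_seq[of s f "\<lambda>x. 2 * \<bar>f x\<bar>"])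
    show "L1_translation_continuous (s i)" for i using lim by blast
  qed (use lim in auto)
qed

text \<open>The pointwise inequality \<open>pt\<close> reduces the claim to L^1 continuity of
  translations for the integrable function \<open>g x * \<bar>g x\<bar>\<close>, the signed square
  of \<open>g\<close>.\<close>

lemma L2_translation_continuous:
  fixes g :: "'a::euclidean_space \<Rightarrow> real"
  assumes g: "L2 g" and e: "e > 0"
  obtains d where "d > 0" "\<And>z. norm z < d \<Longrightarrow> (\<integral>x. (g (x + z) - g x)\<^sup>2 \<partial>lborel) < e"
proof -
  have [measurable]: "g \<in> borel_measurable borel" using g by (simp add: L2_def)
  have i: "integrable lborel (\<lambda>x. g x * \<bar>g x\<bar>)" by (rule L2_mult_integrable[OF g L2_abs[OF g]])
  have pt: "(a - b)\<^sup>2 \<le> 2 * \<bar>a * \<bar>a\<bar> - b * \<bar>b\<bar>\<bar>" for a b :: real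
  proof -
    have *: "(a - b)\<^sup>2 \<le> 2 * \<bar>a * \<bar>a\<bar> - b * \<bar>b\<bar>\<bar>" if ab: "a \<ge> b" for a b :: real
    proof -
      have m: "b * \<bar>b\<bar> \<le> a * \<bar>a\<bar>"
      proof (cases "0 \<le> b")
        case True then show ?thesis using ab by (intro mult_mono) auto
      next
        case b: False
        show ?thesis
        proof (cases "0 \<le> a")
          case True
          have "b * \<bar>b\<bar> \<le> 0" "0 \<le> a * \<bar>a\<bar>" using b True by (auto simp: mult_nonpos_nonneg)
          then show ?thesis by linarith
        next
          case False
          then have "(- a) * (- a) \<le> (- b) * (- b)" using ab by (intro mult_mono) auto
          then show ?thesis using False b by simp
        qed
      qed
      \<comment> \<open>In each sign pattern the difference of the two sides factors, as
        \<open>(a - b) * (a + 3 * b)\<close>, as \<open>(a - b) * (- b - 3 * a)\<close> or as the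
        square of \<open>a + b\<close>.\<close>
      consider "0 \<le> b" | "a \<le> 0" | "b < 0" "a > 0" by linarith
      then have "(a - b)\<^sup>2 \<le> 2 * (a * \<bar>a\<bar> - b * \<bar>b\<bar>)"
      proof cases
        case 1
        have "2 * (a * \<bar>a\<bar> - b * \<bar>b\<bar>) - (a - b)\<^sup>2 = (a - b) * (a + 3 * b)"
          using 1 ab by (simp add: power2_eq_square algebra_simps)
        moreover have "(a - b) * (a + 3 * b) \<ge> 0" using 1 ab by (intro mult_nonneg_nonneg) auto
        ultimately show ?thesis by linarith
      next
        case 2
        have "2 * (a * \<bar>a\<bar> - b * \<bar>b\<bar>) - (a - b)\<^sup>2 = (a - b) * (- b - 3 * a)"
          using 2 ab by (simp add: power2_eq_square algebra_simps)
        moreover have "(a - b) * (- b - 3 * a) \<ge> 0" using 2 ab by (intro mult_nonneg_nonneg) auto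
        ultimately show ?thesis by linarith
      next
        case 3
        have "2 * (a * \<bar>a\<bar> - b * \<bar>b\<bar>) - (a - b)\<^sup>2 = (a + b)\<^sup>2"
          using 3 by (simp add: power2_eq_square algebra_simps)
        then show ?thesis using zero_le_power2[of "a + b"] by linarith
      qed
      then show ?thesis using m by simp
    qed
    show ?thesis
      using *[of a b] *[of b a] by (cases "a \<ge> b") (auto simp: power2_commute abs_minus_commute)
  qed
  obtain d where d: "d > 0"
    "\<And>z. norm z < d \<Longrightarrow> (\<integral>x. \<bar>g (x + z) * \<bar>g (x + z)\<bar> - g x * \<bar>g x\<bar>\<bar> \<partial>lborel) < e / 2"
    using integrable_L1_translation_continuous[OF i] half_gt_zero[OF e]
    unfolding L1_translation_continuous_def by blast
  have "(\<integral>x. (g (x + z) - g x)\<^sup>2 \<partial>lborel) < e" if "norm z < d" for z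
  proof -
    have "L2 (\<lambda>x. g (x + z))" using L2_affine[OF g, of 1 z] by (simp add: add.commute)
    then have "integrable lborel (\<lambda>x. (g (x + z) - g x)\<^sup>2)" using L2_integrable[OF L2_diff[OF _ g]] by blast
    moreover have "integrable lborel (\<lambda>x. g (x + z) * \<bar>g (x + z)\<bar>)"
      using lborel_shift(1)[of "\<lambda>x. g x * \<bar>g x\<bar>" z] i by simp
    ultimately have "(\<integral>x. (g (x + z) - g x)\<^sup>2 \<partial>lborel)
      \<le> (\<integral>x. 2 * \<bar>g (x + z) * \<bar>g (x + z)\<bar> - g x * \<bar>g x\<bar>\<bar> \<partial>lborel)"
      using i pt by (intro Bochner_Integration.integral_mono) auto
    also have "\<dots> < e" using d(2)[OF that] by simp
    finally show ?thesis .
  qed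
  then show ?thesis using that d(1) by blast
qed

section \<open>Mollification\<close>


definition conv :: "('a::euclidean_space \<Rightarrow> real) \<Rightarrow> ('a \<Rightarrow> real) \<Rightarrow> 'a \<Rightarrow> real" where
  "conv \<rho> g x = (\<integral>y. \<rho> (x - y) * g y \<partial>lborel)"

lemma conv_integrable: "test_fun \<rho> \<Longrightarrow> L2 g \<Longrightarrow> integrable lborel (\<lambda>y. \<rho> (x - y) * g y)"
  by (rule L2_mult_integrable[OF test_fun_L2[OF test_fun_reflect]])

lemma test_fun_differentiable: "test_fun \<rho> \<Longrightarrow> \<rho> differentiable (at x)"
  by (simp add: test_fun_iff smooth_differentiable)

text \<open>Linearity in the direction, from which the candidate derivative in
  \<open>conv_has_derivative\<close> is seen to be a bounded linear map.\<close>

lemma conv_dd_direction: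
  assumes "test_fun \<rho>" "L2 g"
  shows "(\<Sum>b\<in>Basis. (v \<bullet> b) * conv (dd \<rho> b) g x) = conv (dd \<rho> v) g x"
proof -
  have "(\<Sum>b\<in>Basis. (v \<bullet> b) * conv (dd \<rho> b) g x) = (\<integral>y. (\<Sum>b\<in>Basis. (v \<bullet> b) * (dd \<rho> b (x - y) * g y)) \<partial>lborel)"
    unfolding conv_def using conv_integrable[OF test_fun_dd[OF assms(1)] assms(2)]
    by (subst Bochner_Integration.integral_sum) auto
  also have "(\<lambda>y. (\<Sum>b\<in>Basis. (v \<bullet> b) * (dd \<rho> b (x - y) * g y))) = (\<lambda>y. dd \<rho> v (x - y) * g y)"
    by (intro ext) (simp add: dd_basis_sum[OF test_fun_differentiable[OF assms(1)], of v]
        sum_distrib_right mult.assoc)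
  finally show ?thesis by (simp add: conv_def)
qed

text \<open>By uniform continuity of its partial derivatives, the first-order remainder of
  \<open>\<rho>\<close> is of smaller order than \<open>norm h\<close> uniformly in the point. For
  small \<open>h\<close> it lives on a fixed ball around \<open>x\<close>, where \<open>g\<close> is
  integrable.\<close>

lemma conv_has_derivative:
  fixes g :: "'a::euclidean_space \<Rightarrow> real"
  assumes rho: "test_fun \<rho>" and g: "L2 g"
  shows "(conv \<rho> g has_derivative (\<lambda>v. conv (dd \<rho> v) g x)) (at x)"
proof -
  define D where "D v = conv (dd \<rho> v) g x" for v
  have D: "D = (\<lambda>v. \<Sum>b\<in>Basis. (v \<bullet> b) * conv (dd \<rho> b) g x)"
    unfolding D_def using conv_dd_direction[OF rho g] by auto
  have bl: "bounded_linear D"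
    unfolding D by (intro bounded_linear_sum bounded_linear_mult_left[THEN bounded_linear_compose] bounded_linear_inner_left)
  obtain R where R: "\<And>x. norm x > R \<Longrightarrow> \<rho> x = 0" using rho unfolding test_fun_iff bsupp_def by blast
  have RD: "dd \<rho> v x = 0" if "norm x > R" for x v
    using that R by (intro dd_locally_zero[of "- cball 0 R"]) auto
  have gi: "integrable lborel (\<lambda>y. indicator (cball x (R + 1)) y * \<bar>g y\<bar>)"
  proof (rule L2_mult_integrable[OF _ L2_abs[OF g]])
    have "integrable lborel (\<lambda>y. (indicator (cball x (R + 1)) y)\<^sup>2 :: real)"
      using integrable_indicator_cball[of x "R + 1"] by (simp add: power2_eq_square indicator_inter_arith[symmetric])
    then show "L2 (indicator (cball x (R + 1)))" by (simp add: L2_def borel_measurable_indicator)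
  qed
  define M where "M = (\<integral>y. indicator (cball x (R + 1)) y * \<bar>g y\<bar> \<partial>lborel)"
  have M: "M \<ge> 0" unfolding M_def by (intro Bochner_Integration.integral_nonneg) auto
  have "(\<lambda>h. norm (conv \<rho> g (x + h) - conv \<rho> g x - D h) / norm h) \<midarrow>0\<rightarrow> 0"
  proof (rule LIM_I)
    fix e :: real assume e: "e > 0"
    \<comment> \<open>Chosen so that a remainder of at most
      \<open>real DIM('a) * r * norm h\<close>, integrated against \<open>g\<close> with local L^1
      norm \<open>M\<close>, stays below \<open>e * norm h\<close>.\<close>
    define r where "r = e / (real DIM('a) * (M + 1))"
    have r: "r > 0" using e M by (simp add: r_def)
    have "\<exists>d>0. \<forall>x y. norm (x - y) < d \<longrightarrow> \<bar>dd \<rho> b x - dd \<rho> b y\<bar> < r" for b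
    proof -
      have "test_fun (dd \<rho> b)" by (rule test_fun_dd[OF rho])
      then show ?thesis
        using continuous_bsupp_uniform[OF _ _ r, of "dd \<rho> b"] smooth_continuous unfolding test_fun_iff by metis
    qed
    then obtain d where d: "\<And>b. d b > 0" "\<And>b x y. norm (x - y) < d b \<Longrightarrow> \<bar>dd \<rho> b x - dd \<rho> b y\<bar> < r"
      by metis
    \<comment> \<open>The bound \<open>d0 \<le> 1\<close> keeps the support of the remainder inside
      the ball of radius \<open>R + 1\<close>.\<close>
    define d0 where "d0 = min 1 (Min (d ` Basis))"
    have d0: "d0 > 0" "d0 \<le> 1" "\<And>b. b \<in> Basis \<Longrightarrow> d0 \<le> d b"
      using d(1) by (auto simp: d0_def intro: min.coboundedI2 Min_le)
    have pt: "\<bar>\<rho> (z + h) - \<rho> z - dd \<rho> h z\<bar> \<le> real DIM('a) * r * norm h" if h: "norm h < d0" for h z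
    proof -
      obtain t where t: "0 < t" "t < 1" "\<rho> (z + 1 *\<^sub>R h) - \<rho> z = 1 * dd \<rho> h (z + t *\<^sub>R h)"
        using dd_mvt[OF test_fun_differentiable[OF rho] zero_less_one, of z h] by metis
      have th: "norm (t *\<^sub>R h) < d0"
      proof -
        have "norm (t *\<^sub>R h) \<le> norm h" using t by (simp add: mult_left_le_one_le)
        then show ?thesis using h by simp
      qed
      have "\<rho> (z + h) - \<rho> z - dd \<rho> h z = (\<Sum>b\<in>Basis. (h \<bullet> b) * (dd \<rho> b (z + t *\<^sub>R h) - dd \<rho> b z))"
        using t(3) dd_basis_sum[OF test_fun_differentiable[OF rho], of h "z + t *\<^sub>R h"]
          dd_basis_sum[OF test_fun_differentiable[OF rho], of h z]
        by (simp add: right_diff_distrib sum_subtractf)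
      also have "\<bar>\<dots>\<bar> \<le> (\<Sum>b\<in>Basis. \<bar>(h \<bullet> b) * (dd \<rho> b (z + t *\<^sub>R h) - dd \<rho> b z)\<bar>)" by (rule sum_abs)
      also have "\<dots> \<le> (\<Sum>b\<in>(Basis :: 'a set). norm h * r)"
      proof (rule sum_mono)
        fix b :: 'a assume b: "b \<in> Basis"
        have "\<bar>dd \<rho> b (z + t *\<^sub>R h) - dd \<rho> b z\<bar> < r"
          by (rule d(2)) (use th d0(3)[OF b] in simp)
        then show "\<bar>(h \<bullet> b) * (dd \<rho> b (z + t *\<^sub>R h) - dd \<rho> b z)\<bar> \<le> norm h * r"
          unfolding abs_mult by (intro mult_mono Basis_le_norm b) auto
      qed
      also have "\<dots> = real DIM('a) * r * norm h" by simp
      finally show ?thesis .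
    qed
    have "norm (norm (conv \<rho> g (x + h) - conv \<rho> g x - D h) / norm h - 0) < e"
      if h: "h \<noteq> 0" "norm (h - 0) < d0" for h
    proof -
      have i: "integrable lborel (\<lambda>y. (\<rho> (x + h - y) - \<rho> (x - y) - dd \<rho> h (x - y)) * g y)"
        using conv_integrable[OF rho g] conv_integrable[OF test_fun_dd[OF rho] g]
        by (simp add: left_diff_distrib)
      have "conv \<rho> g (x + h) - conv \<rho> g x - D h
          = (\<integral>y. (\<rho> (x + h - y) - \<rho> (x - y) - dd \<rho> h (x - y)) * g y \<partial>lborel)"
        using conv_integrable[OF rho g] conv_integrable[OF test_fun_dd[OF rho] g]
        by (simp add: conv_def D_def left_diff_distrib)
      also have "\<bar>\<dots>\<bar> \<le> (\<integral>y. (real DIM('a) * r * norm h) * (indicator (cball x (R + 1)) y * \<bar>g y\<bar>) \<partial>lborel)"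
      proof (rule integral_abs_bound_integral[OF i])
        show "integrable lborel (\<lambda>y. (real DIM('a) * r * norm h) * (indicator (cball x (R + 1)) y * \<bar>g y\<bar>))"
          using gi by simp
        fix y
        show "\<bar>(\<rho> (x + h - y) - \<rho> (x - y) - dd \<rho> h (x - y)) * g y\<bar>
          \<le> (real DIM('a) * r * norm h) * (indicator (cball x (R + 1)) y * \<bar>g y\<bar>)"
        proof (cases "norm (x - y) \<le> R + 1")
          case True
          then show ?thesis
            using mult_right_mono[OF pt[of h "x - y"], of "\<bar>g y\<bar>"] h
            by (simp add: abs_mult dist_norm mult.assoc add_diff_eq[symmetric] diff_add_eq)
        next
          case False
          have "norm (x - y + h) > R"
            using False h d0(2) norm_triangle_ineq4[of "x - y + h" h] by simp
          then show ?thesis using False R[of "x - y"] R[of "x - y + h"] RD[of "x - y" h]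
            by (simp add: algebra_simps dist_norm)
        qed
      qed
      also have "\<dots> = (real DIM('a) * r * norm h) * M" by (simp add: M_def)
      also have "\<dots> = e * (M / (M + 1)) * norm h" using M by (simp add: r_def)
      finally have "\<bar>conv \<rho> g (x + h) - conv \<rho> g x - D h\<bar> / norm h \<le> e * (M / (M + 1))"
        using h by (simp add: field_simps)
      also have "\<dots> < e" using e M by (simp add: field_simps)
      finally show ?thesis by simp
    qed
    then show "\<exists>s>0. \<forall>h. h \<noteq> 0 \<and> norm (h - 0) < s \<longrightarrow>
        norm (norm (conv \<rho> g (x + h) - conv \<rho> g x - D h) / norm h - 0) < e"
      using d0(1) by blast
  qed
  then show ?thesis unfolding has_derivative_at using bl unfolding D_def by blast
qed

lemma dd_conv: "test_fun \<rho> \<Longrightarrow> L2 g \<Longrightarrow> dd (conv \<rho> g) v = conv (dd \<rho> v) g"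
  using dd_eqI[OF conv_has_derivative] by blast

text \<open>For fixed \<open>g\<close> the convolutions with test functions form a derivative-closed
  family, because each derivative falls on the kernel.\<close>

lemma smooth_conv:
  assumes "test_fun \<rho>" "L2 g" shows "smooth (conv \<rho> g)"
proof (rule smooth_class[where F="{conv \<rho> g |\<rho>. test_fun \<rho>}"])
  fix f assume "f \<in> {conv \<rho> g |\<rho>. test_fun \<rho>}"
  then obtain r where r: "test_fun r" "f = conv r g" by blast
  show "(\<forall>x. f differentiable at x) \<and> (\<forall>v. dd f v \<in> {conv \<rho> g |\<rho>. test_fun \<rho>})"
    using conv_has_derivative[OF r(1) assms(2)] dd_conv[OF r(1) assms(2)] test_fun_dd[OF r(1)]
    by (auto simp: r(2) differentiable_def)
qed (use assms in blast)

section \<open>The standard mollifier and its convergence in L^2\<close>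

definition bump :: "'a::euclidean_space \<Rightarrow> real" where
  "bump x = flat 0 (1 - x \<bullet> x)"

lemma bump_nonneg: "bump x \<ge> 0" by (simp add: bump_def flat_def)

lemma bump_eq_0_iff: "bump x = 0 \<longleftrightarrow> norm x \<ge> 1"
proof -
  have "x \<bullet> x < 1 \<longleftrightarrow> norm x < 1" 
    using real_sqrt_lt_1_iff[of "x \<bullet> x"] by (simp add: norm_eq_sqrt_inner)
  then show ?thesis by (auto simp: bump_def flat_def)
qed

lemma test_fun_bump: "test_fun (bump :: 'a::euclidean_space \<Rightarrow> real)"
proof -
  have "smooth (\<lambda>x::'a. flat 0 (1 - x \<bullet> x))" by (rule smooth_alg_smooth[OF smooth_alg.bump])
  moreover have "bsupp (bump :: 'a \<Rightarrow> real)"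
    unfolding bsupp_def using bump_eq_0_iff less_imp_le by blast
  ultimately show ?thesis by (simp add: test_fun_iff bump_def[abs_def])
qed

lemma integral_bump_pos: "(\<integral>x. bump (x :: 'a::euclidean_space) \<partial>lborel) > 0"
proof -
  have i: "integrable lborel (bump :: 'a \<Rightarrow> real)"
    using test_fun_bump continuous_bsupp_integrable smooth_continuous unfolding test_fun_iff by blast
  have "(\<integral>x. bump (x :: 'a) \<partial>lborel) \<noteq> 0"
  proof
    assume "(\<integral>x. bump (x :: 'a) \<partial>lborel) = 0"
    then have "AE x in lborel. bump (x::'a) = 0"
      using integral_nonneg_eq_0_iff_AE[OF i] bump_nonneg by auto
    then have "AE x in lborel. (x::'a) \<notin> ball 0 1"
      by eventually_elim (simp add: bump_eq_0_iff)
    then have "ball (0::'a) 1 \<in> null_sets lborel"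
      by (simp add: AE_iff_null_sets)
    then have "negligible (ball (0::'a) 1)"
      using null_sets_completionI negligible_iff_null_sets by blast
    then show False using open_not_negligible[of "ball (0::'a) 1"] by simp
  qed
  moreover have "(\<integral>x. bump (x :: 'a) \<partial>lborel) \<ge> 0"
    by (intro Bochner_Integration.integral_nonneg bump_nonneg)
  ultimately show ?thesis by linarith
qed

definition moll :: "nat \<Rightarrow> 'a::euclidean_space \<Rightarrow> real" where
  "moll n x = real (Suc n) ^ DIM('a) / (\<integral>x. bump (x::'a) \<partial>lborel) * bump (real (Suc n) *\<^sub>R x)"

lemma test_fun_cmult: "test_fun f \<Longrightarrow> test_fun (\<lambda>x. c * f x)"
  using test_fun_mult[OF _ smooth_const[of c]] by (simp add: mult.commute)

lemma test_fun_moll: "test_fun (moll n)"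
proof -
  have "test_fun (\<lambda>x. c * bump (real (Suc n) *\<^sub>R x + 0))" for c
    by (intro test_fun_cmult test_fun_affine test_fun_bump) simp
  then show ?thesis unfolding moll_def by (simp only: add_0_right)
qed

lemma moll_nonneg: "moll n x \<ge> 0"
  unfolding moll_def using integral_bump_pos bump_nonneg
  by (intro mult_nonneg_nonneg divide_nonneg_nonneg) (auto simp: less_imp_le)

lemma moll_eq_0: "norm x \<ge> inverse (real (Suc n)) \<Longrightarrow> moll n x = 0"
  by (simp add: moll_def bump_eq_0_iff inverse_le_iff_le pos_divide_le_eq inverse_eq_divide mult.commute
      del: of_nat_Suc)

lemma test_fun_borel: "test_fun f \<Longrightarrow> f \<in> borel_measurable borel"
  using test_fun_L2 L2_measurable by blast

lemma integral_moll: "(\<integral>x. moll n (x::'a::euclidean_space) \<partial>lborel) = 1"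
proof -
  have "(\<integral>x. bump (x::'a) \<partial>lborel) = real (Suc n) ^ DIM('a) * (\<integral>x. bump (real (Suc n) *\<^sub>R (x::'a)) \<partial>lborel)"
    using integrable_lborel_affine(2)[OF test_fun_borel[OF test_fun_bump], of "real (Suc n)" 0] by simp
  then show ?thesis
    using integral_bump_pos[where ?'a='a] unfolding moll_def by (simp del: of_nat_Suc) (metis less_irrefl mult_zero_right)
qed

lemma integrable_moll: "integrable lborel (moll n)"
  using test_fun_moll[of n] continuous_bsupp_integrable smooth_continuous unfolding test_fun_iff by blast

text \<open>An instance of Jensen's inequality: \<open>moll n\<close> is a probability density, and
  Cauchy-Schwarz is applied with the weight split into two factors
  \<open>sqrt (moll n z)\<close>.\<close>

lemma conv_minus_square_le:
  fixes g :: "'a::euclidean_space \<Rightarrow> real"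
  assumes g: "L2 g"
  shows "(conv (moll n) g x - g x)\<^sup>2 \<le> (\<integral>z. moll n z * (g (x - z) - g x)\<^sup>2 \<partial>lborel)"
    and "integrable lborel (\<lambda>z. moll n z * (g (x - z) - g x)\<^sup>2)"
proof -
  have gm[measurable]: "g \<in> borel_measurable borel" using g by (simp add: L2_def)
  have mm[measurable]: "moll n \<in> borel_measurable borel" by (rule test_fun_borel[OF test_fun_moll])
  obtain B where B: "\<And>z::'a. \<bar>moll n z\<bar> \<le> B"
    using continuous_bsupp_bounded[of "moll n"] test_fun_moll[of n] smooth_continuous unfolding test_fun_iff by metis
  have gx: "L2 (\<lambda>z. g (x - z))" using L2_affine[OF g, of "-1" x] by simp
  have i1: "integrable lborel (\<lambda>z. moll n z * (g (x - z))\<^sup>2)"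
  proof (rule Bochner_Integration.integrable_bound)
    show "integrable lborel (\<lambda>z. B * (g (x - z))\<^sup>2)" using L2_integrable[OF gx] by simp
    show "AE z in lborel. norm (moll n z * (g (x - z))\<^sup>2) \<le> norm (B * (g (x - z))\<^sup>2)"
      using order_trans[OF B abs_ge_self] by (intro AE_I2) (auto simp: abs_mult intro!: mult_right_mono)
  qed measurable
  have i2: "integrable lborel (\<lambda>z. moll n z * g (x - z))"
    by (rule L2_mult_integrable[OF test_fun_L2[OF test_fun_moll] gx])
  have "(\<lambda>z. moll n z * (g (x - z) - g x)\<^sup>2) =
      (\<lambda>z. moll n z * (g (x - z))\<^sup>2 - 2 * g x * (moll n z * g (x - z)) + (g x)\<^sup>2 * moll n z)"
    by (simp add: power2_diff algebra_simps)
  then show i: "integrable lborel (\<lambda>z. moll n z * (g (x - z) - g x)\<^sup>2)"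
    using i1 i2 integrable_moll[of n, where ?'a='a] by simp
  have "conv (moll n) g x = (\<integral>z. moll n z * g (x - z) \<partial>lborel)"
    unfolding conv_def using lborel_reflect(2)[of "\<lambda>y. moll n (x - y) * g y" x] by simp
  also have "\<dots> - g x = (\<integral>z. moll n z * g (x - z) - g x * moll n z \<partial>lborel)"
    using i2 integrable_moll[of n, where ?'a='a] integral_moll[of n, where ?'a='a] by simp
  also have "\<dots> = (\<integral>z. sqrt (moll n z) * (sqrt (moll n z) * (g (x - z) - g x)) \<partial>lborel)"
  proof (intro Bochner_Integration.integral_cong refl)
    fix z
    have "sqrt (moll n z) * (sqrt (moll n z) * (g (x - z) - g x)) = moll n z * (g (x - z) - g x)"
      by (simp only: mult.assoc[symmetric] real_sqrt_mult_self abs_of_nonneg[OF moll_nonneg])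
    then show "moll n z * g (x - z) - g x * moll n z = sqrt (moll n z) * (sqrt (moll n z) * (g (x - z) - g x))"
      by (simp only: right_diff_distrib mult.commute)
  qed
  also have "\<dots>\<^sup>2 \<le> (\<integral>z. (sqrt (moll n z))\<^sup>2 \<partial>(lborel :: 'a measure)) * (\<integral>z. (sqrt (moll n z) * (g (x - z) - g x))\<^sup>2 \<partial>lborel)"
    using i integrable_moll[of n, where ?'a='a] by (intro Cauchy_Schwarz_integral) (auto simp: L2_def moll_nonneg power_mult_distrib)
  also have "\<dots> = (\<integral>z. moll n z * (g (x - z) - g x)\<^sup>2 \<partial>lborel)"
    by (simp add: moll_nonneg power_mult_distrib integral_moll)
  finally show "(conv (moll n) g x - g x)\<^sup>2 \<le> (\<integral>z. moll n z * (g (x - z) - g x)\<^sup>2 \<partial>lborel)" .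
qed

text \<open>Tonelli's theorem applied to the preceding pointwise bound; only translations shorter
  than the radius of \<open>moll n\<close> contribute. Working with nonnegative integrals yields
  square integrability of the convolution along the way.\<close>

lemma conv_moll_bound:
  fixes g :: "'a::euclidean_space \<Rightarrow> real"
  assumes g: "L2 g" and e: "e \<ge> 0"
    and d: "\<And>z. norm z < inverse (real (Suc n)) \<Longrightarrow> (\<integral>x. (g (x + z) - g x)\<^sup>2 \<partial>lborel) \<le> e"
  shows "L2 (conv (moll n) g)" "(\<integral>x. (conv (moll n) g x - g x)\<^sup>2 \<partial>lborel) \<le> e"
proof -
  have gm[measurable]: "g \<in> borel_measurable borel" using g by (simp add: L2_def)
  have mm[measurable]: "moll n \<in> borel_measurable borel" by (rule test_fun_borel[OF test_fun_moll])
  have cm[measurable]: "conv (moll n) g \<in> borel_measurable borel"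
    using continuous_borel smooth_continuous[OF smooth_conv[OF test_fun_moll g]] by blast
  have "(\<integral>\<^sup>+x. ennreal ((conv (moll n) g x - g x)\<^sup>2) \<partial>lborel)
      \<le> (\<integral>\<^sup>+x. (\<integral>\<^sup>+z. ennreal (moll n z * (g (x - z) - g x)\<^sup>2) \<partial>lborel) \<partial>lborel)"
  proof (rule nn_integral_mono)
    fix x
    have "ennreal ((conv (moll n) g x - g x)\<^sup>2) \<le> ennreal (\<integral>z. moll n z * (g (x - z) - g x)\<^sup>2 \<partial>lborel)"
      by (rule ennreal_leI[OF conv_minus_square_le(1)[OF g]])
    also have "\<dots> = (\<integral>\<^sup>+z. ennreal (moll n z * (g (x - z) - g x)\<^sup>2) \<partial>lborel)"
      by (rule nn_integral_eq_integral[symmetric, OF conv_minus_square_le(2)[OF g]]) (simp add: moll_nonneg)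
    finally show "ennreal ((conv (moll n) g x - g x)\<^sup>2) \<le> (\<integral>\<^sup>+z. ennreal (moll n z * (g (x - z) - g x)\<^sup>2) \<partial>lborel)" .
  qed
  also have "\<dots> = (\<integral>\<^sup>+z. (\<integral>\<^sup>+x. ennreal (moll n z * (g (x - z) - g x)\<^sup>2) \<partial>lborel) \<partial>lborel)"
    by (rule lborel_pair.Fubini') measurable
  also have "\<dots> \<le> (\<integral>\<^sup>+z. ennreal (moll n z) * ennreal e \<partial>(lborel :: 'a measure))"
  proof (rule nn_integral_mono)
    fix z :: 'a
    have L: "L2 (\<lambda>x. g (x - z) - g x)" using L2_diff[OF L2_affine[OF g, of 1 "-z"] g] by (simp add: algebra_simps)
    have "(\<integral>\<^sup>+x. ennreal (moll n z * (g (x - z) - g x)\<^sup>2) \<partial>lborel)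
       = ennreal (moll n z) * (\<integral>\<^sup>+x. ennreal ((g (x - z) - g x)\<^sup>2) \<partial>lborel)"
      by (subst nn_integral_cmult[symmetric]) (auto simp: ennreal_mult moll_nonneg)
    also have "(\<integral>\<^sup>+x. ennreal ((g (x - z) - g x)\<^sup>2) \<partial>lborel) = ennreal (\<integral>x. (g (x - z) - g x)\<^sup>2 \<partial>lborel)"
      by (rule nn_integral_eq_integral[OF L2_integrable[OF L]]) simp
    also have "ennreal (moll n z) * \<dots> \<le> ennreal (moll n z) * ennreal e"
    proof (cases "norm z < inverse (real (Suc n))")
      case True
      then show ?thesis using d[of "- z"] by (intro mult_left_mono ennreal_leI) auto
    next
      case False
      then show ?thesis by (simp add: moll_eq_0)
    qed
    finally show "(\<integral>\<^sup>+x. ennreal (moll n z * (g (x - z) - g x)\<^sup>2) \<partial>lborel) \<le> ennreal (moll n z) * ennreal e" .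
  qed
  also have "\<dots> = (\<integral>\<^sup>+z. ennreal (moll n z) \<partial>(lborel :: 'a measure)) * ennreal e"
    by (rule nn_integral_multc) measurable
  also have "(\<integral>\<^sup>+z. ennreal (moll n z) \<partial>(lborel :: 'a measure)) = ennreal 1"
    using nn_integral_eq_integral[OF integrable_moll[of n, where ?'a='a]] moll_nonneg[where ?'a='a]
      integral_moll[of n, where ?'a='a] by simp
  finally have le: "(\<integral>\<^sup>+x. ennreal ((conv (moll n) g x - g x)\<^sup>2) \<partial>lborel) \<le> ennreal e" by simp
  then have "integrable lborel (\<lambda>x. (conv (moll n) g x - g x)\<^sup>2)"
    by (intro integrableI_bounded) (auto intro: order.strict_trans1)
  then have "L2 (\<lambda>x. conv (moll n) g x - g x)" by (simp add: L2_def)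
  from L2_add[OF this g] show "L2 (conv (moll n) g)" by simp
  show "(\<integral>x. (conv (moll n) g x - g x)\<^sup>2 \<partial>lborel) \<le> e"
    using le e by (subst integral_eq_nn_integral) (auto simp: enn2real_leI)
qed

lemma L2_conv_moll:
  assumes g: "L2 g"
  shows "L2_conv (\<lambda>n. conv (moll n) g) g"
proof -
  \<comment> \<open>The translation bound is first used with a crude constant, four times the
    integral of the square of \<open>g\<close>, merely to obtain membership in
    \<open>L2\<close>.\<close>
  have "L2 (conv (moll n) g)" for n
  proof (rule conv_moll_bound(1)[OF g])
    fix z
    have L: "L2 (\<lambda>x. g (x + z))" using L2_affine[OF g, of 1 z] by (simp add: add.commute)
    have "(\<integral>x. (g (x + z) - g x)\<^sup>2 \<partial>lborel) \<le> (\<integral>x. 2 * (g (x + z))\<^sup>2 + 2 * (g x)\<^sup>2 \<partial>lborel)"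
    proof (rule Bochner_Integration.integral_mono)
      show "integrable lborel (\<lambda>x. (g (x + z) - g x)\<^sup>2)" by (rule L2_integrable[OF L2_diff[OF L g]])
      show "integrable lborel (\<lambda>x. 2 * (g (x + z))\<^sup>2 + 2 * (g x)\<^sup>2)"
        using L2_integrable[OF L] L2_integrable[OF g] by simp
      show "(g (x + z) - g x)\<^sup>2 \<le> 2 * (g (x + z))\<^sup>2 + 2 * (g x)\<^sup>2" for x
        using zero_le_power2[of "g (x + z) + g x"] by (simp add: power2_sum power2_diff)
    qed
    also have "\<dots> = 4 * (\<integral>x. (g x)\<^sup>2 \<partial>lborel)"
      using L2_integrable[OF L] L2_integrable[OF g] lborel_shift(2)[of "\<lambda>x. (g x)\<^sup>2" z] g by (simp add: L2_def)
    finally show "(\<integral>x. (g (x + z) - g x)\<^sup>2 \<partial>lborel) \<le> 4 * (\<integral>x. (g x)\<^sup>2 \<partial>lborel)" .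
  qed simp
  moreover have "(\<lambda>n. \<integral>x. (conv (moll n) g x - g x)\<^sup>2 \<partial>lborel) \<longlonglongrightarrow> 0"
  proof (rule LIMSEQ_I)
    fix r :: real assume r: "r > 0"
    then obtain d where d: "d > 0" "\<And>z. norm z < d \<Longrightarrow> (\<integral>x. (g (x + z) - g x)\<^sup>2 \<partial>lborel) < r / 2"
      using L2_translation_continuous[OF g, of "r/2"] by auto
    obtain N where N: "inverse (real (Suc N)) < d" using reals_Archimedean[OF d(1)] by blast
    have "norm ((\<integral>x. (conv (moll n) g x - g x)\<^sup>2 \<partial>lborel) - 0) < r" if "n \<ge> N" for n
    proof -
      have "inverse (real (Suc n)) \<le> inverse (real (Suc N))" using that by (simp add: field_simps)
      then have "(\<integral>x. (conv (moll n) g x - g x)\<^sup>2 \<partial>lborel) \<le> r / 2"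
        using N r by (intro conv_moll_bound(2)[OF g] less_imp_le[OF d(2)]) (simp, erule order_less_trans[OF order_less_le_trans], simp_all)
      moreover have "(\<integral>x. (conv (moll n) g x - g x)\<^sup>2 \<partial>lborel) \<ge> 0" by simp
      ultimately show ?thesis using r by simp
    qed
    then show "\<exists>no. \<forall>n\<ge>no. norm ((\<integral>x. (conv (moll n) g x - g x)\<^sup>2 \<partial>lborel) - 0) < r" by blast
  qed
  ultimately show ?thesis using g by (simp add: L2_conv_def)
qed

section \<open>Weak derivatives and a local Pohozaev identity\<close>


text \<open>Borel functions and \<open>lborel\<close> instead of Lebesgue measurable functions: the Fubini arguments
  below need measurability of \<open>(x, y) \<mapsto> u (x - y)\<close> on the product space.\<close>

definition h1 :: "('a::euclidean_space \<Rightarrow> real) \<Rightarrow> ('a \<Rightarrow> 'a) \<Rightarrow> bool" where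
  "h1 u G \<longleftrightarrow> L2 u \<and> G \<in> borel_measurable borel \<and> (\<forall>v. L2 (\<lambda>x. G x \<bullet> v)) \<and>
     (\<forall>\<phi> v. test_fun \<phi> \<longrightarrow> (\<integral>x. u x * dd \<phi> v x \<partial>lborel) = - (\<integral>x. (G x \<bullet> v) * \<phi> x \<partial>lborel))"

lemma h1_L2: "h1 u G \<Longrightarrow> L2 u" "h1 u G \<Longrightarrow> L2 (\<lambda>x. G x \<bullet> v)"
  by (auto simp: h1_def)

lemma dd_reflect: "\<phi> differentiable (at (a - x)) \<Longrightarrow> dd (\<lambda>y. \<phi> (a - y)) v x = - dd \<phi> v (a - x)"
  using dd_affine[of \<phi> "-1" x a v] by simp

text \<open>The definition of the weak derivative is tested with the reflected kernel
  \<open>y \<mapsto> \<rho> (x - y)\<close>; the sign produced by the reflection cancels the one in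
  the definition.\<close>

lemma conv_dd_h1:
  assumes u: "h1 u G" and rho: "test_fun \<rho>"
  shows "conv (dd \<rho> v) u = conv \<rho> (\<lambda>x. G x \<bullet> v)"
proof
  fix x
  have "(\<integral>y. u y * dd (\<lambda>y. \<rho> (x - y)) v y \<partial>lborel) = - (\<integral>y. (G y \<bullet> v) * \<rho> (x - y) \<partial>lborel)"
    using u test_fun_reflect[OF rho] unfolding h1_def by blast
  also have "(\<lambda>y. u y * dd (\<lambda>y. \<rho> (x - y)) v y) = (\<lambda>y. - (dd \<rho> v (x - y) * u y))"
    by (simp add: dd_reflect test_fun_differentiable[OF rho] mult.commute)
  finally show "conv (dd \<rho> v) u x = conv \<rho> (\<lambda>x. G x \<bullet> v) x"
    by (simp add: conv_def mult.commute)
qed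

text \<open>Because mollification commutes with the weak gradient, convergence of the gradients is
  the L^2 convergence already proved, applied to \<open>G x \<bullet> v\<close>.\<close>

lemma h1_approx:
  assumes u: "h1 u G"
  shows "smooth (conv (moll n) u)" "L2_conv (\<lambda>n. conv (moll n) u) u"
    "dd (conv (moll n) u) v = conv (moll n) (\<lambda>x. G x \<bullet> v)"
    "L2_conv (\<lambda>n. dd (conv (moll n) u) v) (\<lambda>x. G x \<bullet> v)"
proof -
  show "smooth (conv (moll n) u)" by (rule smooth_conv[OF test_fun_moll h1_L2(1)[OF u]])
  show "L2_conv (\<lambda>n. conv (moll n) u) u" by (rule L2_conv_moll[OF h1_L2(1)[OF u]])
  have eq: "dd (conv (moll n) u) v = conv (moll n) (\<lambda>x. G x \<bullet> v)" for n
    using dd_conv[OF test_fun_moll h1_L2(1)[OF u]] conv_dd_h1[OF u test_fun_moll] by simp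
  then show "dd (conv (moll n) u) v = conv (moll n) (\<lambda>x. G x \<bullet> v)" .
  show "L2_conv (\<lambda>n. dd (conv (moll n) u) v) (\<lambda>x. G x \<bullet> v)"
    unfolding eq by (rule L2_conv_moll[OF h1_L2(2)[OF u]])
qed

lemma C1c_bounded:
  assumes "C1c f"
  obtains B where "B > 0" "\<And>x. \<bar>f x\<bar> \<le> B" "\<And>x. \<bar>dd f v x\<bar> \<le> B"
proof -
  have b: "bsupp f" "continuous_on UNIV (dd f v)" using assms by (auto simp: C1c_def)
  obtain A where "A > 0" "\<And>x. \<bar>f x\<bar> \<le> A"
    using continuous_bsupp_bounded[OF C1c_continuous[OF assms] b(1)] by blast
  moreover obtain B where "B > 0" "\<And>x. \<bar>dd f v x\<bar> \<le> B"
    using continuous_bsupp_bounded[OF b(2) bsupp_dd[OF b(1)]] by blast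
  ultimately show ?thesis using that[of "max A B"] by (simp add: le_max_iff_disj)
qed

lemma C1c_borel: "C1c f \<Longrightarrow> f \<in> borel_measurable borel" "C1c f \<Longrightarrow> dd f v \<in> borel_measurable borel"
  by (simp_all add: continuous_borel C1c_continuous) (simp add: continuous_borel C1c_def)

lemma L2_bounded_product_integrable:
  assumes "L2 f" "L2 g" "psi \<in> borel_measurable borel" "\<And>x. \<bar>psi x\<bar> \<le> C"
  shows "integrable lborel (\<lambda>x. psi x * (f x * g x))"
  using L2_mult_integrable[OF L2_bounded_mult[OF assms(1,3,4)] assms(2)] by (simp add: mult.assoc)

text \<open>For smooth \<open>u\<close> this is the vanishing of the integral of a derivative of
  \<open>\<psi>\<close> times the square of \<open>u\<close>. In general \<open>u\<close> is
  mollified while \<open>\<psi>\<close> stays fixed, so that C^1 weights are admissible.\<close>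

lemma h1_square_ibp:
  assumes u: "h1 u G" and psi: "C1c \<psi>"
  shows "(\<integral>x. dd \<psi> v x * (u x)\<^sup>2 \<partial>lborel) = - 2 * (\<integral>x. \<psi> x * (u x * (G x \<bullet> v)) \<partial>lborel)"
proof -
  obtain B where B: "\<And>x. \<bar>\<psi> x\<bar> \<le> B" "\<And>x. \<bar>dd \<psi> v x\<bar> \<le> B" using C1c_bounded[OF psi] by metis
  define w where "w n = conv (moll n) u" for n
  have w: "smooth (w n)" "L2_conv w u" "L2_conv (\<lambda>n. dd (w n) v) (\<lambda>x. G x \<bullet> v)" for n
    unfolding w_def[abs_def] by (rule h1_approx[OF u])+
  have L: "L2 (w n)" "L2 (dd (w n) v)" for n using w(2,3) by (auto simp: L2_conv_def)
  have eq: "(\<integral>x. dd \<psi> v x * (w n x * w n x) \<partial>lborel) = - 2 * (\<integral>x. \<psi> x * (w n x * dd (w n) v x) \<partial>lborel)" for n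
  proof -
    have "(\<integral>x. dd (\<lambda>x. \<psi> x * (w n x * w n x)) v x \<partial>lborel) = 0"
      by (intro C1c_integral_dd C1c_mult_smooth psi smooth_mult w)
    also have "dd (\<lambda>x. \<psi> x * (w n x * w n x)) v = (\<lambda>x. dd \<psi> v x * (w n x * w n x) + 2 * (\<psi> x * (w n x * dd (w n) v x)))"
    proof
      fix x
      show "dd (\<lambda>x. \<psi> x * (w n x * w n x)) v x = dd \<psi> v x * (w n x * w n x) + 2 * (\<psi> x * (w n x * dd (w n) v x))"
        using psi w(1)[of n] by (simp add: C1c_def dd_mult smooth_differentiable differentiable_mult algebra_simps)
    qed
    finally have "(\<integral>x. dd \<psi> v x * (w n x * w n x) + 2 * (\<psi> x * (w n x * dd (w n) v x)) \<partial>lborel) = 0" .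
    moreover have "integrable lborel (\<lambda>x. dd \<psi> v x * (w n x * w n x))" "integrable lborel (\<lambda>x. \<psi> x * (w n x * dd (w n) v x))"
      using L2_bounded_product_integrable[OF L(1) L(1) C1c_borel(2)[OF psi] B(2)]
        L2_bounded_product_integrable[OF L(1) L(2) C1c_borel(1)[OF psi] B(1)] by auto
    ultimately show ?thesis by simp
  qed
  have "(\<lambda>n. (\<integral>x. dd \<psi> v x * (w n x * w n x) \<partial>lborel)) \<longlonglongrightarrow> (\<integral>x. dd \<psi> v x * (u x * u x) \<partial>lborel)"
    by (rule L2_conv_product[OF w(2) w(2) C1c_borel(2)[OF psi] B(2)])
  moreover have "(\<lambda>n. (\<integral>x. dd \<psi> v x * (w n x * w n x) \<partial>lborel)) \<longlonglongrightarrow> - 2 * (\<integral>x. \<psi> x * (u x * (G x \<bullet> v)) \<partial>lborel)"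
    unfolding eq by (intro tendsto_mult tendsto_const L2_conv_product[OF w(2) w(3) C1c_borel(1)[OF psi] B(1)])
  ultimately show ?thesis using LIMSEQ_unique by (simp add: power2_eq_square)
qed

text \<open>In the application \<open>f\<close> contains \<open>P x * u x\<close> with
  \<open>P\<close> possibly unbounded, so square integrability is asked for on balls.\<close>

definition L2loc :: "('a::euclidean_space \<Rightarrow> real) \<Rightarrow> bool" where
  "L2loc f \<longleftrightarrow> f \<in> borel_measurable borel \<and> (\<forall>R. L2 (\<lambda>x. indicator (cball 0 R) x * f x))"

lemma test_fun_bounded:
  assumes "test_fun f" obtains B where "B > 0" "\<And>x. \<bar>f x\<bar> \<le> B"
  using C1c_bounded[OF test_fun_C1c[OF assms]] by metis

lemma L2loc_test_mult:
  assumes f: "L2loc f" and eta: "test_fun \<eta>"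
  shows "L2 (\<lambda>x. \<eta> x * f x)"
proof -
  obtain R where R: "\<And>x. norm x > R \<Longrightarrow> \<eta> x = 0" using eta unfolding test_fun_iff bsupp_def by blast
  obtain B where B: "\<And>x. \<bar>\<eta> x\<bar> \<le> B" using test_fun_bounded[OF eta] by metis
  have "L2 (\<lambda>x. \<eta> x * (indicator (cball 0 R) x * f x))"
    using f B by (intro L2_bounded_mult[where f=\<eta> and C=B] test_fun_borel[OF eta]) (auto simp: L2loc_def)
  also have "(\<lambda>x. \<eta> x * (indicator (cball 0 R) x * f x)) = (\<lambda>x. \<eta> x * f x)"
    using R by (intro ext) (auto simp: indicator_def not_le)
  finally show ?thesis .
qed

text \<open>The products \<open>\<eta> x * p n x\<close>, with \<open>p n\<close> a mollification of
  \<open>w\<close>, are test functions; in the limit \<open>\<eta> x * w x\<close> becomes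
  admissible for every \<open>w\<close> in H^1.\<close>

lemma weak_test_h1:
  assumes u: "h1 u G" and w: "h1 w H" and f: "L2loc f" and eta: "test_fun \<eta>"
    and weak: "\<And>\<phi>. test_fun \<phi> \<Longrightarrow> (\<integral>x. (\<Sum>b\<in>Basis. (G x \<bullet> b) * dd \<phi> b x) + f x * \<phi> x \<partial>lborel) = 0"
  shows "(\<Sum>b\<in>Basis. (\<integral>x. dd \<eta> b x * ((G x \<bullet> b) * w x) \<partial>lborel) + (\<integral>x. \<eta> x * ((G x \<bullet> b) * (H x \<bullet> b)) \<partial>lborel))
     + (\<integral>x. \<eta> x * f x * w x \<partial>lborel) = 0"
proof -
  define p where "p n = conv (moll n) w" for n
  have p: "smooth (p n)" "L2_conv p w" "L2_conv (\<lambda>n. dd (p n) b) (\<lambda>x. H x \<bullet> b)" for n b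
    unfolding p_def[abs_def] by (rule h1_approx[OF w])+
  have L: "L2 (p n)" "L2 (dd (p n) b)" for n b using p(2,3) by (auto simp: L2_conv_def)
  obtain B where B: "\<And>x. \<bar>\<eta> x\<bar> \<le> B" using test_fun_bounded[OF eta] by metis
  have "\<exists>B. \<forall>x. \<bar>dd \<eta> b x\<bar> \<le> B" for b using test_fun_bounded[OF test_fun_dd[OF eta]] by metis
  then obtain D where D: "\<And>b x. \<bar>dd \<eta> b x\<bar> \<le> D b" by metis
  note eb = test_fun_borel[OF eta] test_fun_borel[OF test_fun_dd[OF eta]]
  note Lf = L2loc_test_mult[OF f eta]
  have eq: "(\<Sum>b\<in>Basis. (\<integral>x. dd \<eta> b x * ((G x \<bullet> b) * p n x) \<partial>lborel) + (\<integral>x. \<eta> x * ((G x \<bullet> b) * dd (p n) b x) \<partial>lborel))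
     + (\<integral>x. 1 * ((\<eta> x * f x) * p n x) \<partial>lborel) = 0" for n
  proof -
    have i: "integrable lborel (\<lambda>x. dd \<eta> b x * ((G x \<bullet> b) * p n x))"
      "integrable lborel (\<lambda>x. \<eta> x * ((G x \<bullet> b) * dd (p n) b x))"
      "integrable lborel (\<lambda>x. (\<eta> x * f x) * p n x)" for b
      using L2_bounded_product_integrable[OF h1_L2(2)[OF u] L(1) eb(2) D]
        L2_bounded_product_integrable[OF h1_L2(2)[OF u] L(2) eb(1) B] L2_mult_integrable[OF Lf L(1)]
      by auto
    have "0 = (\<integral>x. (\<Sum>b\<in>Basis. (G x \<bullet> b) * dd (\<lambda>x. \<eta> x * p n x) b x) + f x * (\<eta> x * p n x) \<partial>lborel)"
      using weak[OF test_fun_mult[OF eta p(1)]] by simp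
    also have "(\<lambda>x. (\<Sum>b\<in>Basis. (G x \<bullet> b) * dd (\<lambda>x. \<eta> x * p n x) b x) + f x * (\<eta> x * p n x))
       = (\<lambda>x. (\<Sum>b\<in>Basis. dd \<eta> b x * ((G x \<bullet> b) * p n x) + \<eta> x * ((G x \<bullet> b) * dd (p n) b x)) + (\<eta> x * f x) * p n x)"
      by (intro ext) (simp add: dd_mult test_fun_differentiable[OF eta] smooth_differentiable[OF p(1)] algebra_simps)
    finally show ?thesis using i by simp
  qed
  have "(\<lambda>n. (\<Sum>b\<in>Basis. (\<integral>x. dd \<eta> b x * ((G x \<bullet> b) * p n x) \<partial>lborel) + (\<integral>x. \<eta> x * ((G x \<bullet> b) * dd (p n) b x) \<partial>lborel))
     + (\<integral>x. 1 * ((\<eta> x * f x) * p n x) \<partial>lborel)) \<longlonglongrightarrow>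
     (\<Sum>b\<in>Basis. (\<integral>x. dd \<eta> b x * ((G x \<bullet> b) * w x) \<partial>lborel) + (\<integral>x. \<eta> x * ((G x \<bullet> b) * (H x \<bullet> b)) \<partial>lborel))
     + (\<integral>x. 1 * ((\<eta> x * f x) * w x) \<partial>lborel)"
    by (intro tendsto_add tendsto_sum
        L2_conv_product[OF L2_conv_const[OF h1_L2(2)[OF u]] p(2) eb(2) D]
        L2_conv_product[OF L2_conv_const[OF h1_L2(2)[OF u]] p(3) eb(1) B]
        L2_conv_product[OF L2_conv_const[OF Lf] p(2), where psi="\<lambda>x. 1" and C=1]) auto
  then show ?thesis unfolding eq by (simp add: LIMSEQ_const_iff)
qed

text \<open>Testing the equation with \<open>\<zeta> \<partial>\<^sub>v u\<close>: the mollified equation holds classically on the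
  support of \<open>\<zeta>\<close>, so no second weak derivatives of \<open>u\<close> are needed.\<close>

lemma local_pohozaev:
  assumes u: "h1 u G" and f: "L2loc f" and chi: "test_fun \<zeta>"
    and weak: "\<And>\<phi>. test_fun \<phi> \<Longrightarrow> (\<integral>x. (\<Sum>b\<in>Basis. (G x \<bullet> b) * dd \<phi> b x) + f x * \<phi> x \<partial>lborel) = 0"
  shows "(\<integral>x. \<zeta> x * f x * (G x \<bullet> v) \<partial>lborel) =
    (\<Sum>b\<in>Basis. (1/2) * (\<integral>x. dd \<zeta> v x * ((G x \<bullet> b) * (G x \<bullet> b)) \<partial>lborel)
       - (\<integral>x. dd \<zeta> b x * ((G x \<bullet> b) * (G x \<bullet> v)) \<partial>lborel))"
proof -
  obtain R where R: "\<And>x. norm x > R \<Longrightarrow> \<zeta> x = 0" using chi unfolding test_fun_iff bsupp_def by blast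
  \<comment> \<open>Truncation makes \<open>f\<close> square integrable. The radius
    \<open>R + 1\<close> exceeds the support radius of \<open>\<zeta>\<close> by at least every
    mollification radius, so the truncation is invisible where \<open>\<zeta>\<close> is
    nonzero.\<close>
  define F where "F x = indicator (cball 0 (R + 1)) x * f x" for x
  have LF: "L2 F" using f unfolding L2loc_def F_def by blast
  define p where "p n = conv (moll n) u" for n
  define g where "g n v = conv (moll n) (\<lambda>x. G x \<bullet> v)" for n v
  define h where "h n = conv (moll n) F" for n
  have p: "smooth (p n)" "dd (p n) v = g n v" for n v
    using h1_approx[OF u] by (auto simp: p_def g_def)
  have g: "smooth (g n v)" "L2_conv (\<lambda>n. g n v) (\<lambda>x. G x \<bullet> v)" for n v
    unfolding g_def by (rule smooth_conv[OF test_fun_moll h1_L2(2)[OF u]], rule L2_conv_moll[OF h1_L2(2)[OF u]])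
  have h: "L2_conv h F" "smooth (h n)" for n
    unfolding h_def[abs_def] by (rule L2_conv_moll[OF LF], rule smooth_conv[OF test_fun_moll LF])
  have L: "L2 (g n v)" "L2 (h n)" for n v using g(2) h(1) by (auto simp: L2_conv_def)
  \<comment> \<open>The mollified gradient is the gradient of a smooth function, hence curl free.
    This symmetry lets a derivative along \<open>b\<close> of the \<open>v\<close>-component be
    traded for a derivative along \<open>v\<close>.\<close>
  have sym: "dd (g n v) b = dd (g n b) v" for n v b
    using dd_dd_commute[OF p(1)[of n], of v b] by (intro ext) (simp add: p(2))
  obtain B where B: "\<And>x. \<bar>\<zeta> x\<bar> \<le> B" using test_fun_bounded[OF chi] by metis
  have "\<exists>B. \<forall>x. \<bar>dd \<zeta> b x\<bar> \<le> B" for b using test_fun_bounded[OF test_fun_dd[OF chi]] by metis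
  then obtain D where D: "\<And>b x. \<bar>dd \<zeta> b x\<bar> \<le> D b" by metis
  note cb = test_fun_borel[OF chi] test_fun_borel[OF test_fun_dd[OF chi]]
  \<comment> \<open>Testing the weak equation with the mollifier centred at \<open>x\<close> gives
    the pointwise equation for the mollification.\<close>
  have mollified: "(\<Sum>b\<in>Basis. dd (g n b) b x) = h n x" if x: "norm x \<le> R" for n x
  proof -
    have d: "dd (g n b) b x = (\<integral>y. dd (moll n) b (x - y) * (G y \<bullet> b) \<partial>lborel)" for b
      unfolding g_def dd_conv[OF test_fun_moll h1_L2(2)[OF u]] by (simp add: conv_def)
    have i: "integrable lborel (\<lambda>y. dd (moll n) b (x - y) * (G y \<bullet> b))" for b
      by (rule conv_integrable[OF test_fun_dd[OF test_fun_moll] h1_L2(2)[OF u]])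
    have i2: "integrable lborel (\<lambda>y. moll n (x - y) * F y)" by (rule conv_integrable[OF test_fun_moll LF])
    have "0 = (\<integral>y. (\<Sum>b\<in>Basis. (G y \<bullet> b) * dd (\<lambda>y. moll n (x - y)) b y) + f y * moll n (x - y) \<partial>lborel)"
      using weak[OF test_fun_reflect[OF test_fun_moll]] by simp
    also have "(\<lambda>y. (\<Sum>b\<in>Basis. (G y \<bullet> b) * dd (\<lambda>y. moll n (x - y)) b y) + f y * moll n (x - y))
      = (\<lambda>y. moll n (x - y) * F y - (\<Sum>b\<in>Basis. dd (moll n) b (x - y) * (G y \<bullet> b)))"
    proof
      fix y
      have "f y * moll n (x - y) = moll n (x - y) * F y"
      proof (cases "norm y \<le> R + 1")
        case True then show ?thesis by (simp add: F_def)
      next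
        case False
        have "norm (x - y) \<ge> 1" using False x norm_triangle_ineq2[of y x] by (simp add: norm_minus_commute)
        moreover have "inverse (real (Suc n)) \<le> 1" by (simp add: field_simps)
        ultimately show ?thesis using moll_eq_0[of n "x - y"] by simp
      qed
      then show "(\<Sum>b\<in>Basis. (G y \<bullet> b) * dd (\<lambda>y. moll n (x - y)) b y) + f y * moll n (x - y)
        = moll n (x - y) * F y - (\<Sum>b\<in>Basis. dd (moll n) b (x - y) * (G y \<bullet> b))"
        by (simp add: dd_reflect test_fun_differentiable[OF test_fun_moll] sum_negf mult.commute)
    qed
    finally show ?thesis using i i2 by (simp add: d h_def conv_def)
  qed
  \<comment> \<open>Multiplying the mollified equation by \<open>\<zeta> x * g n v x\<close> and
    integrating by parts along \<open>b\<close> and then along \<open>v\<close> leaves only terms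
    with derivatives of \<open>\<zeta>\<close>.\<close>
  have eq: "(\<integral>x. \<zeta> x * (h n x * g n v x) \<partial>lborel) =
    (\<Sum>b\<in>Basis. (1/2) * (\<integral>x. dd \<zeta> v x * (g n b x * g n b x) \<partial>lborel)
       - (\<integral>x. dd \<zeta> b x * (g n b x * g n v x) \<partial>lborel))" for n
  proof -
    have cont: "continuous_on UNIV (g n b)" "continuous_on UNIV (dd (g n b) c)" "continuous_on UNIV \<zeta>"
      "continuous_on UNIV (dd \<zeta> b)" for b c
      using g(1) chi by (auto simp: test_fun_iff intro!: smooth_continuous smooth_dd)
    have bs: "bsupp \<zeta>" using chi by (simp add: test_fun_iff)
    have i: "integrable lborel (\<lambda>x. \<zeta> x * (dd (g n b) c x * g n a x))"
      "integrable lborel (\<lambda>x. dd \<zeta> c x * (g n b x * g n a x))"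
      "integrable lborel (\<lambda>x. \<zeta> x * (h n x * g n a x))" for a b c
      by (intro continuous_bsupp_integrable continuous_intros cont bsupp_mult disjI1 bs bsupp_dd
          smooth_continuous[OF h(2)])+
    have A: "(\<integral>x. dd \<zeta> v x * (g n b x * g n b x) \<partial>lborel) = - 2 * (\<integral>x. \<zeta> x * (dd (g n b) v x * g n b x) \<partial>lborel)" for b
    proof -
      have "(\<integral>x. dd (\<lambda>x. \<zeta> x * (g n b x * g n b x)) v x \<partial>lborel) = 0"
        by (intro C1c_integral_dd C1c_mult_smooth test_fun_C1c chi smooth_mult g)
      also have "dd (\<lambda>x. \<zeta> x * (g n b x * g n b x)) v =
         (\<lambda>x. dd \<zeta> v x * (g n b x * g n b x) + 2 * (\<zeta> x * (dd (g n b) v x * g n b x)))"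
        by (intro ext) (simp add: dd_mult test_fun_differentiable[OF chi] smooth_differentiable[OF g(1)]
            differentiable_mult algebra_simps)
      finally show ?thesis using i by simp
    qed
    have C: "(\<integral>x. \<zeta> x * (dd (g n b) b x * g n v x) \<partial>lborel) =
       - (\<integral>x. dd \<zeta> b x * (g n b x * g n v x) \<partial>lborel) + (1/2) * (\<integral>x. dd \<zeta> v x * (g n b x * g n b x) \<partial>lborel)" for b
    proof -
      have "(\<integral>x. dd (\<lambda>x. \<zeta> x * (g n b x * g n v x)) b x \<partial>lborel) = 0"
        by (intro C1c_integral_dd C1c_mult_smooth test_fun_C1c chi smooth_mult g)
      also have "dd (\<lambda>x. \<zeta> x * (g n b x * g n v x)) b =
         (\<lambda>x. dd \<zeta> b x * (g n b x * g n v x) + \<zeta> x * (dd (g n b) b x * g n v x) + \<zeta> x * (dd (g n b) v x * g n b x))"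
        by (intro ext) (simp add: dd_mult test_fun_differentiable[OF chi] smooth_differentiable[OF g(1)]
            differentiable_mult sym[of n v b] algebra_simps)
      finally show ?thesis using i A[of b] by simp
    qed
    have "(\<integral>x. \<zeta> x * (h n x * g n v x) \<partial>lborel) = (\<integral>x. (\<Sum>b\<in>Basis. \<zeta> x * (dd (g n b) b x * g n v x)) \<partial>lborel)"
    proof (intro Bochner_Integration.integral_cong refl)
      fix x
      show "\<zeta> x * (h n x * g n v x) = (\<Sum>b\<in>Basis. \<zeta> x * (dd (g n b) b x * g n v x))"
      proof (cases "norm x \<le> R")
        case True
        show ?thesis unfolding mollified[OF True, symmetric] by (simp add: sum_distrib_left sum_distrib_right)
      next
        case False then show ?thesis by (simp add: R)
      qed
    qed
    also have "\<dots> = (\<Sum>b\<in>Basis. (\<integral>x. \<zeta> x * (dd (g n b) b x * g n v x) \<partial>lborel))"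
      by (rule Bochner_Integration.integral_sum) (rule i)
    finally show ?thesis by (simp add: C)
  qed
  have lim1: "(\<lambda>n. (\<integral>x. \<zeta> x * (h n x * g n v x) \<partial>lborel)) \<longlonglongrightarrow> (\<integral>x. \<zeta> x * (F x * (G x \<bullet> v)) \<partial>lborel)"
    by (rule L2_conv_product[OF h(1) g(2) cb(1) B])
  have lim2: "(\<lambda>n. (\<integral>x. \<zeta> x * (h n x * g n v x) \<partial>lborel)) \<longlonglongrightarrow>
    (\<Sum>b\<in>Basis. (1/2) * (\<integral>x. dd \<zeta> v x * ((G x \<bullet> b) * (G x \<bullet> b)) \<partial>lborel)
       - (\<integral>x. dd \<zeta> b x * ((G x \<bullet> b) * (G x \<bullet> v)) \<partial>lborel))"
    unfolding eq by (intro tendsto_sum tendsto_diff tendsto_mult tendsto_const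
        L2_conv_product[OF g(2) g(2) cb(2) D])
  have Feq: "(\<lambda>x. \<zeta> x * (F x * (G x \<bullet> v))) = (\<lambda>x. \<zeta> x * f x * (G x \<bullet> v))"
    using R by (intro ext) (auto simp: F_def indicator_def not_le)
  show ?thesis using LIMSEQ_unique[OF lim1 lim2] by (simp only: Feq)
qed

text \<open>Convolving the indicator of the ball of radius \<open>3 * r / 2\<close> with a mollifier
  of radius below \<open>r / 2\<close> leaves its values untouched within distance \<open>r\<close>
  of \<open>a\<close> and beyond distance \<open>2 * r\<close>.\<close>

lemma cutoff_exists:
  fixes a :: "'a::euclidean_space"
  assumes r: "r > 0"
  obtains \<zeta> :: "'a \<Rightarrow> real" where "test_fun \<zeta>" "\<And>x. 0 \<le> \<zeta> x" "\<And>x. \<zeta> x \<le> 1"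
    "\<And>x. dist a x \<le> r \<Longrightarrow> \<zeta> x = 1" "\<And>x. dist a x \<ge> 2 * r \<Longrightarrow> \<zeta> x = 0"
proof -
  obtain n where n: "inverse (real (Suc n)) < r / 2" using reals_Archimedean[of "r/2"] r by auto
  let ?g = "indicator (cball a (3 * r / 2)) :: 'a \<Rightarrow> real"
  let ?z = "conv (moll n) ?g"
  have gi: "integrable lborel ?g" by (rule integrable_indicator_cball)
  have Lg: "L2 ?g"
    using gi by (simp add: L2_def borel_measurable_indicator power2_eq_square indicator_inter_arith[symmetric])
  have m: "integrable lborel (\<lambda>y. moll n (x - y))" "(\<integral>y. moll n (x - y) \<partial>lborel) = 1" for x :: 'a
    using lborel_reflect[OF test_fun_borel[OF test_fun_moll[of n]], of x] integrable_moll[of n, where ?'a='a]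
      integral_moll[of n, where ?'a='a] by auto
  have z: "\<And>x y. dist x y \<ge> r / 2 \<Longrightarrow> moll n (x - y) = 0" for x y
    using moll_eq_0 n by (metis dist_norm less_imp_le order_trans)
  have one: "?z x = 1" if x: "dist a x \<le> r" for x
  proof -
    have "moll n (x - y) * ?g y = moll n (x - y)" for y
    proof (cases "dist x y \<ge> r / 2")
      case True
      then show ?thesis by (metis z mult_zero_left)
    next
      case False
      then have "dist a y \<le> 3 * r / 2" using x dist_triangle[of a y x] by simp
      then show ?thesis by simp
    qed
    then have "(\<lambda>y. moll n (x - y) * ?g y) = (\<lambda>y. moll n (x - y))" by blast
    then show ?thesis unfolding conv_def by (simp only: m)
  qed
  have zero: "?z x = 0" if x: "dist a x \<ge> 2 * r" for x
  proof -
    have "moll n (x - y) * ?g y = 0" for y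
    proof (cases "dist x y \<ge> r / 2")
      case True
      then show ?thesis by (metis z mult_zero_left)
    next
      case False
      then have "dist a y > 3 * r / 2" using x dist_triangle[of a x y] by (simp add: dist_commute)
      then show ?thesis by simp
    qed
    then have "(\<lambda>y. moll n (x - y) * ?g y) = (\<lambda>y. 0)" by blast
    then show ?thesis unfolding conv_def by simp
  qed
  have "bsupp ?z"
  proof -
    have "?z x = 0" if "norm x > norm a + 2 * r" for x
      using that norm_triangle_ineq2[of x a] by (intro zero) (simp add: dist_norm norm_minus_commute)
    then show ?thesis unfolding bsupp_def by blast
  qed
  then have "test_fun ?z" using smooth_conv[OF test_fun_moll Lg] by (simp add: test_fun_iff)
  moreover have "?z x \<ge> 0" for x
    unfolding conv_def by (intro Bochner_Integration.integral_nonneg mult_nonneg_nonneg moll_nonneg) auto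
  moreover have "?z x \<le> 1" for x
  proof -
    have "?z x \<le> (\<integral>y. moll n (x - y) \<partial>lborel)"
      unfolding conv_def
      using m by (intro Bochner_Integration.integral_mono conv_integrable test_fun_moll Lg)
        (auto simp: indicator_def moll_nonneg)
    then show ?thesis by (simp add: m)
  qed
  ultimately show ?thesis using that one zero by blast
qed

section \<open>Hardy's inequality and the Newton potential\<close>


text \<open>The Coulomb kernel \<open>1 / norm z\<close> regularised at scale \<open>\<eta>\<close>:
  bounded and differentiable everywhere, and increasing to \<open>1 / norm z\<close> away from the
  origin as \<open>\<eta>\<close> decreases to 0.\<close>

definition ker :: "real \<Rightarrow> 'a::euclidean_space \<Rightarrow> real" where
  "ker \<eta> z = inverse (sqrt (z \<bullet> z + \<eta>\<^sup>2))"

lemma ker_arg_pos: "\<eta> > 0 \<Longrightarrow> z \<bullet> z + \<eta>\<^sup>2 > 0"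
  by (simp add: add_nonneg_pos)

lemma ker_pos: "\<eta> > 0 \<Longrightarrow> ker \<eta> z > 0"
  using ker_arg_pos[of \<eta> z] by (simp add: ker_def)

lemma ker_minus: "ker \<eta> (x - y) = ker \<eta> (y - x)"
  by (simp add: ker_def inner_diff algebra_simps inner_commute)

lemma norm_le_ker_arg: "norm z \<le> sqrt (z \<bullet> z + \<eta>\<^sup>2)"
  unfolding norm_eq_sqrt_inner by (rule real_sqrt_le_mono) simp

lemma ker_le_eta: assumes "\<eta> > 0" shows "ker \<eta> z \<le> inverse \<eta>"
proof -
  have "\<eta> \<le> sqrt (z \<bullet> z + \<eta>\<^sup>2)" using assms by (intro real_le_rsqrt) simp
  then show ?thesis using assms by (simp add: ker_def le_imp_inverse_le)
qed

lemma ker_le_norm: "z \<noteq> 0 \<Longrightarrow> ker \<eta> z \<le> inverse (norm z)"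
  using norm_le_ker_arg[of z \<eta>] by (simp add: ker_def le_imp_inverse_le)

lemma norm_mult_ker: assumes "\<eta> > 0" shows "norm z * ker \<eta> z \<le> 1"
proof -
  have "sqrt (z \<bullet> z + \<eta>\<^sup>2) > 0" using ker_arg_pos[OF assms] by simp
  then show ?thesis using norm_le_ker_arg[of z \<eta>] by (simp add: ker_def field_simps)
qed

lemma abs_inner_ker: assumes "\<eta> > 0" shows "\<bar>z \<bullet> v\<bar> * ker \<eta> z \<le> norm v"
proof -
  have "\<bar>z \<bullet> v\<bar> * ker \<eta> z \<le> (norm z * norm v) * ker \<eta> z"
    using Cauchy_Schwarz_ineq2[of z v] ker_pos[OF assms, of z] by (intro mult_right_mono) auto
  also have "\<dots> = norm v * (norm z * ker \<eta> z)" by simp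
  also have "\<dots> \<le> norm v * 1" by (rule mult_left_mono[OF norm_mult_ker[OF assms]]) simp
  finally show ?thesis by simp
qed

lemma continuous_ker [continuous_intros]:
  assumes "\<eta> > 0" "continuous_on S f" shows "continuous_on S (\<lambda>x. ker \<eta> (f x))"
proof -
  have "sqrt (f x \<bullet> f x + \<eta>\<^sup>2) \<noteq> 0" for x using ker_arg_pos[OF assms(1), of "f x"] by simp
  then show ?thesis unfolding ker_def by (intro continuous_intros assms) blast
qed

lemma ker_has_derivative:
  assumes "\<eta> > 0"
  shows "(ker \<eta> has_derivative (\<lambda>v. - (z \<bullet> v) * ker \<eta> z ^ 3)) (at z)"
proof -
  have q: "((\<lambda>z. z \<bullet> z + \<eta>\<^sup>2) has_derivative (\<lambda>v. 2 * (z \<bullet> v))) (at z)"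
    by (auto intro!: derivative_eq_intros simp: inner_commute)
  define t where "t = z \<bullet> z + \<eta>\<^sup>2"
  have t: "t > 0" using ker_arg_pos[OF assms] by (simp add: t_def)
  have "((\<lambda>t. inverse (sqrt t)) has_real_derivative - (1/2) * inverse (sqrt t) ^ 3) (at t)"
    using t by (auto intro!: derivative_eq_intros simp: field_simps power3_eq_cube power2_eq_square)
  then have "((\<lambda>t. inverse (sqrt t)) has_derivative (\<lambda>h. (- (1/2) * inverse (sqrt t) ^ 3) * h)) (at t)"
    unfolding has_field_derivative_def .
  from has_derivative_compose[OF q this[unfolded t_def]] show ?thesis
    by (simp add: ker_def[abs_def] mult.commute)
qed

lemma ker_shift_dd:
  assumes "\<eta> > 0"
  shows "(\<lambda>x. ker \<eta> (x - y)) differentiable (at x)"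
    "dd (\<lambda>x. ker \<eta> (x - y)) v x = - ((x - y) \<bullet> v) * ker \<eta> (x - y) ^ 3"
proof -
  have "((\<lambda>x. ker \<eta> (x - y)) has_derivative (\<lambda>v. - ((x - y) \<bullet> v) * ker \<eta> (x - y) ^ 3)) (at x)"
    by (rule has_derivative_compose[where f="\<lambda>x. x - y" and f'="\<lambda>v. v",
          OF _ ker_has_derivative[OF assms]]) (auto intro!: derivative_eq_intros)
  then show "(\<lambda>x. ker \<eta> (x - y)) differentiable (at x)"
    "dd (\<lambda>x. ker \<eta> (x - y)) v x = - ((x - y) \<bullet> v) * ker \<eta> (x - y) ^ 3"
    using dd_eqI differentiable_def by blast+
qed

lemma ker_tendsto:
  assumes "z \<noteq> 0" shows "(\<lambda>n. ker (inverse (real (Suc n))) z) \<longlonglongrightarrow> inverse (norm z)"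
proof -
  have "(\<lambda>n. inverse (sqrt (z \<bullet> z + (inverse (real (Suc n)))\<^sup>2))) \<longlonglongrightarrow> inverse (sqrt (z \<bullet> z + 0\<^sup>2))"
    by (intro tendsto_intros LIMSEQ_inverse_real_of_nat) (use assms in simp)
  then show ?thesis by (simp add: ker_def norm_eq_sqrt_inner)
qed

lemma ker_antimono:
  assumes "0 < \<eta>" "\<eta> \<le> \<eta>'" shows "ker \<eta>' z \<le> ker \<eta> z"
proof -
  have "\<eta>\<^sup>2 \<le> \<eta>'\<^sup>2" using assms by (intro power_mono) auto
  then have "sqrt (z \<bullet> z + \<eta>\<^sup>2) \<le> sqrt (z \<bullet> z + \<eta>'\<^sup>2)" by simp
  moreover have "0 < sqrt (z \<bullet> z + \<eta>\<^sup>2)" using ker_arg_pos[OF assms(1)] by simp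
  ultimately show ?thesis unfolding ker_def by (rule le_imp_inverse_le)
qed

lemma norm_power2_basis: "(norm (x :: 'a::euclidean_space))\<^sup>2 = (\<Sum>b\<in>Basis. (x \<bullet> b)\<^sup>2)"
proof -
  have "(norm x)\<^sup>2 = x \<bullet> x" by (rule power2_norm_eq_inner)
  also have "\<dots> = (\<Sum>b\<in>Basis. (x \<bullet> b) * (x \<bullet> b))" by (rule euclidean_inner)
  finally show ?thesis by (simp only: power2_eq_square)
qed

lemma h1_norm_L2:
  assumes "h1 u G" shows "L2 (\<lambda>x. norm (G x))"
proof -
  have "integrable lborel (\<lambda>x. \<Sum>b\<in>Basis. (G x \<bullet> b)\<^sup>2)"
    using assms by (intro Bochner_Integration.integrable_sum L2_integrable h1_L2(2))
  moreover have "G \<in> borel_measurable borel" using assms by (simp add: h1_def)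
  ultimately show ?thesis by (simp add: L2_def norm_power2_basis borel_measurable_norm)
qed

abbreviation mass :: "('a::euclidean_space \<Rightarrow> real) \<Rightarrow> real" where
  "mass u \<equiv> (\<integral>x. (u x)\<^sup>2 \<partial>lborel)"

lemma integrable_ker_mult:
  assumes "\<eta> > 0" "integrable lborel p"
  shows "integrable lborel (\<lambda>y. ker \<eta> (y - x) * p y)"
proof (rule Bochner_Integration.integrable_bound)
  show "integrable lborel (\<lambda>y. inverse \<eta> * p y)" using assms(2) by simp
  have "continuous_on UNIV (\<lambda>y. ker \<eta> (y - x))" by (intro continuous_intros assms(1))
  then show "(\<lambda>y. ker \<eta> (y - x) * p y) \<in> borel_measurable lborel"
    using continuous_borel assms(2) by (intro borel_measurable_times) auto
  show "AE y in lborel. norm (ker \<eta> (y - x) * p y) \<le> norm (inverse \<eta> * p y)"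
  proof (rule AE_I2)
    fix y
    have "\<bar>ker \<eta> (y - x)\<bar> \<le> \<bar>inverse \<eta>\<bar>"
      using ker_le_eta[OF assms(1), of "y - x"] ker_pos[OF assms(1), of "y - x"] assms(1) by simp
    then show "norm (ker \<eta> (y - x) * p y) \<le> norm (inverse \<eta> * p y)"
      by (simp only: real_norm_def abs_mult) (rule mult_right_mono, auto)
  qed
qed

text \<open>Hardy's inequality, obtained by testing with the field \<open>z / |z|\<close>, whose divergence is \<open>2 / |z|\<close>
  in dimension three.\<close>

lemma hardy_regularized:
  fixes u :: "real^3 \<Rightarrow> real"
  assumes u: "h1 u G" and eta: "\<eta> > 0"
  shows "(\<integral>y. ker \<eta> (y - x) * (u y)\<^sup>2 \<partial>lborel) \<le> sqrt (mass u) * sqrt (mass (\<lambda>x. norm (G x)))"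
proof -
  obtain \<zeta> :: "real^3 \<Rightarrow> real" where z: "test_fun \<zeta>" "\<And>x. 0 \<le> \<zeta> x" "\<And>x. \<zeta> x \<le> 1"
    "\<And>x. dist 0 x \<le> 1 \<Longrightarrow> \<zeta> x = 1"
    using cutoff_exists[of 1 0] by (metis zero_less_one)
  have "\<exists>B. \<forall>x. \<bar>dd \<zeta> b x\<bar> \<le> B" for b using test_fun_bounded[OF test_fun_dd[OF z(1)]] by metis
  then obtain D where D: "\<And>b x. \<bar>dd \<zeta> b x\<bar> \<le> D b" by metis
  define L where "L = (\<Sum>b\<in>Basis. D b)"
  define c where "c n = inverse (real (Suc n))" for n
  have c: "c n > 0" for n by (simp add: c_def)
  \<comment> \<open>Cutoffs dilated by the factor \<open>Suc n\<close> around \<open>x\<close>;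
    their gradients are of order \<open>c n\<close> and disappear in the limit.\<close>
  define Z where "Z n y = \<zeta> (c n *\<^sub>R y + (- (c n *\<^sub>R x)))" for n y
  have Z: "test_fun (Z n)" for n unfolding Z_def by (rule test_fun_affine[OF z(1)]) (use c[of n] in simp)
  have dZ: "\<bar>dd (Z n) b y\<bar> \<le> c n * D b" for n b y
    unfolding Z_def dd_affine[OF test_fun_differentiable[OF z(1)]] abs_mult
    using D c[of n] by (simp add: mult_left_mono)
  define k where "k y = ker \<eta> (y - x)" for y
  have k0: "k y > 0" for y using ker_pos[OF eta] by (simp add: k_def)
  define g where "g b y = ((y - x) \<bullet> b) * k y" for b y
  have gd: "g b differentiable (at y)"
    "dd (g b) v y = (v \<bullet> b) * k y - ((y - x) \<bullet> b) * ((y - x) \<bullet> v) * k y ^ 3" for b v y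
  proof -
    have lin: "((\<lambda>y. (y - x) \<bullet> b) has_derivative (\<lambda>v. v \<bullet> b)) (at y)"
      by (auto intro!: derivative_eq_intros)
    have kd: "k differentiable (at y)" "dd k v y = - ((y - x) \<bullet> v) * k y ^ 3"
      unfolding k_def[abs_def] using ker_shift_dd[OF eta] by blast+
    have ld: "(\<lambda>y. (y - x) \<bullet> b) differentiable (at y)" using lin differentiable_def by blast
    show "g b differentiable (at y)" unfolding g_def[abs_def] by (intro differentiable_mult ld kd)
    show "dd (g b) v y = (v \<bullet> b) * k y - ((y - x) \<bullet> b) * ((y - x) \<bullet> v) * k y ^ 3"
      unfolding g_def[abs_def] dd_mult[OF ld kd(1)] kd(2) dd_eqI[OF lin] by simp
  qed
  have kc: "continuous_on UNIV k" unfolding k_def[abs_def] by (intro continuous_intros eta)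
  have gC: "C1c (\<lambda>y. Z n y * g b y)" for n b
  proof (rule C1c_mult[OF test_fun_C1c[OF Z]])
    show "g b differentiable (at y)" for y by (rule gd)
    show "continuous_on UNIV (dd (g b) v)" for v
      unfolding gd(2)[abs_def] by (intro continuous_intros kc)
  qed
  have gb: "\<bar>g b y\<bar> \<le> 1" if "b \<in> Basis" for b y
    using abs_inner_ker[OF eta, of "y - x" b] that k0[of y] by (simp add: g_def k_def abs_mult)
  have div: "2 * (Z n y * k y) - c n * L \<le> (\<Sum>b\<in>Basis. dd (\<lambda>y. Z n y * g b y) b y)" for n y
  proof -
    have "(\<Sum>b\<in>Basis. dd (\<lambda>y. Z n y * g b y) b y) =
        (\<Sum>b\<in>Basis. Z n y * dd (g b) b y + dd (Z n) b y * g b y)"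
      by (intro sum.cong refl dd_mult gd(1) test_fun_differentiable[OF Z])
    also have "\<dots> = Z n y * (\<Sum>b\<in>Basis. dd (g b) b y) + (\<Sum>b\<in>Basis. dd (Z n) b y * g b y)"
      by (simp add: sum.distrib sum_distrib_left)
    also have "(\<Sum>b\<in>Basis. dd (g b) b y) = 3 * k y - (norm (y - x))\<^sup>2 * k y ^ 3"
    proof -
      have "(\<Sum>b\<in>Basis. dd (g b) b y) = (\<Sum>b\<in>Basis. k y - ((y - x) \<bullet> b)\<^sup>2 * k y ^ 3)"
        by (intro sum.cong refl) (simp add: gd(2) power2_eq_square)
      also have "\<dots> = 3 * k y - (norm (y - x))\<^sup>2 * k y ^ 3"
        by (simp add: sum_subtractf norm_power2_basis sum_distrib_right)
      finally show ?thesis .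
    qed
    finally have eq: "(\<Sum>b\<in>Basis. dd (\<lambda>y. Z n y * g b y) b y) =
        Z n y * (3 * k y - (norm (y - x))\<^sup>2 * k y ^ 3) + (\<Sum>b\<in>Basis. dd (Z n) b y * g b y)" .
    \<comment> \<open>Since \<open>norm (y - x) * k y \<le> 1\<close>, the subtracted term of the
      divergence is at most \<open>k y\<close>, which leaves at least
      \<open>2 * k y\<close>.\<close>
    have "(norm (y - x) * k y)\<^sup>2 \<le> 1"
      using norm_mult_ker[OF eta, of "y - x"] k0[of y] by (simp add: k_def abs_square_le_1 abs_mult less_imp_le)
    then have "(norm (y - x) * k y)\<^sup>2 * k y \<le> 1 * k y" using k0[of y] by (intro mult_right_mono) auto
    then have "(norm (y - x))\<^sup>2 * k y ^ 3 \<le> k y" by (simp add: power_mult_distrib power2_eq_square power3_eq_cube mult_ac)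
    then have "Z n y * (2 * k y) \<le> Z n y * (3 * k y - (norm (y - x))\<^sup>2 * k y ^ 3)"
      using z(2) by (intro mult_left_mono) (auto simp: Z_def)
    moreover have "\<bar>\<Sum>b\<in>Basis. dd (Z n) b y * g b y\<bar> \<le> c n * L"
    proof -
      have "\<bar>\<Sum>b\<in>Basis. dd (Z n) b y * g b y\<bar> \<le> (\<Sum>b\<in>Basis. \<bar>dd (Z n) b y * g b y\<bar>)" by (rule sum_abs)
      also have "\<dots> \<le> (\<Sum>b\<in>Basis. c n * D b * 1)"
        unfolding abs_mult using c[of n] D[THEN order_trans[OF abs_ge_zero]]
        by (intro sum_mono mult_mono dZ gb) (auto simp: less_imp_le)
      finally show ?thesis by (simp add: L_def sum_distrib_left)
    qed
    ultimately show ?thesis unfolding eq by (simp add: abs_le_iff)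
  qed
  let ?S = "sqrt (mass u) * sqrt (mass (\<lambda>x. norm (G x)))"
  have Lu: "L2 u" and LG: "L2 (\<lambda>x. norm (G x))" by (rule h1_L2(1)[OF u], rule h1_norm_L2[OF u])
  have zk_b: "Z n \<in> borel_measurable borel" "k \<in> borel_measurable borel" for n
    by (rule test_fun_borel[OF Z], rule continuous_borel[OF kc])
  have Z1: "\<bar>Z n y\<bar> \<le> 1" "0 \<le> Z n y" for n y using z(2,3) by (auto simp: Z_def)
  have kb: "\<bar>k y\<bar> \<le> inverse \<eta>" for y using ker_le_eta[OF eta] k0[of y] by (simp add: k_def)
  have iZk: "integrable lborel (\<lambda>y. Z n y * (k y * (u y)\<^sup>2))" for n
  proof (rule Bochner_Integration.integrable_bound)
    show ik: "integrable lborel (\<lambda>y. k y * (u y)\<^sup>2)"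
      unfolding k_def by (rule integrable_ker_mult[OF eta L2_integrable[OF Lu]])
    show "(\<lambda>y. Z n y * (k y * (u y)\<^sup>2)) \<in> borel_measurable lborel"
      using zk_b L2_measurable[OF Lu] by measurable
    show "AE y in lborel. norm (Z n y * (k y * (u y)\<^sup>2)) \<le> norm (k y * (u y)\<^sup>2)"
      using Z1 by (intro AE_I2) (auto simp: abs_mult intro!: mult_left_le_one_le)
  qed
  \<comment> \<open>The factor 2 of the divergence matches the factor 2 from differentiating the
    square of \<open>u\<close>, so the final constant is 1.\<close>
  have bound: "2 * (\<integral>y. Z n y * (k y * (u y)\<^sup>2) \<partial>lborel) \<le> 2 * ?S + c n * L * mass u" for n
  proof -
    have i1: "integrable lborel (\<lambda>y. dd (\<lambda>y. Z n y * g b y) b y * (u y)\<^sup>2)" for b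
    proof -
      obtain B where "\<And>y. \<bar>dd (\<lambda>y. Z n y * g b y) b y\<bar> \<le> B" using C1c_bounded[OF gC] by metis
      from L2_bounded_product_integrable[OF Lu Lu C1c_borel(2)[OF gC] this] show ?thesis
        by (simp add: power2_eq_square)
    qed
    have i2: "integrable lborel (\<lambda>y. (Z n y * g b y) * (u y * (G y \<bullet> b)))" for b
    proof -
      obtain B where "\<And>y. \<bar>Z n y * g b y\<bar> \<le> B" using C1c_bounded[OF gC] by metis
      from L2_bounded_product_integrable[OF Lu h1_L2(2)[OF u] C1c_borel(1)[OF gC] this] show ?thesis .
    qed
    have "2 * (\<integral>y. Z n y * (k y * (u y)\<^sup>2) \<partial>lborel) - c n * L * mass u
        = (\<integral>y. (2 * (Z n y * k y) - c n * L) * (u y)\<^sup>2 \<partial>lborel)"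
      using iZk[of n] L2_integrable[OF Lu] by (simp add: left_diff_distrib mult.assoc)
    also have "\<dots> \<le> (\<integral>y. (\<Sum>b\<in>Basis. dd (\<lambda>y. Z n y * g b y) b y * (u y)\<^sup>2) \<partial>lborel)"
    proof (rule Bochner_Integration.integral_mono)
      show "integrable lborel (\<lambda>y. (2 * (Z n y * k y) - c n * L) * (u y)\<^sup>2)"
        using iZk[of n] L2_integrable[OF Lu] by (simp add: left_diff_distrib mult.assoc)
      show "integrable lborel (\<lambda>y. (\<Sum>b\<in>Basis. dd (\<lambda>y. Z n y * g b y) b y * (u y)\<^sup>2))" using i1 by simp
      show "(2 * (Z n y * k y) - c n * L) * (u y)\<^sup>2 \<le> (\<Sum>b\<in>Basis. dd (\<lambda>y. Z n y * g b y) b y * (u y)\<^sup>2)" for y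
        unfolding sum_distrib_right[symmetric] by (rule mult_right_mono[OF div]) simp
    qed
    also have "\<dots> = (\<Sum>b\<in>Basis. - 2 * (\<integral>y. (Z n y * g b y) * (u y * (G y \<bullet> b)) \<partial>lborel))"
      using i1 by (subst Bochner_Integration.integral_sum) (auto simp: h1_square_ibp[OF u gC])
    also have "\<dots> = (\<integral>y. (\<Sum>b\<in>Basis. - 2 * ((Z n y * g b y) * (u y * (G y \<bullet> b)))) \<partial>lborel)"
      using i2 by (subst Bochner_Integration.integral_sum) auto
    also have "\<dots> \<le> (\<integral>y. 2 * (\<bar>u y\<bar> * \<bar>norm (G y)\<bar>) \<partial>lborel)"
    proof (rule Bochner_Integration.integral_mono)
      show "integrable lborel (\<lambda>y. \<Sum>b\<in>Basis. - 2 * ((Z n y * g b y) * (u y * (G y \<bullet> b))))" using i2 by simp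
      show "integrable lborel (\<lambda>y. 2 * (\<bar>u y\<bar> * \<bar>norm (G y)\<bar>))"
        using L2_mult_integrable[OF L2_abs[OF Lu] L2_abs[OF LG]] by simp
      fix y
      have "(\<Sum>b\<in>Basis. - 2 * ((Z n y * g b y) * (u y * (G y \<bullet> b)))) = - 2 * Z n y * u y * k y * (\<Sum>b\<in>Basis. ((y - x) \<bullet> b) * (G y \<bullet> b))"
        by (simp add: sum_distrib_left g_def algebra_simps)
      also have "(\<Sum>b\<in>Basis. ((y - x) \<bullet> b) * (G y \<bullet> b)) = (y - x) \<bullet> G y" by (rule euclidean_inner[symmetric])
      also have "- 2 * Z n y * u y * k y * ((y - x) \<bullet> G y) \<le> \<bar>- 2 * Z n y * u y * k y * ((y - x) \<bullet> G y)\<bar>" by (rule abs_ge_self)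
      also have "\<dots> = 2 * (\<bar>u y\<bar> * (\<bar>Z n y\<bar> * (\<bar>(y - x) \<bullet> G y\<bar> * k y)))" using k0[of y] by (simp add: abs_mult)
      also have "\<dots> \<le> 2 * (\<bar>u y\<bar> * (1 * norm (G y)))"
        using abs_inner_ker[OF eta, of "y - x" "G y"] k0[of y]
        by (intro mult_left_mono mult_mono Z1) (auto simp: k_def less_imp_le)
      finally show "(\<Sum>b\<in>Basis. - 2 * ((Z n y * g b y) * (u y * (G y \<bullet> b)))) \<le> 2 * (\<bar>u y\<bar> * \<bar>norm (G y)\<bar>)" by simp
    qed
    also have "\<dots> \<le> 2 * ?S" using Cauchy_Schwarz_sqrt[OF Lu LG] by simp
    finally show ?thesis by simp
  qed
  have "(\<lambda>n. \<integral>y. Z n y * (k y * (u y)\<^sup>2) \<partial>lborel) \<longlonglongrightarrow> (\<integral>y. k y * (u y)\<^sup>2 \<partial>lborel)"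
  proof (rule integral_dominated_convergence[where w="\<lambda>y. k y * (u y)\<^sup>2"])
    show "integrable lborel (\<lambda>y. k y * (u y)\<^sup>2)"
      unfolding k_def by (rule integrable_ker_mult[OF eta L2_integrable[OF Lu]])
    show "(\<lambda>y. k y * (u y)\<^sup>2) \<in> borel_measurable lborel" "(\<lambda>y. Z n y * (k y * (u y)\<^sup>2)) \<in> borel_measurable lborel" for n
      using zk_b L2_measurable[OF Lu] by measurable
    show "AE y in lborel. norm (Z n y * (k y * (u y)\<^sup>2)) \<le> k y * (u y)\<^sup>2" for n
      using Z1 k0 by (intro AE_I2) (auto simp: abs_mult less_imp_le intro!: mult_left_le_one_le)
    have "(\<lambda>n. Z n y * (k y * (u y)\<^sup>2)) \<longlonglongrightarrow> k y * (u y)\<^sup>2" for y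
    proof -
      obtain N :: nat where N: "norm (y - x) \<le> real N" using real_arch_simple by blast
      have "Z n y = 1" if "n \<ge> N" for n
      proof -
        have "norm (y - x) \<le> real (Suc n)" using N that by simp
        then have "norm (c n *\<^sub>R (y - x)) \<le> 1" unfolding norm_scaleR
          by (simp add: c_def inverse_eq_divide pos_divide_le_eq del: of_nat_Suc)
        then show ?thesis using z(4)[of "c n *\<^sub>R (y - x)"] by (simp add: Z_def scaleR_diff_right)
      qed
      then have "\<forall>\<^sub>F n in sequentially. k y * (u y)\<^sup>2 = Z n y * (k y * (u y)\<^sup>2)"
        unfolding eventually_sequentially by (intro exI[of _ N]) simp
      then show ?thesis by (rule Lim_transform_eventually[OF tendsto_const])
    qed
    then show "AE y in lborel. (\<lambda>n. Z n y * (k y * (u y)\<^sup>2)) \<longlonglongrightarrow> k y * (u y)\<^sup>2" by simp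
  qed
  then have lim1: "(\<lambda>n. 2 * (\<integral>y. Z n y * (k y * (u y)\<^sup>2) \<partial>lborel)) \<longlonglongrightarrow> 2 * (\<integral>y. k y * (u y)\<^sup>2 \<partial>lborel)"
    by (intro tendsto_intros)
  have lim2: "(\<lambda>n. 2 * ?S + c n * L * mass u) \<longlonglongrightarrow> 2 * ?S + 0 * L * mass u"
    unfolding c_def by (intro tendsto_intros LIMSEQ_inverse_real_of_nat)
  have "2 * (\<integral>y. k y * (u y)\<^sup>2 \<partial>lborel) \<le> 2 * ?S + 0 * L * mass u"
    by (rule LIMSEQ_le[OF lim1 lim2]) (use bound in blast)
  then show ?thesis by (simp add: k_def)
qed

section \<open>The Newton potential as a limit of regularised potentials\<close>

definition newt :: "('a::euclidean_space \<Rightarrow> real) \<Rightarrow> 'a \<Rightarrow> real" where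
  "newt u x = (\<integral>y. (u y)\<^sup>2 / norm (x - y) \<partial>lborel)"

text \<open>The regularised integrals increase as the scale decreases and are bounded by
  \<open>hardy_regularized\<close>, so monotone convergence gives integrability, bound and limit
  together. The singular point \<open>y = x\<close> is a null set.\<close>

lemma hardy:
  fixes u :: "real^3 \<Rightarrow> real"
  assumes u: "h1 u G"
  shows "integrable lborel (\<lambda>y. (u y)\<^sup>2 / norm (x - y))"
    and "newt u x \<le> sqrt (mass u) * sqrt (mass (\<lambda>x. norm (G x)))"
    and "(\<lambda>n. \<integral>y. ker (inverse (real (Suc n))) (y - x) * (u y)\<^sup>2 \<partial>lborel) \<longlonglongrightarrow> newt u x"
proof -
  define f where "f n y = ker (inverse (real (Suc n))) (y - x) * (u y)\<^sup>2" for n y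
  have Lu: "L2 u" by (rule h1_L2(1)[OF u])
  have i: "integrable lborel (f n)" for n
    unfolding f_def[abs_def] by (rule integrable_ker_mult[OF _ L2_integrable[OF Lu]]) simp
  have m: "mono (\<lambda>n. f n y)" for y
    unfolding f_def by (intro monoI mult_right_mono ker_antimono) (auto simp: field_simps)
  have b: "(\<integral>y. f n y \<partial>lborel) \<le> sqrt (mass u) * sqrt (mass (\<lambda>x. norm (G x)))" for n
    unfolding f_def by (rule hardy_regularized[OF u]) simp
  have "incseq (\<lambda>n. \<integral>y. f n y \<partial>lborel)"
    using m i by (intro monoI Bochner_Integration.integral_mono) (auto simp: mono_def)
  then obtain l where l: "(\<lambda>n. \<integral>y. f n y \<partial>lborel) \<longlonglongrightarrow> l"
    using incseq_convergent b by metis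
  have ae: "AE y in lborel. (\<lambda>n. f n y) \<longlonglongrightarrow> (u y)\<^sup>2 / norm (x - y)"
    using AE_lborel_singleton[of x]
  proof eventually_elim
    case (elim y)
    then have "(\<lambda>n. f n y) \<longlonglongrightarrow> inverse (norm (y - x)) * (u y)\<^sup>2"
      unfolding f_def by (intro tendsto_intros ker_tendsto) auto
    then show ?case by (simp add: divide_inverse mult.commute norm_minus_commute)
  qed
  have meas: "(\<lambda>y. (u y)\<^sup>2 / norm (x - y)) \<in> borel_measurable lborel"
    using L2_measurable[OF Lu] by measurable
  have mm: "AE y in lborel. mono (\<lambda>n. f n y)" using m by simp
  show "integrable lborel (\<lambda>y. (u y)\<^sup>2 / norm (x - y))"
    by (rule integrable_monotone_convergence[OF i mm ae l meas])
  have "newt u x = l" unfolding newt_def by (rule integral_monotone_convergence[OF i mm ae l meas])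
  then show "(\<lambda>n. \<integral>y. ker (inverse (real (Suc n))) (y - x) * (u y)\<^sup>2 \<partial>lborel) \<longlonglongrightarrow> newt u x"
    using l by (simp add: f_def)
  show "newt u x \<le> sqrt (mass u) * sqrt (mass (\<lambda>x. norm (G x)))"
    using LIMSEQ_le_const2[OF l] b \<open>newt u x = l\<close> by blast
qed

section \<open>The interaction force\<close>


text \<open>An integral over the product space rather than an iterated one, so that exchanging the
  roles of the two variables is a single step.\<close>

definition pint :: "('a::euclidean_space \<Rightarrow> 'a \<Rightarrow> real) \<Rightarrow> ('a \<Rightarrow> real) \<Rightarrow> ('a \<Rightarrow> real) \<Rightarrow> real" where
  "pint w p q = (\<integral>z. w (fst z) (snd z) * (p (fst z) * q (snd z)) \<partial>(lborel \<Otimes>\<^sub>M lborel))"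

text \<open>A bounded kernel and integrable densities make Fubini's theorem applicable without
  further conditions; this is why the Coulomb kernel is regularised before forces are
  computed.\<close>

definition bounded_kernel :: "('a::euclidean_space \<Rightarrow> 'a \<Rightarrow> real) \<Rightarrow> bool" where
  "bounded_kernel w \<longleftrightarrow> (\<lambda>z. w (fst z) (snd z)) \<in> borel_measurable (borel \<Otimes>\<^sub>M borel) \<and> (\<exists>C. \<forall>x y. \<bar>w x y\<bar> \<le> C)"

lemma pair_product_integrable:
  fixes p q :: "'a::euclidean_space \<Rightarrow> real"
  assumes p: "integrable lborel p" and q: "integrable lborel q"
  shows "integrable (lborel \<Otimes>\<^sub>M lborel) (\<lambda>z. p (fst z) * q (snd z))"
proof (rule lborel_pair.Fubini_integrable)
  have [measurable]: "p \<in> borel_measurable lborel" "q \<in> borel_measurable lborel" using p q by auto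
  show "(\<lambda>z. p (fst z) * q (snd z)) \<in> borel_measurable (lborel \<Otimes>\<^sub>M lborel)" by measurable
  show "integrable lborel (\<lambda>x. \<integral>y. norm (p (fst (x, y)) * q (snd (x, y))) \<partial>lborel)"
    using p by (simp add: abs_mult)
  show "AE x in lborel. integrable lborel (\<lambda>y. p (fst (x, y)) * q (snd (x, y)))" using q by simp
qed

lemma bounded_kernel_integrable:
  fixes p q :: "'a::euclidean_space \<Rightarrow> real"
  assumes w: "bounded_kernel w" and p: "integrable lborel p" and q: "integrable lborel q"
  shows "integrable (lborel \<Otimes>\<^sub>M lborel) (\<lambda>z. w (fst z) (snd z) * (p (fst z) * q (snd z)))"
proof -
  obtain C where C: "\<And>x y. \<bar>w x y\<bar> \<le> C" using w unfolding bounded_kernel_def by blast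
  have [measurable]: "(\<lambda>z. w (fst z) (snd z)) \<in> borel_measurable (lborel \<Otimes>\<^sub>M lborel)"
    using w unfolding bounded_kernel_def by (simp cong: measurable_cong_sets sets_pair_measure_cong)
  have [measurable]: "p \<in> borel_measurable lborel" "q \<in> borel_measurable lborel" using p q by auto
  show ?thesis
  proof (rule Bochner_Integration.integrable_bound)
    show "integrable (lborel \<Otimes>\<^sub>M lborel) (\<lambda>z. C * (p (fst z) * q (snd z)))"
      using pair_product_integrable[OF p q] by simp
    show "AE z in lborel \<Otimes>\<^sub>M lborel. norm (w (fst z) (snd z) * (p (fst z) * q (snd z))) \<le> norm (C * (p (fst z) * q (snd z)))"
      using order_trans[OF C abs_ge_self] by (intro AE_I2) (simp only: real_norm_def abs_mult mult_right_mono abs_ge_zero mult_nonneg_nonneg)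
  qed measurable
qed

lemma pint_fst:
  assumes "bounded_kernel w" "integrable lborel p" "integrable lborel q"
  shows "pint w p q = (\<integral>x. p x * (\<integral>y. w x y * q y \<partial>lborel) \<partial>lborel)"
proof -
  have "pint w p q = (\<integral>x. (\<integral>y. w (fst (x, y)) (snd (x, y)) * (p (fst (x, y)) * q (snd (x, y))) \<partial>lborel) \<partial>lborel)"
    unfolding pint_def by (rule lborel_pair.integral_fst'[OF bounded_kernel_integrable[OF assms], symmetric])
  also have "\<dots> = (\<integral>x. (\<integral>y. p x * (w x y * q y) \<partial>lborel) \<partial>lborel)"
    by (simp add: mult_ac)
  finally show ?thesis by simp
qed

lemma bounded_kernel_swap:
  assumes "bounded_kernel w" shows "bounded_kernel (\<lambda>x y. w y x)"
proof -
  have w: "(\<lambda>z. w (fst z) (snd z)) \<in> borel_measurable (borel \<Otimes>\<^sub>M borel)"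
    using assms by (simp add: bounded_kernel_def)
  have "(\<lambda>z. (snd z, fst z)) \<in> measurable (borel \<Otimes>\<^sub>M borel) (borel \<Otimes>\<^sub>M borel)" by measurable
  from measurable_compose[OF this w] show ?thesis
    using assms by (auto simp: bounded_kernel_def)
qed

lemma pint_swap:
  assumes "bounded_kernel w" "integrable lborel p" "integrable lborel q"
  shows "pint w p q = pint (\<lambda>x y. w y x) q p"
proof -
  let ?f = "\<lambda>z. w (fst z) (snd z) * (p (fst z) * q (snd z))"
  have "?f \<in> borel_measurable (lborel \<Otimes>\<^sub>M lborel)" using bounded_kernel_integrable[OF assms] by simp
  from lborel_pair.integral_product_swap[OF this]
  show ?thesis unfolding pint_def by (simp add: case_prod_unfold mult_ac)
qed

lemma pint_snd:
  assumes "bounded_kernel w" "integrable lborel p" "integrable lborel q"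
  shows "pint w p q = (\<integral>y. q y * (\<integral>x. w x y * p x \<partial>lborel) \<partial>lborel)"
  unfolding pint_swap[OF assms] by (rule pint_fst[OF bounded_kernel_swap[OF assms(1)] assms(3,2)])

lemma bounded_kernel_add:
  assumes "bounded_kernel w" "bounded_kernel w'" shows "bounded_kernel (\<lambda>x y. w x y + w' x y)"
proof -
  obtain C C' where "\<And>x y. \<bar>w x y\<bar> \<le> C" "\<And>x y. \<bar>w' x y\<bar> \<le> C'" using assms unfolding bounded_kernel_def by blast
  then have "\<bar>w x y + w' x y\<bar> \<le> C + C'" for x y by (meson abs_triangle_ineq add_mono order_trans)
  then show ?thesis using assms unfolding bounded_kernel_def by (auto intro: borel_measurable_add)
qed

lemma bounded_kernel_mult:
  assumes "bounded_kernel w" "bounded_kernel w'" shows "bounded_kernel (\<lambda>x y. w x y * w' x y)"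
proof -
  obtain C C' where C: "\<And>x y. \<bar>w x y\<bar> \<le> C" "\<And>x y. \<bar>w' x y\<bar> \<le> C'" using assms unfolding bounded_kernel_def by blast
  have "\<bar>w x y * w' x y\<bar> \<le> C * C'" for x y
    unfolding abs_mult by (rule mult_mono[OF C]) (use order_trans[OF abs_ge_zero C(1)] in auto)
  then show ?thesis using assms unfolding bounded_kernel_def by (auto intro: borel_measurable_times)
qed

lemma bounded_kernel_fst:
  assumes "f \<in> borel_measurable borel" "\<And>x. \<bar>f x\<bar> \<le> C" shows "bounded_kernel (\<lambda>x y. f x)"
  using assms measurable_compose[OF measurable_fst assms(1)] unfolding bounded_kernel_def by auto

lemma bounded_kernel_const: "bounded_kernel (\<lambda>x y. c)"
  unfolding bounded_kernel_def by auto

lemma bounded_kernel_diff: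
  assumes "f \<in> borel_measurable borel" "\<And>z. \<bar>f z\<bar> \<le> C"
  shows "bounded_kernel (\<lambda>x y. f (x - y))"
proof -
  have "(\<lambda>z. fst z - snd z) \<in> borel_measurable (borel \<Otimes>\<^sub>M borel :: ('a \<times> 'a) measure)" by measurable
  from measurable_compose[OF this assms(1)] show ?thesis
    using assms(2) unfolding bounded_kernel_def by auto
qed

lemma pint_add:
  assumes "bounded_kernel w" "bounded_kernel w'" "integrable lborel p" "integrable lborel q"
  shows "pint (\<lambda>x y. w x y + w' x y) p q = pint w p q + pint w' p q"
  unfolding pint_def
  using bounded_kernel_integrable[OF assms(1,3,4)] bounded_kernel_integrable[OF assms(2,3,4)]
  by (simp add: distrib_right)

lemma pint_cmult: "pint (\<lambda>x y. c * w x y) p q = c * pint w p q"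
  unfolding pint_def by (simp add: mult.assoc)

lemma pint_mono:
  assumes "bounded_kernel w" "bounded_kernel w'" "integrable lborel p" "integrable lborel q"
    and "\<And>x. p x \<ge> 0" "\<And>x. q x \<ge> 0" "\<And>x y. w x y \<le> w' x y"
  shows "pint w p q \<le> pint w' p q"
  unfolding pint_def
  using assms by (intro Bochner_Integration.integral_mono bounded_kernel_integrable mult_right_mono) auto

lemma ker_borel: "\<eta> > 0 \<Longrightarrow> ker \<eta> \<in> borel_measurable borel"
  by (rule continuous_borel[OF continuous_ker[OF _ continuous_on_id]])

lemma bounded_kernel_ker:
  fixes v :: "'a::euclidean_space"
  assumes "\<eta> > 0"
  shows "bounded_kernel (\<lambda>x y :: 'a. ker \<eta> (x - y))"
    and "bounded_kernel (\<lambda>x y. ((y - x) \<bullet> v) * ker \<eta> (x - y) ^ 3)"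
proof -
  have a: "\<bar>ker \<eta> z\<bar> \<le> inverse \<eta>" for z :: 'a
    using ker_le_eta[OF assms, of z] ker_pos[OF assms, of z] by simp
  show "bounded_kernel (\<lambda>x y :: 'a. ker \<eta> (x - y))"
    by (rule bounded_kernel_diff[OF ker_borel[OF assms] a])
  have "bounded_kernel (\<lambda>x y. - ((x - y) \<bullet> v) * ker \<eta> (x - y) ^ 3)"
  proof (rule bounded_kernel_diff[where f="\<lambda>z. - (z \<bullet> v) * ker \<eta> z ^ 3"])
    show "(\<lambda>z. - (z \<bullet> v) * ker \<eta> z ^ 3) \<in> borel_measurable borel"
      by (intro continuous_borel continuous_intros assms)
    fix z
    have "\<bar>- (z \<bullet> v) * ker \<eta> z ^ 3\<bar> = (\<bar>z \<bullet> v\<bar> * ker \<eta> z) * (ker \<eta> z)\<^sup>2"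
      using ker_pos[OF assms, of z] by (simp add: abs_mult power3_eq_cube power2_eq_square)
    also have "\<dots> \<le> norm v * (inverse \<eta>)\<^sup>2"
      using a[of z] ker_pos[OF assms, of z] by (intro mult_mono abs_inner_ker assms power_mono) auto
    finally show "\<bar>- (z \<bullet> v) * ker \<eta> z ^ 3\<bar> \<le> norm v * (inverse \<eta>)\<^sup>2" .
  qed
  moreover have "- ((x - y) \<bullet> v) = (y - x) \<bullet> v" for x y by (simp add: inner_diff_left)
  ultimately show "bounded_kernel (\<lambda>x y. ((y - x) \<bullet> v) * ker \<eta> (x - y) ^ 3)" by simp
qed

definition regularized_newton :: "real \<Rightarrow> ('a::euclidean_space \<Rightarrow> real) \<Rightarrow> 'a \<Rightarrow> real" where
  "regularized_newton \<eta> u x = (\<integral>y. ker \<eta> (y - x) * (u y)\<^sup>2 \<partial>lborel)"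

text \<open>Up to regularisation, \<open>ker \<eta> (x - y) ^ 3 *\<^sub>R (y - x)\<close> is the
  inverse-square attraction exerted on \<open>x\<close> by a unit mass at \<open>y\<close>. Its
  component along \<open>v\<close> is weighted by the difference of the cutoff at the two
  points.\<close>

definition interaction :: "('a::euclidean_space \<Rightarrow> real) \<Rightarrow> 'a \<Rightarrow> real \<Rightarrow> ('a \<Rightarrow> real) \<Rightarrow> real" where
  "interaction \<zeta> v \<eta> u =
     pint (\<lambda>x y. (\<zeta> x - \<zeta> y) * (((y - x) \<bullet> v) * ker \<eta> (x - y) ^ 3)) (\<lambda>x. (u x)\<^sup>2) (\<lambda>x. (u x)\<^sup>2)"

lemma interaction_kernel:
  assumes "\<eta> > 0" "test_fun \<zeta>"
  shows "bounded_kernel (\<lambda>x y. \<zeta> x)" "bounded_kernel (\<lambda>x y. \<zeta> y)"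
    "bounded_kernel (\<lambda>x y. (\<zeta> x - \<zeta> y) * (((y - x) \<bullet> v) * ker \<eta> (x - y) ^ 3))"
proof -
  obtain B where B: "\<And>x. \<bar>\<zeta> x\<bar> \<le> B" using test_fun_bounded[OF assms(2)] by metis
  show 1: "bounded_kernel (\<lambda>x y. \<zeta> x)" by (rule bounded_kernel_fst[OF test_fun_borel[OF assms(2)] B])
  show 2: "bounded_kernel (\<lambda>x y. \<zeta> y)" by (rule bounded_kernel_swap[OF 1])
  have "bounded_kernel (\<lambda>x y. (\<zeta> x + (- 1) * \<zeta> y) * (((y - x) \<bullet> v) * ker \<eta> (x - y) ^ 3))"
    by (intro bounded_kernel_mult bounded_kernel_add bounded_kernel_const bounded_kernel_ker 1 2 assms)
  then show "bounded_kernel (\<lambda>x y. (\<zeta> x - \<zeta> y) * (((y - x) \<bullet> v) * ker \<eta> (x - y) ^ 3))" by simp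
qed

text \<open>The interaction is antisymmetrised, which removes the self-force where \<open>\<zeta>\<close> is constant.\<close>

lemma newton_force:
  assumes u: "h1 u G" and eta: "\<eta> > 0" and z: "test_fun \<zeta>"
  shows "(\<integral>x. \<zeta> x * (regularized_newton \<eta> u x * (u x * (G x \<bullet> v))) \<partial>lborel) =
     - (1/2) * (\<integral>x. dd \<zeta> v x * (regularized_newton \<eta> u x * (u x)\<^sup>2) \<partial>lborel) - (1/4) * interaction \<zeta> v \<eta> u"
proof -
  let ?p = "\<lambda>x. (u x)\<^sup>2" and ?g = "\<lambda>x. u x * (G x \<bullet> v)"
  let ?k = "\<lambda>x y. ker \<eta> (x - y)" and ?d = "\<lambda>x y. ((y - x) \<bullet> v) * ker \<eta> (x - y) ^ 3"
  have p: "integrable lborel ?p" by (rule L2_integrable[OF h1_L2(1)[OF u]])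
  have g: "integrable lborel ?g" by (rule L2_mult_integrable[OF h1_L2[OF u]])
  obtain B where B: "\<And>x. \<bar>dd \<zeta> v x\<bar> \<le> B" using test_fun_bounded[OF test_fun_dd[OF z]] by metis
  note bk = interaction_kernel[OF eta z] bounded_kernel_ker[OF eta]
  have bd: "bounded_kernel (\<lambda>x y. dd \<zeta> v x)"
    by (rule bounded_kernel_fst[OF test_fun_borel[OF test_fun_dd[OF z]] B])
  have w1: "bounded_kernel (\<lambda>x y. \<zeta> x * ?k x y)" by (intro bounded_kernel_mult bk)
  have w2: "bounded_kernel (\<lambda>x y. dd \<zeta> v x * ?k x y)" by (intro bounded_kernel_mult bk bd)
  have w3: "bounded_kernel (\<lambda>x y. \<zeta> x * ?d x y)" by (intro bounded_kernel_mult bk)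
  have w4: "bounded_kernel (\<lambda>x y. \<zeta> y * ?d y x)" by (rule bounded_kernel_swap[OF w3])
  have newt: "regularized_newton \<eta> u x = (\<integral>y. ?k x y * ?p y \<partial>lborel)" for x
    unfolding regularized_newton_def by (subst ker_minus) simp
  \<comment> \<open>For fixed \<open>y\<close> this is an integration by parts in \<open>x\<close>:
    \<open>u x * (G x \<bullet> v)\<close> is half the derivative of the square of \<open>u\<close>,
    and the weight is the cutoff times the kernel.\<close>
  have ibp: "(\<integral>x. (\<zeta> x * ?k x y) * ?g x \<partial>lborel) =
      - (1/2) * (\<integral>x. (\<zeta> x * ?d x y + dd \<zeta> v x * ?k x y) * ?p x \<partial>lborel)" for y
  proof -
    have kd: "\<And>x. (\<lambda>x. ker \<eta> (x - y)) differentiable (at x)"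
      "\<And>v x. dd (\<lambda>x. ker \<eta> (x - y)) v x = - ((x - y) \<bullet> v) * ker \<eta> (x - y) ^ 3"
      using ker_shift_dd[OF eta] by blast+
    have C: "C1c (\<lambda>x. \<zeta> x * ?k x y)"
    proof (rule C1c_mult[OF test_fun_C1c[OF z] kd(1)])
      show "continuous_on UNIV (dd (\<lambda>x. ker \<eta> (x - y)) v)" for v
        unfolding kd(2)[abs_def] by (intro continuous_intros eta)
    qed
    have "dd (\<lambda>x. \<zeta> x * ?k x y) v = (\<lambda>x. \<zeta> x * ?d x y + dd \<zeta> v x * ?k x y)"
    proof
      fix x
      have "- ((x - y) \<bullet> v) = (y - x) \<bullet> v" by (simp add: inner_diff_left)
      then show "dd (\<lambda>x. \<zeta> x * ?k x y) v x = \<zeta> x * ?d x y + dd \<zeta> v x * ?k x y"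
        by (simp add: dd_mult[OF test_fun_differentiable[OF z] kd(1)] kd(2))
    qed
    then show ?thesis using h1_square_ibp[OF u C, of v] by simp
  qed
  have "(\<integral>x. \<zeta> x * (regularized_newton \<eta> u x * ?g x) \<partial>lborel) = pint (\<lambda>x y. \<zeta> x * ?k x y) ?g ?p"
    unfolding pint_fst[OF w1 g p] newt by (simp add: mult_ac)
  also have "\<dots> = (\<integral>y. ?p y * (- (1/2) * (\<integral>x. (\<zeta> x * ?d x y + dd \<zeta> v x * ?k x y) * ?p x \<partial>lborel)) \<partial>lborel)"
    unfolding pint_snd[OF w1 g p] ibp ..
  also have "\<dots> = - (1/2) * (\<integral>y. ?p y * (\<integral>x. (\<zeta> x * ?d x y + dd \<zeta> v x * ?k x y) * ?p x \<partial>lborel) \<partial>lborel)"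
    by (subst integral_mult_right_zero[symmetric]) (simp add: mult_ac)
  also have "\<dots> = - (1/2) * (pint (\<lambda>x y. \<zeta> x * ?d x y) ?p ?p + pint (\<lambda>x y. dd \<zeta> v x * ?k x y) ?p ?p)"
    unfolding pint_snd[OF bounded_kernel_add[OF w3 w2] p p, symmetric] pint_add[OF w3 w2 p p] ..
  also have "pint (\<lambda>x y. dd \<zeta> v x * ?k x y) ?p ?p = (\<integral>x. dd \<zeta> v x * (regularized_newton \<eta> u x * (u x)\<^sup>2) \<partial>lborel)"
    unfolding pint_fst[OF w2 p p] newt by (simp add: mult_ac)
  also have "pint (\<lambda>x y. \<zeta> x * ?d x y) ?p ?p = (1/2) * interaction \<zeta> v \<eta> u"
  proof -
    \<comment> \<open>The two halves of the antisymmetrised kernel are exchanged by swapping the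
      variables and hence contribute equally.\<close>
    have "interaction \<zeta> v \<eta> u = pint (\<lambda>x y. \<zeta> x * ?d x y + \<zeta> y * ?d y x) ?p ?p"
    proof -
      have "(\<zeta> x - \<zeta> y) * ?d x y = \<zeta> x * ?d x y + \<zeta> y * ?d y x" for x y
      proof -
        have "(x - y) \<bullet> v = - ((y - x) \<bullet> v)" by (simp add: inner_diff_left)
        then show ?thesis by (simp add: ker_minus[of \<eta> y x] algebra_simps)
      qed
      then show ?thesis unfolding interaction_def by simp
    qed
    also have "\<dots> = pint (\<lambda>x y. \<zeta> x * ?d x y) ?p ?p + pint (\<lambda>x y. \<zeta> y * ?d y x) ?p ?p"
      by (rule pint_add[OF w3 w4 p p])
    also have "pint (\<lambda>x y. \<zeta> y * ?d y x) ?p ?p = pint (\<lambda>x y. \<zeta> x * ?d x y) ?p ?p"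
      by (rule pint_swap[OF w4 p p])
    finally show ?thesis by simp
  qed
  finally show ?thesis by (simp add: field_simps)
qed

text \<open>Pairs of points are sorted by their position relative to \<open>b i\<close>. If one
  point lies in the annulus \<open>A\<close>, the Lipschitz bound on \<open>\<zeta>\<close> tames
  the singular force at the price of a potential integrated over \<open>A\<close>. Otherwise
  \<open>\<zeta> x - \<zeta> y\<close> is nonzero only for one point in the core ball and one beyond
  distance \<open>2 * r\<close>. Such a pair attracts by a definite amount if the outer point lies
  in ball \<open>l\<close>, contributes nonnegatively if it lies in another core, and is bounded by
  \<open>norm v / r\<^sup>2\<close> if it lies in \<open>R\<close>.\<close>

lemma interaction_lower_bound:
  fixes b :: "nat \<Rightarrow> 'a::euclidean_space"
  assumes u: "L2 u" and eta: "0 < \<eta>" "\<eta> \<le> 1" and z: "test_fun \<zeta>" and r: "r > 0"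
    and z1: "\<And>x. dist (b i) x \<le> r \<Longrightarrow> \<zeta> x = 1" and z0: "\<And>x. dist (b i) x \<ge> 2 * r \<Longrightarrow> \<zeta> x = 0"
    and lip: "\<And>x y. \<bar>\<zeta> x - \<zeta> y\<bar> \<le> Lz * norm (x - y)"
    and Lz0: "Lz \<ge> 0" and im: "i < m" "l < m" "l \<noteq> i" and m1: "mass u = 1"
    and sep: "\<And>j. j < m \<Longrightarrow> j \<noteq> i \<Longrightarrow> dist (b i) (b j) \<ge> 3 * r"
    and pos: "\<And>j x y. j < m \<Longrightarrow> j \<noteq> i \<Longrightarrow> dist (b i) x < r \<Longrightarrow> dist (b j) y < r \<Longrightarrow> (y - x) \<bullet> v \<ge> \<gamma>"
    and gam: "\<gamma> > 0"
    and bd: "\<And>x y. dist (b i) x < r \<Longrightarrow> dist (b l) y < r \<Longrightarrow> norm (x - y) \<le> D"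
    and D: "D \<ge> 0"
  defines "A \<equiv> {x. r \<le> dist (b i) x \<and> dist (b i) x \<le> 2 * r}"
    and "R \<equiv> {x. \<forall>j<m. dist (b j) x \<ge> r}"
  shows "interaction \<zeta> v \<eta> u \<ge> \<gamma> * inverse (sqrt (D\<^sup>2 + 1)) ^ 3 *
       ((\<integral>x. indicator (ball (b i) r) x * (u x)\<^sup>2 \<partial>lborel) * (\<integral>x. indicator (ball (b l) r) x * (u x)\<^sup>2 \<partial>lborel))
     - 2 * Lz * norm v * (\<integral>x. indicator A x * (regularized_newton \<eta> u x * (u x)\<^sup>2) \<partial>lborel)
     - 2 * norm v / r\<^sup>2 * (\<integral>x. indicator R x * (u x)\<^sup>2 \<partial>lborel)"
proof -
  let ?p = "\<lambda>x. (u x)\<^sup>2"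
  define k0 where "k0 = inverse (sqrt (D\<^sup>2 + 1)) ^ 3"
  let ?k = "\<lambda>x y. ker \<eta> (x - y)" and ?d = "\<lambda>x y. ((y - x) \<bullet> v) * ker \<eta> (x - y) ^ 3"
  let ?i = "\<lambda>S x. indicator S x :: real"
  have p: "integrable lborel ?p" by (rule L2_integrable[OF u])
  have Ab: "A \<in> sets borel" "R \<in> sets borel"
  proof -
    have "closed A" unfolding A_def
      by (intro closed_Collect_conj closed_Collect_le continuous_intros)
    moreover have "R = (\<Inter>j\<in>{..<m}. {x. r \<le> dist (b j) x})" using im(1) by (auto simp: R_def)
    then have "closed R"
      by (simp, intro closed_INT ballI closed_Collect_le continuous_intros)
    ultimately show "A \<in> sets borel" "R \<in> sets borel" by auto
  qed
  have ind: "bounded_kernel (\<lambda>x y. ?i S x)" if "S \<in> sets borel" for S :: "'a set"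
    by (rule bounded_kernel_fst[where C=1]) (use that in auto)
  have Lz: "Lz * norm w \<ge> 0" for w :: 'a using Lz0 by simp
  have kp: "?k x y > 0" for x y by (rule ker_pos[OF eta(1)])
  have kn: "norm (x - y) * ?k x y \<le> 1" for x y by (rule norm_mult_ker[OF eta(1)])
  \<comment> \<open>Two factors \<open>norm (x - y)\<close>, one from the Lipschitz bound and one
    from the numerator of the force, reduce the cube of the kernel to its first power.\<close>
  have q_general: "\<bar>(\<zeta> x - \<zeta> y) * ?d x y\<bar> \<le> Lz * norm v * ?k x y" for x y
  proof -
    have "\<bar>(\<zeta> x - \<zeta> y) * ?d x y\<bar> = \<bar>\<zeta> x - \<zeta> y\<bar> * \<bar>(y - x) \<bullet> v\<bar> * ?k x y ^ 3"
      using kp[of x y] by (simp add: abs_mult)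
    also have "\<dots> \<le> (Lz * norm (x - y)) * (norm (x - y) * norm v) * ?k x y ^ 3"
      using Cauchy_Schwarz_ineq2[of "y - x" v] kp[of x y] lip[of x y] Lz0
      by (intro mult_right_mono mult_mono) (auto simp: norm_minus_commute)
    also have "\<dots> = (Lz * norm v * ?k x y) * (norm (x - y) * ?k x y)\<^sup>2"
      by (simp add: power2_eq_square power3_eq_cube)
    also have "\<dots> \<le> (Lz * norm v * ?k x y) * 1"
    proof (rule mult_left_mono)
      show "(norm (x - y) * ?k x y)\<^sup>2 \<le> 1"
        using kn[of x y] kp[of x y] by (intro power_le_one) auto
      show "0 \<le> Lz * norm v * ?k x y" using Lz0 kp[of x y] by (intro mult_nonneg_nonneg) auto
    qed
    finally show ?thesis by simp
  qed
  have d_far: "\<bar>?d x y\<bar> \<le> norm v / r\<^sup>2" if "norm (x - y) \<ge> r" for x y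
  proof -
    have "x \<noteq> y" using that r by auto
    then have kr: "?k x y \<le> inverse r"
      using order_trans[OF ker_le_norm[of "x - y" \<eta>] le_imp_inverse_le[OF that r]] by simp
    have "\<bar>?d x y\<bar> = (\<bar>(x - y) \<bullet> v\<bar> * ?k x y) * (?k x y)\<^sup>2"
      using kp[of x y] by (simp add: abs_mult power3_eq_cube power2_eq_square inner_diff_left abs_minus_commute)
    also have "\<dots> \<le> norm v * (inverse r)\<^sup>2"
      using kr kp[of x y] by (intro mult_mono abs_inner_ker eta power_mono) auto
    finally show ?thesis by (simp add: power_inverse divide_inverse)
  qed
  \<comment> \<open>Because \<open>\<eta> \<le> 1\<close>, the lower bound \<open>k0\<close> for the
    cube of the kernel does not depend on the regularisation.\<close>
  have d_core: "?d x y \<ge> \<gamma> * k0" if "dist (b i) x < r" "dist (b l) y < r" for x y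
  proof -
    have "norm (x - y) \<le> D" by (rule bd[OF that])
    then have "(x - y) \<bullet> (x - y) + \<eta>\<^sup>2 \<le> D\<^sup>2 + 1"
      using eta D power_mono[of "norm (x - y)" D 2] power_mono[of \<eta> 1 2] by (simp add: power2_norm_eq_inner)
    then have "sqrt ((x - y) \<bullet> (x - y) + \<eta>\<^sup>2) \<le> sqrt (D\<^sup>2 + 1)" by simp
    then have "inverse (sqrt (D\<^sup>2 + 1)) \<le> ?k x y"
      unfolding ker_def using ker_arg_pos[OF eta(1), of "x - y"] by (intro le_imp_inverse_le) auto
    then have "k0 \<le> ?k x y ^ 3" unfolding k0_def by (intro power_mono) auto
    moreover have "k0 \<ge> 0" by (simp add: k0_def)
    ultimately show ?thesis
      using pos[OF im(2,3) that] gam by (intro mult_mono) auto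
  qed
  have d_pos: "?d x y \<ge> 0" if "dist (b i) x < r" "dist (b j) y < r" "j < m" "j \<noteq> i" for x y j
    using pos[OF that(3,4,1,2)] gam kp[of x y] by simp
  have dsym: "?d y x = - ?d x y" for x y
    by (simp add: ker_minus[of \<eta> y x] inner_diff_left left_diff_distrib)
  have vr: "norm v / r\<^sup>2 \<ge> 0" by simp
  have LA: "Lz * norm v * ?k x y * ?i A z \<ge> 0" for x y z
    using Lz0 kp[of x y] by (intro mult_nonneg_nonneg) auto
  have k0: "\<gamma> * k0 \<ge> 0" using gam by (simp add: k0_def)
  have half: "\<gamma> * k0 * (?i (ball (b i) r) x * ?i (ball (b l) r) y) - norm v / r\<^sup>2 * ?i R y \<le> ?d x y"
    if x: "dist (b i) x < r" and y: "dist (b i) y > 2 * r" for x y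
  proof -
    have far: "norm (x - y) \<ge> r" using x y dist_triangle[of "b i" y x] by (simp add: dist_norm norm_minus_commute)
    show ?thesis
    proof (cases "y \<in> R")
      case True
      then have "y \<notin> ball (b l) r" using im(2) by (force simp: R_def)
      then show ?thesis using True d_far[OF far] by (simp add: abs_le_iff)
    next
      case False
      then obtain j where j: "j < m" "dist (b j) y < r" by (auto simp: R_def not_le)
      then have "j \<noteq> i" using y r by auto
      then have "?d x y \<ge> 0" using d_pos[OF x j(2,1)] by simp
      moreover have "?d x y \<ge> \<gamma> * k0" if "y \<in> ball (b l) r" using d_core[OF x] that by simp
      ultimately show ?thesis using False x by (auto simp: indicator_def)
    qed
  qed
  \<comment> \<open>A pointwise lower bound by five elementary kernels that are integrated
    separately below. The error kernels come in pairs because either variable can be the annular or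
    the outer point.\<close>
  have key: "\<gamma> * k0 * (?i (ball (b i) r) x * ?i (ball (b l) r) y)
      + (- (Lz * norm v)) * (?k x y * ?i A x) + (- (Lz * norm v)) * (?k x y * ?i A y)
      + (- (norm v / r\<^sup>2)) * ?i R x + (- (norm v / r\<^sup>2)) * ?i R y
     \<le> (\<zeta> x - \<zeta> y) * ?d x y" for x y
  proof -
    have Rn: "norm v / r\<^sup>2 * ?i R x \<ge> 0" "norm v / r\<^sup>2 * ?i R y \<ge> 0" by auto
    have eq: "\<gamma> * k0 * (?i (ball (b i) r) x * ?i (ball (b l) r) y)
      + (- (Lz * norm v)) * (?k x y * ?i A x) + (- (Lz * norm v)) * (?k x y * ?i A y)
      + (- (norm v / r\<^sup>2)) * ?i R x + (- (norm v / r\<^sup>2)) * ?i R y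
      = \<gamma> * k0 * (?i (ball (b i) r) x * ?i (ball (b l) r) y) - Lz * norm v * ?k x y * ?i A x
       - Lz * norm v * ?k x y * ?i A y - norm v / r\<^sup>2 * ?i R x - norm v / r\<^sup>2 * ?i R y"
      by simp
    consider (a) "x \<in> A \<or> y \<in> A" | (b) "x \<notin> A" "y \<notin> A" by blast
    then show ?thesis
    proof cases
      case a
      have "?i (ball (b i) r) x * ?i (ball (b l) r) y = 0"
      proof (rule ccontr)
        assume "?i (ball (b i) r) x * ?i (ball (b l) r) y \<noteq> 0"
        then have "dist (b i) x < r" "dist (b l) y < r" by (auto simp: indicator_def split: if_splits)
        moreover have "dist (b i) y > 2 * r"
          using sep[OF im(2,3)] \<open>dist (b l) y < r\<close> dist_triangle[of "b i" "b l" y] by (simp add: dist_commute)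
        ultimately show False using a by (auto simp: A_def)
      qed
      moreover have "Lz * norm v * ?k x y \<le> Lz * norm v * ?k x y * ?i A x + Lz * norm v * ?k x y * ?i A y"
        using a LA[of x y x] LA[of x y y] by (auto simp: indicator_def split: if_splits)
      moreover have "- (Lz * norm v * ?k x y) \<le> (\<zeta> x - \<zeta> y) * ?d x y"
        using abs_le_D2[OF q_general[of x y]] by linarith
      ultimately show ?thesis unfolding eq using Rn by (simp only: mult_zero_right)
    next
      case b
      have xy: "dist (b i) w < r \<or> dist (b i) w > 2 * r" if "w \<notin> A" for w using that by (auto simp: A_def)
      have A0: "?i A x = 0" "?i A y = 0" using b by auto
      have in1: "\<zeta> w = 1" if "dist (b i) w < r" for w using z1 that by simp
      have out0: "\<zeta> w = 0" if "dist (b i) w > 2 * r" for w using z0 that by simp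
      have lout: "?i (ball (b l) r) y = 0" if "dist (b i) y < r"
        using that sep[OF im(2,3)] dist_triangle[of "b i" "b l" y] r by (simp add: dist_commute indicator_def)
      consider "dist (b i) x < r" "dist (b i) y < r" | "dist (b i) x < r" "dist (b i) y > 2 * r"
        | "dist (b i) x > 2 * r" "dist (b i) y < r" | "dist (b i) x > 2 * r" "dist (b i) y > 2 * r"
        using xy[OF b(1)] xy[OF b(2)] by blast
      then show ?thesis
      proof cases
        case 1
        then show ?thesis unfolding eq A0 lout[OF 1(2)] in1[OF 1(1)] in1[OF 1(2)] using Rn
          by (simp only: mult_zero_right mult_zero_left diff_self)
      next
        case 2
        then show ?thesis unfolding eq A0 in1[OF 2(1)] out0[OF 2(2)] using Rn half[OF 2]
          by (simp only: mult_zero_right diff_0_right mult_1)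
      next
        case 3
        \<comment> \<open>In this reversed configuration the attraction between the two cores is
          nonnegative and is simply discarded; the other ordering supplies the term that is
          kept.\<close>
        have x0: "?i (ball (b i) r) x = 0" using 3 r by simp
        have "\<gamma> * k0 * (?i (ball (b i) r) y * ?i (ball (b l) r) x) \<ge> 0" using k0 by simp
        then have "- (norm v / r\<^sup>2 * ?i R x) \<le> - ?d x y" using half[OF 3(2,1)] unfolding dsym[of x y] by linarith
        moreover have "(0 - 1) * ?d x y = - ?d x y" by simp
        ultimately show ?thesis unfolding eq A0 in1[OF 3(2)] out0[OF 3(1)] x0 using Rn
          by (simp only: mult_zero_right mult_zero_left)
      next
        case 4
        have x0: "?i (ball (b i) r) x = 0" using 4 r by simp
        show ?thesis unfolding eq A0 out0[OF 4(1)] out0[OF 4(2)] x0 using Rn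
          by (simp only: mult_zero_right mult_zero_left diff_self)
      qed
    qed
  qed
  note bk = bounded_kernel_mult bounded_kernel_add bounded_kernel_const bounded_kernel_ker(1)[OF eta(1)]
    ind[OF Ab(1)] ind[OF Ab(2)] ind[of "ball (b i) r"]
    bounded_kernel_swap[OF ind[of "ball (b l) r"]]
    bounded_kernel_swap[OF ind[OF Ab(1)]] bounded_kernel_swap[OF ind[OF Ab(2)]]
  have bb: "ball c r \<in> sets borel" for c :: 'a by simp
  define w1 w2 w3 w4 w5 where w: "w1 = (\<lambda>x y. ?i (ball (b i) r) x * ?i (ball (b l) r) y)"
    "w2 = (\<lambda>x y. ?k x y * ?i A x)" "w3 = (\<lambda>x y. ?k x y * ?i A y)"
    "w4 = (\<lambda>x y::'a. ?i R x)" "w5 = (\<lambda>x::'a. \<lambda>y. ?i R y)"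
  have wk: "bounded_kernel w1" "bounded_kernel w2" "bounded_kernel w3" "bounded_kernel w4" "bounded_kernel w5"
    unfolding w by (intro bk bb)+
  have iN: "integrable lborel (\<lambda>y. ker \<eta> (y - x) * ?p y)" for x by (rule integrable_ker_mult[OF eta(1) p])
  have e1: "pint w1 ?p ?p = (\<integral>x. ?i (ball (b i) r) x * ?p x \<partial>lborel) * (\<integral>x. ?i (ball (b l) r) x * ?p x \<partial>lborel)"
  proof -
    let ?K = "\<integral>y. ?i (ball (b l) r) y * ?p y \<partial>lborel"
    have "?p x * (\<integral>y. ?i (ball (b i) r) x * ?i (ball (b l) r) y * ?p y \<partial>lborel) = (?i (ball (b i) r) x * ?p x) * ?K" for x
      by (simp add: mult.assoc)
    then show ?thesis unfolding pint_fst[OF wk(1) p p] unfolding w by (simp only: integral_mult_left_zero)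
  qed
  have e2: "pint w2 ?p ?p = (\<integral>x. ?i A x * (regularized_newton \<eta> u x * ?p x) \<partial>lborel)"
  proof -
    have "?p x * (\<integral>y. ?k x y * ?i A x * ?p y \<partial>lborel) = ?i A x * (regularized_newton \<eta> u x * ?p x)" for x
    proof -
      have "(\<lambda>y. ?k x y * ?i A x * ?p y) = (\<lambda>y. ?i A x * (ker \<eta> (y - x) * ?p y))"
        by (intro ext) (simp add: ker_minus[of \<eta> x] mult_ac)
      then show ?thesis unfolding regularized_newton_def by simp
    qed
    then show ?thesis unfolding pint_fst[OF wk(2) p p] unfolding w by (simp only:)
  qed
  have e3: "pint w3 ?p ?p = pint w2 ?p ?p"
    unfolding pint_swap[OF wk(3) p p] unfolding w by (rule arg_cong[where f="\<lambda>w. pint w ?p ?p"], intro ext, simp add: ker_minus)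
  \<comment> \<open>Integrating out the variable that is absent from the kernel gives the total mass
    1.\<close>
  have e4: "pint w4 ?p ?p = (\<integral>x. ?i R x * ?p x \<partial>lborel)"
    unfolding pint_fst[OF wk(4) p p] unfolding w by (simp add: m1 mult_ac)
  have e5: "pint w5 ?p ?p = (\<integral>x. ?i R x * ?p x \<partial>lborel)"
    unfolding pint_snd[OF wk(5) p p] unfolding w by (simp add: m1 mult_ac)
  have "pint (\<lambda>x y. \<gamma> * k0 * w1 x y + (- (Lz * norm v)) * w2 x y + (- (Lz * norm v)) * w3 x y
      + (- (norm v / r\<^sup>2)) * w4 x y + (- (norm v / r\<^sup>2)) * w5 x y) ?p ?p \<le> interaction \<zeta> v \<eta> u"
    unfolding interaction_def
    by (rule pint_mono[OF _ interaction_kernel(3)[OF eta(1) z] p p])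
      (intro bk wk, simp_all only: zero_le_power2, use key in \<open>simp add: w\<close>)
  also have "pint (\<lambda>x y. \<gamma> * k0 * w1 x y + (- (Lz * norm v)) * w2 x y + (- (Lz * norm v)) * w3 x y
      + (- (norm v / r\<^sup>2)) * w4 x y + (- (norm v / r\<^sup>2)) * w5 x y) ?p ?p
    = \<gamma> * k0 * pint w1 ?p ?p + (- (Lz * norm v)) * pint w2 ?p ?p + (- (Lz * norm v)) * pint w3 ?p ?p
      + (- (norm v / r\<^sup>2)) * pint w4 ?p ?p + (- (norm v / r\<^sup>2)) * pint w5 ?p ?p"
    by (simp only: pint_add[OF _ _ p p] bounded_kernel_add bounded_kernel_mult bounded_kernel_const wk pint_cmult)
  finally show ?thesis
    unfolding e3 e1 e2 e4 e5 k0_def by (simp add: algebra_simps)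
qed

section \<open>Local estimates\<close>


text \<open>The equation is tested with the square of \<open>\<eta>\<close> times \<open>u\<close>,
  and half of the gradient term is absorbed by Young's inequality. A positive
  \<open>\<Lambda>\<close> turns this into a gain: the mass under the cutoff is smaller by a factor
  \<open>\<Lambda>\<close> than the mass where the cutoff varies.\<close>

lemma caccioppoli:
  assumes u: "h1 u G" and f: "L2loc f" and eta: "test_fun \<eta>"
    and weak: "\<And>\<phi>. test_fun \<phi> \<Longrightarrow> (\<integral>x. (\<Sum>b\<in>Basis. (G x \<bullet> b) * dd \<phi> b x) + f x * \<phi> x \<partial>lborel) = 0"
    and V: "\<And>x. f x = V x * u x" "\<And>x. \<eta> x \<noteq> 0 \<Longrightarrow> V x \<ge> \<Lambda>"
  shows "(\<Sum>b\<in>Basis. (1/2) * (\<integral>x. (\<eta> x)\<^sup>2 * (G x \<bullet> b)\<^sup>2 \<partial>lborel)) + \<Lambda> * (\<integral>x. (\<eta> x)\<^sup>2 * (u x)\<^sup>2 \<partial>lborel)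
     \<le> 2 * (\<Sum>b\<in>Basis. \<integral>x. (dd \<eta> b x)\<^sup>2 * (u x)\<^sup>2 \<partial>lborel)"
proof -
  let ?h = "\<lambda>x. \<eta> x * \<eta> x"
  have h: "test_fun ?h" using eta by (intro test_fun_mult) (simp_all add: test_fun_iff)
  have dh: "dd ?h b x = 2 * \<eta> x * dd \<eta> b x" for b x
    by (simp add: dd_mult test_fun_differentiable[OF eta])
  obtain B where B: "\<And>x. \<bar>\<eta> x\<bar> \<le> B" using test_fun_bounded[OF eta] by metis
  have "\<exists>B. \<forall>x. \<bar>dd \<eta> b x\<bar> \<le> B" for b using test_fun_bounded[OF test_fun_dd[OF eta]] by metis
  then obtain D where D: "\<And>b x. \<bar>dd \<eta> b x\<bar> \<le> D b" by metis
  note eb = test_fun_borel[OF eta] test_fun_borel[OF test_fun_dd[OF eta]]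
  have Lu: "L2 u" and LG: "L2 (\<lambda>x. G x \<bullet> b)" for b by (rule h1_L2[OF u])+
  have L1: "L2 (\<lambda>x. \<eta> x * (G x \<bullet> b))" "L2 (\<lambda>x. \<eta> x * u x)" "L2 (\<lambda>x. dd \<eta> b x * u x)" for b
    by (rule L2_bounded_mult[OF LG eb(1) B], rule L2_bounded_mult[OF Lu eb(1) B], rule L2_bounded_mult[OF Lu eb(2) D])
  have Lf: "L2 (\<lambda>x. \<eta> x * f x)" by (rule L2loc_test_mult[OF f eta])
  have sq: "(\<lambda>x. (\<eta> x * (G x \<bullet> b))\<^sup>2) = (\<lambda>x. (\<eta> x)\<^sup>2 * (G x \<bullet> b)\<^sup>2)"
    "(\<lambda>x. (\<eta> x * u x)\<^sup>2) = (\<lambda>x. (\<eta> x)\<^sup>2 * (u x)\<^sup>2)"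
    "(\<lambda>x. (dd \<eta> b x * u x)\<^sup>2) = (\<lambda>x. (dd \<eta> b x)\<^sup>2 * (u x)\<^sup>2)" for b
    by (simp_all add: power_mult_distrib)
  have i: "integrable lborel (\<lambda>x. (\<eta> x)\<^sup>2 * (G x \<bullet> b)\<^sup>2)" "integrable lborel (\<lambda>x. (\<eta> x)\<^sup>2 * (u x)\<^sup>2)"
    "integrable lborel (\<lambda>x. (dd \<eta> b x)\<^sup>2 * (u x)\<^sup>2)" for b
    using L1[THEN L2_integrable] unfolding sq by blast+
  have i2: "integrable lborel (\<lambda>x. (\<eta> x * (G x \<bullet> b)) * (dd \<eta> b x * u x))" for b
    by (rule L2_mult_integrable[OF L1(1) L1(3)])
  have i3: "integrable lborel (\<lambda>x. (\<eta> x * f x) * (\<eta> x * u x))" by (rule L2_mult_integrable[OF Lf L1(2)])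
  have "0 = (\<Sum>b\<in>Basis. (\<integral>x. dd ?h b x * ((G x \<bullet> b) * u x) \<partial>lborel) + (\<integral>x. ?h x * ((G x \<bullet> b) * (G x \<bullet> b)) \<partial>lborel))
     + (\<integral>x. ?h x * f x * u x \<partial>lborel)"
    using weak_test_h1[OF u u f h weak] by simp
  also have "\<dots> = (\<Sum>b\<in>Basis. (\<integral>x. 2 * ((\<eta> x * (G x \<bullet> b)) * (dd \<eta> b x * u x)) \<partial>lborel) + (\<integral>x. (\<eta> x)\<^sup>2 * (G x \<bullet> b)\<^sup>2 \<partial>lborel))
     + (\<integral>x. (\<eta> x * f x) * (\<eta> x * u x) \<partial>lborel)"
    unfolding dh by (simp add: power2_eq_square mult_ac)
  also have "\<dots> \<ge> (\<Sum>b\<in>Basis. - (1/2) * (\<integral>x. (\<eta> x)\<^sup>2 * (G x \<bullet> b)\<^sup>2 \<partial>lborel) - 2 * (\<integral>x. (dd \<eta> b x)\<^sup>2 * (u x)\<^sup>2 \<partial>lborel)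
      + (\<integral>x. (\<eta> x)\<^sup>2 * (G x \<bullet> b)\<^sup>2 \<partial>lborel)) + \<Lambda> * (\<integral>x. (\<eta> x)\<^sup>2 * (u x)\<^sup>2 \<partial>lborel)"
  proof (intro add_mono sum_mono order_refl)
    fix b :: 'a
    have "- (1/2) * (\<integral>x. (\<eta> x)\<^sup>2 * (G x \<bullet> b)\<^sup>2 \<partial>lborel) - 2 * (\<integral>x. (dd \<eta> b x)\<^sup>2 * (u x)\<^sup>2 \<partial>lborel)
      = (\<integral>x. - (1/2) * ((\<eta> x)\<^sup>2 * (G x \<bullet> b)\<^sup>2) - 2 * ((dd \<eta> b x)\<^sup>2 * (u x)\<^sup>2) \<partial>lborel)"
      using i by simp
    also have "\<dots> \<le> (\<integral>x. 2 * ((\<eta> x * (G x \<bullet> b)) * (dd \<eta> b x * u x)) \<partial>lborel)"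
    proof (rule Bochner_Integration.integral_mono)
      fix x
      \<comment> \<open>Expanding this square is Young's inequality with the constants 1/2 and
        2.\<close>
      have "0 \<le> (\<eta> x * (G x \<bullet> b) + 2 * (dd \<eta> b x * u x))\<^sup>2" by simp
      then show "- (1/2) * ((\<eta> x)\<^sup>2 * (G x \<bullet> b)\<^sup>2) - 2 * ((dd \<eta> b x)\<^sup>2 * (u x)\<^sup>2) \<le> 2 * ((\<eta> x * (G x \<bullet> b)) * (dd \<eta> b x * u x))"
        by (simp add: power2_sum power_mult_distrib)
    qed (use i i2 in auto)
    finally show "- (1/2) * (\<integral>x. (\<eta> x)\<^sup>2 * (G x \<bullet> b)\<^sup>2 \<partial>lborel) - 2 * (\<integral>x. (dd \<eta> b x)\<^sup>2 * (u x)\<^sup>2 \<partial>lborel)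
      \<le> (\<integral>x. 2 * ((\<eta> x * (G x \<bullet> b)) * (dd \<eta> b x * u x)) \<partial>lborel)" .
  next
    have "\<Lambda> * (\<integral>x. (\<eta> x)\<^sup>2 * (u x)\<^sup>2 \<partial>lborel) = (\<integral>x. \<Lambda> * ((\<eta> x)\<^sup>2 * (u x)\<^sup>2) \<partial>lborel)" by simp
    also have "\<dots> \<le> (\<integral>x. (\<eta> x * f x) * (\<eta> x * u x) \<partial>lborel)"
    proof (rule Bochner_Integration.integral_mono)
      fix x
      have "\<Lambda> * ((\<eta> x)\<^sup>2 * (u x)\<^sup>2) \<le> V x * ((\<eta> x)\<^sup>2 * (u x)\<^sup>2)"
        using V(2)[of x] by (cases "\<eta> x = 0") (auto intro!: mult_right_mono)
      then show "\<Lambda> * ((\<eta> x)\<^sup>2 * (u x)\<^sup>2) \<le> (\<eta> x * f x) * (\<eta> x * u x)"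
        by (simp add: V(1) power2_eq_square mult_ac)
    qed (use i i3 in auto)
    finally show "\<Lambda> * (\<integral>x. (\<eta> x)\<^sup>2 * (u x)\<^sup>2 \<partial>lborel) \<le> (\<integral>x. (\<eta> x * f x) * (\<eta> x * u x) \<partial>lborel)" .
  qed
  finally have "(\<Sum>b\<in>Basis. (1/2) * (\<integral>x. (\<eta> x)\<^sup>2 * (G x \<bullet> b)\<^sup>2 \<partial>lborel) - 2 * (\<integral>x. (dd \<eta> b x)\<^sup>2 * (u x)\<^sup>2 \<partial>lborel))
      + \<Lambda> * (\<integral>x. (\<eta> x)\<^sup>2 * (u x)\<^sup>2 \<partial>lborel) \<le> 0"
    by (simp add: algebra_simps)
  then show ?thesis by (simp add: sum_subtractf sum_distrib_left)
qed

lemma regularized_newton_measurable: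
  assumes "L2 u" "\<eta> > 0" shows "regularized_newton \<eta> u \<in> borel_measurable borel"
proof -
  have [measurable]: "u \<in> borel_measurable borel" "ker \<eta> \<in> borel_measurable borel"
    using assms by (auto intro: ker_borel)
  have "(\<lambda>x. \<integral>y. ker \<eta> (y - x) * (u y)\<^sup>2 \<partial>lborel) \<in> borel_measurable lborel" by measurable
  then show ?thesis by (simp add: regularized_newton_def[abs_def])
qed

lemma newt_measurable:
  assumes "L2 u" shows "newt u \<in> borel_measurable borel"
proof -
  have [measurable]: "u \<in> borel_measurable borel" using assms by auto
  have "(\<lambda>x. \<integral>y. (u y)\<^sup>2 / norm (x - y) \<partial>lborel) \<in> borel_measurable lborel" by measurable
  then show ?thesis by (simp add: newt_def[abs_def])
qed

lemma newt_nonneg: "newt u x \<ge> 0"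
  unfolding newt_def by (intro Bochner_Integration.integral_nonneg) auto

lemma regularized_newton_bounds:
  fixes u :: "real^3 \<Rightarrow> real"
  assumes u: "h1 u G" and eta: "\<eta> > 0"
  shows "0 \<le> regularized_newton \<eta> u x" "regularized_newton \<eta> u x \<le> newt u x"
proof -
  show "0 \<le> regularized_newton \<eta> u x"
    unfolding regularized_newton_def
    by (intro Bochner_Integration.integral_nonneg mult_nonneg_nonneg less_imp_le[OF ker_pos[OF eta]]) auto
  show "regularized_newton \<eta> u x \<le> newt u x"
    unfolding regularized_newton_def newt_def
  proof (rule integral_mono_AE)
    show "integrable lborel (\<lambda>y. ker \<eta> (y - x) * (u y)\<^sup>2)"
      by (rule integrable_ker_mult[OF eta L2_integrable[OF h1_L2(1)[OF u]]])
    show "integrable lborel (\<lambda>y. (u y)\<^sup>2 / norm (x - y))" by (rule hardy(1)[OF u])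
    show "AE y in lborel. ker \<eta> (y - x) * (u y)\<^sup>2 \<le> (u y)\<^sup>2 / norm (x - y)"
      using AE_lborel_singleton[of x]
    proof eventually_elim
      case (elim y)
      then have "ker \<eta> (y - x) * (u y)\<^sup>2 \<le> inverse (norm (y - x)) * (u y)\<^sup>2"
        by (intro mult_right_mono ker_le_norm) auto
      then show ?case by (simp add: divide_inverse mult.commute norm_minus_commute)
    qed
  qed
qed

text \<open>In \<open>local_pohozaev\<close> the part with \<open>V\<close> is integrated by parts
  against the square of \<open>u\<close>, and the Newton part is evaluated by
  \<open>newton_force\<close> and then freed of its regularisation. The bound \<open>K\<close> is
  therefore demanded along the whole regularising sequence.\<close>

lemma pohozaev_interaction:
  fixes u :: "real^3 \<Rightarrow> real"
  assumes u: "h1 u G" and z: "test_fun \<zeta>" and V: "C1c (\<lambda>x. \<zeta> x * V x)" and c: "c \<ge> 0"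
    and f: "L2loc f" "\<And>x. f x = V x * u x - c * newt u x * u x"
    and weak: "\<And>\<phi>. test_fun \<phi> \<Longrightarrow> (\<integral>x. (\<Sum>b\<in>Basis. (G x \<bullet> b) * dd \<phi> b x) + f x * \<phi> x \<partial>lborel) = 0"
    and K: "\<And>n. K \<le> interaction \<zeta> v (inverse (real (Suc n))) u"
  shows "(c / 4) * K \<le> (1/2) * (\<integral>x. dd (\<lambda>x. \<zeta> x * V x) v x * (u x)\<^sup>2 \<partial>lborel)
     - (c / 2) * (\<integral>x. dd \<zeta> v x * (newt u x * (u x)\<^sup>2) \<partial>lborel)
     + (\<Sum>b\<in>Basis. (1/2) * (\<integral>x. dd \<zeta> v x * ((G x \<bullet> b) * (G x \<bullet> b)) \<partial>lborel)
       - (\<integral>x. dd \<zeta> b x * ((G x \<bullet> b) * (G x \<bullet> v)) \<partial>lborel))"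
proof -
  let ?g = "\<lambda>x. u x * (G x \<bullet> v)"
  have Lu: "L2 u" and LG: "L2 (\<lambda>x. G x \<bullet> v)" by (rule h1_L2[OF u])+
  have g: "integrable lborel ?g" by (rule L2_mult_integrable[OF Lu LG])
  define M where "M = sqrt (mass u) * sqrt (mass (\<lambda>x. norm (G x)))"
  have N: "0 \<le> newt u x" "newt u x \<le> M" for x using newt_nonneg hardy(2)[OF u] by (auto simp: M_def)
  obtain B where B: "\<And>x. \<bar>\<zeta> x\<bar> \<le> B" "\<And>x. \<bar>dd \<zeta> v x\<bar> \<le> B" using C1c_bounded[OF test_fun_C1c[OF z]] by metis
  have B0: "B \<ge> 0" using order_trans[OF abs_ge_zero B(1)] .
  define e where "e n = inverse (real (Suc n))" for n
  have e: "e n > 0" for n by (simp add: e_def)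
  have [measurable]: "u \<in> borel_measurable borel" "(\<lambda>x. G x \<bullet> v) \<in> borel_measurable borel"
    "newt u \<in> borel_measurable borel" "regularized_newton (e n) u \<in> borel_measurable borel"
    "\<zeta> \<in> borel_measurable borel" "dd \<zeta> v \<in> borel_measurable borel" for n
    using Lu LG newt_measurable[OF Lu] regularized_newton_measurable[OF Lu e]
      test_fun_borel[OF z] test_fun_borel[OF test_fun_dd[OF z]] by auto
  have rn: "0 \<le> regularized_newton (e n) u x" "regularized_newton (e n) u x \<le> M" for n x
    using regularized_newton_bounds[OF u e] N order_trans by blast+
  have lim: "(\<lambda>n. regularized_newton (e n) u x) \<longlonglongrightarrow> newt u x" for x
    unfolding regularized_newton_def e_def by (rule hardy(3)[OF u])
  \<comment> \<open>The Hardy bound \<open>M\<close> dominates all regularised potentials at once,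
    so dominated convergence removes the regularisation.\<close>
  have lim_int: "(\<lambda>n. \<integral>x. z x * (regularized_newton (e n) u x * q x) \<partial>lborel) \<longlonglongrightarrow> (\<integral>x. z x * (newt u x * q x) \<partial>lborel)"
    and int_int: "integrable lborel (\<lambda>x. z x * (newt u x * q x))"
    if q: "integrable lborel q" and zb: "\<And>x. \<bar>z x\<bar> \<le> B" "z \<in> borel_measurable borel" for z q
  proof -
    have [measurable]: "q \<in> borel_measurable lborel" using q by auto
    note zb(2)[measurable]
    have bound: "\<bar>z x * (t * q x)\<bar> \<le> B * M * \<bar>q x\<bar>" if "0 \<le> t" "t \<le> M" for t x
    proof -
      have "\<bar>z x\<bar> * (\<bar>t\<bar> * \<bar>q x\<bar>) \<le> B * (M * \<bar>q x\<bar>)"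
        using that B0 by (intro mult_mono zb) auto
      then show ?thesis by (simp add: abs_mult mult.assoc)
    qed
    show "(\<lambda>n. \<integral>x. z x * (regularized_newton (e n) u x * q x) \<partial>lborel) \<longlonglongrightarrow> (\<integral>x. z x * (newt u x * q x) \<partial>lborel)"
    proof (rule integral_dominated_convergence[where w="\<lambda>x. B * M * \<bar>q x\<bar>"])
      show "AE x in lborel. (\<lambda>n. z x * (regularized_newton (e n) u x * q x)) \<longlonglongrightarrow> z x * (newt u x * q x)"
        by (intro AE_I2 tendsto_intros lim)
      show "AE x in lborel. norm (z x * (regularized_newton (e n) u x * q x)) \<le> B * M * \<bar>q x\<bar>" for n
        using bound[OF rn] by simp
    qed (use q in \<open>measurable, simp\<close>)
    show "integrable lborel (\<lambda>x. z x * (newt u x * q x))"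
    proof (rule Bochner_Integration.integrable_bound)
      show "integrable lborel (\<lambda>x. B * M * \<bar>q x\<bar>)" using q by simp
      show "AE x in lborel. norm (z x * (newt u x * q x)) \<le> norm (B * M * \<bar>q x\<bar>)"
        using order_trans[OF bound[OF N] abs_ge_self] by simp
    qed measurable
  qed
  have p: "integrable lborel (\<lambda>x. (u x)\<^sup>2)" by (rule L2_integrable[OF Lu])
  have force: "(\<integral>x. \<zeta> x * (newt u x * ?g x) \<partial>lborel)
     \<le> - (1/2) * (\<integral>x. dd \<zeta> v x * (newt u x * (u x)\<^sup>2) \<partial>lborel) - (1/4) * K"
  proof (rule LIMSEQ_le)
    show "(\<lambda>n. \<integral>x. \<zeta> x * (regularized_newton (e n) u x * ?g x) \<partial>lborel) \<longlonglongrightarrow> (\<integral>x. \<zeta> x * (newt u x * ?g x) \<partial>lborel)"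
      by (rule lim_int[OF g B(1)]) measurable
    show "(\<lambda>n. - (1/2) * (\<integral>x. dd \<zeta> v x * (regularized_newton (e n) u x * (u x)\<^sup>2) \<partial>lborel) - (1/4) * K)
       \<longlonglongrightarrow> - (1/2) * (\<integral>x. dd \<zeta> v x * (newt u x * (u x)\<^sup>2) \<partial>lborel) - (1/4) * K"
      by (intro tendsto_diff tendsto_mult tendsto_const lim_int[OF p B(2)]) measurable
    show "\<exists>N. \<forall>n\<ge>N. (\<integral>x. \<zeta> x * (regularized_newton (e n) u x * ?g x) \<partial>lborel)
       \<le> - (1/2) * (\<integral>x. dd \<zeta> v x * (regularized_newton (e n) u x * (u x)\<^sup>2) \<partial>lborel) - (1/4) * K"
      unfolding newton_force[OF u e z] using K by (simp add: e_def)
  qed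
  obtain BV where BV: "\<And>x. \<bar>\<zeta> x * V x\<bar> \<le> BV" using C1c_bounded[OF V] by metis
  have iV: "integrable lborel (\<lambda>x. (\<zeta> x * V x) * ?g x)"
    by (rule L2_bounded_product_integrable[OF Lu LG C1c_borel(1)[OF V] BV])
  have iN: "integrable lborel (\<lambda>x. \<zeta> x * (newt u x * ?g x))" by (rule int_int[OF g B(1)]) measurable
  have "(\<integral>x. \<zeta> x * f x * (G x \<bullet> v) \<partial>lborel) = (\<integral>x. (\<zeta> x * V x) * ?g x - c * (\<zeta> x * (newt u x * ?g x)) \<partial>lborel)"
    by (simp add: f(2) algebra_simps)
  also have "\<dots> = (\<integral>x. (\<zeta> x * V x) * ?g x \<partial>lborel) - c * (\<integral>x. \<zeta> x * (newt u x * ?g x) \<partial>lborel)"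
    using iV iN by simp
  finally have eq: "(\<integral>x. \<zeta> x * f x * (G x \<bullet> v) \<partial>lborel) =
      (\<integral>x. (\<zeta> x * V x) * ?g x \<partial>lborel) - c * (\<integral>x. \<zeta> x * (newt u x * ?g x) \<partial>lborel)" .
  have "c * (\<integral>x. \<zeta> x * (newt u x * ?g x) \<partial>lborel)
      \<le> - (c / 2) * (\<integral>x. dd \<zeta> v x * (newt u x * (u x)\<^sup>2) \<partial>lborel) - (c / 4) * K"
    using mult_left_mono[OF force c] by (simp add: right_diff_distrib)
  then show ?thesis
    using h1_square_ibp[OF u V, of v] eq local_pohozaev[OF u f(1) z weak, of v] by linarith
qed

lemma test_fun_lipschitz:
  assumes z: "test_fun \<zeta>"
  obtains L where "L > 0" "\<And>x y. \<bar>\<zeta> x - \<zeta> y\<bar> \<le> L * norm (x - y)"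
    "\<And>x b. b \<in> Basis \<Longrightarrow> \<bar>dd \<zeta> b x\<bar> \<le> L" "\<And>x. \<bar>dd \<zeta> v x\<bar> \<le> L"
proof -
  have "\<exists>B>0. \<forall>x. \<bar>dd \<zeta> b x\<bar> \<le> B" for b using test_fun_bounded[OF test_fun_dd[OF z]] by metis
  then obtain D where D: "\<And>b. D b > 0" "\<And>b x. \<bar>dd \<zeta> b x\<bar> \<le> D b" by metis
  define L where "L = (\<Sum>b\<in>Basis. D b) + D v"
  have sm: "D b \<le> (\<Sum>b\<in>Basis. D b)" if "b \<in> Basis" for b
    using that D(1) by (intro member_le_sum) (auto simp: less_imp_le)
  have "(\<Sum>b\<in>Basis. D b) \<ge> 0" using D(1) by (intro sum_nonneg) (auto simp: less_imp_le)
  then have L: "L > 0" "D v \<le> L" "(\<Sum>b\<in>Basis. D b) \<le> L" using D(1)[of v] by (auto simp: L_def)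
  have "\<bar>\<zeta> x - \<zeta> y\<bar> \<le> L * norm (x - y)" for x y
  proof -
    obtain t where "\<zeta> (y + 1 *\<^sub>R (x - y)) - \<zeta> y = 1 * dd \<zeta> (x - y) (y + t *\<^sub>R (x - y))"
      using dd_mvt[OF test_fun_differentiable[OF z] zero_less_one, of y "x - y"] by metis
    then have "\<bar>\<zeta> x - \<zeta> y\<bar> = \<bar>\<Sum>b\<in>Basis. ((x - y) \<bullet> b) * dd \<zeta> b (y + t *\<^sub>R (x - y))\<bar>"
      by (simp add: dd_basis_sum[OF test_fun_differentiable[OF z], of "x - y"])
    also have "\<dots> \<le> (\<Sum>b\<in>Basis. \<bar>((x - y) \<bullet> b) * dd \<zeta> b (y + t *\<^sub>R (x - y))\<bar>)" by (rule sum_abs)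
    also have "\<dots> \<le> (\<Sum>b\<in>Basis. norm (x - y) * D b)"
      unfolding abs_mult by (intro sum_mono mult_mono Basis_le_norm D) auto
    also have "\<dots> = (\<Sum>b\<in>Basis. D b) * norm (x - y)" by (simp add: sum_distrib_right mult.commute)
    also have "\<dots> \<le> L * norm (x - y)" using L by (intro mult_right_mono) auto
    finally show ?thesis .
  qed
  moreover have "\<bar>dd \<zeta> b x\<bar> \<le> L" if "b \<in> Basis" for b x using D(2)[of b x] sm[OF that] L by linarith
  moreover have "\<bar>dd \<zeta> v x\<bar> \<le> L" for x using D(2)[of v x] L by linarith
  ultimately show ?thesis using that L(1) by blast
qed

text \<open>\<open>V\<close> is known to be differentiable only near \<open>a\<close>. The ball of
  radius \<open>r'\<close> and the complement of the smaller closed ball are open and cover the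
  space, and on the latter the product vanishes.\<close>

lemma C1c_local_mult:
  fixes a :: "'a::euclidean_space"
  assumes z: "test_fun \<zeta>" "\<And>x. dist a x \<ge> r \<Longrightarrow> \<zeta> x = 0" and r: "r < r'"
    and V: "\<And>x. x \<in> ball a r' \<Longrightarrow> V differentiable (at x)" "\<And>v. continuous_on (ball a r') (dd V v)"
  shows "C1c (\<lambda>x. \<zeta> x * V x)"
    and "x \<in> ball a r' \<Longrightarrow> dd (\<lambda>x. \<zeta> x * V x) v x = \<zeta> x * dd V v x + dd \<zeta> v x * V x"
    and "x \<notin> ball a r' \<Longrightarrow> dd (\<lambda>x. \<zeta> x * V x) v x = 0"
proof -
  have out: "(\<lambda>x. \<zeta> x * V x) differentiable (at x)" "dd (\<lambda>x. \<zeta> x * V x) v x = 0" if "x \<in> - cball a r" for x v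
    using that z(2) by (intro dd_locally_zero[of "- cball a r"]; force)+
  have inn: "(\<lambda>x. \<zeta> x * V x) differentiable (at x)"
    "dd (\<lambda>x. \<zeta> x * V x) v x = \<zeta> x * dd V v x + dd \<zeta> v x * V x" if "x \<in> ball a r'" for x v
    using V(1)[OF that] test_fun_differentiable[OF z(1)] by (auto intro!: differentiable_mult dd_mult)
  have un: "UNIV = ball a r' \<union> (- cball a r)" using r by force
  have Vc: "continuous_on (ball a r') V"
    using V(1) by (meson continuous_at_imp_continuous_on differentiable_imp_continuous_within)
  have "continuous_on UNIV (dd (\<lambda>x. \<zeta> x * V x) v)" for v
    unfolding un
  proof (rule continuous_on_open_Un)
    have "continuous_on (ball a r') (\<lambda>x. \<zeta> x * dd V v x + dd \<zeta> v x * V x)"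
      using z(1) by (intro continuous_intros V Vc smooth_continuous smooth_dd) (auto simp: test_fun_iff)
    then show "continuous_on (ball a r') (dd (\<lambda>x. \<zeta> x * V x) v)"
      using inn(2) by (subst continuous_on_cong[OF refl]) auto
    show "continuous_on (- cball a r) (dd (\<lambda>x. \<zeta> x * V x) v)"
      using out(2) by (subst continuous_on_cong[OF refl, where g="\<lambda>x. 0"]) auto
  qed auto
  moreover have "(\<lambda>x. \<zeta> x * V x) differentiable (at x)" for x using un inn(1) out(1) by blast
  moreover have "bsupp (\<lambda>x. \<zeta> x * V x)" using z(1) by (intro bsupp_mult) (simp add: test_fun_iff)
  ultimately show "C1c (\<lambda>x. \<zeta> x * V x)" by (simp add: C1c_def)
  show "x \<in> ball a r' \<Longrightarrow> dd (\<lambda>x. \<zeta> x * V x) v x = \<zeta> x * dd V v x + dd \<zeta> v x * V x" by (rule inn)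
  show "x \<notin> ball a r' \<Longrightarrow> dd (\<lambda>x. \<zeta> x * V x) v x = 0" using un by (intro out) blast
qed

section \<open>Balance of forces\<close>


lemma integrable_indicator_times:
  fixes f :: "'a::euclidean_space \<Rightarrow> real"
  assumes "integrable lborel f" "A \<in> sets borel"
  shows "integrable lborel (\<lambda>x. indicator A x * f x)"
  using integrable_mult_indicator[of A lborel f] assms by simp

text \<open>Serves for the error terms: a weight bounded by \<open>L\<close> and supported in the
  annulus is integrated against a nonnegative density.\<close>

lemma abs_integral_localized_le:
  fixes w q :: "'a::euclidean_space \<Rightarrow> real"
  assumes q: "integrable lborel q" "\<And>x. q x \<ge> 0" and A: "A \<in> sets borel"
    and w: "w \<in> borel_measurable borel" "\<And>x. \<bar>w x\<bar> \<le> L * indicator A x"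
  shows "integrable lborel (\<lambda>x. w x * q x)" "\<bar>\<integral>x. w x * q x \<partial>lborel\<bar> \<le> L * (\<integral>x. indicator A x * q x \<partial>lborel)"
proof -
  have i: "integrable lborel (\<lambda>x. L * (indicator A x * q x))" using integrable_indicator_times[OF q(1) A] by simp
  have le: "\<bar>w x * q x\<bar> \<le> L * (indicator A x * q x)" for x
    using mult_right_mono[OF w(2) q(2)] q(2)[of x] by (simp add: abs_mult mult.assoc)
  have [measurable]: "q \<in> borel_measurable lborel" "w \<in> borel_measurable borel" using q w by auto
  show iw: "integrable lborel (\<lambda>x. w x * q x)"
  proof (rule Bochner_Integration.integrable_bound[OF i])
    show "AE x in lborel. norm (w x * q x) \<le> norm (L * (indicator A x * q x))"
      using order_trans[OF le abs_ge_self] by simp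
  qed measurable
  have "\<bar>\<integral>x. w x * q x \<partial>lborel\<bar> \<le> (\<integral>x. L * (indicator A x * q x) \<partial>lborel)"
    by (rule integral_abs_bound_integral[OF iw i le])
  then show "\<bar>\<integral>x. w x * q x \<partial>lborel\<bar> \<le> L * (\<integral>x. indicator A x * q x \<partial>lborel)" by simp
qed

lemma dd_locally_const:
  fixes f :: "'a::euclidean_space \<Rightarrow> real"
  assumes "f differentiable (at x)" "open W" "x \<in> W" "\<And>y. y \<in> W \<Longrightarrow> f y = c"
  shows "dd f v x = 0"
proof -
  have "dd (\<lambda>y. f y - c) v x = 0" by (rule dd_locally_zero[OF assms(2,3)]) (simp add: assms(4))
  then show ?thesis using assms(1) by (simp add: dd_diff)
qed

text \<open>To be applied with \<open>c = a / (8 * pi)\<close> and \<open>lam = - \<mu>\<close>; the integral on the right-hand side is the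
  mass away from all centres. The constants do not depend on the solution.\<close>

lemma force_balance:
  fixes P :: "real^3 \<Rightarrow> real" and b :: "nat \<Rightarrow> real^3" and v :: "real^3"
  assumes im: "i < m" "l < m" "l \<noteq> i" and r: "r > 0"
    and sep': "\<forall>j<m. j \<noteq> i \<longrightarrow> dist (b i) (b j) \<ge> 6 * r"
    and pos': "\<forall>j<m. j \<noteq> i \<longrightarrow> (\<forall>x\<in>ball (b i) r. \<forall>y\<in>ball (b j) r. (y - x) \<bullet> v \<ge> \<gamma>)"
    and gam: "\<gamma> > 0" and CN: "CN \<ge> 0"
    and Pc: "continuous_on UNIV P" and Pd': "\<forall>x\<in>ball (b i) (3 * r). P differentiable (at x)"
    and Pdc': "\<forall>w. continuous_on (ball (b i) (3 * r)) (dd P w)"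
  shows "\<exists>\<kappa>>0. \<exists>C>0. \<forall>u G lam c. h1 u G \<and> mass u = 1 \<and> lam \<ge> C \<and> c > 0 \<and>
      (\<forall>\<phi>. test_fun \<phi> \<longrightarrow> (\<integral>x. (\<Sum>b\<in>Basis. (G x \<bullet> b) * dd \<phi> b x) +
          ((P x + lam) * u x - c * newt u x * u x) * \<phi> x \<partial>lborel) = 0) \<and>
      (\<forall>x. c * newt u x \<le> CN * lam) \<and>
      (\<forall>x. r / 2 \<le> dist (b i) x \<and> dist (b i) x \<le> 4 * r \<longrightarrow> c * newt u x \<le> lam / 4) \<longrightarrow>
      \<kappa> * c * ((\<integral>x. indicator (ball (b i) r) x * (u x)\<^sup>2 \<partial>lborel) * (\<integral>x. indicator (ball (b l) r) x * (u x)\<^sup>2 \<partial>lborel))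
       \<le> C + C * c * (\<integral>x. indicator {x. \<forall>j<m. dist (b j) x \<ge> r / 2} x * (u x)\<^sup>2 \<partial>lborel)"
proof -
  have sep: "dist (b i) (b j) \<ge> 6 * r" if "j < m" "j \<noteq> i" for j using sep' that by blast
  have pos: "(y - x) \<bullet> v \<ge> \<gamma>" if "j < m" "j \<noteq> i" "dist (b i) x < r" "dist (b j) y < r" for j x y
    using pos' that by simp
  have Pd: "P differentiable (at x)" if "x \<in> ball (b i) (3 * r)" for x using Pd' that by blast
  have Pdc: "continuous_on (ball (b i) (3 * r)) (dd P w)" for w using Pdc' by blast
  obtain \<zeta> where z: "test_fun \<zeta>" "\<And>x. 0 \<le> \<zeta> x" "\<And>x. \<zeta> x \<le> 1"
    and z1: "\<And>x. dist (b i) x \<le> r \<Longrightarrow> \<zeta> x = 1" and z0: "\<And>x. dist (b i) x \<ge> 2 * r \<Longrightarrow> \<zeta> x = 0"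
    using cutoff_exists[OF r, of "b i"] by metis
  obtain \<zeta>o where zo: "test_fun \<zeta>o" "\<And>x. dist (b i) x \<le> 2 * r \<Longrightarrow> \<zeta>o x = 1" "\<And>x. dist (b i) x \<ge> 2 * (2 * r) \<Longrightarrow> \<zeta>o x = 0"
    using cutoff_exists[of "2 * r" "b i"] r by (metis mult_pos_pos zero_less_numeral)
  obtain \<zeta>i where zi: "test_fun \<zeta>i" "\<And>x. dist (b i) x \<le> r / 2 \<Longrightarrow> \<zeta>i x = 1" "\<And>x. dist (b i) x \<ge> 2 * (r / 2) \<Longrightarrow> \<zeta>i x = 0"
    using cutoff_exists[of "r / 2" "b i"] half_gt_zero[OF r] by metis
  \<comment> \<open>Equal to 1 on the annulus \<open>A\<close> where \<open>\<zeta>\<close> varies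
    and supported in the wider annulus \<open>A'\<close>; this is the cutoff of the Caccioppoli
    estimate.\<close>
  define \<eta> where "\<eta> x = \<zeta>o x + (- 1) * \<zeta>i x" for x
  have eta: "test_fun \<eta>" unfolding \<eta>_def[abs_def] by (intro test_fun_add test_fun_cmult zo zi)
  obtain L where L: "L > 0" "\<And>x y. \<bar>\<zeta> x - \<zeta> y\<bar> \<le> L * norm (x - y)"
    "\<And>x b. b \<in> Basis \<Longrightarrow> \<bar>dd \<zeta> b x\<bar> \<le> L" "\<And>x. \<bar>dd \<zeta> v x\<bar> \<le> L"
    using test_fun_lipschitz[OF z(1), of v] by metis
  obtain M where M: "M > 0" "\<And>x b. b \<in> Basis \<Longrightarrow> \<bar>dd \<eta> b x\<bar> \<le> M"
    using test_fun_lipschitz[OF eta, of 0] by metis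
  define A where "A = {x. r \<le> dist (b i) x \<and> dist (b i) x \<le> 2 * r}"
  define A' where "A' = {x. r / 2 \<le> dist (b i) x \<and> dist (b i) x \<le> 4 * r}"
  define R where "R = {x. \<forall>j<m. dist (b j) x \<ge> r}"
  define R' where "R' = {x. \<forall>j<m. dist (b j) x \<ge> r / 2}"
  have sets: "A \<in> sets borel" "A' \<in> sets borel" "R \<in> sets borel" "R' \<in> sets borel"
  proof -
    have "closed A" "closed A'" unfolding A_def A'_def
      by (intro closed_Collect_conj closed_Collect_le continuous_intros)+
    moreover have "R = (\<Inter>j\<in>{..<m}. {x. r \<le> dist (b j) x})" "R' = (\<Inter>j\<in>{..<m}. {x. r / 2 \<le> dist (b j) x})"
      using im(1) by (auto simp: R_def R'_def)
    then have "closed R" "closed R'"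
      by (simp_all, (intro closed_INT ballI closed_Collect_le continuous_intros)+)
    ultimately show "A \<in> sets borel" "A' \<in> sets borel" "R \<in> sets borel" "R' \<in> sets borel" by auto
  qed
  \<comment> \<open>Other centres are at distance at least \<open>6 * r\<close> from
    \<open>b i\<close>, hence at least \<open>2 * r\<close> from the points of
    \<open>A'\<close>.\<close>
  have A'R: "A' \<subseteq> R'"
  proof
    fix x assume x: "x \<in> A'"
    have "r / 2 \<le> dist (b j) x" if j: "j < m" for j
    proof (cases "j = i")
      case False
      then show ?thesis using sep[OF j False] x r dist_triangle[of "b i" "b j" x] by (simp add: A'_def dist_commute)
    qed (use x in \<open>simp add: A'_def\<close>)
    then show "x \<in> R'" by (simp add: R'_def)
  qed
  have RR: "R \<subseteq> R'" using r by (auto simp: R_def R'_def intro: order_trans[rotated])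
  have eta1: "\<eta> x = 1" if "x \<in> A" for x using that zo(2) zi(3) by (simp add: \<eta>_def A_def)
  have etaA': "x \<in> A'" if "\<eta> x \<noteq> 0" for x
  proof (rule ccontr)
    assume "x \<notin> A'"
    then have "dist (b i) x < r / 2 \<or> dist (b i) x > 4 * r" by (auto simp: A'_def)
    then have "\<eta> x = 0" using zo(2,3)[of x] zi(2,3)[of x] r by (auto simp: \<eta>_def)
    then show False using that by simp
  qed
  have annulus: "open {x. dist (b i) x < s \<or> dist (b i) x > t}" for s t :: real
    by (intro open_Collect_disj open_Collect_less continuous_intros)
  have deta: "\<bar>dd \<eta> e x\<bar> \<le> M * indicator A' x" if "e \<in> Basis" for e x
  proof (cases "x \<in> A'")
    case True then show ?thesis using M(2)[OF that] by simp
  next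
    case False
    then have x: "x \<in> {x. dist (b i) x < r / 2 \<or> dist (b i) x > 4 * r}" by (auto simp: A'_def)
    have "dd \<eta> e x = 0" using etaA' by (intro dd_locally_zero(2)[OF annulus x]) (force simp: A'_def)
    then show ?thesis using False by simp
  qed
  have dz0: "dd \<zeta> e x = 0" if "x \<notin> A" for e x
  proof -
    have "dist (b i) x < r \<or> dist (b i) x > 2 * r" using that by (auto simp: A_def)
    then show ?thesis
    proof
      assume "dist (b i) x < r"
      then show ?thesis
        using z1 by (intro dd_locally_const[OF test_fun_differentiable[OF z(1)], of "ball (b i) r" x 1]) auto
    next
      assume x: "dist (b i) x > 2 * r"
      show ?thesis
        using z0 x by (intro dd_locally_zero(2)[of "- cball (b i) (2 * r)"]) auto
    qed
  qed
  have dz: "\<bar>dd \<zeta> e x\<bar> \<le> L * indicator A x" if "e \<in> Basis \<or> e = v" for e x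
    using L(3,4) dz0[of x e] that by (cases "x \<in> A") auto
  have "compact (P ` cball (b i) (4 * r))"
    using Pc by (intro compact_continuous_image) (auto intro: continuous_on_subset)
  then obtain p1 where p1: "\<And>x. x \<in> cball (b i) (4 * r) \<Longrightarrow> \<bar>P x\<bar> \<le> p1"
    using compact_imp_bounded bounded_iff by (metis imageI real_norm_def)
  have "cball (b i) (2 * r) \<subseteq> ball (b i) (3 * r)" using r by auto
  then have "compact (dd P v ` cball (b i) (2 * r))"
    using Pdc by (intro compact_continuous_image) (auto intro: continuous_on_subset)
  then obtain p2 where p2: "\<And>x. x \<in> cball (b i) (2 * r) \<Longrightarrow> \<bar>dd P v x\<bar> \<le> p2"
    using compact_imp_bounded bounded_iff by (metis imageI real_norm_def)
  have p0: "p1 \<ge> 0" "p2 \<ge> 0" using order_trans[OF abs_ge_zero p1[of "b i"]] order_trans[OF abs_ge_zero p2[of "b i"]] r by auto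
  define D where "D = dist (b i) (b l) + 2 * r"
  have D: "D \<ge> 0" using r by (simp add: D_def)
  have bd: "norm (x - y) \<le> D" if "dist (b i) x < r" "dist (b l) y < r" for x y
    using that dist_triangle[of x y "b i"] dist_triangle[of "b i" y "b l"] by (simp add: D_def dist_norm norm_minus_commute)
  define k0 where "k0 = inverse (sqrt (D\<^sup>2 + 1)) ^ 3"
  have k0: "k0 > 0" unfolding k0_def by (intro zero_less_power) (simp add: add_nonneg_pos)
  \<comment> \<open>The Caccioppoli factor 2, doubled to clear the halves on its left side, times
    three coordinate directions, times the square of the gradient bound \<open>M\<close>.\<close>
  define E0 where "E0 = 12 * M\<^sup>2"
  have E0: "E0 \<ge> 0" by (simp add: E0_def)
  \<comment> \<open>In units of \<open>E0\<close>, the four summands collect the annulus terms of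
    the interaction, of the cutoff derivative against \<open>P x + lam\<close>, of the cutoff
    derivative against the Newton potential, and of the gradient.\<close>
  define Q where "Q = L * norm v * CN / 2 + L + L * CN / 2 + L * (1 + 3 * (norm v)\<^sup>2 / 2)"
  have Q: "Q \<ge> 0" using L(1) CN by (simp add: Q_def)
  \<comment> \<open>The summand \<open>4 * p1\<close> makes \<open>lam\<close> dominate
    \<open>P\<close> near the annulus, \<open>norm v / (2 * r\<^sup>2)\<close> bounds the
    coefficient of the mass away from the centres, and the rest bounds the terms free of
    \<open>c\<close>.\<close>
  define C where "C = 1 + 4 * p1 + p2 + norm v / (2 * r\<^sup>2) + Q * E0"
  have Cge: "C \<ge> 4 * p1" "C \<ge> 1" "C \<ge> p2 / 2 + Q * E0" "C \<ge> norm v / (2 * r\<^sup>2)"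
    using p0 Q E0 by (auto simp: C_def add_nonneg_nonneg intro!: add_nonneg_nonneg add_increasing add_increasing2)
  have main: "(\<gamma> * k0 / 4) * c * ((\<integral>x. indicator (ball (b i) r) x * (u x)\<^sup>2 \<partial>lborel) * (\<integral>x. indicator (ball (b l) r) x * (u x)\<^sup>2 \<partial>lborel))
       \<le> C + C * c * (\<integral>x. indicator R' x * (u x)\<^sup>2 \<partial>lborel)"
    if u: "h1 u G" and m1: "mass u = 1" and lam: "lam \<ge> C" and c: "c > 0"
      and weak: "\<And>\<phi>. test_fun \<phi> \<Longrightarrow> (\<integral>x. (\<Sum>b\<in>Basis. (G x \<bullet> b) * dd \<phi> b x) +
          ((P x + lam) * u x - c * newt u x * u x) * \<phi> x \<partial>lborel) = 0"
      and N1: "\<And>x. c * newt u x \<le> CN * lam"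
      and N2: "\<And>x. r / 2 \<le> dist (b i) x \<Longrightarrow> dist (b i) x \<le> 4 * r \<Longrightarrow> c * newt u x \<le> lam / 4"
    for u G lam c
  proof -
    let ?p = "\<lambda>x. (u x)\<^sup>2"
    define f where "f x = (P x + lam) * u x - c * newt u x * u x" for x
    define V where "V x = P x + lam - c * newt u x" for x
    have fV: "f x = V x * u x" for x by (simp add: f_def V_def algebra_simps)
    have Lu: "L2 u" and LG: "L2 (\<lambda>x. G x \<bullet> e)" for e by (rule h1_L2[OF u])+
    have p: "integrable lborel ?p" by (rule L2_integrable[OF Lu])
    have lam1: "lam \<ge> 1" "lam \<ge> 4 * p1" using lam Cge by auto
    have newt0: "newt u x \<ge> 0" for x by (rule newt_nonneg)
    have [measurable]: "u \<in> borel_measurable borel" "P \<in> borel_measurable borel" "newt u \<in> borel_measurable borel"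
      using Lu continuous_borel[OF Pc] newt_measurable[OF Lu] by auto
    have weak': "\<And>\<phi>. test_fun \<phi> \<Longrightarrow> (\<integral>x. (\<Sum>b\<in>Basis. (G x \<bullet> b) * dd \<phi> b x) + f x * \<phi> x \<partial>lborel) = 0"
      using weak by (simp only: f_def)
    \<comment> \<open>On a ball \<open>P\<close> is bounded by continuity and the potential by
      \<open>N1\<close>, so there \<open>f\<close> is a bounded multiple of
      \<open>u\<close>.\<close>
    have Lf: "L2loc f"
      unfolding L2loc_def
    proof (intro conjI allI)
      show "f \<in> borel_measurable borel" unfolding f_def[abs_def] by measurable
      fix S :: real
      have "compact (P ` cball 0 S)"
        using Pc by (intro compact_continuous_image) (auto intro: continuous_on_subset)
      then obtain q where q: "\<And>x. x \<in> cball 0 S \<Longrightarrow> \<bar>P x\<bar> \<le> q"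
        using compact_imp_bounded bounded_iff by (metis imageI real_norm_def)
      have "L2 (\<lambda>x. (indicator (cball 0 S) x * V x) * u x)"
      proof (rule L2_bounded_mult[OF Lu])
        show "(\<lambda>x. indicator (cball 0 S) x * V x) \<in> borel_measurable borel"
          unfolding V_def by (intro borel_measurable_times borel_measurable_indicator borel_measurable_diff
              borel_measurable_add) (simp, measurable)
        show "\<bar>indicator (cball 0 S) x * V x\<bar> \<le> \<bar>q\<bar> + lam + CN * lam" for x
        proof (cases "x \<in> cball 0 S")
          case True
          have "0 \<le> c * newt u x" using c newt0[of x] by simp
          then show ?thesis using True q[OF True] N1[of x] lam1 by (simp add: V_def)
        qed (use lam1 CN in simp)
      qed
      then show "L2 (\<lambda>x. indicator (cball 0 S) x * f x)" by (simp add: fV mult.assoc)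
    qed
    define e where "e = (\<integral>x. indicator R' x * ?p x \<partial>lborel)"
    define IA where "IA = (\<integral>x. indicator A x * ?p x \<partial>lborel)"
    define T where "T = (\<Sum>b\<in>Basis. \<integral>x. indicator A x * (G x \<bullet> b)\<^sup>2 \<partial>lborel)"
    have e1: "e \<le> 1" unfolding e_def m1[symmetric]
      by (intro Bochner_Integration.integral_mono integrable_indicator_times p sets) (simp add: indicator_def)
    have e0: "e \<ge> 0" unfolding e_def by (intro Bochner_Integration.integral_nonneg) simp
    have IA0: "IA \<ge> 0" unfolding IA_def by (intro Bochner_Integration.integral_nonneg) simp
    have iG: "integrable lborel (\<lambda>x. (G x \<bullet> b)\<^sup>2)" for b by (rule L2_integrable[OF LG])
    obtain eB where eB: "\<And>x. \<bar>\<eta> x\<bar> \<le> eB" using test_fun_bounded[OF eta] by metis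
    have sq_int: "integrable lborel (\<lambda>x. (\<eta> x)\<^sup>2 * (g x)\<^sup>2)" if "L2 g" for g
      using L2_integrable[OF L2_bounded_mult[OF that test_fun_borel[OF eta] eB]] by (simp add: power_mult_distrib)
    have ind_le: "(\<integral>x. indicator A x * (g x)\<^sup>2 \<partial>lborel) \<le> (\<integral>x. (\<eta> x)\<^sup>2 * (g x)\<^sup>2 \<partial>lborel)" if g: "L2 g" for g
    proof (rule Bochner_Integration.integral_mono[OF integrable_indicator_times[OF L2_integrable[OF g] sets(1)] sq_int[OF g]])
      show "indicator A x * (g x)\<^sup>2 \<le> (\<eta> x)\<^sup>2 * (g x)\<^sup>2" for x
        using eta1[of x] by (cases "x \<in> A") auto
    qed
    \<comment> \<open>On \<open>A'\<close> both \<open>\<bar>P x\<bar>\<close> and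
      \<open>c * newt u x\<close> are at most \<open>lam / 4\<close>, so the effective potential
      \<open>V\<close> is at least \<open>lam / 2\<close>.\<close>
    have cac: "(\<Sum>b\<in>Basis. (1/2) * (\<integral>x. (\<eta> x)\<^sup>2 * (G x \<bullet> b)\<^sup>2 \<partial>lborel)) + (lam / 2) * (\<integral>x. (\<eta> x)\<^sup>2 * (u x)\<^sup>2 \<partial>lborel)
      \<le> 2 * (\<Sum>b\<in>Basis. \<integral>x. (dd \<eta> b x)\<^sup>2 * (u x)\<^sup>2 \<partial>lborel)"
    proof (rule caccioppoli[OF u Lf eta weak' fV])
      fix x assume "\<eta> x \<noteq> 0"
      then have x: "x \<in> A'" by (rule etaA')
      then have "\<bar>P x\<bar> \<le> p1" by (intro p1) (simp add: A'_def)
      moreover have "c * newt u x \<le> lam / 4" using x by (intro N2) (simp_all add: A'_def)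
      ultimately show "lam / 2 \<le> V x" using lam1 by (simp add: V_def abs_le_iff)
    qed
    have grad: "(\<Sum>b\<in>Basis. \<integral>x. (dd \<eta> b x)\<^sup>2 * (u x)\<^sup>2 \<partial>lborel) \<le> 3 * (M\<^sup>2 * e)"
    proof -
      have "(\<Sum>b\<in>Basis. \<integral>x. (dd \<eta> b x)\<^sup>2 * (u x)\<^sup>2 \<partial>lborel) \<le> (\<Sum>b\<in>(Basis :: (real^3) set). M\<^sup>2 * e)"
      proof (rule sum_mono)
        fix e' :: "real^3" assume B: "e' \<in> Basis"
        have le: "\<bar>(dd \<eta> e' x)\<^sup>2\<bar> \<le> M\<^sup>2 * indicator R' x" for x
        proof -
          have "\<bar>dd \<eta> e' x\<bar> \<le> M * indicator R' x"
          proof (cases "x \<in> A'")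
            case True
            then have "x \<in> R'" using A'R by blast
            then show ?thesis using deta[OF B, of x] True by simp
          next
            case False
            then show ?thesis using deta[OF B, of x] M(1) by simp
          qed
          then have "\<bar>dd \<eta> e' x\<bar>\<^sup>2 \<le> (M * indicator R' x)\<^sup>2" by (rule power_mono) simp
          then show ?thesis by (cases "x \<in> R'") (simp_all add: power_mult_distrib)
        qed
        have "\<bar>\<integral>x. (dd \<eta> e' x)\<^sup>2 * (u x)\<^sup>2 \<partial>lborel\<bar> \<le> M\<^sup>2 * (\<integral>x. indicator R' x * ?p x \<partial>lborel)"
          by (rule abs_integral_localized_le(2)[OF p _ sets(4) _ le])
            (simp, rule borel_measurable_power[OF test_fun_borel[OF test_fun_dd[OF eta]]])
        then show "(\<integral>x. (dd \<eta> e' x)\<^sup>2 * (u x)\<^sup>2 \<partial>lborel) \<le> M\<^sup>2 * e" by (simp add: e_def)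
      qed
      then show ?thesis by simp
    qed
    \<comment> \<open>The decisive gain: \<open>lam\<close> times the mass of the annulus is
      bounded, which compensates the factors \<open>lam\<close> and \<open>c * newt u\<close> in all
      error terms.\<close>
    have TI: "T \<le> E0 * e" "lam * IA \<le> E0 * e"
    proof -
      have a: "T \<le> (\<Sum>b\<in>Basis. \<integral>x. (\<eta> x)\<^sup>2 * (G x \<bullet> b)\<^sup>2 \<partial>lborel)"
        unfolding T_def by (intro sum_mono ind_le LG)
      have "0 \<le> (\<Sum>b\<in>Basis. \<integral>x. (\<eta> x)\<^sup>2 * (G x \<bullet> b)\<^sup>2 \<partial>lborel)" by (intro sum_nonneg) simp
      moreover have b: "lam * IA \<le> lam * (\<integral>x. (\<eta> x)\<^sup>2 * (u x)\<^sup>2 \<partial>lborel)"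
        unfolding IA_def using lam1 by (intro mult_left_mono ind_le Lu) auto
      moreover have "0 \<le> lam * IA" using lam1 IA0 by simp
      moreover have "(\<Sum>b\<in>Basis. (1/2) * (\<integral>x. (\<eta> x)\<^sup>2 * (G x \<bullet> b)\<^sup>2 \<partial>lborel)) =
         (1/2) * (\<Sum>b\<in>Basis. \<integral>x. (\<eta> x)\<^sup>2 * (G x \<bullet> b)\<^sup>2 \<partial>lborel)" by (simp add: sum_distrib_left)
      ultimately show "T \<le> E0 * e" "lam * IA \<le> E0 * e" using a cac grad by (auto simp: E0_def)
    qed
    have E0e: "E0 * e \<le> E0" using E0 e0 e1 by (simp add: mult_left_le)
    let ?mi = "\<integral>x. indicator (ball (b i) r) x * (u x)\<^sup>2 \<partial>lborel" and ?ml = "\<integral>x. indicator (ball (b l) r) x * (u x)\<^sup>2 \<partial>lborel"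
    \<comment> \<open>The middle term carries \<open>1 / c\<close> because the regularised potential
      is at most \<open>CN * lam / c\<close>, while \<open>lam * IA\<close> is at most
      \<open>E0\<close>.\<close>
    define K where "K = \<gamma> * k0 * (?mi * ?ml) - 2 * L * norm v * (CN * E0 / c) - 2 * norm v / r\<^sup>2 * e"
    have K: "K \<le> interaction \<zeta> v (inverse (real (Suc n))) u" for n
    proof -
      define h where "h = inverse (real (Suc n))"
      have h: "0 < h" "h \<le> 1" by (auto simp: h_def field_simps)
      have "interaction \<zeta> v h u \<ge> \<gamma> * inverse (sqrt (D\<^sup>2 + 1)) ^ 3 * (?mi * ?ml)
       - 2 * L * norm v * (\<integral>x. indicator {x. r \<le> dist (b i) x \<and> dist (b i) x \<le> 2 * r} x * (regularized_newton h u x * (u x)\<^sup>2) \<partial>lborel)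
       - 2 * norm v / r\<^sup>2 * (\<integral>x. indicator {x. \<forall>j<m. dist (b j) x \<ge> r} x * (u x)\<^sup>2 \<partial>lborel)"
      proof (rule interaction_lower_bound[OF Lu h z(1) r z1 z0 L(2) less_imp_le[OF L(1)] im m1 _ pos gam bd D])
        show "3 * r \<le> dist (b i) (b j)" if "j < m" "j \<noteq> i" for j using sep[OF that] r by simp
      qed auto
      moreover have "(\<integral>x. indicator A x * (regularized_newton h u x * (u x)\<^sup>2) \<partial>lborel) \<le> CN * E0 / c"
      proof -
        have [measurable]: "regularized_newton h u \<in> borel_measurable borel" by (rule regularized_newton_measurable[OF Lu h(1)])
        have le: "\<bar>indicator A x * regularized_newton h u x\<bar> \<le> (CN * lam / c) * indicator A x" for x
        proof -
          have "regularized_newton h u x \<le> CN * lam / c"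
            using regularized_newton_bounds(2)[OF u h(1), of x] N1[of x] c by (simp add: field_simps) (smt (verit) mult_left_mono)
          then show ?thesis using regularized_newton_bounds(1)[OF u h(1), of x] by (simp add: indicator_def)
        qed
        have m: "(\<lambda>x. indicator A x * regularized_newton h u x) \<in> borel_measurable borel" using sets(1) by measurable
        have "\<bar>\<integral>x. (indicator A x * regularized_newton h u x) * (u x)\<^sup>2 \<partial>lborel\<bar> \<le> (CN * lam / c) * IA"
          unfolding IA_def by (rule abs_integral_localized_le(2)[OF p _ sets(1) m le]) simp
        also have "\<dots> = (CN / c) * (lam * IA)" by simp
        also have "\<dots> \<le> (CN / c) * E0" using CN c TI(2) E0e by (intro mult_left_mono) auto
        finally show ?thesis by (simp add: mult.assoc)
      qed
      then have "2 * L * norm v * (\<integral>x. indicator A x * (regularized_newton h u x * (u x)\<^sup>2) \<partial>lborel) \<le> 2 * L * norm v * (CN * E0 / c)"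
        using L(1) by (intro mult_left_mono) auto
      moreover have "(\<integral>x. indicator R x * (u x)\<^sup>2 \<partial>lborel) \<le> e"
        unfolding e_def using RR
        by (intro Bochner_Integration.integral_mono integrable_indicator_times p sets) (auto simp: indicator_def)
      then have "2 * norm v / r\<^sup>2 * (\<integral>x. indicator R x * (u x)\<^sup>2 \<partial>lborel) \<le> 2 * norm v / r\<^sup>2 * e"
        by (intro mult_left_mono) auto
      ultimately show ?thesis unfolding K_def h_def[symmetric] k0_def A_def R_def by linarith
    qed
    have Vd: "(\<lambda>x. P x + lam) differentiable (at x)" "dd (\<lambda>x. P x + lam) w x = dd P w x" if "x \<in> ball (b i) (3 * r)" for x w
      using Pd[OF that] by (auto simp: dd_add)
    have Vdc: "continuous_on (ball (b i) (3 * r)) (dd (\<lambda>x. P x + lam) w)" for w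
      using Pdc[of w] Vd(2) by (subst continuous_on_cong[OF refl, where g="dd P w"]) auto
    have r23: "2 * r < 3 * r" using r by simp
    have CV1: "C1c (\<lambda>x. \<zeta> x * (P x + lam))"
      by (rule C1c_local_mult(1)[OF z(1) _ r23]) (fact z0, fact Vd(1), fact Vdc)
    have CV2: "dd (\<lambda>x. \<zeta> x * (P x + lam)) w x = \<zeta> x * dd (\<lambda>x. P x + lam) w x + dd \<zeta> w x * (P x + lam)"
      if "x \<in> ball (b i) (3 * r)" for x w
      by (rule C1c_local_mult(2)[OF z(1) _ r23 _ _ that]) (fact z0, fact Vd(1), fact Vdc)
    have CV3: "dd (\<lambda>x. \<zeta> x * (P x + lam)) w x = 0" if "x \<notin> ball (b i) (3 * r)" for x w
      by (rule C1c_local_mult(3)[OF z(1) _ r23 _ _ that]) (fact z0, fact Vd(1), fact Vdc)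
    have poh: "(c / 4) * K \<le> (1/2) * (\<integral>x. dd (\<lambda>x. \<zeta> x * (P x + lam)) v x * (u x)\<^sup>2 \<partial>lborel)
     - (c / 2) * (\<integral>x. dd \<zeta> v x * (newt u x * (u x)\<^sup>2) \<partial>lborel)
     + (\<Sum>b\<in>Basis. (1/2) * (\<integral>x. dd \<zeta> v x * ((G x \<bullet> b) * (G x \<bullet> b)) \<partial>lborel)
       - (\<integral>x. dd \<zeta> b x * ((G x \<bullet> b) * (G x \<bullet> v)) \<partial>lborel))"
      by (rule pohozaev_interaction[OF u z(1) CV1 less_imp_le[OF c] Lf f_def weak' K])
    \<comment> \<open>Only the derivative of the cutoff meets \<open>lam\<close>, and only on
      \<open>A\<close>, where \<open>\<bar>P x + lam\<bar> \<le> 2 * lam\<close>. The derivative of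
      \<open>P\<close> contributes at most \<open>p2\<close> times the total mass 1.\<close>
    have t1: "(\<integral>x. dd (\<lambda>x. \<zeta> x * (P x + lam)) v x * (u x)\<^sup>2 \<partial>lborel) \<le> p2 + 2 * L * E0"
    proof -
      have le: "dd (\<lambda>x. \<zeta> x * (P x + lam)) v x \<le> p2 + (2 * L * lam) * indicator A x" for x
      proof (cases "x \<in> ball (b i) (3 * r)")
        case True
        have "\<zeta> x * dd P v x \<le> p2"
        proof (cases "dist (b i) x \<le> 2 * r")
          case True
          then have "\<bar>\<zeta> x * dd P v x\<bar> \<le> 1 * p2" unfolding abs_mult using z(2,3)[of x] p2[of x] by (intro mult_mono) auto
          then show ?thesis by simp
        qed (use z0[of x] p0 in simp)
        moreover have "dd \<zeta> v x * (P x + lam) \<le> (2 * L * lam) * indicator A x"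
        proof (cases "x \<in> A")
          case inA: True
          have "\<bar>P x\<bar> \<le> p1" using inA r by (intro p1) (simp add: A_def)
          then have "\<bar>dd \<zeta> v x * (P x + lam)\<bar> \<le> L * (2 * lam)"
            unfolding abs_mult using L(1,4) lam1 by (intro mult_mono) auto
          then show ?thesis using inA by simp
        qed (simp add: dz0)
        ultimately show ?thesis unfolding CV2[OF True] Vd(2)[OF True] by linarith
      next
        case False
        then show ?thesis unfolding CV3[OF False] using p0 L(1) lam1 by simp
      qed
      obtain B where B: "\<And>x. \<bar>dd (\<lambda>x. \<zeta> x * (P x + lam)) v x\<bar> \<le> B" using C1c_bounded[OF CV1] by metis
      have "(\<integral>x. dd (\<lambda>x. \<zeta> x * (P x + lam)) v x * (u x)\<^sup>2 \<partial>lborel) \<le> (\<integral>x. p2 * (u x)\<^sup>2 + (2 * L * lam) * (indicator A x * (u x)\<^sup>2) \<partial>lborel)"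
      proof (rule Bochner_Integration.integral_mono)
        show "integrable lborel (\<lambda>x. dd (\<lambda>x. \<zeta> x * (P x + lam)) v x * (u x)\<^sup>2)"
          using L2_bounded_product_integrable[OF Lu Lu C1c_borel(2)[OF CV1] B] by (simp add: power2_eq_square)
        show "integrable lborel (\<lambda>x. p2 * (u x)\<^sup>2 + (2 * L * lam) * (indicator A x * (u x)\<^sup>2))"
          using p integrable_indicator_times[OF p sets(1)] by simp
        show "dd (\<lambda>x. \<zeta> x * (P x + lam)) v x * (u x)\<^sup>2 \<le> p2 * (u x)\<^sup>2 + (2 * L * lam) * (indicator A x * (u x)\<^sup>2)" for x
          using mult_right_mono[OF le zero_le_power2, of x "u x"] by (simp add: algebra_simps)
      qed
      also have "\<dots> = p2 + 2 * L * (lam * IA)"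
        using p integrable_indicator_times[OF p sets(1)] m1 by (simp add: IA_def)
      also have "\<dots> \<le> p2 + 2 * L * E0" using L(1) TI(2) E0e by (intro add_left_mono mult_left_mono) auto
      finally show ?thesis .
    qed
    have t2: "- (c * (\<integral>x. dd \<zeta> v x * (newt u x * (u x)\<^sup>2) \<partial>lborel)) \<le> L * CN * E0"
    proof -
      have le: "\<bar>dd \<zeta> v x * (c * newt u x)\<bar> \<le> (L * (CN * lam)) * indicator A x" for x
      proof -
        have "\<bar>dd \<zeta> v x\<bar> * \<bar>c * newt u x\<bar> \<le> (L * indicator A x) * (CN * lam)"
          using dz[of v x] N1[of x] c newt0[of x] L(1) by (intro mult_mono) auto
        then show ?thesis by (simp add: abs_mult mult_ac)
      qed
      have m: "(\<lambda>x. dd \<zeta> v x * (c * newt u x)) \<in> borel_measurable borel"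
        using test_fun_borel[OF test_fun_dd[OF z(1)]] by measurable
      have "\<bar>\<integral>x. (dd \<zeta> v x * (c * newt u x)) * (u x)\<^sup>2 \<partial>lborel\<bar> \<le> (L * (CN * lam)) * IA"
        unfolding IA_def by (rule abs_integral_localized_le(2)[OF p _ sets(1) m le]) simp
      also have "(\<lambda>x. (dd \<zeta> v x * (c * newt u x)) * (u x)\<^sup>2) = (\<lambda>x. c * (dd \<zeta> v x * (newt u x * (u x)\<^sup>2)))"
        by (simp add: mult_ac)
      also have "(L * (CN * lam)) * IA = L * CN * (lam * IA)" by simp
      also have "\<dots> \<le> L * CN * E0" using L(1) CN TI(2) E0e by (intro mult_left_mono) auto
      finally show ?thesis by simp
    qed
    have iA: "integrable lborel (\<lambda>x. indicator A x * (G x \<bullet> b)\<^sup>2)" for b by (rule integrable_indicator_times[OF iG sets(1)])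
    have t3: "(\<integral>x. dd \<zeta> v x * ((G x \<bullet> b) * (G x \<bullet> b)) \<partial>lborel) \<le> L * (\<integral>x. indicator A x * (G x \<bullet> b)\<^sup>2 \<partial>lborel)" for b
    proof -
      have "\<bar>\<integral>x. dd \<zeta> v x * (G x \<bullet> b)\<^sup>2 \<partial>lborel\<bar> \<le> L * (\<integral>x. indicator A x * (G x \<bullet> b)\<^sup>2 \<partial>lborel)"
        by (rule abs_integral_localized_le(2)[OF iG _ sets(1) test_fun_borel[OF test_fun_dd[OF z(1)]] dz]) auto
      then show ?thesis by (simp add: power2_eq_square)
    qed
    have Gv: "(G x \<bullet> v)\<^sup>2 \<le> (norm v)\<^sup>2 * (\<Sum>b\<in>Basis. (G x \<bullet> b)\<^sup>2)" for x
      using power_mono[OF Cauchy_Schwarz_ineq2[of "G x" v] abs_ge_zero, of 2]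
      by (simp add: power_mult_distrib norm_power2_basis[of "G x", symmetric] mult.commute)
    define S where "S x = (\<Sum>b\<in>Basis. indicator A x * (G x \<bullet> b)\<^sup>2)" for x
    have iS: "integrable lborel S" unfolding S_def[abs_def] by (intro Bochner_Integration.integrable_sum iA)
    have ST: "(\<integral>x. S x \<partial>lborel) = T"
      unfolding S_def T_def by (rule Bochner_Integration.integral_sum) (rule iA)
    have t4: "- (\<integral>x. dd \<zeta> b x * ((G x \<bullet> b) * (G x \<bullet> v)) \<partial>lborel)
       \<le> (L / 2) * ((\<integral>x. indicator A x * (G x \<bullet> b)\<^sup>2 \<partial>lborel) + (norm v)\<^sup>2 * T)" if B: "b \<in> Basis" for b
    proof -
      have "\<bar>\<integral>x. dd \<zeta> b x * ((G x \<bullet> b) * (G x \<bullet> v)) \<partial>lborel\<bar>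
         \<le> (\<integral>x. (L / 2) * (indicator A x * (G x \<bullet> b)\<^sup>2 + (norm v)\<^sup>2 * S x) \<partial>lborel)"
      proof (rule integral_abs_bound_integral)
        show "integrable lborel (\<lambda>x. dd \<zeta> b x * ((G x \<bullet> b) * (G x \<bullet> v)))"
          by (rule L2_bounded_product_integrable[OF LG LG test_fun_borel[OF test_fun_dd[OF z(1)]] L(3)[OF B]])
        show "integrable lborel (\<lambda>x. (L / 2) * (indicator A x * (G x \<bullet> b)\<^sup>2 + (norm v)\<^sup>2 * S x))"
          by (intro Bochner_Integration.integrable_mult_right Bochner_Integration.integrable_add iA iS)
        fix x
        have "\<bar>(G x \<bullet> b) * (G x \<bullet> v)\<bar> \<le> ((G x \<bullet> b)\<^sup>2 + (G x \<bullet> v)\<^sup>2) / 2"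
          using sum_squares_bound[of "\<bar>G x \<bullet> b\<bar>" "\<bar>G x \<bullet> v\<bar>"] by (simp add: abs_mult)
        also have "\<dots> \<le> ((G x \<bullet> b)\<^sup>2 + (norm v)\<^sup>2 * (\<Sum>b\<in>Basis. (G x \<bullet> b)\<^sup>2)) / 2" using Gv[of x] by simp
        finally have "\<bar>dd \<zeta> b x\<bar> * \<bar>(G x \<bullet> b) * (G x \<bullet> v)\<bar> \<le> (L * indicator A x) * (((G x \<bullet> b)\<^sup>2 + (norm v)\<^sup>2 * (\<Sum>b\<in>Basis. (G x \<bullet> b)\<^sup>2)) / 2)"
          using dz[of b x] B L(1) by (intro mult_mono) auto
        also have "\<dots> = (L / 2) * (indicator A x * (G x \<bullet> b)\<^sup>2 + (norm v)\<^sup>2 * S x)"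
          by (simp only: S_def sum_distrib_left[symmetric]) (simp add: field_simps)
        finally show "\<bar>dd \<zeta> b x * ((G x \<bullet> b) * (G x \<bullet> v))\<bar> \<le> \<dots>" by (simp add: abs_mult)
      qed
      also have "\<dots> = (L / 2) * ((\<integral>x. indicator A x * (G x \<bullet> b)\<^sup>2 \<partial>lborel) + (norm v)\<^sup>2 * T)"
        using iA[of b] iS ST by simp
      finally show ?thesis by (simp add: abs_le_iff)
    qed
    have T0: "T \<ge> 0" unfolding T_def by (intro sum_nonneg Bochner_Integration.integral_nonneg) simp
    have t5: "(\<Sum>b\<in>Basis. (1/2) * (\<integral>x. dd \<zeta> v x * ((G x \<bullet> b) * (G x \<bullet> b)) \<partial>lborel)
       - (\<integral>x. dd \<zeta> b x * ((G x \<bullet> b) * (G x \<bullet> v)) \<partial>lborel)) \<le> L * (1 + 3 * (norm v)\<^sup>2 / 2) * E0"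
    proof -
      have "(\<Sum>b\<in>Basis. (1/2) * (\<integral>x. dd \<zeta> v x * ((G x \<bullet> b) * (G x \<bullet> b)) \<partial>lborel)
       - (\<integral>x. dd \<zeta> b x * ((G x \<bullet> b) * (G x \<bullet> v)) \<partial>lborel))
        \<le> (\<Sum>b\<in>(Basis :: (real^3) set). L * (\<integral>x. indicator A x * (G x \<bullet> b)\<^sup>2 \<partial>lborel) + (L / 2) * ((norm v)\<^sup>2 * T))"
      proof (rule sum_mono)
        fix b' :: "real^3" assume B: "b' \<in> Basis"
        show "(1/2) * (\<integral>x. dd \<zeta> v x * ((G x \<bullet> b') * (G x \<bullet> b')) \<partial>lborel) - (\<integral>x. dd \<zeta> b' x * ((G x \<bullet> b') * (G x \<bullet> v)) \<partial>lborel)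
          \<le> L * (\<integral>x. indicator A x * (G x \<bullet> b')\<^sup>2 \<partial>lborel) + (L / 2) * ((norm v)\<^sup>2 * T)"
          using t3[of b'] t4[OF B] unfolding distrib_left by linarith
      qed
      also have "\<dots> = L * T + 3 * ((L / 2) * ((norm v)\<^sup>2 * T))"
        by (simp add: sum.distrib T_def sum_distrib_left)
      also have "\<dots> = L * (1 + 3 * (norm v)\<^sup>2 / 2) * T" by (simp add: algebra_simps)
      also have "\<dots> \<le> L * (1 + 3 * (norm v)\<^sup>2 / 2) * E0" using L(1) TI(1) E0e by (intro mult_left_mono) auto
      finally show ?thesis .
    qed
    \<comment> \<open>Multiplication by \<open>c / 4\<close> cancels the \<open>1 / c\<close> in the
      middle term of \<open>K\<close>; the attraction and the mass away from the centres keep the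
      factor \<open>c\<close>.\<close>
    have "(c / 4) * K = (\<gamma> * k0 / 4) * c * (?mi * ?ml) - L * norm v * CN / 2 * E0 - norm v / (2 * r\<^sup>2) * c * e"
      using c unfolding K_def right_diff_distrib by (simp add: mult_ac)
    moreover have "norm v / (2 * r\<^sup>2) * (c * e) \<le> C * (c * e)"
      using Cge(4) c e0 by (intro mult_right_mono) auto
    moreover have "Q * E0 = L * norm v * CN / 2 * E0 + L * E0 + L * CN * E0 / 2 + L * (1 + 3 * (norm v)\<^sup>2 / 2) * E0"
      by (simp add: Q_def algebra_simps)
    ultimately show ?thesis
      using poh t1 t2 t5 Cge(3) unfolding e_def[symmetric] by (simp only: mult.assoc)
  qed
  show ?thesis
  proof (intro exI conjI allI impI)
    show "\<gamma> * k0 / 4 > 0" using gam k0 by simp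
    show "C > 0" using Cge(2) by simp
  qed (elim conjE, rule main[unfolded R'_def], assumption, assumption, assumption, assumption, blast, blast, blast)
qed

section \<open>Borel representatives and decay of the ground state potential\<close>


lemma borel_lebesgue: "f \<in> borel_measurable borel \<Longrightarrow> f \<in> borel_measurable lebesgue"
  by (rule measurable_completion) simp

lemma lebesgue_integral_transfer:
  fixes f g :: "'a::euclidean_space \<Rightarrow> real"
  assumes f: "f \<in> borel_measurable lebesgue" and g: "g \<in> borel_measurable borel" and ae: "AE x in lebesgue. f x = g x"
  shows "(LINT x|lebesgue. f x) = (\<integral>x. g x \<partial>lborel)" and "integrable lebesgue f \<longleftrightarrow> integrable lborel g"
proof -
  have gl: "g \<in> borel_measurable lebesgue" by (rule borel_lebesgue[OF g])
  have "(LINT x|lebesgue. f x) = (LINT x|lebesgue. g x)" by (rule integral_cong_AE[OF f gl ae])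
  then show "(LINT x|lebesgue. f x) = (\<integral>x. g x \<partial>lborel)" using integral_completion[of g lborel] g by simp
  have "integrable lebesgue f \<longleftrightarrow> integrable lebesgue g" by (rule integrable_cong_AE[OF f gl ae])
  then show "integrable lebesgue f \<longleftrightarrow> integrable lborel g" using integrable_completion[of g lborel] g by simp
qed

text \<open>Each component has a Borel representative, and changing functions on null sets affects
  none of the integrals in \<open>H1_grad\<close>. The weak derivative identity extends from basis
  vectors to all directions by linearity.\<close>

lemma H1_grad_borel_representative:
  fixes f :: "'a::euclidean_space \<Rightarrow> real"
  assumes H: "H1_grad f F"
  obtains u G where "h1 u G" "AE x in lebesgue. f x = u x" "AE x in lebesgue. F x = G x"
proof -
  have fm: "f \<in> borel_measurable lebesgue" and Fm: "F \<in> borel_measurable lebesgue"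
    and fi: "integrable lebesgue (\<lambda>x. (f x)\<^sup>2)" and Fi: "integrable lebesgue (\<lambda>x. (norm (F x))\<^sup>2)"
    and weak: "\<And>\<phi> e. test_fun \<phi> \<Longrightarrow> e \<in> Basis \<Longrightarrow>
        (LINT x|lebesgue. f x * dd \<phi> e x) = - (LINT x|lebesgue. (F x \<bullet> e) * \<phi> x)"
    using H unfolding H1_grad_def by auto
  have rep: "\<exists>g\<in>borel_measurable borel. AE x in lebesgue. h x = g x" if "h \<in> borel_measurable lebesgue" for h :: "'a \<Rightarrow> real"
    using completion_ex_borel_measurable_real[OF that] AE_completion by auto
  obtain u where u: "u \<in> borel_measurable borel" "AE x in lebesgue. f x = u x" using rep[OF fm] by blast
  have Fb: "(\<lambda>x. F x \<bullet> b) \<in> borel_measurable lebesgue" for b using Fm by (intro borel_measurable_inner) auto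
  have "\<exists>g. g \<in> borel_measurable borel \<and> (AE x in lebesgue. F x \<bullet> b = g x)" for b
    using rep[OF Fb] by blast
  then obtain g where g: "\<And>b. g b \<in> borel_measurable borel" "\<And>b. AE x in lebesgue. F x \<bullet> b = g b x" by metis
  define G where "G x = (\<Sum>b\<in>Basis. g b x *\<^sub>R b)" for x
  have Gm: "G \<in> borel_measurable borel" unfolding G_def[abs_def]
    using g(1) by (intro borel_measurable_sum borel_measurable_scaleR) auto
  have FG: "AE x in lebesgue. F x = G x"
  proof -
    have "AE x in lebesgue. \<forall>b\<in>Basis. F x \<bullet> b = g b x" using g(2) by (intro AE_finite_allI) auto
    then show ?thesis
    proof eventually_elim
      case (elim x)
      then show ?case unfolding G_def by (subst euclidean_representation[of "F x", symmetric]) (intro sum.cong, auto)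
    qed
  qed
  have Lu: "L2 u"
  proof -
    have "AE x in lebesgue. (f x)\<^sup>2 = (u x)\<^sup>2" using u(2) by eventually_elim simp
    from lebesgue_integral_transfer(2)[OF _ _ this] fm u(1) fi show ?thesis by (simp add: L2_def)
  qed
  have LG: "L2 (\<lambda>x. norm (G x))"
  proof -
    have "AE x in lebesgue. (norm (F x))\<^sup>2 = (norm (G x))\<^sup>2" using FG by eventually_elim simp
    from lebesgue_integral_transfer(2)[OF _ _ this] Fm Gm Fi show ?thesis by (simp add: L2_def)
  qed
  have LGv: "L2 (\<lambda>x. G x \<bullet> v)" for v
  proof (rule L2_bound[OF LG])
    show "(\<lambda>x. G x \<bullet> v) \<in> borel_measurable borel" using Gm by (intro borel_measurable_inner) auto
    show "\<bar>G x \<bullet> v\<bar> \<le> norm v * \<bar>norm (G x)\<bar>" for x using Cauchy_Schwarz_ineq2[of "G x" v] by (simp add: mult.commute)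
  qed simp
  have wB: "(\<integral>x. u x * dd \<phi> e x \<partial>lborel) = - (\<integral>x. (G x \<bullet> e) * \<phi> x \<partial>lborel)" if \<phi>: "test_fun \<phi>" and e: "e \<in> Basis" for \<phi> e
  proof -
    note pb = test_fun_borel[OF \<phi>] test_fun_borel[OF test_fun_dd[OF \<phi>, of e]]
    have "AE x in lebesgue. f x * dd \<phi> e x = u x * dd \<phi> e x" using u(2) by eventually_elim simp
    from lebesgue_integral_transfer(1)[OF _ _ this] have 1: "(LINT x|lebesgue. f x * dd \<phi> e x) = (\<integral>x. u x * dd \<phi> e x \<partial>lborel)"
      using fm u(1) pb borel_lebesgue[OF pb(2)] by (simp add: borel_measurable_times)
    have "AE x in lebesgue. (F x \<bullet> e) * \<phi> x = (G x \<bullet> e) * \<phi> x" using FG by eventually_elim simp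
    from lebesgue_integral_transfer(1)[OF _ _ this] have 2: "(LINT x|lebesgue. (F x \<bullet> e) * \<phi> x) = (\<integral>x. (G x \<bullet> e) * \<phi> x \<partial>lborel)"
      using Fb[of e] L2_measurable[OF LGv[of e]] pb borel_lebesgue[OF pb(1)] by (simp add: borel_measurable_times)
    show ?thesis using weak[OF \<phi> e] 1 2 by simp
  qed
  have "h1 u G"
    unfolding h1_def
  proof (intro conjI allI impI Lu Gm LGv)
    fix \<phi> :: "'a \<Rightarrow> real" and v :: 'a assume \<phi>: "test_fun \<phi>"
    have i: "integrable lborel (\<lambda>x. u x * dd \<phi> b x)" "integrable lborel (\<lambda>x. (G x \<bullet> b) * \<phi> x)" for b
      by (rule L2_mult_integrable[OF Lu test_fun_L2[OF test_fun_dd[OF \<phi>]]], rule L2_mult_integrable[OF LGv test_fun_L2[OF \<phi>]])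
    have "(\<integral>x. u x * dd \<phi> v x \<partial>lborel) = (\<integral>x. (\<Sum>b\<in>Basis. (v \<bullet> b) * (u x * dd \<phi> b x)) \<partial>lborel)"
      by (simp add: dd_basis_sum[OF test_fun_differentiable[OF \<phi>], of v] sum_distrib_left mult_ac)
    also have "\<dots> = (\<Sum>b\<in>Basis. (v \<bullet> b) * (\<integral>x. u x * dd \<phi> b x \<partial>lborel))"
      using i by (subst Bochner_Integration.integral_sum) auto
    also have "\<dots> = (\<Sum>b\<in>Basis. (v \<bullet> b) * - (\<integral>x. (G x \<bullet> b) * \<phi> x \<partial>lborel))"
      using wB[OF \<phi>] by (intro sum.cong) auto
    also have "\<dots> = - (\<integral>x. (\<Sum>b\<in>Basis. (v \<bullet> b) * ((G x \<bullet> b) * \<phi> x)) \<partial>lborel)"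
      using i by (subst Bochner_Integration.integral_sum) (auto simp: sum_negf)
    also have "(\<lambda>x. \<Sum>b\<in>Basis. (v \<bullet> b) * ((G x \<bullet> b) * \<phi> x)) = (\<lambda>x. (G x \<bullet> v) * \<phi> x)"
      by (intro ext) (simp add: euclidean_inner[of "G _" v] sum_distrib_left mult_ac)
    finally show "(\<integral>x. u x * dd \<phi> v x \<partial>lborel) = - (\<integral>x. (G x \<bullet> v) * \<phi> x \<partial>lborel)" .
  qed
  then show ?thesis using that u(2) FG by blast
qed

text \<open>The exceptional null set is invisible to the integral over \<open>y\<close>, so the
  equality holds at every \<open>x\<close> and not merely almost everywhere.\<close>

lemma newton_eq_newt:
  assumes f: "f \<in> borel_measurable lebesgue" and u: "u \<in> borel_measurable borel" and ae: "AE x in lebesgue. f x = u x"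
  shows "newton f x = newt u x"
  unfolding newton_def newt_def
proof (rule lebesgue_integral_transfer(1))
  show "(\<lambda>y. (f y)\<^sup>2 / norm (x - y)) \<in> borel_measurable lebesgue"
    by (rule borel_measurable_divide[OF borel_measurable_power[OF f] borel_lebesgue]) measurable
  show "(\<lambda>y. (u y)\<^sup>2 / norm (x - y)) \<in> borel_measurable borel" using u by measurable
  show "AE y in lebesgue. (f y)\<^sup>2 / norm (x - y) = (u y)\<^sup>2 / norm (x - y)" using ae by eventually_elim simp
qed

text \<open>The weak equation equates two integrals. Merging them into one vanishing integral needs
  both integrands to be integrable: the test function localises \<open>P\<close>, and Hardy's
  inequality bounds the potential.\<close>

lemma weak_eq_borel_representative:
  assumes f: "f \<in> borel_measurable lebesgue" and F: "F \<in> borel_measurable lebesgue" and u: "h1 u G"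
    and ae: "AE x in lebesgue. f x = u x" "AE x in lebesgue. F x = G x"
    and weak: "weak_eq P a \<mu> f F" and P: "continuous_on UNIV P" and phi: "test_fun \<phi>"
  shows "(\<integral>x. (\<Sum>b\<in>Basis. (G x \<bullet> b) * dd \<phi> b x) + ((P x + - \<mu>) * u x - a / (8 * pi) * newt u x * u x) * \<phi> x \<partial>lborel) = 0"
proof -
  let ?l = "\<lambda>x. (\<Sum>b\<in>Basis. (G x \<bullet> b) * dd \<phi> b x) + P x * u x * \<phi> x"
  let ?r = "\<lambda>x. a / (8 * pi) * newt u x * u x * \<phi> x + \<mu> * u x * \<phi> x"
  have Lu: "L2 u" and LG: "L2 (\<lambda>x. G x \<bullet> b)" for b by (rule h1_L2[OF u])+
  note nm = newton_eq_newt[OF f L2_measurable[OF Lu] ae(1)]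
  note pb = test_fun_borel[OF phi] test_fun_borel[OF test_fun_dd[OF phi]]
  have [measurable]: "u \<in> borel_measurable borel" "P \<in> borel_measurable borel" "newt u \<in> borel_measurable borel"
    "\<phi> \<in> borel_measurable borel" using Lu continuous_borel[OF P] newt_measurable[OF Lu] pb by auto
  have mG: "(\<lambda>x. \<Sum>b\<in>Basis. (G x \<bullet> b) * dd \<phi> b x) \<in> borel_measurable borel"
    using L2_measurable[OF LG] pb by (intro borel_measurable_sum borel_measurable_times) auto
  have ml: "?l \<in> borel_measurable borel" by (rule borel_measurable_add[OF mG]) measurable
  have mr: "?r \<in> borel_measurable borel" by measurable
  have "(LINT x|lebesgue. (\<Sum>e\<in>Basis. (F x \<bullet> e) * dd \<phi> e x) + P x * f x * \<phi> x) = (\<integral>x. ?l x \<partial>lborel)"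
  proof (rule lebesgue_integral_transfer(1)[OF _ ml])
    show "(\<lambda>x. (\<Sum>e\<in>Basis. (F x \<bullet> e) * dd \<phi> e x) + P x * f x * \<phi> x) \<in> borel_measurable lebesgue"
      using f F pb[THEN borel_lebesgue] borel_lebesgue[OF \<open>P \<in> borel_measurable borel\<close>]
      by (intro borel_measurable_add borel_measurable_sum borel_measurable_times borel_measurable_inner) auto
    show "AE x in lebesgue. (\<Sum>e\<in>Basis. (F x \<bullet> e) * dd \<phi> e x) + P x * f x * \<phi> x = ?l x"
      using ae by eventually_elim simp
  qed
  moreover have "(LINT x|lebesgue. a / (8 * pi) * newton f x * f x * \<phi> x + \<mu> * f x * \<phi> x) = (\<integral>x. ?r x \<partial>lborel)"
  proof (rule lebesgue_integral_transfer(1)[OF _ mr])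
    show "(\<lambda>x. a / (8 * pi) * newton f x * f x * \<phi> x + \<mu> * f x * \<phi> x) \<in> borel_measurable lebesgue"
      unfolding nm using f pb(1)[THEN borel_lebesgue] borel_lebesgue[OF newt_measurable[OF Lu]]
      by (intro borel_measurable_add borel_measurable_times) auto
    show "AE x in lebesgue. a / (8 * pi) * newton f x * f x * \<phi> x + \<mu> * f x * \<phi> x = ?r x"
      using ae(1) by eventually_elim (simp add: nm)
  qed
  ultimately have eq: "(\<integral>x. ?l x \<partial>lborel) = (\<integral>x. ?r x \<partial>lborel)" using weak phi unfolding weak_eq_def by auto
  have Lphi: "L2 \<phi>" by (rule test_fun_L2[OF phi])
  have il: "integrable lborel ?l"
  proof -
    have "continuous_on UNIV (\<lambda>x. \<phi> x * P x)" "bsupp (\<lambda>x. \<phi> x * P x)"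
      using phi P smooth_continuous[of \<phi>] by (auto simp: test_fun_iff intro!: continuous_on_mult bsupp_mult)
    then have "L2 (\<lambda>x. \<phi> x * P x)" by (rule L2_continuous_bsupp)
    from L2_mult_integrable[OF this Lu] have "integrable lborel (\<lambda>x. P x * u x * \<phi> x)" by (simp add: mult_ac)
    then show ?thesis
      by (intro Bochner_Integration.integrable_add Bochner_Integration.integrable_sum
          L2_mult_integrable[OF LG test_fun_L2[OF test_fun_dd[OF phi]]])
  qed
  have ir: "integrable lborel ?r"
  proof -
    have "L2 (\<lambda>x. newt u x * u x)"
      using newt_nonneg hardy(2)[OF u] by (intro L2_bounded_mult[OF Lu newt_measurable[OF Lu]]) (simp add: abs_le_iff newt_nonneg order_trans[OF _ newt_nonneg])
    from L2_mult_integrable[OF this Lphi] L2_mult_integrable[OF Lu Lphi] show ?thesis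
      by (simp add: mult.assoc)
  qed
  have "(\<integral>x. ?l x - ?r x \<partial>lborel) = 0" using il ir eq by simp
  moreover have "(\<lambda>x. ?l x - ?r x) = (\<lambda>x. (\<Sum>b\<in>Basis. (G x \<bullet> b) * dd \<phi> b x) + ((P x + - \<mu>) * u x - a / (8 * pi) * newt u x * u x) * \<phi> x)"
    by (intro ext) (simp add: algebra_simps)
  ultimately show ?thesis by (simp only:)
qed

section \<open>Local integrability of the Coulomb kernel and decay of the potential\<close>

lemma test_fun_h1:
  assumes phi: "test_fun \<phi>"
  shows "h1 \<phi> (\<lambda>x. \<Sum>b\<in>Basis. dd \<phi> b x *\<^sub>R b)"
proof -
  have G: "(\<Sum>b\<in>Basis. dd \<phi> b x *\<^sub>R b) \<bullet> v = dd \<phi> v x" for x v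
    unfolding dd_basis_sum[OF test_fun_differentiable[OF phi], of v] inner_sum_left
    by (intro sum.cong refl) (simp add: inner_commute)
  have "(\<integral>x. \<phi> x * dd \<psi> v x \<partial>lborel) = - (\<integral>x. dd \<phi> v x * \<psi> x \<partial>lborel)" if psi: "test_fun \<psi>" for \<psi> v
  proof -
    have "(\<integral>x. dd (\<lambda>x. \<phi> x * \<psi> x) v x \<partial>lborel) = 0"
      using psi by (intro C1c_integral_dd C1c_mult_smooth test_fun_C1c phi) (simp add: test_fun_iff)
    moreover have "dd (\<lambda>x. \<phi> x * \<psi> x) v = (\<lambda>x. \<phi> x * dd \<psi> v x + dd \<phi> v x * \<psi> x)"
      by (intro ext dd_mult test_fun_differentiable phi psi)
    ultimately show ?thesis
      using L2_mult_integrable[OF test_fun_L2[OF phi] test_fun_L2[OF test_fun_dd[OF psi]], of v]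
        L2_mult_integrable[OF test_fun_L2[OF test_fun_dd[OF phi]] test_fun_L2[OF psi], of v] by simp
  qed
  moreover have "(\<lambda>x. \<Sum>b\<in>Basis. dd \<phi> b x *\<^sub>R b) \<in> borel_measurable borel"
    using test_fun_borel[OF test_fun_dd[OF phi]] by (intro borel_measurable_sum borel_measurable_scaleR) auto
  ultimately show ?thesis unfolding h1_def G using test_fun_L2[OF phi] test_fun_L2[OF test_fun_dd[OF phi]] by blast
qed

lemma inverse_norm_borel: "(\<lambda>y::real^3. indicator (ball 0 l) y / norm y) \<in> borel_measurable borel"
  by (intro borel_measurable_divide borel_measurable_indicator) auto

text \<open>Hardy's inequality for a cutoff equal to 1 on the unit ball already contains this,
  without polar coordinates.\<close>

lemma inverse_norm_locally_integrable:
  "integrable lborel (\<lambda>y::real^3. indicator (ball 0 1) y / norm y)"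
proof -
  note m = inverse_norm_borel[of 1]
  obtain \<zeta> :: "real^3 \<Rightarrow> real" where z: "test_fun \<zeta>" "\<And>x. dist 0 x \<le> 1 \<Longrightarrow> \<zeta> x = 1"
    using cutoff_exists[of 1 0] by (metis zero_less_one)
  have i: "integrable lborel (\<lambda>y. (\<zeta> y)\<^sup>2 / norm (0 - y))" by (rule hardy(1)[OF test_fun_h1[OF z(1)]])
  show ?thesis
  proof (rule Bochner_Integration.integrable_bound[OF i])
    show "AE y in lborel. norm (indicator (ball 0 1) y / norm y) \<le> norm ((\<zeta> y)\<^sup>2 / norm (0 - y))"
      using z(2) by (intro AE_I2) (auto simp: indicator_def)
  qed (use m in simp)
qed

abbreviation inverse_norm_mass :: "real \<Rightarrow> real" where
  "inverse_norm_mass l \<equiv> (\<integral>y. indicator (ball (0 :: real^3) l) y / norm y \<partial>lborel)"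

lemma inverse_norm_integral_small:
  assumes "e > 0"
  obtains l where "0 < l" "l \<le> 1" "inverse_norm_mass l < e"
proof -
  define h where "h n = inverse (real (Suc n))" for n
  have "(\<lambda>n. inverse_norm_mass (h n)) \<longlonglongrightarrow> (\<integral>y. 0 \<partial>(lborel :: (real^3) measure))"
  proof (rule integral_dominated_convergence[OF _ _ inverse_norm_locally_integrable])
    show "AE y in lborel. (\<lambda>n. indicator (ball 0 (h n)) y / norm (y :: real^3)) \<longlonglongrightarrow> 0" 
    proof (rule AE_I2)
      fix y :: "real^3"
      show "(\<lambda>n. indicator (ball 0 (h n)) y / norm y) \<longlonglongrightarrow> 0"
      proof (cases "y = 0")
        case False
        then obtain N where N: "inverse (real (Suc N)) < norm y" using reals_Archimedean[of "norm y"] by auto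
        have "indicator (ball 0 (h n)) y / norm y = 0" if "n \<ge> N" for n
        proof -
          have "h n \<le> inverse (real (Suc N))" using that by (simp add: h_def field_simps)
          then show ?thesis using N by simp
        qed
        then have "\<forall>\<^sub>F n in sequentially. 0 = indicator (ball 0 (h n)) y / norm y"
          unfolding eventually_sequentially by (intro exI[of _ N]) simp
        then show ?thesis by (rule Lim_transform_eventually[OF tendsto_const])
      qed simp
    qed
    have h1': "h n \<le> 1" for n by (simp add: h_def field_simps)
    show "AE y in lborel. norm (indicator (ball 0 (h n)) y / norm y) \<le> indicator (ball 0 1) y / norm (y :: real^3)" for n
      using h1'[of n] by (intro AE_I2) (auto simp: indicator_def intro!: divide_right_mono)
  qed (use inverse_norm_borel in simp_all)
  then have "(\<lambda>n. inverse_norm_mass (h n)) \<longlonglongrightarrow> 0" by simp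
  from order_tendstoD(2)[OF this assms] obtain n where "inverse_norm_mass (h n) < e"
    unfolding eventually_sequentially by blast
  then show ?thesis using that[of "h n"] by (simp add: h_def field_simps)
qed

abbreviation tail_mass :: "('a::euclidean_space \<Rightarrow> real) \<Rightarrow> real \<Rightarrow> real" where
  "tail_mass U t \<equiv> (\<integral>y. indicator {y. norm y \<ge> t} y * (U y)\<^sup>2 \<partial>lborel)"

lemma closed_outside: "closed {y::'a::euclidean_space. norm y \<ge> t}"
  by (intro closed_Collect_le continuous_intros)

text \<open>The integral is split by the position of \<open>y\<close>. Within distance
  \<open>l\<close> of \<open>z\<close> the function is bounded by \<open>B\<close>; where
  \<open>norm y \<ge> norm z / 2\<close> the tail of \<open>U\<close> meets a kernel of at most
  \<open>1 / l\<close>; for smaller \<open>y\<close> the kernel is at most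
  \<open>2 / norm z\<close>. The second bound uses the same idea with radius 1 and is uniform in the
  point.\<close>

lemma newt_split_bound:
  fixes U :: "real^3 \<Rightarrow> real"
  assumes U: "L2 U" and B: "\<And>x. \<bar>U x\<bar> \<le> B" and l: "0 < l" "l \<le> 1" and z: "norm z > 0"
  shows "newt U z \<le> B\<^sup>2 * inverse_norm_mass l + tail_mass U (norm z / 2) / l
     + 2 / norm z * mass U"
    and "newt U x \<le> B\<^sup>2 * inverse_norm_mass 1 + mass U"
proof -
  have [measurable]: "U \<in> borel_measurable borel" using U by auto
  have p: "integrable lborel (\<lambda>y. (U y)\<^sup>2)" by (rule L2_integrable[OF U])
  have iK: "integrable lborel (\<lambda>y::real^3. indicator (ball 0 l) y / norm y)" if "l \<le> 1" for l
  proof (rule Bochner_Integration.integrable_bound[OF inverse_norm_locally_integrable])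
    show "AE y in lborel. norm (indicator (ball 0 l) y / norm y) \<le> norm (indicator (ball 0 1) y / norm (y::real^3))"
      using that by (intro AE_I2) (auto simp: indicator_def)
  qed (use inverse_norm_borel in simp)
  have sh: "integrable lborel (\<lambda>y::real^3. indicator (ball 0 l) (x - y) / norm (x - y))"
    "(\<integral>y. indicator (ball (0::real^3) l) (x - y) / norm (x - y) \<partial>lborel) = inverse_norm_mass l"
    if "l \<le> 1" for l x
    using lborel_reflect[OF inverse_norm_borel[of l], of x] iK[OF that] by auto
  have near: "(U y)\<^sup>2 / norm w \<le> B\<^sup>2 * (indicator (ball 0 l) w / norm w)" if "norm w < l" for w y :: "real^3" and l
  proof -
    have "(U y)\<^sup>2 \<le> B\<^sup>2" using power_mono[OF B[of y] abs_ge_zero, of 2] by simp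
    then show ?thesis using that by (simp add: divide_right_mono)
  qed
  have mono: "newt U x \<le> (\<integral>y. g y \<partial>lborel)" if "integrable lborel g" "\<And>y. (U y)\<^sup>2 / norm (x - y) \<le> g y" for g x
  proof -
    have "integrable lborel (\<lambda>y. (U y)\<^sup>2 / norm (x - y))"
    proof (rule Bochner_Integration.integrable_bound[OF that(1)])
      show "AE y in lborel. norm ((U y)\<^sup>2 / norm (x - y)) \<le> norm (g y)"
        using order_trans[OF that(2) abs_ge_self] by (intro AE_I2) simp
    qed measurable
    then show ?thesis unfolding newt_def using that by (intro Bochner_Integration.integral_mono) auto
  qed
  have it: "integrable lborel (\<lambda>y. indicator {y. norm y \<ge> t} y * (U y)\<^sup>2)" for t
    by (rule integrable_indicator_times[OF p]) (use closed_outside in auto)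
  show "newt U z \<le> B\<^sup>2 * inverse_norm_mass l + tail_mass U (norm z / 2) / l
     + 2 / norm z * mass U"
  proof -
    let ?g = "\<lambda>y. B\<^sup>2 * (indicator (ball 0 l) (z - y) / norm (z - y)) + (inverse l * (indicator {y. norm y \<ge> norm z / 2} y * (U y)\<^sup>2)
       + (2 / norm z) * (U y)\<^sup>2)"
    have le1: "newt U z \<le> (\<integral>y. ?g y \<partial>lborel)"
    proof (rule mono)
      show "integrable lborel ?g"
        by (intro Bochner_Integration.integrable_add Bochner_Integration.integrable_mult_right sh l it p)
      fix y
      have pos: "0 \<le> B\<^sup>2 * (indicator (ball 0 l) (z - y) / norm (z - y))"
        "0 \<le> inverse l * (indicator {y. norm y \<ge> norm z / 2} y * (U y)\<^sup>2)" "0 \<le> (2 / norm z) * (U y)\<^sup>2"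
        using l by auto
      consider "norm (z - y) < l" | "norm (z - y) \<ge> l" "norm y \<ge> norm z / 2" | "norm y < norm z / 2" by linarith
      then show "(U y)\<^sup>2 / norm (z - y) \<le> ?g y"
      proof cases
        case 1 then show ?thesis using near[OF 1, of y] pos by linarith
      next
        case 2
        have "norm (z - y) > 0" using 2(1) l by linarith
        then have le: "(U y)\<^sup>2 / norm (z - y) \<le> (U y)\<^sup>2 / l"
          by (rule divide_left_mono[OF 2(1) zero_le_power2 mult_pos_pos[OF _ l(1)]])
        have "indicator {y. norm y \<ge> norm z / 2} y = (1::real)" using 2(2) by simp
        then have "(U y)\<^sup>2 / l = inverse l * (indicator {y. norm y \<ge> norm z / 2} y * (U y)\<^sup>2)"
          by (simp only: divide_inverse mult.commute mult_1_right)
        then show ?thesis using pos le by linarith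
      next
        case 3
        have "norm (z - y) \<ge> norm z / 2" using 3 norm_triangle_ineq2[of z y] by linarith
        moreover have "norm (z - y) > 0" "norm z / 2 > 0" using calculation z by linarith+
        ultimately have le: "(U y)\<^sup>2 / norm (z - y) \<le> (U y)\<^sup>2 / (norm z / 2)"
          by (intro divide_left_mono[OF _ zero_le_power2 mult_pos_pos])
        have "(U y)\<^sup>2 / (norm z / 2) = (2 / norm z) * (U y)\<^sup>2" by simp
        then show ?thesis using pos le by linarith
      qed
    qed
    have eq1: "(\<integral>y. ?g y \<partial>lborel) = B\<^sup>2 * (\<integral>y. indicator (ball 0 l) (z - y) / norm (z - y) \<partial>lborel) + (inverse l * tail_mass U (norm z / 2) + 2 / norm z * mass U)"
    proof -
      note i = Bochner_Integration.integrable_mult_right[OF sh(1)[OF l(2), of z], of "B\<^sup>2"]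
        Bochner_Integration.integrable_mult_right[OF it[of "norm z / 2"], of "inverse l"]
        Bochner_Integration.integrable_mult_right[OF p, of "2 / norm z"]
      show ?thesis
        by (simp only: Bochner_Integration.integral_add[OF i(1) Bochner_Integration.integrable_add[OF i(2,3)]]
            Bochner_Integration.integral_add[OF i(2,3)] integral_mult_right_zero)
    qed
    have "tail_mass U (norm z / 2) / l = inverse l * tail_mass U (norm z / 2)" by (simp only: divide_inverse mult.commute)
    then show ?thesis using le1 unfolding eq1 sh(2)[OF l(2), of z] by linarith
  qed
  show "newt U x \<le> B\<^sup>2 * inverse_norm_mass 1 + mass U"
  proof -
    note i = Bochner_Integration.integrable_mult_right[OF sh(1)[OF order_refl, of x], of "B\<^sup>2"]
    have le1: "newt U x \<le> (\<integral>y. B\<^sup>2 * (indicator (ball 0 1) (x - y) / norm (x - y)) + (U y)\<^sup>2 \<partial>lborel)"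
    proof (rule mono)
      show "integrable lborel (\<lambda>y. B\<^sup>2 * (indicator (ball 0 1) (x - y) / norm (x - y)) + (U y)\<^sup>2)"
        by (rule Bochner_Integration.integrable_add[OF i p])
      fix y
      have pos: "0 \<le> B\<^sup>2 * (indicator (ball 0 1) (x - y) / norm (x - y))" "0 \<le> (U y)\<^sup>2" by auto
      show "(U y)\<^sup>2 / norm (x - y) \<le> B\<^sup>2 * (indicator (ball 0 1) (x - y) / norm (x - y)) + (U y)\<^sup>2"
      proof (cases "norm (x - y) < 1")
        case True then show ?thesis using near[OF True, of y] pos by linarith
      next
        case False
        then have "norm (x - y) > 0" "1 \<le> norm (x - y)" by linarith+
        then have "(U y)\<^sup>2 / norm (x - y) \<le> (U y)\<^sup>2 / 1" by (intro divide_left_mono[OF _ zero_le_power2 mult_pos_pos]) simp_all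
        then show ?thesis using pos by linarith
      qed
    qed
    have eq1: "(\<integral>y. B\<^sup>2 * (indicator (ball 0 1) (x - y) / norm (x - y)) + (U y)\<^sup>2 \<partial>lborel)
        = B\<^sup>2 * (\<integral>y. indicator (ball 0 1) (x - y) / norm (x - y) \<partial>lborel) + mass U"
      by (simp only: Bochner_Integration.integral_add[OF i p] integral_mult_right_zero)
    show ?thesis using le1 unfolding eq1 sh(2)[OF order_refl, of x] .
  qed
qed

lemma tail_mass_tendsto_0:
  fixes U :: "'a::euclidean_space \<Rightarrow> real"
  assumes U: "L2 U"
  shows "(tail_mass U \<longlongrightarrow> 0) at_top"
proof -
  have [measurable]: "U \<in> borel_measurable borel" using U by auto
  have "((\<lambda>t. \<integral>y. indicator {y. norm y \<ge> t} y * (U y)\<^sup>2 \<partial>lborel) \<longlongrightarrow> (\<integral>y. 0 \<partial>(lborel :: 'a measure))) at_top"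
  proof (rule integral_dominated_convergence_at_top[where w="\<lambda>y. (U y)\<^sup>2"])
    show "integrable lborel (\<lambda>y. (U y)\<^sup>2)" by (rule L2_integrable[OF U])
    show "(\<lambda>y. indicator {y. norm y \<ge> t} y * (U y)\<^sup>2) \<in> borel_measurable lborel" for t
      using closed_outside[of t, where ?'a='a] by (intro borel_measurable_times borel_measurable_indicator) auto
    show "\<forall>\<^sub>F t in at_top. AE y in lborel. norm (indicator {y. norm y \<ge> t} y * (U y)\<^sup>2) \<le> (U y)\<^sup>2"
      by (intro always_eventually allI AE_I2) (auto simp: indicator_def)
    have "((\<lambda>t. indicator {y. norm y \<ge> t} y * (U y)\<^sup>2) \<longlongrightarrow> 0) at_top" for y
    proof -
      have "\<forall>\<^sub>F t in at_top. 0 = indicator {y. norm y \<ge> t} y * (U y)\<^sup>2"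
        using eventually_gt_at_top[of "norm y"] by eventually_elim simp
      then show ?thesis by (rule Lim_transform_eventually[OF tendsto_const])
    qed
    then show "AE y in lborel. ((\<lambda>t. indicator {y. norm y \<ge> t} y * (U y)\<^sup>2) \<longlongrightarrow> 0) at_top" by simp
  qed simp
  then show ?thesis by simp
qed

text \<open>Each of the three pieces in \<open>newt_split_bound\<close> is brought down to
  \<open>e / 3\<close>.\<close>

lemma newt_tendsto_0:
  fixes U :: "real^3 \<Rightarrow> real"
  assumes U: "L2 U" and B: "\<And>x. \<bar>U x\<bar> \<le> B" and e: "e > 0"
  obtains S where "S > 0" "\<And>z. norm z \<ge> S \<Longrightarrow> newt U z \<le> e"
proof -
  have B1: "B\<^sup>2 + 1 > 0" by (simp add: add_nonneg_pos)
  have "e / (3 * (B\<^sup>2 + 1)) > 0" using e B1 by simp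
  \<comment> \<open>The radius \<open>l\<close> is fixed before the tail threshold, because the tail
    of \<open>U\<close> gets divided by \<open>l\<close>.\<close>
  then obtain l where l: "0 < l" "l \<le> 1" and li: "inverse_norm_mass l < e / (3 * (B\<^sup>2 + 1))"
    using inverse_norm_integral_small by metis
  have "e * l / 3 > 0" using e l by simp
  from order_tendstoD(2)[OF tail_mass_tendsto_0[OF U] this] obtain t where t: "\<And>s. s \<ge> t \<Longrightarrow> tail_mass U s < e * l / 3"
    unfolding eventually_at_top_linorder by blast
  \<comment> \<open>\<open>2 * t\<close> puts \<open>norm z / 2\<close> beyond the tail threshold,
    \<open>6 * mass U / e\<close> makes the third piece small, and 1 keeps \<open>z\<close> away
    from the origin.\<close>
  define S where "S = max 1 (max (2 * t) (6 * mass U / e))"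
  have S: "S \<ge> 1" "S \<ge> 2 * t" "S \<ge> 6 * mass U / e" by (auto simp: S_def)
  have "newt U z \<le> e" if z: "norm z \<ge> S" for z
  proof -
    have z0: "norm z > 0" using z S by linarith
    have "B\<^sup>2 * inverse_norm_mass l \<le> (B\<^sup>2 + 1) * (e / (3 * (B\<^sup>2 + 1)))"
      using li by (intro mult_mono) auto
    also have "\<dots> = e / 3" using B1 unfolding times_divide_eq_right by (subst mult.commute[of 3]) (rule nonzero_mult_divide_mult_cancel_left, simp)
    finally have 1: "B\<^sup>2 * inverse_norm_mass l \<le> e / 3" .
    have "tail_mass U (norm z / 2) < e * l / 3" using z S by (intro t) simp
    then have 2: "tail_mass U (norm z / 2) / l \<le> e / 3" using l by (simp add: field_simps)
    have "6 * mass U / e \<le> norm z" using z S by linarith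
    then have 3: "2 / norm z * mass U \<le> e / 3" using e z0 by (simp add: field_simps)
    show ?thesis using newt_split_bound(1)[OF U B l z0] 1 2 3 by linarith
  qed
  then show ?thesis using that[of S] S by simp
qed

section \<open>Estimates for multi-bump functions\<close>


text \<open>Boundedness takes the place of Hardy's inequality, so a single rescaled bump can be
  treated without mentioning its weak gradient.\<close>

lemma bounded_newt_integrable:
  fixes U :: "real^3 \<Rightarrow> real"
  assumes U: "L2 U" and B: "\<And>x. \<bar>U x\<bar> \<le> B"
  shows "integrable lborel (\<lambda>y. (U y)\<^sup>2 / norm (x - y))"
proof (rule Bochner_Integration.integrable_bound)
  have [measurable]: "U \<in> borel_measurable borel" using U by auto
  show "integrable lborel (\<lambda>y. B\<^sup>2 * (indicator (ball 0 1) (x - y) / norm (x - y)) + (U y)\<^sup>2)"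
    using lborel_reflect(1)[OF inverse_norm_borel[of 1], of x] inverse_norm_locally_integrable L2_integrable[OF U]
    by (intro Bochner_Integration.integrable_add Bochner_Integration.integrable_mult_right) auto
  show "(\<lambda>y. (U y)\<^sup>2 / norm (x - y)) \<in> borel_measurable lborel" by measurable
  show "AE y in lborel. norm ((U y)\<^sup>2 / norm (x - y)) \<le> norm (B\<^sup>2 * (indicator (ball 0 1) (x - y) / norm (x - y)) + (U y)\<^sup>2)"
  proof (rule AE_I2)
    fix y
    have U2: "(U y)\<^sup>2 \<le> B\<^sup>2" using power_mono[OF B[of y] abs_ge_zero, of 2] by simp
    have "(U y)\<^sup>2 / norm (x - y) \<le> B\<^sup>2 * (indicator (ball 0 1) (x - y) / norm (x - y)) + (U y)\<^sup>2"
    proof (cases "norm (x - y) < 1")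
      case True
      have "(U y)\<^sup>2 / norm (x - y) \<le> B\<^sup>2 / norm (x - y)" by (rule divide_right_mono[OF U2]) simp
      then show ?thesis using True by (simp add: add_increasing2)
    next
      case False
      then have "1 \<le> norm (x - y)" "norm (x - y) > 0" by linarith+
      then have "(U y)\<^sup>2 / norm (x - y) \<le> (U y)\<^sup>2 / 1" by (intro divide_left_mono[OF _ zero_le_power2 mult_pos_pos]) simp_all
      then show ?thesis using False by simp
    qed
    then show "norm ((U y)\<^sup>2 / norm (x - y)) \<le> norm (B\<^sup>2 * (indicator (ball 0 1) (x - y) / norm (x - y)) + (U y)\<^sup>2)"
      by simp
  qed
qed

section \<open>Rescaled bumps\<close>

lemma integral_rescaled:
  fixes g :: "real^3 \<Rightarrow> real"
  assumes g: "g \<in> borel_measurable borel" and s: "s > 0"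
  shows "(\<integral>y. g (s *\<^sub>R (y - x)) \<partial>lborel) = (\<integral>y. g y \<partial>lborel) / s ^ 3"
    and "integrable lborel (\<lambda>y. g (s *\<^sub>R (y - x))) \<longleftrightarrow> integrable lborel g"
proof -
  have *: "(\<lambda>y. g (- (s *\<^sub>R x) + s *\<^sub>R y)) = (\<lambda>y. g (s *\<^sub>R (y - x)))"
    by (simp add: scaleR_diff_right)
  have s': "s \<noteq> 0" using s by simp
  show "integrable lborel (\<lambda>y. g (s *\<^sub>R (y - x))) \<longleftrightarrow> integrable lborel g"
    using integrable_lborel_affine(1)[OF g s', of "- (s *\<^sub>R x)"] unfolding * .
  show "(\<integral>y. g (s *\<^sub>R (y - x)) \<partial>lborel) = (\<integral>y. g y \<partial>lborel) / s ^ 3"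
    using integrable_lborel_affine(2)[OF g s', of "- (s *\<^sub>R x)"] s unfolding * by simp
qed

text \<open>Rescaling the volume divides by \<open>s ^ 3\<close> and rescaling the kernel gives back
  one factor \<open>s\<close>.\<close>

lemma newt_rescaled:
  fixes U :: "real^3 \<Rightarrow> real"
  assumes [measurable]: "U \<in> borel_measurable borel" and s: "s > 0"
  shows "newt (\<lambda>y. U (s *\<^sub>R (y - x))) z = newt U (s *\<^sub>R (z - x)) / s\<^sup>2"
proof -
  define g where "g w = (U w)\<^sup>2 / norm (s *\<^sub>R (z - x) - w)" for w
  have gm: "g \<in> borel_measurable borel" unfolding g_def[abs_def] by measurable
  have "(U (s *\<^sub>R (y - x)))\<^sup>2 / norm (z - y) = s * g (s *\<^sub>R (y - x))" for y
  proof -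
    have "s *\<^sub>R (z - x) - s *\<^sub>R (y - x) = s *\<^sub>R (z - y)" by (simp add: algebra_simps)
    then have "norm (s *\<^sub>R (z - x) - s *\<^sub>R (y - x)) = s * norm (z - y)" using s by simp
    then show ?thesis using s by (simp add: g_def)
  qed
  then have "newt (\<lambda>y. U (s *\<^sub>R (y - x))) z = s * (\<integral>y. g (s *\<^sub>R (y - x)) \<partial>lborel)" by (simp add: newt_def)
  also have "\<dots> = newt U (s *\<^sub>R (z - x)) / s\<^sup>2"
    unfolding integral_rescaled(1)[OF gm s] using s
    by (simp add: newt_def g_def[abs_def] power2_eq_square power3_eq_cube)
  finally show ?thesis .
qed

text \<open>A factor 2 separates \<open>w\<close> from the sum, and Cauchy-Schwarz for
  \<open>m\<close> summands gives the factor \<open>m\<close>.\<close>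

lemma sum_plus_square_le:
  fixes f :: "nat \<Rightarrow> real"
  assumes "m > 0"
  shows "((\<Sum>i<m. f i) + w)\<^sup>2 \<le> 2 * real m * ((\<Sum>i<m. (f i)\<^sup>2) + w\<^sup>2)"
proof -
  have "((\<Sum>i<m. f i) + w)\<^sup>2 \<le> 2 * (\<Sum>i<m. f i)\<^sup>2 + 2 * w\<^sup>2"
    using zero_le_power2[of "(\<Sum>i<m. f i) - w"] by (simp add: power2_sum power2_diff)
  moreover have "(\<Sum>i<m. f i)\<^sup>2 \<le> (\<Sum>i<m. (f i)\<^sup>2) * real m"
    using sum_squared_le_sum_of_squares[of f "{..<m}"] by simp
  moreover have "1 * w\<^sup>2 \<le> real m * w\<^sup>2" using assms by (intro mult_right_mono) auto
  ultimately show ?thesis by (simp add: algebra_simps)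
qed

text \<open>A bump of amplitude \<open>s\<^sup>2 / sqrt a\<close> and width \<open>1 / s\<close> has
  mass of order \<open>s / a\<close>, so both mass estimates carry this factor. The remainder
  \<open>w\<close> enters through \<open>\<theta>\<close>: its mass is at most
  \<open>\<theta> / s ^ 3\<close>, on the scale of a rescaled bump, and its potential is at most
  \<open>\<theta> / s\<^sup>2\<close> by Hardy's inequality.\<close>

lemma bump_estimates:
  fixes U u w :: "real^3 \<Rightarrow> real" and xs :: "nat \<Rightarrow> real^3"
  assumes U: "L2 U" and U0: "\<And>x. U x \<ge> 0" and B: "\<And>x. \<bar>U x\<bar> \<le> B"
    and w: "h1 w H" and th: "s ^ 3 * mass w \<le> \<theta>" "s * mass (\<lambda>x. norm (H x)) \<le> \<theta>"
    and pos: "s > 0" "a > 0" "m > 0" and u: "h1 u G"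
    and ae: "AE y in lborel. u y = s\<^sup>2 / sqrt a * ((\<Sum>i<m. U (s *\<^sub>R (y - xs i))) + w y)"
  shows "\<And>A t. A \<in> sets borel \<Longrightarrow> (\<And>i y. i < m \<Longrightarrow> y \<in> A \<Longrightarrow> dist (xs i) y \<ge> t) \<Longrightarrow>
      (\<integral>y. indicator A y * (u y)\<^sup>2 \<partial>lborel) \<le> (s / a) * (2 * real m * (real m * tail_mass U (s * t) + \<theta>))"
    and "\<And>j c \<rho>. j < m \<Longrightarrow> dist (xs j) c \<le> \<rho> / 2 \<Longrightarrow>
      (s / a) * ((mass U - tail_mass U (s * (\<rho> / 2))) / 2 - \<theta>) \<le> (\<integral>y. indicator (ball c \<rho>) y * (u y)\<^sup>2 \<partial>lborel)"
    and "\<And>z. a * newt u z \<le> 2 * real m * s\<^sup>2 * ((\<Sum>i<m. newt U (s *\<^sub>R (z - xs i))) + \<theta>)"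
proof -
  let ?U = "\<lambda>i y. U (s *\<^sub>R (y - xs i))"
  have Um[measurable]: "U \<in> borel_measurable borel" using U by auto
  have Lw: "L2 w" and Lu: "L2 u" by (rule h1_L2(1)[OF w], rule h1_L2(1)[OF u])
  have pU: "integrable lborel (\<lambda>y. (U y)\<^sup>2)" by (rule L2_integrable[OF U])
  have pw: "integrable lborel (\<lambda>y. (w y)\<^sup>2)" and pu: "integrable lborel (\<lambda>y. (u y)\<^sup>2)"
    by (rule L2_integrable[OF Lw], rule L2_integrable[OF Lu])
  have LUi: "L2 (?U i)" for i
    unfolding L2_def using integral_rescaled(2)[of "\<lambda>y. (U y)\<^sup>2" s "xs i"] pU pos by auto
  have pUi: "integrable lborel (\<lambda>y. (?U i y)\<^sup>2)" for i by (rule L2_integrable[OF LUi])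
  define \<kappa> where "\<kappa> = s ^ 4 / a"
  have k: "\<kappa> > 0" using pos by (simp add: \<kappa>_def)
  have kk: "(s\<^sup>2 / sqrt a)\<^sup>2 = \<kappa>" using pos by (simp add: \<kappa>_def power_divide)
  \<comment> \<open>Squared amplitude times the volume factor \<open>1 / s ^ 3\<close> is
    \<open>s / a\<close>.\<close>
  have ksa: "\<kappa> * (t / s ^ 3) = (s / a) * t" for t
    using pos by (simp add: \<kappa>_def power4_eq_xxxx power3_eq_cube)
  have mw: "mass w \<le> \<theta> / s ^ 3" using th(1) pos by (simp add: field_simps)
  have upper: "AE y in lborel. (u y)\<^sup>2 \<le> \<kappa> * (2 * real m * ((\<Sum>i<m. (?U i y)\<^sup>2) + (w y)\<^sup>2))"
    using ae
  proof eventually_elim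
    case (elim y)
    then show ?case
      unfolding elim power_mult_distrib kk
      by (intro mult_left_mono sum_plus_square_le) (use pos k in auto)
  qed
  show "(\<integral>y. indicator A y * (u y)\<^sup>2 \<partial>lborel) \<le> (s / a) * (2 * real m * (real m * tail_mass U (s * t) + \<theta>))"
    if A: "A \<in> sets borel" and far: "\<And>i y. i < m \<Longrightarrow> y \<in> A \<Longrightarrow> dist (xs i) y \<ge> t" for A t
  proof -
    let ?T = "\<lambda>y. indicator {y. norm y \<ge> s * t} y * (U y)\<^sup>2"
    have cl: "{y::real^3. norm y \<ge> s * t} \<in> sets borel" by (rule borel_closed[OF closed_outside])
    have iT: "integrable lborel ?T" by (rule integrable_indicator_times[OF pU cl])
    have Tm: "?T \<in> borel_measurable borel" using cl by (intro borel_measurable_times borel_measurable_indicator) auto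
    have iTi: "integrable lborel (\<lambda>y. ?T (s *\<^sub>R (y - xs i)))" for i
      using integral_rescaled(2)[OF Tm pos(1)] iT by blast
    have "(\<integral>y. indicator A y * (u y)\<^sup>2 \<partial>lborel) \<le>
       (\<integral>y. \<kappa> * (2 * real m * ((\<Sum>i<m. ?T (s *\<^sub>R (y - xs i))) + (w y)\<^sup>2)) \<partial>lborel)"
    proof (rule integral_mono_AE)
      show "integrable lborel (\<lambda>y. indicator A y * (u y)\<^sup>2)" by (rule integrable_indicator_times[OF pu A])
      show "integrable lborel (\<lambda>y. \<kappa> * (2 * real m * ((\<Sum>i<m. ?T (s *\<^sub>R (y - xs i))) + (w y)\<^sup>2)))"
        by (intro Bochner_Integration.integrable_mult_right Bochner_Integration.integrable_add
            Bochner_Integration.integrable_sum iTi pw)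
      show "AE y in lborel. indicator A y * (u y)\<^sup>2 \<le> \<kappa> * (2 * real m * ((\<Sum>i<m. ?T (s *\<^sub>R (y - xs i))) + (w y)\<^sup>2))"
        using upper
      proof eventually_elim
        case (elim y)
        show ?case
        proof (cases "y \<in> A")
          case True
          have "(?U i y)\<^sup>2 = ?T (s *\<^sub>R (y - xs i))" if "i < m" for i
            using far[OF that True] pos by (simp add: dist_norm norm_minus_commute)
          then have "(\<Sum>i<m. (?U i y)\<^sup>2) = (\<Sum>i<m. ?T (s *\<^sub>R (y - xs i)))" by (intro sum.cong) auto
          then show ?thesis using elim True by simp
        next
          case False
          then show ?thesis using k by (simp add: sum_nonneg)
        qed
      qed
    qed
    also have "\<dots> = \<kappa> * (2 * real m * ((\<Sum>i<m. (\<integral>y. ?T (s *\<^sub>R (y - xs i)) \<partial>lborel)) + mass w))"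
      unfolding integral_mult_right_zero
      by (subst Bochner_Integration.integral_add[OF Bochner_Integration.integrable_sum[OF iTi] pw],
          subst Bochner_Integration.integral_sum[OF iTi]) (rule refl)
    also have "\<dots> = \<kappa> * (2 * real m * (real m * (tail_mass U (s * t) / s ^ 3) + mass w))"
      unfolding integral_rescaled(1)[OF Tm pos(1)] by simp
    also have "\<dots> \<le> \<kappa> * (2 * real m * (real m * (tail_mass U (s * t) / s ^ 3) + \<theta> / s ^ 3))"
      using mw k by (intro mult_left_mono add_left_mono) auto
    also have "\<dots> = \<kappa> * ((2 * real m * (real m * tail_mass U (s * t) + \<theta>)) / s ^ 3)"
      by (simp only: add_divide_distrib[symmetric] times_divide_eq_right)
    also have "\<dots> = (s / a) * (2 * real m * (real m * tail_mass U (s * t) + \<theta>))" by (rule ksa)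
    finally show ?thesis .
  qed
  show "(s / a) * ((mass U - tail_mass U (s * (\<rho> / 2))) / 2 - \<theta>) \<le> (\<integral>y. indicator (ball c \<rho>) y * (u y)\<^sup>2 \<partial>lborel)"
    if j: "j < m" and near: "dist (xs j) c \<le> \<rho> / 2" for j c \<rho>
  proof -
    let ?T = "\<lambda>y. indicator {y. norm y \<ge> s * (\<rho> / 2)} y * (U y)\<^sup>2"
    have cl: "{y::real^3. norm y \<ge> s * (\<rho> / 2)} \<in> sets borel" by (rule borel_closed[OF closed_outside])
    have iT: "integrable lborel ?T" by (rule integrable_indicator_times[OF pU cl])
    have Tm: "?T \<in> borel_measurable borel" using cl by (intro borel_measurable_times borel_measurable_indicator) auto
    have iTj: "integrable lborel (\<lambda>y. ?T (s *\<^sub>R (y - xs j)))"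
      using integral_rescaled(2)[OF Tm pos(1)] iT by blast
    have "(s / a) * ((mass U - tail_mass U (s * (\<rho> / 2))) / 2 - \<theta>) = \<kappa> * (((mass U - tail_mass U (s * (\<rho> / 2))) / 2 - \<theta>) / s ^ 3)"
      by (rule ksa[symmetric])
    also have "\<dots> = \<kappa> * ((1/2) * (mass U / s ^ 3 - tail_mass U (s * (\<rho> / 2)) / s ^ 3) - \<theta> / s ^ 3)"
      by (simp add: diff_divide_distrib)
    also have "\<dots> \<le> \<kappa> * ((1/2) * (mass U / s ^ 3 - tail_mass U (s * (\<rho> / 2)) / s ^ 3) - mass w)"
      using mw k by (intro mult_left_mono diff_left_mono) auto
    also have "\<dots> = \<kappa> * ((1/2) * ((\<integral>y. (?U j y)\<^sup>2 \<partial>lborel) - (\<integral>y. ?T (s *\<^sub>R (y - xs j)) \<partial>lborel)) - mass w)"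
      using integral_rescaled(1)[OF Tm pos(1), of "xs j"] integral_rescaled(1)[of "\<lambda>y. (U y)\<^sup>2" s "xs j"] pos by simp
    also have "\<dots> = (\<integral>y. \<kappa> * ((1/2) * ((?U j y)\<^sup>2 - ?T (s *\<^sub>R (y - xs j))) - (w y)\<^sup>2) \<partial>lborel)"
    proof -
      have d: "integrable lborel (\<lambda>y. (?U j y)\<^sup>2 - ?T (s *\<^sub>R (y - xs j)))"
        by (rule Bochner_Integration.integrable_diff[OF pUi iTj])
      show ?thesis
        by (simp only: integral_mult_right_zero Bochner_Integration.integral_diff[OF Bochner_Integration.integrable_mult_right[OF d] pw]
            Bochner_Integration.integral_diff[OF pUi iTj])
    qed
    also have "\<dots> \<le> (\<integral>y. indicator (ball c \<rho>) y * (u y)\<^sup>2 \<partial>lborel)"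
    proof (rule integral_mono_AE)
      show "integrable lborel (\<lambda>y. \<kappa> * ((1/2) * ((?U j y)\<^sup>2 - ?T (s *\<^sub>R (y - xs j))) - (w y)\<^sup>2))"
        by (intro Bochner_Integration.integrable_mult_right Bochner_Integration.integrable_diff pUi iTj pw)
      show "integrable lborel (\<lambda>y. indicator (ball c \<rho>) y * (u y)\<^sup>2)" by (rule integrable_indicator_times[OF pu]) simp
      show "AE y in lborel. \<kappa> * ((1/2) * ((?U j y)\<^sup>2 - ?T (s *\<^sub>R (y - xs j))) - (w y)\<^sup>2) \<le> indicator (ball c \<rho>) y * (u y)\<^sup>2"
        using ae
      proof eventually_elim
        case (elim y)
        show ?case
        \<comment> \<open>The ball of radius \<open>\<rho> / 2\<close> around \<open>xs j\<close>
          lies inside \<open>ball c \<rho>\<close>; outside it the subtracted tail cancels the bump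
          on the left.\<close>
        proof (cases "dist (xs j) y < \<rho> / 2")
          case True
          then have yb: "y \<in> ball c \<rho>" using near dist_triangle[of c y "xs j"] by (simp add: dist_commute)
          have T0: "?T (s *\<^sub>R (y - xs j)) = 0"
            using True pos by (simp add: dist_norm norm_minus_commute)
          \<comment> \<open>Positivity lets bump \<open>j\<close> bound the whole sum S from below,
            and the square of S + w is at least half the square of S minus the square of w.\<close>
          have "(1/2) * (?U j y)\<^sup>2 - (w y)\<^sup>2 \<le> ((\<Sum>i<m. ?U i y) + w y)\<^sup>2"
          proof -
            have "?U j y \<le> (\<Sum>i<m. ?U i y)" using U0 j by (intro member_le_sum) auto
            then have "(?U j y)\<^sup>2 \<le> (\<Sum>i<m. ?U i y)\<^sup>2" using U0 by (intro power_mono) auto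
            moreover have "0 \<le> ((\<Sum>i<m. ?U i y) + 2 * w y)\<^sup>2" by simp
            ultimately show ?thesis by (simp add: power2_sum power_mult_distrib)
          qed
          then have "\<kappa> * ((1/2) * (?U j y)\<^sup>2 - (w y)\<^sup>2) \<le> (u y)\<^sup>2"
            unfolding elim power_mult_distrib kk using k by (intro mult_left_mono) auto
          then show ?thesis unfolding T0 using yb by simp
        next
          case False
          then have T1: "?T (s *\<^sub>R (y - xs j)) = (?U j y)\<^sup>2"
            using pos by (simp add: dist_norm norm_minus_commute not_less)
          have "\<kappa> * ((1/2) * ((?U j y)\<^sup>2 - ?T (s *\<^sub>R (y - xs j))) - (w y)\<^sup>2) = - (\<kappa> * (w y)\<^sup>2)"
            unfolding T1 by simp
          also have "\<dots> \<le> 0" using k by simp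
          also have "0 \<le> indicator (ball c \<rho>) y * (u y)\<^sup>2" by simp
          finally show ?thesis .
        qed
      qed
    qed
    finally show ?thesis .
  qed
  show "a * newt u z \<le> 2 * real m * s\<^sup>2 * ((\<Sum>i<m. newt U (s *\<^sub>R (z - xs i))) + \<theta>)" for z
  proof -
    have iU: "integrable lborel (\<lambda>y. (?U i y)\<^sup>2 / norm (z - y))" for i by (rule bounded_newt_integrable[OF LUi B])
    have iw: "integrable lborel (\<lambda>y. (w y)\<^sup>2 / norm (z - y))" by (rule hardy(1)[OF w])
    have "newt u z \<le> (\<integral>y. \<kappa> * (2 * real m * ((\<Sum>i<m. (?U i y)\<^sup>2 / norm (z - y)) + (w y)\<^sup>2 / norm (z - y))) \<partial>lborel)"
      unfolding newt_def
    proof (rule integral_mono_AE[OF hardy(1)[OF u]])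
      show "integrable lborel (\<lambda>y. \<kappa> * (2 * real m * ((\<Sum>i<m. (?U i y)\<^sup>2 / norm (z - y)) + (w y)\<^sup>2 / norm (z - y))))"
        by (intro Bochner_Integration.integrable_mult_right Bochner_Integration.integrable_add
            Bochner_Integration.integrable_sum iU iw)
      show "AE y in lborel. (u y)\<^sup>2 / norm (z - y) \<le> \<kappa> * (2 * real m * ((\<Sum>i<m. (?U i y)\<^sup>2 / norm (z - y)) + (w y)\<^sup>2 / norm (z - y)))"
        using upper
      proof eventually_elim
        case (elim y)
        from divide_right_mono[OF elim norm_ge_zero, of "z - y"] show ?case
          by (simp only: sum_divide_distrib[symmetric] add_divide_distrib[symmetric] times_divide_eq_right)
      qed
    qed
    also have "\<dots> = \<kappa> * (2 * real m * ((\<Sum>i<m. newt (?U i) z) + newt w z))"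
      unfolding integral_mult_right_zero newt_def
      by (subst Bochner_Integration.integral_add[OF Bochner_Integration.integrable_sum[OF iU] iw],
          subst Bochner_Integration.integral_sum[OF iU]) (rule refl)
    also have "\<dots> \<le> \<kappa> * (2 * real m * ((\<Sum>i<m. newt (?U i) z) + \<theta> / s\<^sup>2))"
    proof -
      have "mass (\<lambda>x. norm (H x)) \<le> \<theta> / s" using th(2) pos by (simp add: field_simps)
      moreover have th0: "\<theta> \<ge> 0"
      proof -
        have "0 \<le> s ^ 3 * mass w" using pos by simp
        then show ?thesis using th(1) by linarith
      qed
      \<comment> \<open>The two smallness hypotheses carry the weights \<open>s ^ 3\<close> and
        \<open>s\<close>, whose geometric mean is exactly the \<open>s\<^sup>2\<close> needed for
        the potential.\<close>
      ultimately have "sqrt (mass w) * sqrt (mass (\<lambda>x. norm (H x))) \<le> sqrt (\<theta> / s ^ 3) * sqrt (\<theta> / s)"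
        using mw pos by (intro mult_mono real_sqrt_le_mono) auto
      also have "\<dots> = sqrt ((\<theta> / s\<^sup>2)\<^sup>2)"
        by (simp add: real_sqrt_mult[symmetric] power_divide power2_eq_square power3_eq_cube mult_ac)
      also have "\<dots> = \<theta> / s\<^sup>2" using th0 by simp
      finally have "newt w z \<le> \<theta> / s\<^sup>2" using hardy(2)[OF w, of z] by linarith
      then show ?thesis using k by (intro mult_left_mono add_left_mono) auto
    qed
    also have "\<dots> = (\<kappa> / s\<^sup>2) * (2 * real m * ((\<Sum>i<m. newt U (s *\<^sub>R (z - xs i))) + \<theta>))"
      by (simp only: newt_rescaled[OF Um pos(1)] sum_divide_distrib[symmetric] add_divide_distrib[symmetric]
          times_divide_eq_right times_divide_eq_left)
    finally have "a * newt u z \<le> a * ((\<kappa> / s\<^sup>2) * (2 * real m * ((\<Sum>i<m. newt U (s *\<^sub>R (z - xs i))) + \<theta>)))"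
      using pos by (intro mult_left_mono) auto
    also have "a * ((\<kappa> / s\<^sup>2) * t) = s\<^sup>2 * t" for t
      using pos by (simp add: \<kappa>_def power2_eq_square power4_eq_xxxx)
    finally show ?thesis by (simp only: mult_ac)
  qed
qed

section \<open>Nonexistence\<close>


lemma Ck_mono: "Ck k f S \<Longrightarrow> l \<le> k \<Longrightarrow> Ck l f S"
  by (induction k) (auto simp del: Ck.simps simp: le_Suc_eq dest: Ck_Suc_D)

text \<open>The distance to the surface is at most the distance to its point \<open>b\<close>, so
  the ball stays in the tube where \<open>P\<close> is of class C^4.\<close>

lemma condition_P_local_C1:
  assumes P: "condition_P P m \<Gamma> Pc \<delta>" and i: "i < m" and b: "b \<in> \<Gamma> i" and r: "r \<le> \<delta>"
  shows "x \<in> ball b r \<Longrightarrow> P differentiable (at x)" and "continuous_on (ball b r) (dd P w)"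
proof -
  let ?W = "\<Union>i<m. {x. infdist x (\<Gamma> i) < \<delta>}"
  have C4: "Ck (Suc 3) P ?W" using P by (simp add: condition_P_def eval_nat_numeral del: Ck.simps)
  have sub: "ball b r \<subseteq> ?W"
  proof
    fix x assume "x \<in> ball b r"
    then have "infdist x (\<Gamma> i) < \<delta>" using infdist_le[OF b, of x] r by (simp add: dist_commute)
    then show "x \<in> ?W" using i by blast
  qed
  have op: "open ?W" by (intro open_UN ballI open_Collect_less continuous_intros)
  have "P differentiable_on ?W" "Ck 3 (dd P w) ?W" using C4 by (simp_all only: Ck.simps)
  show "P differentiable (at x)" if "x \<in> ball b r"
  proof -
    have "x \<in> ?W" using that sub by blast
    then show ?thesis using \<open>P differentiable_on ?W\<close> at_within_open[OF _ op] unfolding differentiable_on_def by metis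
  qed
  have "Ck 0 (dd P w) ?W" by (rule Ck_mono[OF \<open>Ck 3 (dd P w) ?W\<close>]) simp
  then show "continuous_on (ball b r) (dd P w)" using sub by (simp add: continuous_on_subset)
qed

text \<open>Take \<open>b i\<close> of maximal norm, expand the square of
  \<open>norm (b i - b j)\<close> and use \<open>norm (b j) \<le> norm (b i)\<close>: the component
  of \<open>b j - b i\<close> along \<open>- b i\<close> is at least half that square. The index
  \<open>l\<close> stands for one further centre, whose attraction is kept quantitatively.\<close>

lemma extremal_center:
  fixes b :: "nat \<Rightarrow> 'a::real_inner"
  assumes m: "2 \<le> m" and distinct: "\<forall>i<m. \<forall>j<m. i \<noteq> j \<longrightarrow> b i \<noteq> b j"
  shows "\<exists>i l d. i < m \<and> l < m \<and> l \<noteq> i \<and> 0 < d \<and>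
    (\<forall>j<m. j \<noteq> i \<longrightarrow> dist (b i) (b j) \<ge> d \<and> (b j - b i) \<bullet> (- b i) \<ge> d\<^sup>2 / 2)"
proof -
  have "0 \<in> {..<m}" using m by simp
  then have "finite ((\<lambda>j. norm (b j)) ` {..<m})" "(\<lambda>j. norm (b j)) ` {..<m} \<noteq> {}" by blast+
  from Max_in[OF this] obtain i where i: "i < m" "norm (b i) = Max ((\<lambda>j. norm (b j)) ` {..<m})" by auto
  have max: "norm (b j) \<le> norm (b i)" if "j < m" for j using that i(2) by simp
  define l where "l = (if i = 0 then 1 else (0::nat))"
  have l: "l < m" "l \<noteq> i" using m by (auto simp: l_def)
  define J where "J = {j. j < m \<and> j \<noteq> i}"
  have J: "finite J" "J \<noteq> {}" using l by (auto simp: J_def)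
  define d where "d = Min ((\<lambda>j. dist (b i) (b j)) ` J)"
  have d0: "d > 0" unfolding d_def using J distinct[rule_format, OF i(1)]
    by (subst Min_gr_iff) (auto simp: J_def)
  have dle: "d \<le> dist (b i) (b j)" if "j < m" "j \<noteq> i" for j
    unfolding d_def using J that by (intro Min_le) (auto simp: J_def)
  have "(b j - b i) \<bullet> (- b i) \<ge> d\<^sup>2 / 2" if j: "j < m" "j \<noteq> i" for j
  proof -
    have "d\<^sup>2 \<le> (norm (b i - b j))\<^sup>2" using dle[OF j] d0 by (intro power_mono) (auto simp: dist_norm)
    moreover have "(norm (b j))\<^sup>2 \<le> (norm (b i))\<^sup>2" using max[OF j(1)] by (intro power_mono) auto
    moreover have "(norm (b i - b j))\<^sup>2 = (norm (b i))\<^sup>2 + (norm (b j))\<^sup>2 - 2 * (b i \<bullet> b j)"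
      by (simp add: power2_norm_eq_inner inner_diff inner_commute)
    moreover have "(b j - b i) \<bullet> (- b i) = (norm (b i))\<^sup>2 - b i \<bullet> b j"
      by (simp add: power2_norm_eq_inner inner_diff inner_commute)
    ultimately show ?thesis by linarith
  qed
  then show ?thesis using i(1) l d0 dle
    by - (rule exI[of _ i], rule exI[of _ l], rule exI[of _ d], simp)
qed

lemma tail_mass_eventually_small:
  assumes "L2 U" "e > 0"
  obtains t where "t > 0" "\<And>s. s \<ge> t \<Longrightarrow> tail_mass U s \<le> e"
proof -
  from order_tendstoD(2)[OF tail_mass_tendsto_0[OF assms(1)] assms(2)]
  obtain t where t: "\<And>s. s \<ge> t \<Longrightarrow> tail_mass U s < e" unfolding eventually_at_top_linorder by blast
  have "tail_mass U s \<le> e" if "s \<ge> max t 1" for s using t[of s] that by simp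
  then show ?thesis using that[of "max t 1"] by auto
qed

text \<open>The limit of large \<open>a\<close> is expressed through sequences. A family of
  solutions indexed by all large \<open>a\<close> restricts to such a sequence, so excluding
  sequences also excludes families.\<close>

theorem theorem1p5:
  fixes P :: "real^3 \<Rightarrow> real" and m :: nat and \<Gamma> :: "nat \<Rightarrow> (real^3) set"
    and Pc :: "nat \<Rightarrow> real" and \<delta> :: real and b :: "nat \<Rightarrow> real^3"
    and U :: "real^3 \<Rightarrow> real"
  assumes U: "choquard_ground_state U"
    and condP: "condition_P P m \<Gamma> Pc \<delta>"
    and m2: "m \<ge> 2"
    and nondeg: "\<forall>i<m. b i \<in> \<Gamma> i \<and> nondegenerate P (\<Gamma> i) (b i)"
    and crit: "\<forall>i<m. \<forall>\<tau>1 \<tau>2. principal_dirs (\<Gamma> i) (b i) \<tau>1 \<tau>2 \<longrightarrow>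
                 dd (lap P) \<tau>1 (b i) = 0 \<and> dd (lap P) \<tau>2 (b i) = 0"
    and distinct: "\<forall>i<m. \<forall>j<m. i \<noteq> j \<longrightarrow> b i \<noteq> b j"
  shows "\<exists>a0>0. \<not> (\<exists>(a :: nat \<Rightarrow> real) (u :: nat \<Rightarrow> real^3 \<Rightarrow> real) (\<mu> :: nat \<Rightarrow> real)
                    (x :: nat \<Rightarrow> nat \<Rightarrow> real^3) (\<omega> :: nat \<Rightarrow> real^3 \<Rightarrow> real)
                    (G\<omega> :: nat \<Rightarrow> real^3 \<Rightarrow> real^3).
            (\<forall>n. a n \<ge> a0) \<and> filterlim a at_top sequentially \<and>
            (\<forall>n. solves_Q P (a n) (u n) (\<mu> n)) \<and> (\<forall>n. \<mu> n < 0) \<and>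
            (\<forall>n y. u n y = (- \<mu> n) / sqrt (a n) *
                 ((\<Sum>i<m. U (sqrt (- \<mu> n) *\<^sub>R (y - x n i))) + \<omega> n y)) \<and>
            (\<forall>n. H1_grad (\<omega> n) (G\<omega> n)) \<and>
            ((\<lambda>n. (- \<mu> n) powr (3/2) *
                 (LINT y|lebesgue. - (1 / \<mu> n) * (norm (G\<omega> n y))^2 + (\<omega> n y)^2))
               \<longlonglongrightarrow> 0) \<and>
            (\<forall>i<m. (\<lambda>n. x n i) \<longlonglongrightarrow> b i))"
proof (intro exI[of _ 1] conjI notI)
  \<comment> \<open>Any positive \<open>a0\<close> serves, since the contradiction arises at a late
    index of a sequence with \<open>a n\<close> tending to infinity.\<close>
  show "(0::real) < 1" by simp
  assume "\<exists>(a :: nat \<Rightarrow> real) (u :: nat \<Rightarrow> real^3 \<Rightarrow> real) (\<mu> :: nat \<Rightarrow> real)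
                    (x :: nat \<Rightarrow> nat \<Rightarrow> real^3) (\<omega> :: nat \<Rightarrow> real^3 \<Rightarrow> real)
                    (G\<omega> :: nat \<Rightarrow> real^3 \<Rightarrow> real^3).
            (\<forall>n. a n \<ge> 1) \<and> filterlim a at_top sequentially \<and>
            (\<forall>n. solves_Q P (a n) (u n) (\<mu> n)) \<and> (\<forall>n. \<mu> n < 0) \<and>
            (\<forall>n y. u n y = (- \<mu> n) / sqrt (a n) *
                 ((\<Sum>i<m. U (sqrt (- \<mu> n) *\<^sub>R (y - x n i))) + \<omega> n y)) \<and>
            (\<forall>n. H1_grad (\<omega> n) (G\<omega> n)) \<and>
            ((\<lambda>n. (- \<mu> n) powr (3/2) *
                 (LINT y|lebesgue. - (1 / \<mu> n) * (norm (G\<omega> n y))^2 + (\<omega> n y)^2))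
               \<longlonglongrightarrow> 0) \<and>
            (\<forall>i<m. (\<lambda>n. x n i) \<longlonglongrightarrow> b i)"
  then obtain a :: "nat \<Rightarrow> real" and u :: "nat \<Rightarrow> real^3 \<Rightarrow> real" and \<mu> :: "nat \<Rightarrow> real"
    and x :: "nat \<Rightarrow> nat \<Rightarrow> real^3" and \<omega> :: "nat \<Rightarrow> real^3 \<Rightarrow> real" and G\<omega> :: "nat \<Rightarrow> real^3 \<Rightarrow> real^3"
    where a: "\<And>n. a n \<ge> 1" "filterlim a at_top sequentially"
      and sol: "\<And>n. solves_Q P (a n) (u n) (\<mu> n)" and mu: "\<And>n. \<mu> n < 0"
      and form: "\<And>n y. u n y = (- \<mu> n) / sqrt (a n) *
                 ((\<Sum>i<m. U (sqrt (- \<mu> n) *\<^sub>R (y - x n i))) + \<omega> n y)"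
      and om: "\<And>n. H1_grad (\<omega> n) (G\<omega> n)"
      and small: "(\<lambda>n. (- \<mu> n) powr (3/2) *
                 (LINT y|lebesgue. - (1 / \<mu> n) * (norm (G\<omega> n y))^2 + (\<omega> n y)^2)) \<longlonglongrightarrow> 0"
      and xb: "\<And>i. i < m \<Longrightarrow> (\<lambda>n. x n i) \<longlonglongrightarrow> b i"
    by blast

  have Ucont: "continuous_on UNIV U" and Upos: "\<And>x. U x > 0" and Umax: "\<And>x. U x \<le> U 0"
    and Uint: "integrable lebesgue (\<lambda>x. (U x)\<^sup>2)"
  proof -
    obtain GU where "H1_grad U GU" "continuous_on UNIV U" "\<forall>x. U x > 0" "\<forall>x. U x \<le> U 0"
      using U unfolding choquard_ground_state_def by blast
    then show "continuous_on UNIV U" "\<And>x. U x > 0" "\<And>x. U x \<le> U 0" "integrable lebesgue (\<lambda>x. (U x)\<^sup>2)"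
      by (simp_all add: H1_grad_def)
  qed
  have Um: "U \<in> borel_measurable borel" by (rule continuous_borel[OF Ucont])
  have LU: "L2 U"
    unfolding L2_def using Um Uint integrable_completion[of "\<lambda>x. (U x)\<^sup>2" lborel] by simp
  have UB: "\<bar>U x\<bar> \<le> U 0" for x using Upos[of x] Umax[of x] by simp
  have Mpos: "mass U > 0"
  proof -
    have "mass U \<noteq> 0"
    proof
      assume "mass U = 0"
      then have "AE x in lborel. (U x)\<^sup>2 = 0"
        using integral_nonneg_eq_0_iff_AE[OF L2_integrable[OF LU]] by simp
      then have "AE x in (lborel :: (real^3) measure). False"
        by eventually_elim (use Upos in \<open>simp add: less_imp_neq[THEN not_sym]\<close>)
      then show False by (simp add: eventually_const_iff ae_filter_eq_bot_iff emeasure_lborel_UNIV)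
    qed
    moreover have "mass U \<ge> 0" by simp
    ultimately show ?thesis by linarith
  qed
  define M where "M = mass U"
  have M: "M > 0" using Mpos by (simp add: M_def)

  obtain i l d where il: "i < m" "l < m" "l \<noteq> i" and d: "d > 0"
    and ext: "\<forall>j<m. j \<noteq> i \<longrightarrow> dist (b i) (b j) \<ge> d \<and> (b j - b i) \<bullet> (- b i) \<ge> d\<^sup>2 / 2"
    using extremal_center[OF m2 distinct] by (elim exE conjE) (rule that)
  have dist_d: "dist (b i) (b j) \<ge> d" and inner_d: "(b j - b i) \<bullet> (- b i) \<ge> d\<^sup>2 / 2" if "j < m" "j \<noteq> i" for j
    using ext that by blast+
  have delta: "\<delta> > 0" and Pcont: "continuous_on UNIV P" using condP by (auto simp: condition_P_def)
  \<comment> \<open>The three bounds give separation \<open>6 * r \<le> d\<close> of the centres,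
    differentiability of \<open>P\<close> on the ball of radius \<open>3 * r\<close>, and a loss of
    at most half of the pull \<open>d\<^sup>2 / 2\<close> when both points move by less than
    \<open>r\<close>.\<close>
  define r where "r = min (d / 6) (min (\<delta> / 3) (d\<^sup>2 / (8 * (norm (b i) + 1))))"
  have nb: "norm (b i) + 1 > 0" by (simp add: add_nonneg_pos)
  have r: "r > 0" using d delta nb by (simp add: r_def)
  have r1: "6 * r \<le> d" "3 * r \<le> \<delta>" "r \<le> d\<^sup>2 / (8 * (norm (b i) + 1))" by (auto simp: r_def)
  have r2: "2 * r * norm (b i) \<le> d\<^sup>2 / 4"
  proof -
    have "r * (8 * (norm (b i) + 1)) \<le> d\<^sup>2" using r1(3) nb by (simp add: pos_le_divide_eq)
    then show ?thesis using r by (simp add: algebra_simps)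
  qed
  have sep: "dist (b i) (b j) \<ge> 6 * r" if "j < m" "j \<noteq> i" for j using dist_d[OF that] r1 by simp
  have pull: "(y - z) \<bullet> (- b i) \<ge> d\<^sup>2 / 4" if j: "j < m" "j \<noteq> i" and z: "dist (b i) z < r" and y: "dist (b j) y < r" for j y z
  proof -
    have "norm ((y - b j) - (z - b i)) \<le> 2 * r"
      using norm_triangle_ineq4[of "y - b j" "z - b i"] y z by (simp add: dist_norm norm_minus_commute)
    then have "norm ((y - b j) - (z - b i)) * norm (- b i) \<le> 2 * r * norm (b i)"
      by (simp add: mult_right_mono)
    then have "\<bar>((y - b j) - (z - b i)) \<bullet> (- b i)\<bar> \<le> 2 * r * norm (b i)"
      using Cauchy_Schwarz_ineq2[of "(y - b j) - (z - b i)" "- b i"] by linarith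
    moreover have "(y - z) \<bullet> (- b i) = (b j - b i) \<bullet> (- b i) + ((y - b j) - (z - b i)) \<bullet> (- b i)"
      by (simp add: inner_diff_left)
    ultimately show ?thesis using inner_d[OF j] r2 by linarith
  qed
  have bG: "b i \<in> \<Gamma> i" using nondeg il by blast
  note Ploc = condition_P_local_C1[OF condP il(1) bG r1(2)]
  define Nm where "Nm = (U 0)\<^sup>2 * inverse_norm_mass 1 + mass U"
  have Nm: "newt U z \<le> Nm" for z
  proof -
    \<comment> \<open>An arbitrary nonzero vector instantiates the premise on \<open>z\<close> that
      both bounds of \<open>newt_split_bound\<close> share.\<close>
    have one: "norm (axis 1 1 :: real^3) > 0" by simp
    show ?thesis unfolding Nm_def by (rule newt_split_bound(2)[OF LU UB zero_less_one order_refl one])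
  qed
  have Nm0: "Nm \<ge> 0" using order_trans[OF newt_nonneg Nm[of 0]] .
  \<comment> \<open>The factor in the third part of \<open>bump_estimates\<close>, with each ground
    state potential replaced by its bound \<open>Nm\<close> and the remainder by 1.\<close>
  define CN where "CN = 2 * real m * (real m * Nm + 1)"
  have CN: "CN \<ge> 0" using Nm0 by (simp add: CN_def)
  have g4: "d\<^sup>2 / 4 > 0" using d by simp
  have sep_all: "\<forall>j<m. j \<noteq> i \<longrightarrow> dist (b i) (b j) \<ge> 6 * r" using sep by blast
  have pull_all: "\<forall>j<m. j \<noteq> i \<longrightarrow> (\<forall>x\<in>ball (b i) r. \<forall>y\<in>ball (b j) r. (y - x) \<bullet> (- b i) \<ge> d\<^sup>2 / 4)"
    using pull by simp
  have Pd: "\<forall>x\<in>ball (b i) (3 * r). P differentiable (at x)" and Pdc: "\<forall>w. continuous_on (ball (b i) (3 * r)) (dd P w)"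
    using Ploc by blast+
  obtain \<kappa> C where \<kappa>: "\<kappa> > 0" and C: "C > 0" and balance:
    "\<forall>u G lam c. h1 u G \<and> mass u = 1 \<and> lam \<ge> C \<and> c > 0 \<and>
      (\<forall>\<phi>. test_fun \<phi> \<longrightarrow> (\<integral>x. (\<Sum>b\<in>Basis. (G x \<bullet> b) * dd \<phi> b x) +
          ((P x + lam) * u x - c * newt u x * u x) * \<phi> x \<partial>lborel) = 0) \<and>
      (\<forall>x. c * newt u x \<le> CN * lam) \<and>
      (\<forall>x. r / 2 \<le> dist (b i) x \<and> dist (b i) x \<le> 4 * r \<longrightarrow> c * newt u x \<le> lam / 4) \<longrightarrow>
      \<kappa> * c * ((\<integral>x. indicator (ball (b i) r) x * (u x)\<^sup>2 \<partial>lborel) * (\<integral>x. indicator (ball (b l) r) x * (u x)\<^sup>2 \<partial>lborel))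
       \<le> C + C * c * (\<integral>x. indicator {x. \<forall>j<m. dist (b j) x \<ge> r / 2} x * (u x)\<^sup>2 \<partial>lborel)"
    using force_balance[OF il r sep_all pull_all g4 CN Pcont Pd Pdc] by (elim exE conjE) (rule that)

  have mpos: "m > 0" using m2 by simp
  \<comment> \<open>The total mass 1 is at most \<open>(s / A) * Q0\<close>, so \<open>s\<close>
    grows at least linearly in \<open>A\<close>.\<close>
  define Q0 where "Q0 = 2 * real m * (real m * M + 1)"
  have Q0: "Q0 > 0" using mpos M by (simp add: Q0_def add_nonneg_pos)
  \<comment> \<open>A lower bound for the mass near each centre: \<open>(s / A) * (M / 8)\<close>
    together with \<open>s / A \<ge> 1 / Q0\<close>.\<close>
  define q where "q = M / (8 * Q0)"
  have q: "q > 0" using M Q0 by (simp add: q_def)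
  \<comment> \<open>Solved from the requirement that the mass \<open>\<epsilon>\<close> away from
    the centres satisfy \<open>C * \<epsilon> \<le> \<kappa> * q\<^sup>2 / 2\<close>, given
    \<open>s / A \<le> 8 / M\<close>. This leakage then uses up at most half of the
    attraction.\<close>
  define \<tau> where "\<tau> = \<kappa> * q\<^sup>2 / (2 * C) / ((8 / M) * (2 * real m * (real m + 1)))"
  have \<tau>: "\<tau> > 0" using \<kappa> q C M mpos by (simp add: \<tau>_def)
  \<comment> \<open>Makes \<open>2 * real m * (real m + 1) * e1\<close> equal to 1/4, the fraction
    of \<open>lam\<close> that \<open>force_balance\<close> allows for the potential near the
    annulus.\<close>
  define e1 where "e1 = 1 / (8 * real m * (real m + 1))"
  have e1: "e1 > 0" using mpos by (simp add: e1_def)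
  obtain S where S: "S > 0" "\<And>z. norm z \<ge> S \<Longrightarrow> newt U z \<le> e1" using newt_tendsto_0[OF LU UB e1] by metis
  obtain t1 where t1: "t1 > 0" "\<And>s. s \<ge> t1 \<Longrightarrow> tail_mass U s \<le> M / 2"
    using tail_mass_eventually_small[OF LU, of "M / 2"] M by auto
  obtain t2 where t2: "t2 > 0" "\<And>s. s \<ge> t2 \<Longrightarrow> tail_mass U s \<le> \<tau>"
    using tail_mass_eventually_small[OF LU \<tau>] by metis
  \<comment> \<open>The entries ensure, in this order, \<open>s\<^sup>2 \<ge> C\<close>, a tail of
    at most \<open>M / 2\<close> at distance \<open>r / 2\<close>, a tail of at most
    \<open>\<tau>\<close> at distance \<open>r / 4\<close>, and a potential of at most
    \<open>e1\<close> at distance \<open>r / 4\<close>.\<close>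
  define s0 where "s0 = max (sqrt C) (max (2 * t1 / r) (max (4 * t2 / r) (4 * S / r)))"
  \<comment> \<open>The four bounds on the remainder serve, in turn, the total mass and global
    potential estimates, the core masses, the leakage, and the potential near the annulus.\<close>
  define \<theta>0 where "\<theta>0 = min 1 (min (M / 8) (min \<tau> e1))"
  have \<theta>0: "\<theta>0 > 0" using M \<tau> e1 by (simp add: \<theta>0_def)
  define \<theta> where "\<theta> n = (- \<mu> n) powr (3/2) * (LINT y|lebesgue. - (1 / \<mu> n) * (norm (G\<omega> n y))^2 + (\<omega> n y)^2)" for n
  have "\<forall>\<^sub>F n in sequentially. \<theta> n < \<theta>0" using order_tendstoD(2)[OF small \<theta>0] by (simp add: \<theta>_def)
  \<comment> \<open>The first threshold forces \<open>s > s0\<close> through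
    \<open>A \<le> s * Q0\<close>; the second contradicts the inequality derived at the end.\<close>
  moreover have "\<forall>\<^sub>F n in sequentially. a n > max (s0 * Q0) (16 * pi * C / (\<kappa> * q\<^sup>2))"
    using a(2) unfolding filterlim_at_top_dense by blast
  moreover have "\<forall>\<^sub>F n in sequentially. \<forall>j\<in>{..<m}. dist (x n j) (b j) < r / 4"
  proof (intro eventually_ball_finite ballI)
    show "\<forall>\<^sub>F n in sequentially. dist (x n j) (b j) < r / 4" if "j \<in> {..<m}" for j
      using that r by (intro tendstoD[OF xb]) auto
  qed simp
  ultimately have "\<forall>\<^sub>F n in sequentially. \<theta> n < \<theta>0 \<and> a n > max (s0 * Q0) (16 * pi * C / (\<kappa> * q\<^sup>2)) \<and>
      (\<forall>j\<in>{..<m}. dist (x n j) (b j) < r / 4)" by eventually_elim simp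
  \<comment> \<open>A single late index suffices; no limit is taken from here on.\<close>
  then obtain n where n: "\<theta> n < \<theta>0" "a n > s0 * Q0" "a n > 16 * pi * C / (\<kappa> * q\<^sup>2)"
      "\<And>j. j < m \<Longrightarrow> dist (x n j) (b j) < r / 4"
    unfolding eventually_sequentially by auto

  define s where "s = sqrt (- \<mu> n)"
  define A where "A = a n"
  define c where "c = A / (8 * pi)"
  have s: "s > 0" "s\<^sup>2 = - \<mu> n" using mu[of n] by (auto simp: s_def)
  have A: "A > 0" using a(1)[of n] by (simp add: A_def)
  have c: "c > 0" using A by (simp add: c_def)
  obtain F where F: "H1_grad (u n) F" "weak_eq P A (\<mu> n) (u n) F" "(LINT x|lebesgue. (u n x)\<^sup>2) = 1"
    using sol[of n] unfolding solves_Q_def A_def by blast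
  obtain v G where v: "h1 v G" and uv: "AE x in lebesgue. u n x = v x" and FG: "AE x in lebesgue. F x = G x"
    using H1_grad_borel_representative[OF F(1)] by metis
  obtain w H where w: "h1 w H" and \<omega>w: "AE x in lebesgue. \<omega> n x = w x" and GH: "AE x in lebesgue. G\<omega> n x = H x"
    using H1_grad_borel_representative[OF om[of n]] by metis
  have um: "u n \<in> borel_measurable lebesgue" "F \<in> borel_measurable lebesgue" using F(1) by (auto simp: H1_grad_def)
  have omm: "\<omega> n \<in> borel_measurable lebesgue" "G\<omega> n \<in> borel_measurable lebesgue" using om[of n] by (auto simp: H1_grad_def)
  have Lv: "L2 v" and Lw: "L2 w" and LH: "L2 (\<lambda>x. norm (H x))"
    by (rule h1_L2(1)[OF v], rule h1_L2(1)[OF w], rule h1_norm_L2[OF w])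
  have m1: "mass v = 1"
  proof -
    have "AE x in lebesgue. (u n x)\<^sup>2 = (v x)\<^sup>2" using uv by eventually_elim simp
    from lebesgue_integral_transfer(1)[OF borel_measurable_power[OF um(1)] _ this] show ?thesis
      using F(3) L2_measurable[OF Lv] by simp
  qed
  have aev: "AE y in lborel. v y = s\<^sup>2 / sqrt A * ((\<Sum>i<m. U (s *\<^sub>R (y - x n i))) + w y)"
  proof -
    have "AE y in lebesgue. v y = s\<^sup>2 / sqrt A * ((\<Sum>i<m. U (s *\<^sub>R (y - x n i))) + w y)"
      using uv \<omega>w by eventually_elim (use form[of n] s(2) in \<open>simp add: A_def s_def[symmetric]\<close>)
    then show ?thesis by (simp add: AE_completion_iff)
  qed
  \<comment> \<open>The power 3/2 of \<open>- \<mu> n\<close> is \<open>s ^ 3\<close> and the factor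
    before the gradient is \<open>1 / s\<^sup>2\<close>, so the assumed smallness splits into the
    two quantities that \<open>bump_estimates\<close> bounds by \<open>\<theta>0\<close>.\<close>
  have theta: "\<theta> n = s ^ 3 * mass w + s * mass (\<lambda>x. norm (H x))"
  proof -
    have "(- \<mu> n) powr (3/2) = s ^ 3"
    proof -
      have "(- \<mu> n) powr (3/2) = ((- \<mu> n) powr (1/2)) powr 3" by (simp add: powr_powr)
      also have "\<dots> = s powr 3" using mu[of n] by (simp add: s_def powr_half_sqrt)
      finally show ?thesis using s by simp
    qed
    moreover have "(LINT y|lebesgue. - (1 / \<mu> n) * (norm (G\<omega> n y))^2 + (\<omega> n y)^2) = mass (\<lambda>x. norm (H x)) / s\<^sup>2 + mass w"
    proof -
      have "(LINT y|lebesgue. - (1 / \<mu> n) * (norm (G\<omega> n y))^2 + (\<omega> n y)^2)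
         = (\<integral>y. (1 / s\<^sup>2) * (norm (H y))\<^sup>2 + (w y)\<^sup>2 \<partial>lborel)"
      proof (rule lebesgue_integral_transfer(1))
        show "(\<lambda>y. - (1 / \<mu> n) * (norm (G\<omega> n y))^2 + (\<omega> n y)^2) \<in> borel_measurable lebesgue"
          using omm by (intro borel_measurable_add borel_measurable_times borel_measurable_power borel_measurable_norm) auto
        show "(\<lambda>y. (1 / s\<^sup>2) * (norm (H y))\<^sup>2 + (w y)\<^sup>2) \<in> borel_measurable borel"
          using L2_measurable[OF Lw] L2_measurable[OF LH] by measurable
        show "AE y in lebesgue. - (1 / \<mu> n) * (norm (G\<omega> n y))^2 + (\<omega> n y)^2 = (1 / s\<^sup>2) * (norm (H y))\<^sup>2 + (w y)\<^sup>2"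
          using \<omega>w GH by eventually_elim (simp add: s(2))
      qed
      then show ?thesis using L2_integrable[OF Lw] L2_integrable[OF LH] by simp
    qed
    ultimately show ?thesis using s(1) by (simp add: \<theta>_def power2_eq_square power3_eq_cube field_simps)
  qed
  have th: "s ^ 3 * mass w \<le> \<theta>0" "s * mass (\<lambda>x. norm (H x)) \<le> \<theta>0"
  proof -
    have "0 \<le> s ^ 3 * mass w" "0 \<le> s * mass (\<lambda>x. norm (H x))" using s(1) by auto
    then show "s ^ 3 * mass w \<le> \<theta>0" "s * mass (\<lambda>x. norm (H x)) \<le> \<theta>0" using n(1) theta by linarith+
  qed
  have \<theta>le: "\<theta>0 \<le> 1" "\<theta>0 \<le> M / 8" "\<theta>0 \<le> \<tau>" "\<theta>0 \<le> e1" by (auto simp: \<theta>0_def)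
  note est = bump_estimates[OF LU less_imp_le[OF Upos] UB w th s(1) A mpos v aev]
  \<comment> \<open>The first part of \<open>bump_estimates\<close> for the whole space with
    \<open>t = 0\<close>, where the tail is the full mass of \<open>U\<close>.\<close>
  have sA: "1 \<le> (s / A) * Q0"
  proof -
    have "1 \<le> (s / A) * (2 * real m * (real m * tail_mass U (s * 0) + \<theta>0))"
      using est(1)[of UNIV 0] m1 by simp
    also have "\<dots> \<le> (s / A) * Q0"
      unfolding Q0_def M_def using s A \<theta>le by (intro mult_left_mono) auto
    finally show ?thesis .
  qed
  have sge: "s > s0"
  proof -
    have "A \<le> s * Q0" using sA A by (simp add: field_simps)
    then have "s0 * Q0 < s * Q0" using n(2) by (simp add: A_def)
    then show ?thesis using Q0 by simp
  qed
  have s_big: "s \<ge> sqrt C" "s * (r / 2) \<ge> t1" "s * (r / 4) \<ge> t2" "s * (r / 4) \<ge> S"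
  proof -
    have "s \<ge> sqrt C" "s \<ge> 2 * t1 / r" "s \<ge> 4 * t2 / r" "s \<ge> 4 * S / r" using sge by (auto simp: s0_def)
    then show "s \<ge> sqrt C" "s * (r / 2) \<ge> t1" "s * (r / 4) \<ge> t2" "s * (r / 4) \<ge> S"
      using r by (auto simp: field_simps)
  qed
  have lamC: "s\<^sup>2 \<ge> C"
  proof -
    have "(sqrt C)\<^sup>2 \<le> s\<^sup>2" using s_big(1) C by (intro power_mono) auto
    then show ?thesis using C by simp
  qed
  have core: "q \<le> (\<integral>y. indicator (ball (b j) r) y * (v y)\<^sup>2 \<partial>lborel)"
    and coreA: "(s / A) * (M / 8) \<le> (\<integral>y. indicator (ball (b j) r) y * (v y)\<^sup>2 \<partial>lborel)" if j: "j < m" for j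
  proof -
    have near: "dist (x n j) (b j) \<le> r / 2" using n(4)[OF j] r by simp
    have "M / 8 \<le> (mass U - tail_mass U (s * (r / 2))) / 2 - \<theta>0"
    proof -
      have "X / 8 \<le> (X - T) / 2 - t" if "T \<le> X / 2" "t \<le> X / 8" for X T t :: real using that by (simp add: field_simps)
      then show ?thesis using t1(2)[OF s_big(2)] \<theta>le(2) unfolding M_def by blast
    qed
    then have "(s / A) * (M / 8) \<le> (s / A) * ((mass U - tail_mass U (s * (r / 2))) / 2 - \<theta>0)"
      using s A by (intro mult_left_mono) auto
    also have "\<dots> \<le> (\<integral>y. indicator (ball (b j) r) y * (v y)\<^sup>2 \<partial>lborel)" by (rule est(2)[OF j near])
    finally show 1: "(s / A) * (M / 8) \<le> (\<integral>y. indicator (ball (b j) r) y * (v y)\<^sup>2 \<partial>lborel)" .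
    have "1 / Q0 \<le> s / A" using sA Q0 by (simp add: field_simps)
    then have "1 / Q0 * (M / 8) \<le> (s / A) * (M / 8)" using M by (intro mult_right_mono) auto
    then show "q \<le> (\<integral>y. indicator (ball (b j) r) y * (v y)\<^sup>2 \<partial>lborel)" using 1 by (simp add: q_def)
  qed
  \<comment> \<open>The mass near one centre is at most 1, which bounds \<open>s\<close> from above
    by a multiple of \<open>A\<close>; together with \<open>sA\<close> the two are
    comparable.\<close>
  have sA_le: "s / A \<le> 8 / M"
  proof -
    have "(\<integral>y. indicator (ball (b i) r) y * (v y)\<^sup>2 \<partial>lborel) \<le> mass v"
      by (intro Bochner_Integration.integral_mono integrable_indicator_times L2_integrable[OF Lv]) (auto simp: indicator_def)
    then have "(s / A) * (M / 8) \<le> 1" using coreA[OF il(1)] m1 by simp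
    then show ?thesis using M by (simp add: field_simps)
  qed
  define R where "R = {y. \<forall>j<m. dist (b j) y \<ge> r / 2}"
  have farR: "dist (x n j) y \<ge> r / 4" if "j < m" "dist (b j) y \<ge> r / 2" for j y
    using n(4)[OF that(1)] that(2) dist_triangle[of "b j" y "x n j"] by (simp add: dist_commute)
  have Rb: "R \<in> sets borel"
  proof -
    have "R = (\<Inter>j\<in>{..<m}. {y. r / 2 \<le> dist (b j) y})" using mpos by (auto simp: R_def)
    then have "closed R" by (simp, intro closed_INT ballI closed_Collect_le continuous_intros)
    then show ?thesis by simp
  qed
  define \<epsilon> where "\<epsilon> = (\<integral>y. indicator R y * (v y)\<^sup>2 \<partial>lborel)"
  have eps: "C * \<epsilon> \<le> \<kappa> * q\<^sup>2 / 2"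
  proof -
    have "\<epsilon> \<le> (s / A) * (2 * real m * (real m * tail_mass U (s * (r / 4)) + \<theta>0))"
      unfolding \<epsilon>_def by (rule est(1)[OF Rb]) (use farR in \<open>auto simp: R_def\<close>)
    also have "\<dots> \<le> (8 / M) * (2 * real m * (real m * \<tau> + \<tau>))"
      using sA_le s A t2(2)[OF s_big(3)] \<theta>le \<tau> M \<theta>0 by (intro mult_mono add_mono) auto
    also have "\<dots> = \<tau> * ((8 / M) * (2 * real m * (real m + 1)))" by (simp add: algebra_simps)
    also have "\<dots> = \<kappa> * q\<^sup>2 / (2 * C)"
    proof -
      have "(8 / M) * (2 * real m * (real m + 1)) \<noteq> 0" using M mpos by auto
      then show ?thesis unfolding \<tau>_def by (rule nonzero_eq_divide_eq[THEN iffD1]) simp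
    qed
    finally have "\<epsilon> \<le> \<kappa> * q\<^sup>2 / (2 * C)" .
    then show ?thesis using C by (simp add: field_simps)
  qed
  have pi8: "8 * pi \<ge> 1" using pi_ge_two by simp
  have cN: "c * newt v z \<le> A * newt v z" for z
  proof -
    have "c \<le> A" using A pi8 unfolding c_def by (simp add: pos_divide_le_eq)
    then show ?thesis using newt_nonneg by (intro mult_right_mono) auto
  qed
  have N1: "c * newt v z \<le> CN * s\<^sup>2" for z
  proof -
    have "(\<Sum>i<m. newt U (s *\<^sub>R (z - x n i))) \<le> (\<Sum>i<m. Nm)" by (intro sum_mono Nm)
    then have "2 * real m * s\<^sup>2 * ((\<Sum>i<m. newt U (s *\<^sub>R (z - x n i))) + \<theta>0) \<le> 2 * real m * s\<^sup>2 * (real m * Nm + 1)"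
      using \<theta>le by (intro mult_left_mono) auto
    moreover have "CN * s\<^sup>2 = 2 * real m * s\<^sup>2 * (real m * Nm + 1)" unfolding CN_def by (simp only: mult_ac)
    ultimately show ?thesis using order_trans[OF cN[of z] est(3)[of z]] by linarith
  qed
  \<comment> \<open>Points of the wide annulus stay at distance at least \<open>r / 4\<close> from
    every moving centre \<open>x n j\<close>, so each bump contributes a potential of at most
    \<open>e1\<close>.\<close>
  have N2: "c * newt v z \<le> s\<^sup>2 / 4" if z: "r / 2 \<le> dist (b i) z" "dist (b i) z \<le> 4 * r" for z
  proof -
    have "newt U (s *\<^sub>R (z - x n j)) \<le> e1" if j: "j < m" for j
    proof -
      have "r / 2 \<le> dist (b j) z"
      proof (cases "j = i")
        case False
        then show ?thesis using sep[OF j False] z(2) r dist_triangle[of "b i" "b j" z] by (simp add: dist_commute)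
      qed (use z in simp)
      then have "r / 4 \<le> norm (z - x n j)" using farR[OF j] by (simp add: dist_norm norm_minus_commute)
      then have "s * (r / 4) \<le> norm (s *\<^sub>R (z - x n j))" using s(1) by simp
      then show ?thesis using S(2) s_big(4) by simp
    qed
    then have "(\<Sum>i<m. newt U (s *\<^sub>R (z - x n i))) \<le> (\<Sum>i<m. e1)" by (intro sum_mono) auto
    then have "2 * real m * s\<^sup>2 * ((\<Sum>i<m. newt U (s *\<^sub>R (z - x n i))) + \<theta>0) \<le> 2 * real m * s\<^sup>2 * (real m * e1 + e1)"
      using \<theta>le by (intro mult_left_mono) auto
    also have "\<dots> = s\<^sup>2 * (2 * real m * (real m + 1) * e1)" by (simp add: algebra_simps)
    also have "2 * real m * (real m + 1) * e1 = 1 / 4" 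
    proof -
      have "X * e = 1 / 4" if "e = 1 / (4 * X)" "X \<noteq> 0" for X e :: real using that by simp
      moreover have "e1 = 1 / (4 * (2 * real m * (real m + 1)))" by (simp add: e1_def)
      moreover have "2 * real m * (real m + 1) \<noteq> 0" using mpos by (simp add: add_nonneg_eq_0_iff)
      ultimately show ?thesis by blast
    qed
    finally have "2 * real m * s\<^sup>2 * ((\<Sum>i<m. newt U (s *\<^sub>R (z - x n i))) + \<theta>0) \<le> s\<^sup>2 * (1 / 4)" .
    then show ?thesis using order_trans[OF cN[of z] est(3)[of z]] by linarith
  qed
  have weak: "(\<integral>x. (\<Sum>b\<in>Basis. (G x \<bullet> b) * dd \<phi> b x) + ((P x + s\<^sup>2) * v x - c * newt v x * v x) * \<phi> x \<partial>lborel) = 0"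
    if "test_fun \<phi>" for \<phi>
    using weak_eq_borel_representative[OF um v uv FG F(2) Pcont that] by (simp only: s(2) c_def)
  have final: "\<kappa> * c * ((\<integral>x. indicator (ball (b i) r) x * (v x)\<^sup>2 \<partial>lborel) * (\<integral>x. indicator (ball (b l) r) x * (v x)\<^sup>2 \<partial>lborel))
       \<le> C + C * c * \<epsilon>"
    unfolding \<epsilon>_def R_def 
    by (rule balance[THEN spec[of _ v], THEN spec[of _ G], THEN spec[of _ "s\<^sup>2"], THEN spec[of _ c], THEN mp])
      (use v m1 lamC c weak N1 N2 in blast)
  have "q * q \<le> (\<integral>x. indicator (ball (b i) r) x * (v x)\<^sup>2 \<partial>lborel) * (\<integral>x. indicator (ball (b l) r) x * (v x)\<^sup>2 \<partial>lborel)"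
    using core[OF il(1)] core[OF il(2)] q by (intro mult_mono) auto
  then have "\<kappa> * c * (q * q) \<le> C + C * c * \<epsilon>"
    using final \<kappa> c by (meson mult_left_mono mult_pos_pos less_imp_le order_trans)
  moreover have "C * c * \<epsilon> \<le> c * (\<kappa> * q\<^sup>2 / 2)"
    using mult_left_mono[OF eps less_imp_le[OF c]] by (simp add: mult_ac)
  \<comment> \<open>Half of the attraction absorbs the leakage; what is left bounds
    \<open>c\<close>, against the choice of \<open>n\<close>.\<close>
  ultimately have "c * (\<kappa> * q\<^sup>2 / 2) \<le> C" by (simp add: power2_eq_square algebra_simps)
  moreover have "C < c * (\<kappa> * q\<^sup>2 / 2)"
  proof -
    have "\<kappa> * q\<^sup>2 > 0" using \<kappa> q by simp
    then have "16 * pi * C < A * (\<kappa> * q\<^sup>2)" using n(3) by (simp add: A_def pos_divide_less_eq)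
    then show ?thesis by (simp add: c_def field_simps)
  qed
  ultimately show False by linarith
qed

end
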